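(* Let $R$ be a commutative noetherian local ring which is a homomorphic image of a Gorenstein ring $S$, and let $M$ be a finitely generated $R$-module. Then $\operatorname{Ass}_R(M)\subseteq\bigcup_{i\ge 0}\operatorname{Ass}_R(\operatorname{Ext}^i_S(M,S))$.
   Context: $M$ is regarded as an $S$-module via a fixed surjective ring homomorphism $S\to R$, and $\operatorname{Ext}^i_S(M,S)$ is regarded as an $R$-module through the $R$-module structure of $M$. The set $\bigcup_i\operatorname{Ass}_R(\operatorname{Ext}^i_S(M,S))$ is called the set of homological associated primes of $M$. *)

theory Defs
  imports "HOL-Algebra.Module" "HOL-Algebra.AbelCoset" "HOL-Algebra.Ring_Divisibility"
begin

section \<open>Modules\<close>

text \<open>
  The record type of modules extends that of rings; the fields \<open>mult\<close> and \<open>one\<close> play no role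
  for a module and are left undefined in all constructions below.
\<close>

definition self_module :: "'a ring \<Rightarrow> ('a, 'a) module" where
  "self_module A =
    \<lparr>carrier = carrier A, monoid.mult = \<lambda>_ _. undefined, one = undefined,
     zero = \<zero>\<^bsub>A\<^esub>, add = (\<oplus>\<^bsub>A\<^esub>), smult = (\<otimes>\<^bsub>A\<^esub>)\<rparr>"

definition restrict_scalars :: "('s \<Rightarrow> 'r) \<Rightarrow> ('r, 'm) module \<Rightarrow> ('s, 'm) module" where
  "restrict_scalars f M =
    \<lparr>carrier = carrier M, monoid.mult = \<lambda>_ _. undefined, one = undefined,
     zero = \<zero>\<^bsub>M\<^esub>, add = (\<oplus>\<^bsub>M\<^esub>), smult = \<lambda>s x. f s \<odot>\<^bsub>M\<^esub> x\<rparr>"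

definition fin_gen_module :: "'a ring \<Rightarrow> ('a, 'm) module \<Rightarrow> bool" where
  "fin_gen_module A M \<longleftrightarrow> module A M \<and>
    (\<exists>X. finite X \<and> X \<subseteq> carrier M \<and>
      (\<forall>N. submodule N A M \<and> X \<subseteq> N \<longrightarrow> N = carrier M))"

definition Ass :: "'a ring \<Rightarrow> ('a, 'm) module \<Rightarrow> 'a set set" where
  "Ass A M =
    {P. primeideal P A \<and> (\<exists>x\<in>carrier M. P = {a \<in> carrier A. a \<odot>\<^bsub>M\<^esub> x = \<zero>\<^bsub>M\<^esub>})}"

definition module_hom :: "'a ring \<Rightarrow> ('a, 'm) module \<Rightarrow> ('a, 'n) module \<Rightarrow> ('m \<Rightarrow> 'n) set" where
  "module_hom A X Y =
    {h \<in> carrier X \<rightarrow> carrier Y.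
      (\<forall>x\<in>carrier X. \<forall>y\<in>carrier X. h (x \<oplus>\<^bsub>X\<^esub> y) = h x \<oplus>\<^bsub>Y\<^esub> h y) \<and>
      (\<forall>a\<in>carrier A. \<forall>x\<in>carrier X. h (a \<odot>\<^bsub>X\<^esub> x) = a \<odot>\<^bsub>Y\<^esub> h x)}"

text \<open>Homomorphisms are taken extensional, so that equality of functions is equality on the carrier.\<close>

definition Hom_module ::
    "'a ring \<Rightarrow> ('a, 'm) module \<Rightarrow> ('a, 'n) module \<Rightarrow> ('a, 'm \<Rightarrow> 'n) module" where
  "Hom_module A X Y =
    \<lparr>carrier = module_hom A X Y \<inter> extensional (carrier X),
     monoid.mult = \<lambda>_ _. undefined, one = undefined,
     zero = \<lambda>x\<in>carrier X. \<zero>\<^bsub>Y\<^esub>,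
     add = \<lambda>\<phi> \<psi>. \<lambda>x\<in>carrier X. \<phi> x \<oplus>\<^bsub>Y\<^esub> \<psi> x,
     smult = \<lambda>a \<phi>. \<lambda>x\<in>carrier X. a \<odot>\<^bsub>Y\<^esub> \<phi> x\<rparr>"


section \<open>Local rings, localization, Gorenstein rings\<close>

definition local_ring :: "'a ring \<Rightarrow> bool" where
  "local_ring A \<longleftrightarrow> cring A \<and> (\<exists>!P. maximalideal P A)"

definition frac_rel :: "'a ring \<Rightarrow> 'a set \<Rightarrow> (('a \<times> 'a) \<times> ('a \<times> 'a)) set" where
  "frac_rel A P =
    {((a, s), (b, t)). a \<in> carrier A \<and> s \<in> carrier A - P \<and> b \<in> carrier A \<and> t \<in> carrier A - P \<and>
      (\<exists>u\<in>carrier A - P. u \<otimes>\<^bsub>A\<^esub> (a \<otimes>\<^bsub>A\<^esub> t) = u \<otimes>\<^bsub>A\<^esub> (b \<otimes>\<^bsub>A\<^esub> s))}"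

definition loc_frac :: "'a ring \<Rightarrow> 'a set \<Rightarrow> 'a \<Rightarrow> 'a \<Rightarrow> ('a \<times> 'a) set" where
  "loc_frac A P a s = frac_rel A P `` {(a, s)}"

text \<open>The localization of \<open>A\<close> at the prime ideal \<open>P\<close>, with fractions as equivalence classes.\<close>

definition localization :: "'a ring \<Rightarrow> 'a set \<Rightarrow> ('a \<times> 'a) set ring" where
  "localization A P =
    \<lparr>carrier = (carrier A \<times> (carrier A - P)) // frac_rel A P,
     monoid.mult = \<lambda>X Y. \<Union>(a, s)\<in>X. \<Union>(b, t)\<in>Y. loc_frac A P (a \<otimes>\<^bsub>A\<^esub> b) (s \<otimes>\<^bsub>A\<^esub> t),
     one = loc_frac A P \<one>\<^bsub>A\<^esub> \<one>\<^bsub>A\<^esub>,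
     zero = loc_frac A P \<zero>\<^bsub>A\<^esub> \<one>\<^bsub>A\<^esub>,
     add = \<lambda>X Y. \<Union>(a, s)\<in>X. \<Union>(b, t)\<in>Y.
       loc_frac A P (a \<otimes>\<^bsub>A\<^esub> t \<oplus>\<^bsub>A\<^esub> b \<otimes>\<^bsub>A\<^esub> s) (s \<otimes>\<^bsub>A\<^esub> t)\<rparr>"

text \<open>
  The extension property is required for all pairs \<open>Y \<subseteq> X\<close> of modules on subsets of the type of
  the ring \<open>A\<close>. HOL cannot quantify over all types here, and nothing is lost: \<open>X\<close> may be \<open>A\<close>
  itself and \<open>Y\<close> any ideal, so by Baer's criterion the property holds for modules of any type.
\<close>

definition injective_module :: "'a ring \<Rightarrow> ('a, 'e) module \<Rightarrow> bool" where
  "injective_module A J \<longleftrightarrow> module A J \<and>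
    (\<forall>(X :: ('a, 'a) module) Y. module A X \<and> submodule Y A X \<longrightarrow>
      (\<forall>g\<in>module_hom A (X\<lparr>carrier := Y\<rparr>) J. \<exists>h\<in>module_hom A X J. \<forall>y\<in>Y. h y = g y))"

definition injective_resolution ::
    "'a ring \<Rightarrow> ('a, 'n) module \<Rightarrow> (nat \<Rightarrow> ('a, 'e) module) \<Rightarrow> ('n \<Rightarrow> 'e) \<Rightarrow> (nat \<Rightarrow> 'e \<Rightarrow> 'e) \<Rightarrow> bool"
  where
  "injective_resolution A N I \<iota> d \<longleftrightarrow>
    (\<forall>k. injective_module A (I k)) \<and>
    \<iota> \<in> module_hom A N (I 0) \<and> (\<forall>k. d k \<in> module_hom A (I k) (I (Suc k))) \<and>
    inj_on \<iota> (carrier N) \<and>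
    \<iota> ` carrier N = {x \<in> carrier (I 0). d 0 x = \<zero>\<^bsub>I 1\<^esub>} \<and>
    (\<forall>k. d k ` carrier (I k) = {x \<in> carrier (I (Suc k)). d (Suc k) x = \<zero>\<^bsub>I (Suc (Suc k))\<^esub>})"

text \<open>
  Finite injective dimension is witnessed by a resolution whose terms are carried by the type
  \<open>'e\<close>. A theorem that assumes it for an arbitrary \<open>'e\<close> covers resolutions by modules of any type.
\<close>

definition finite_injective_dimension ::
    "'e itself \<Rightarrow> 'a ring \<Rightarrow> ('a, 'n) module \<Rightarrow> bool" where
  "finite_injective_dimension _ A N \<longleftrightarrow>
    (\<exists>(I :: nat \<Rightarrow> ('a, 'e) module) \<iota> d n.
      injective_resolution A N I \<iota> d \<and> (\<forall>k>n. carrier (I k) = {\<zero>\<^bsub>I k\<^esub>}))"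

definition gorenstein_ring :: "'e itself \<Rightarrow> 'a ring \<Rightarrow> bool" where
  "gorenstein_ring T A \<longleftrightarrow> cring A \<and> noetherian_ring A \<and>
    (\<forall>P. primeideal P A \<longrightarrow>
      finite_injective_dimension T (localization A P) (self_module (localization A P)))"


section \<open>The standard free resolution\<close>

text \<open>The free module with basis \<open>B\<close>: finitely supported functions from \<open>B\<close> to the ring.\<close>

definition free_module :: "'a ring \<Rightarrow> 'b set \<Rightarrow> ('a, 'b \<Rightarrow> 'a) module" where
  "free_module A B =
    \<lparr>carrier = {v. (\<forall>b\<in>B. v b \<in> carrier A) \<and> (\<forall>b. b \<notin> B \<longrightarrow> v b = \<zero>\<^bsub>A\<^esub>) \<and>
       finite {b. v b \<noteq> \<zero>\<^bsub>A\<^esub>}},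
     monoid.mult = \<lambda>_ _. undefined, one = undefined,
     zero = \<lambda>b. \<zero>\<^bsub>A\<^esub>,
     add = \<lambda>v w b. v b \<oplus>\<^bsub>A\<^esub> w b,
     smult = \<lambda>a v b. a \<otimes>\<^bsub>A\<^esub> v b\<rparr>"

definition basis_vec :: "'a ring \<Rightarrow> 'b \<Rightarrow> 'b \<Rightarrow> 'a" where
  "basis_vec A b = (\<lambda>c. if c = b then \<one>\<^bsub>A\<^esub> else \<zero>\<^bsub>A\<^esub>)"

definition lin_ext :: "'a ring \<Rightarrow> ('a, 'n) module \<Rightarrow> ('b \<Rightarrow> 'n) \<Rightarrow> ('b \<Rightarrow> 'a) \<Rightarrow> 'n" where
  "lin_ext A N g v = (\<Oplus>\<^bsub>N\<^esub>b\<in>{b. v b \<noteq> \<zero>\<^bsub>A\<^esub>}. v b \<odot>\<^bsub>N\<^esub> g b)"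

text \<open>
  The standard free resolution \<open>\<dots> \<rightarrow> F\<^sub>1 \<rightarrow> F\<^sub>0 \<rightarrow> X \<rightarrow> 0\<close> of a module \<open>X\<close> has one basis vector in
  degree \<open>0\<close> for each element of \<open>X\<close>, and one in degree \<open>n + 1\<close> for each formal linear combination
  of basis elements of degree \<open>n\<close> whose value in \<open>F\<^sub>n\<close> is a cycle; the boundary sends the basis
  vector to that value. It is exact by construction, functorial in \<open>X\<close>, and all its bases live in a
  single type. Every cycle is the value of many formal combinations, which is redundant but harmless.
\<close>

datatype ('a, 'm) gen = Elt 'm | Syz "('a \<times> ('a, 'm) gen) list"

definition comb_val :: "'a ring \<Rightarrow> ('a \<times> 'b) list \<Rightarrow> 'b \<Rightarrow> 'a" where
  "comb_val A xs = (\<lambda>c. foldr (\<lambda>(a, b) y. if b = c then a \<oplus>\<^bsub>A\<^esub> y else y) xs \<zero>\<^bsub>A\<^esub>)"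

fun elt_val :: "('a, 'm) gen \<Rightarrow> 'm" where
  "elt_val (Elt x) = x"
| "elt_val (Syz xs) = undefined"

fun syz_val :: "'a ring \<Rightarrow> ('a, 'm) gen \<Rightarrow> ('a, 'm) gen \<Rightarrow> 'a" where
  "syz_val A (Syz xs) = comb_val A xs"
| "syz_val A (Elt x) = undefined"

fun res_basis :: "'a ring \<Rightarrow> ('a, 'm) module \<Rightarrow> nat \<Rightarrow> ('a, 'm) gen set" where
  "res_basis A X 0 = Elt ` carrier X"
| "res_basis A X (Suc 0) =
    {Syz xs | xs. set xs \<subseteq> carrier A \<times> res_basis A X 0 \<and>
      lin_ext A X elt_val (comb_val A xs) = \<zero>\<^bsub>X\<^esub>}"
| "res_basis A X (Suc (Suc n)) =
    {Syz xs | xs. set xs \<subseteq> carrier A \<times> res_basis A X (Suc n) \<and>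
      lin_ext A (free_module A (res_basis A X n)) (syz_val A) (comb_val A xs)
        = \<zero>\<^bsub>free_module A (res_basis A X n)\<^esub>}"

definition res_module ::
    "'a ring \<Rightarrow> ('a, 'm) module \<Rightarrow> nat \<Rightarrow> ('a, ('a, 'm) gen \<Rightarrow> 'a) module" where
  "res_module A X n = free_module A (res_basis A X n)"

text \<open>\<open>res_bdry A X n\<close> is the differential from degree \<open>n + 1\<close> to degree \<open>n\<close>.\<close>

definition res_bdry ::
    "'a ring \<Rightarrow> ('a, 'm) module \<Rightarrow> nat \<Rightarrow> (('a, 'm) gen \<Rightarrow> 'a) \<Rightarrow> (('a, 'm) gen \<Rightarrow> 'a)" where
  "res_bdry A X n = lin_ext A (res_module A X n) (syz_val A)"

text \<open>The chain map between standard resolutions that lifts a module homomorphism \<open>h\<close> into \<open>Y\<close>.\<close>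

definition res_map ::
    "'a ring \<Rightarrow> ('a, 'n) module \<Rightarrow> ('m \<Rightarrow> 'n) \<Rightarrow> nat \<Rightarrow> (('a, 'm) gen \<Rightarrow> 'a) \<Rightarrow> (('a, 'n) gen \<Rightarrow> 'a)"
  where
  "res_map A Y h n = lin_ext A (res_module A Y n) (\<lambda>b. basis_vec A (map_gen id h b))"


section \<open>Ext\<close>

text \<open>\<open>Ext A X N n\<close> is the \<open>n\<close>-th cohomology of the complex \<open>Hom\<^sub>A(F, N)\<close>, where \<open>F\<close> is the standard
  free resolution of \<open>X\<close>; its elements are cosets of coboundaries.\<close>

definition cochains ::
    "'a ring \<Rightarrow> ('a, 'm) module \<Rightarrow> ('a, 'n) module \<Rightarrow> nat \<Rightarrow>
      ('a, (('a, 'm) gen \<Rightarrow> 'a) \<Rightarrow> 'n) module" where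
  "cochains A X N n = Hom_module A (res_module A X n) N"

definition cobdry ::
    "'a ring \<Rightarrow> ('a, 'm) module \<Rightarrow> nat \<Rightarrow>
      ((('a, 'm) gen \<Rightarrow> 'a) \<Rightarrow> 'n) \<Rightarrow> ((('a, 'm) gen \<Rightarrow> 'a) \<Rightarrow> 'n)" where
  "cobdry A X n \<phi> = compose (carrier (res_module A X (Suc n))) \<phi> (res_bdry A X n)"

definition cocycles ::
    "'a ring \<Rightarrow> ('a, 'm) module \<Rightarrow> ('a, 'n) module \<Rightarrow> nat \<Rightarrow> ((('a, 'm) gen \<Rightarrow> 'a) \<Rightarrow> 'n) set" where
  "cocycles A X N n =
    {\<phi> \<in> carrier (cochains A X N n). cobdry A X n \<phi> = \<zero>\<^bsub>cochains A X N (Suc n)\<^esub>}"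

fun coboundaries ::
    "'a ring \<Rightarrow> ('a, 'm) module \<Rightarrow> ('a, 'n) module \<Rightarrow> nat \<Rightarrow> ((('a, 'm) gen \<Rightarrow> 'a) \<Rightarrow> 'n) set" where
  "coboundaries A X N 0 = {\<zero>\<^bsub>cochains A X N 0\<^esub>}"
| "coboundaries A X N (Suc n) = cobdry A X n ` carrier (cochains A X N n)"

definition Ext_class ::
    "'a ring \<Rightarrow> ('a, 'm) module \<Rightarrow> ('a, 'n) module \<Rightarrow> nat \<Rightarrow>
      ((('a, 'm) gen \<Rightarrow> 'a) \<Rightarrow> 'n) \<Rightarrow> ((('a, 'm) gen \<Rightarrow> 'a) \<Rightarrow> 'n) set" where
  "Ext_class A X N n \<phi> = coboundaries A X N n +>\<^bsub>cochains A X N n\<^esub> \<phi>"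

definition Ext ::
    "'a ring \<Rightarrow> ('a, 'm) module \<Rightarrow> ('a, 'n) module \<Rightarrow> nat \<Rightarrow>
      ('a, ((('a, 'm) gen \<Rightarrow> 'a) \<Rightarrow> 'n) set) module" where
  "Ext A X N n =
    \<lparr>carrier = Ext_class A X N n ` cocycles A X N n,
     monoid.mult = \<lambda>_ _. undefined, one = undefined,
     zero = Ext_class A X N n \<zero>\<^bsub>cochains A X N n\<^esub>,
     add = \<lambda>K L. K <+>\<^bsub>cochains A X N n\<^esub> L,
     smult = \<lambda>a K. \<Union>\<phi>\<in>K. Ext_class A X N n (a \<odot>\<^bsub>cochains A X N n\<^esub> \<phi>)\<rparr>"

text \<open>The map from \<open>Ext A Y N n\<close> to \<open>Ext A X N n\<close> induced by a homomorphism \<open>h\<close> from \<open>X\<close> to \<open>Y\<close>.\<close>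

definition Ext_map ::
    "'a ring \<Rightarrow> ('a, 'm) module \<Rightarrow> ('a, 'l) module \<Rightarrow> ('a, 'n) module \<Rightarrow> nat \<Rightarrow> ('m \<Rightarrow> 'l) \<Rightarrow>
      ((('a, 'l) gen \<Rightarrow> 'a) \<Rightarrow> 'n) set \<Rightarrow> ((('a, 'm) gen \<Rightarrow> 'a) \<Rightarrow> 'n) set" where
  "Ext_map A X Y N n h K =
    (\<Union>\<phi>\<in>K. Ext_class A X N n (compose (carrier (res_module A X n)) \<phi> (res_map A Y h n)))"

text \<open>
  For a ring homomorphism \<open>f\<close> from \<open>S\<close> to \<open>R\<close> and an \<open>R\<close>-module \<open>M\<close>, \<open>Ext_over S f M N n\<close> is the group
  \<open>Ext\<close> over \<open>S\<close> of \<open>M\<close> and \<open>N\<close> as a module over \<open>R\<close>: the scalar \<open>r\<close> acts by the map induced by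
  the \<open>S\<close>-linear endomorphism \<open>x \<mapsto> r x\<close> of \<open>M\<close>.
\<close>

definition Ext_over ::
    "'s ring \<Rightarrow> ('s \<Rightarrow> 'r) \<Rightarrow> ('r, 'm) module \<Rightarrow> ('s, 'n) module \<Rightarrow> nat \<Rightarrow>
      ('r, ((('s, 'm) gen \<Rightarrow> 's) \<Rightarrow> 'n) set) module" where
  "Ext_over S f M N n =
    (let X = restrict_scalars f M; E = Ext S X N n in
      \<lparr>carrier = carrier E, monoid.mult = \<lambda>_ _. undefined, one = undefined,
       zero = \<zero>\<^bsub>E\<^esub>, add = (\<oplus>\<^bsub>E\<^esub>),
       smult = \<lambda>r. Ext_map S X X N n (\<lambda>x. r \<odot>\<^bsub>M\<^esub> x)\<rparr>)"

end

theory Submission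
  imports Defs
begin

text \<open>
  Let \<open>P\<close> be the annihilator of an element of \<open>M\<close>, let \<open>Q\<close> be its preimage in \<open>S\<close>, and let \<open>I\<close> be a
  finite injective resolution of \<open>A = S\<^sub>Q\<close>. For finitely generated \<open>S\<close>-modules \<open>X\<close> the groups
  \<open>E\<^sup>i(X) = H\<^sup>i(Hom(X, I))\<close> have long exact sequences because \<open>I\<close> consists of injective modules over \<open>S\<close>
  on which the complement of \<open>Q\<close> acts bijectively; they are noetherian over \<open>A\<close> by dimension shifting,
  and they vanish for large \<open>i\<close>. Let \<open>d\<close> be the largest degree in which some \<open>E\<^sup>d(X)\<close> is nonzero.
  For a prime \<open>p \<noteq> Q\<close> contained in \<open>Q\<close> and \<open>x \<in> Q - p\<close>, multiplication by \<open>x\<close> is surjective on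
  \<open>E\<^sup>d(S/p)\<close>, so Nakayama's lemma gives \<open>E\<^sup>d(S/p) = 0\<close>. Filtering \<open>X\<close> with prime quotients shows
  that a power of every element of \<open>Q\<close> kills \<open>E\<^sup>d(X)\<close> and that \<open>E\<^sup>d(S/Q) \<noteq> 0\<close>; since \<open>E\<^sup>d\<close> is right
  exact and \<open>S/Q\<close> embeds in \<open>M\<close>, also \<open>E\<^sup>d(M) \<noteq> 0\<close>. Comparing \<open>E\<^sup>d(M)\<close> with \<open>Ext\<^sup>d(M, S)\<close> through a
  resolution of \<open>M\<close> by free modules of finite rank, which is a retract of the standard resolution,
  one finds an element of \<open>Ext\<^sup>d(M, S)\<close> with annihilator \<open>Q\<close>.
\<close>

section \<open>Ascending chain condition\<close>

text \<open>The hypothesis on \<open>S\<close> concerns the localization at \<open>Q\<close>, yet no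
  module is ever localized: read over \<open>S\<close>, the terms of the resolution already let the
  elements outside \<open>Q\<close> act invertibly. The price is that E^i(X) is finitely generated
  over the localization and not over \<open>S\<close>, so chain conditions and Nakayama's lemma have
  to speak of submodules closed under division by elements outside \<open>Q\<close>. The induction
  ranges over many finitely generated X, which need a common type. Therefore X is a subquotient Y/Z
  of one ambient module, a class is represented by a map on Y that vanishes on Z, and quotients are
  never formed. A free module over an infinite index type serves as the ambient module. The degree d
  exists because E^0(S) is the localization, which is not zero. It is taken as large as possible
  since E^(d+1) = 0 is what makes E^d right exact: injective maps, be it multiplication by x on S/p
  or an embedding of S/Q, then induce surjections.\<close>

definition acc :: "'a set set \<Rightarrow> bool" where
  "acc F \<longleftrightarrow> (\<forall>G\<subseteq>F. G \<noteq> {} \<longrightarrow> (\<exists>N\<in>G. \<forall>N'\<in>G. N \<subseteq> N' \<longrightarrow> N' = N))"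

lemma acc_maximal:
  assumes "acc F" "G \<subseteq> F" "N0 \<in> G"
  obtains N where "N \<in> G" "\<And>N'. N' \<in> G \<Longrightarrow> N \<subseteq> N' \<Longrightarrow> N' = N"
  using assms unfolding acc_def by (metis empty_iff)

lemma acc_subset: "acc F \<Longrightarrow> G \<subseteq> F \<Longrightarrow> acc G"
  unfolding acc_def by (meson subset_trans)

text \<open>A lexicographic choice: among the members with maximal \<open>\<Theta>1\<close>, one
  with maximal \<open>\<Theta>2\<close> is taken. The model is an extension of modules, where nested
  submodules with the same trace on the sub and the same image in the quotient coincide.\<close>

lemma acc_transfer2:
  assumes "acc F1" "acc F2"
    and "\<And>N. N \<in> F \<Longrightarrow> \<Theta>1 N \<in> F1" "\<And>N. N \<in> F \<Longrightarrow> \<Theta>2 N \<in> F2"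
    and mono: "\<And>N N'. N \<in> F \<Longrightarrow> N' \<in> F \<Longrightarrow> N \<subseteq> N' \<Longrightarrow> \<Theta>1 N \<subseteq> \<Theta>1 N'"
      "\<And>N N'. N \<in> F \<Longrightarrow> N' \<in> F \<Longrightarrow> N \<subseteq> N' \<Longrightarrow> \<Theta>2 N \<subseteq> \<Theta>2 N'"
    and strict: "\<And>N N'. N \<in> F \<Longrightarrow> N' \<in> F \<Longrightarrow> N \<subseteq> N' \<Longrightarrow> \<Theta>1 N = \<Theta>1 N' \<Longrightarrow> \<Theta>2 N = \<Theta>2 N' \<Longrightarrow> N' \<subseteq> N"
  shows "acc F"
  unfolding acc_def
proof (intro allI impI)
  fix G assume G: "G \<subseteq> F" "G \<noteq> {}"
  then obtain N0 where "N0 \<in> G" by blast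
  have "\<Theta>1 ` G \<subseteq> F1" using G assms(3) by blast
  from acc_maximal[OF assms(1) this imageI[OF \<open>N0 \<in> G\<close>]]
  obtain A where A: "A \<in> \<Theta>1 ` G" "\<And>A'. A' \<in> \<Theta>1 ` G \<Longrightarrow> A \<subseteq> A' \<Longrightarrow> A' = A" by blast
  let ?H = "{N\<in>G. \<Theta>1 N = A}"
  from A obtain N1 where N1: "N1 \<in> ?H" by blast
  have "\<Theta>2 ` ?H \<subseteq> F2" using G assms(4) by blast
  from acc_maximal[OF assms(2) this imageI[OF N1]]
  obtain B where B: "B \<in> \<Theta>2 ` ?H" "\<And>B'. B' \<in> \<Theta>2 ` ?H \<Longrightarrow> B \<subseteq> B' \<Longrightarrow> B' = B" by blast
  from B obtain N where N: "N \<in> G" "\<Theta>1 N = A" "\<Theta>2 N = B" by blast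
  have "N' = N" if "N' \<in> G" "N \<subseteq> N'" for N'
  proof -
    have 1: "\<Theta>1 N' = A" using A(2)[of "\<Theta>1 N'"] mono(1)[of N N'] that N G by blast
    have "\<Theta>2 N' = B" using B(2)[of "\<Theta>2 N'"] mono(2)[of N N'] that N G 1 by blast
    then show ?thesis using strict[of N N'] that N G 1 by blast
  qed
  then show "\<exists>N\<in>G. \<forall>N'\<in>G. N \<subseteq> N' \<longrightarrow> N' = N" using N by blast
qed

lemma acc_transfer:
  assumes "acc F1"
    and "\<And>N. N \<in> F \<Longrightarrow> \<Theta> N \<in> F1"
    and "\<And>N N'. N \<in> F \<Longrightarrow> N' \<in> F \<Longrightarrow> N \<subseteq> N' \<Longrightarrow> \<Theta> N \<subseteq> \<Theta> N'"
    and "\<And>N N'. N \<in> F \<Longrightarrow> N' \<in> F \<Longrightarrow> N \<subseteq> N' \<Longrightarrow> \<Theta> N = \<Theta> N' \<Longrightarrow> N' \<subseteq> N"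
  shows "acc F"
  by (rule acc_transfer2[OF assms(1) assms(1) assms(2) assms(2) assms(3) assms(3) assms(4)])

text \<open>A nonempty chain of ideals contains its own union, which is then an upper bound inside
  \<open>G\<close>; Zorn's lemma does the rest.\<close>

lemma (in noetherian_ring) acc_ideals: "acc {I. ideal I R}"
  unfolding acc_def
proof (intro allI impI)
  fix G assume G: "G \<subseteq> {I. ideal I R}" "G \<noteq> {}"
  have "\<exists>U\<in>G. \<forall>X\<in>C. X \<subseteq> U" if C: "subset.chain G C" for C
  proof (cases "C = {}")
    case False
    have "subset.chain {I. ideal I R} C" using C G unfolding pred_on.chain_def by auto
    then have "\<Union>C \<in> C" using ideal_chain_is_trivial False by blast
    then have "\<Union>C \<in> G" using C unfolding pred_on.chain_def by blast
    then show ?thesis by (intro bexI[of _ "\<Union>C"]) auto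
  qed (use G in blast)
  then show "\<exists>N\<in>G. \<forall>N'\<in>G. N \<subseteq> N' \<longrightarrow> N' = N"
    using subset_Zorn[of G] by blast
qed

section \<open>Linear maps on submodules\<close>

text \<open>Linearity is demanded on \<open>Y\<close> alone and values elsewhere are arbitrary.
  Restriction to a smaller submodule is then no operation at all, and maps that agree on a submodule
  \<open>Y\<close> are interchangeable.\<close>

definition lin :: "'s ring \<Rightarrow> ('s, 'u) module \<Rightarrow> 'u set \<Rightarrow> ('s, 'n) module \<Rightarrow> ('u \<Rightarrow> 'n) set" where
  "lin S U Y N = module_hom S (U\<lparr>carrier := Y\<rparr>) N"

lemma linI:
  assumes "\<And>y. y \<in> Y \<Longrightarrow> g y \<in> carrier N"
    and "\<And>y z. y \<in> Y \<Longrightarrow> z \<in> Y \<Longrightarrow> g (y \<oplus>\<^bsub>U\<^esub> z) = g y \<oplus>\<^bsub>N\<^esub> g z"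
    and "\<And>a y. a \<in> carrier S \<Longrightarrow> y \<in> Y \<Longrightarrow> g (a \<odot>\<^bsub>U\<^esub> y) = a \<odot>\<^bsub>N\<^esub> g y"
  shows "g \<in> lin S U Y N"
  using assms by (auto simp: lin_def module_hom_def)

lemma lin_closed: "g \<in> lin S U Y N \<Longrightarrow> y \<in> Y \<Longrightarrow> g y \<in> carrier N"
  and lin_add: "g \<in> lin S U Y N \<Longrightarrow> y \<in> Y \<Longrightarrow> z \<in> Y \<Longrightarrow> g (y \<oplus>\<^bsub>U\<^esub> z) = g y \<oplus>\<^bsub>N\<^esub> g z"
  and lin_smult: "g \<in> lin S U Y N \<Longrightarrow> a \<in> carrier S \<Longrightarrow> y \<in> Y \<Longrightarrow> g (a \<odot>\<^bsub>U\<^esub> y) = a \<odot>\<^bsub>N\<^esub> g y"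
  by (auto simp: lin_def module_hom_def)

lemma module_hom_eq_lin: "module_hom S U N = lin S U (carrier U) N"
  by (simp add: lin_def module_hom_def)

lemma lin_subset: "g \<in> lin S U Y N \<Longrightarrow> Z \<subseteq> Y \<Longrightarrow> g \<in> lin S U Z N"
  by (rule linI) (auto simp: lin_closed lin_add lin_smult subset_iff)

lemma submod_facts:
  assumes "module S U" "submodule Y S U"
  shows submod_zero: "\<zero>\<^bsub>U\<^esub> \<in> Y"
    and submod_add: "\<And>y z. y \<in> Y \<Longrightarrow> z \<in> Y \<Longrightarrow> y \<oplus>\<^bsub>U\<^esub> z \<in> Y"
    and submod_smult: "\<And>a y. a \<in> carrier S \<Longrightarrow> y \<in> Y \<Longrightarrow> a \<odot>\<^bsub>U\<^esub> y \<in> Y"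
    and submod_neg: "\<And>y. y \<in> Y \<Longrightarrow> \<ominus>\<^bsub>U\<^esub> y \<in> Y"
    and submod_diff: "\<And>y z. y \<in> Y \<Longrightarrow> z \<in> Y \<Longrightarrow> y \<ominus>\<^bsub>U\<^esub> z \<in> Y"
    and submod_mem: "\<And>y. y \<in> Y \<Longrightarrow> y \<in> carrier U"
proof -
  interpret module S U by fact
  note E = submoduleE[OF assms(2)]
  show "\<And>y z. y \<in> Y \<Longrightarrow> z \<in> Y \<Longrightarrow> y \<oplus>\<^bsub>U\<^esub> z \<in> Y"
     "\<And>a y. a \<in> carrier S \<Longrightarrow> y \<in> Y \<Longrightarrow> a \<odot>\<^bsub>U\<^esub> y \<in> Y"
     "\<And>y. y \<in> Y \<Longrightarrow> \<ominus>\<^bsub>U\<^esub> y \<in> Y" "\<And>y. y \<in> Y \<Longrightarrow> y \<in> carrier U"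
    using E by auto
  then show "\<And>y z. y \<in> Y \<Longrightarrow> z \<in> Y \<Longrightarrow> y \<ominus>\<^bsub>U\<^esub> z \<in> Y" by (simp add: a_minus_def)
  obtain y where "y \<in> Y" using E(2) by blast
  then show "\<zero>\<^bsub>U\<^esub> \<in> Y" using E(1,3,5) by (metis M.r_neg in_mono)
qed

lemma submodI:
  assumes "module S U" "Y \<subseteq> carrier U" "\<zero>\<^bsub>U\<^esub> \<in> Y"
    and "\<And>y z. y \<in> Y \<Longrightarrow> z \<in> Y \<Longrightarrow> y \<oplus>\<^bsub>U\<^esub> z \<in> Y"
    and sm: "\<And>a y. a \<in> carrier S \<Longrightarrow> y \<in> Y \<Longrightarrow> a \<odot>\<^bsub>U\<^esub> y \<in> Y"
  shows "submodule Y S U"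
proof -
  interpret module S U by fact
  have "\<ominus>\<^bsub>U\<^esub> y \<in> Y" if "y \<in> Y" for y
    using sm[of "\<ominus>\<^bsub>S\<^esub> \<one>\<^bsub>S\<^esub>" y] that assms(2) smult_l_minus[of "\<one>\<^bsub>S\<^esub>" y] by auto
  then show ?thesis using assms by (intro submoduleI) auto
qed

lemma smult_minus:
  assumes "module S U" "a \<in> carrier S" "y \<in> carrier U" "z \<in> carrier U"
  shows "a \<odot>\<^bsub>U\<^esub> (y \<ominus>\<^bsub>U\<^esub> z) = a \<odot>\<^bsub>U\<^esub> y \<ominus>\<^bsub>U\<^esub> a \<odot>\<^bsub>U\<^esub> z"
proof -
  interpret module S U by fact
  show ?thesis using assms by (simp add: a_minus_def smult_r_distr smult_r_minus)
qed

lemma smult_minus_l: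
  assumes "module S U" "a \<in> carrier S" "b \<in> carrier S" "y \<in> carrier U"
  shows "(a \<ominus>\<^bsub>S\<^esub> b) \<odot>\<^bsub>U\<^esub> y = a \<odot>\<^bsub>U\<^esub> y \<ominus>\<^bsub>U\<^esub> b \<odot>\<^bsub>U\<^esub> y"
proof -
  interpret module S U by fact
  show ?thesis using assms by (simp add: a_minus_def smult_l_distr smult_l_minus)
qed

context
  fixes S :: "'s ring" and U :: "('s, 'u) module" and N :: "('s, 'n) module"
  assumes U: "module S U" and N: "module S N"
begin

interpretation U: module S U by (rule U)
interpretation N: module S N by (rule N)

lemma lin_zero: "g \<in> lin S U Y N \<Longrightarrow> submodule Y S U \<Longrightarrow> g \<zero>\<^bsub>U\<^esub> = \<zero>\<^bsub>N\<^esub>"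
  using lin_add[of g S U Y N "\<zero>\<^bsub>U\<^esub>" "\<zero>\<^bsub>U\<^esub>"] submod_zero[OF U] lin_closed[of g S U Y N "\<zero>\<^bsub>U\<^esub>"]
  by simp

lemma lin_neg: "g \<in> lin S U Y N \<Longrightarrow> submodule Y S U \<Longrightarrow> y \<in> Y \<Longrightarrow> g (\<ominus>\<^bsub>U\<^esub> y) = \<ominus>\<^bsub>N\<^esub> g y"
  using lin_smult[of g S U Y N "\<ominus>\<^bsub>S\<^esub> \<one>\<^bsub>S\<^esub>" y] submod_mem[OF U] lin_closed[of g S U Y N y]
  by (simp add: U.smult_l_minus N.smult_l_minus)

lemma lin_diff: "g \<in> lin S U Y N \<Longrightarrow> submodule Y S U \<Longrightarrow> y \<in> Y \<Longrightarrow> z \<in> Y \<Longrightarrow>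
    g (y \<ominus>\<^bsub>U\<^esub> z) = g y \<ominus>\<^bsub>N\<^esub> g z"
  by (simp add: a_minus_def lin_add lin_neg submod_neg[OF U])

lemma lin_const_zero: "(\<lambda>_. \<zero>\<^bsub>N\<^esub>) \<in> lin S U Y N"
  by (rule linI) auto

lemma lin_plus: "g \<in> lin S U Y N \<Longrightarrow> h \<in> lin S U Y N \<Longrightarrow> (\<lambda>y. g y \<oplus>\<^bsub>N\<^esub> h y) \<in> lin S U Y N"
  by (rule linI) (auto simp: lin_closed lin_add lin_smult N.a_ac N.smult_r_distr)

lemma lin_scale: "g \<in> lin S U Y N \<Longrightarrow> a \<in> carrier S \<Longrightarrow> (\<lambda>y. a \<odot>\<^bsub>N\<^esub> g y) \<in> lin S U Y N"
  by (rule linI) (auto simp: lin_closed lin_add lin_smult N.smult_r_distr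
      N.smult_assoc1[symmetric] U.R.m_comm)

lemma lin_minus: "g \<in> lin S U Y N \<Longrightarrow> h \<in> lin S U Y N \<Longrightarrow> (\<lambda>y. g y \<ominus>\<^bsub>N\<^esub> h y) \<in> lin S U Y N"
  by (rule linI) (auto simp: lin_closed lin_add lin_smult N.smult_r_distr N.smult_r_minus
     N.minus_add N.a_ac a_minus_def)

lemma submod_preimage:
  assumes g: "g \<in> lin S U Y N" and Y: "submodule Y S U" and W: "submodule W S N"
  shows "submodule {y\<in>Y. g y \<in> W} S U"
  by (rule submodI[OF U])
    (auto simp: submod_mem[OF U Y] submod_zero[OF U Y] submod_add[OF U Y] submod_smult[OF U Y]
    lin_zero[OF g Y] lin_add[OF g] lin_smult[OF g] submod_zero[OF N W] submod_add[OF N W] submod_smult[OF N W])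

lemma submod_image:
  assumes g: "g \<in> lin S U Y N" and Y: "submodule Y S U"
  shows "submodule (g ` Y) S N"
proof (rule submodI[OF N])
  show "\<zero>\<^bsub>N\<^esub> \<in> g ` Y" using lin_zero[OF g Y] submod_zero[OF U Y] by (metis imageI)
qed (auto simp: lin_closed[OF g] lin_add[OF g,symmetric] lin_smult[OF g,symmetric]
    submod_add[OF U Y] submod_smult[OF U Y])

lemma submod_equalizer:
  assumes g: "g \<in> lin S U Y N" and h: "h \<in> lin S U Y N" and Y: "submodule Y S U"
  shows "submodule {y\<in>Y. g y = h y} S U"
  by (rule submodI[OF U])
    (auto simp: submod_mem[OF U Y] submod_zero[OF U Y] submod_add[OF U Y] submod_smult[OF U Y]
    lin_zero[OF g Y] lin_zero[OF h Y] lin_add[OF g] lin_add[OF h] lin_smult[OF g] lin_smult[OF h])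

end

lemma lin_comp:
  assumes "p \<in> lin S L X U" "p ` X \<subseteq> Y" "g \<in> lin S U Y N"
  shows "(\<lambda>x. g (p x)) \<in> lin S L X N"
  using assms by (intro linI) (auto simp: lin_closed lin_add lin_smult image_subset_iff)

lemma lin_cong:
  assumes "module S U" "submodule Y S U" "g \<in> lin S U Y N" and eq: "\<And>y. y \<in> Y \<Longrightarrow> g y = h y"
  shows "h \<in> lin S U Y N"
  by (rule linI) (simp_all add: eq[symmetric] submod_add[OF assms(1,2)] submod_smult[OF assms(1,2)]
      lin_closed[OF assms(3)] lin_add[OF assms(3)] lin_smult[OF assms(3)])

lemma submod_trivial: "module S U \<Longrightarrow> submodule {\<zero>\<^bsub>U\<^esub>} S U"
proof -
  assume "module S U"
  then interpret module S U .
  show ?thesis by (rule submodI[OF \<open>module S U\<close>]) auto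
qed

lemma (in abelian_group) add_eq_iff_minus_eq:
  assumes "a \<in> carrier G" "b \<in> carrier G" "c \<in> carrier G" "d \<in> carrier G"
  shows "a \<oplus> b = c \<oplus> d \<longleftrightarrow> b \<ominus> d = c \<ominus> a"
proof
  assume eq: "a \<oplus> b = c \<oplus> d"
  have "b \<ominus> d = \<ominus> a \<oplus> (a \<oplus> b) \<ominus> d" using assms by (simp add: r_neg1)
  also have "\<dots> = c \<ominus> a \<oplus> (d \<ominus> d)" unfolding eq using assms by (simp add: a_minus_def a_ac)
  finally show "b \<ominus> d = c \<ominus> a" using assms by (simp add: r_neg a_minus_def)
next
  assume eq: "b \<ominus> d = c \<ominus> a"
  have "a \<oplus> b = a \<oplus> (b \<ominus> d) \<oplus> d" using assms by (simp add: a_minus_def a_assoc l_neg)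
  also have "\<dots> = c \<oplus> d" unfolding eq using assms r_neg2[of a "c \<oplus> d"] by (simp add: a_minus_def a_ac)
  finally show "a \<oplus> b = c \<oplus> d" .
qed

text \<open>The pushout property of \<open>Y = Z + p(X)\<close>.\<close>

lemma lin_glue:
  assumes U: "module S U" and L: "module S L" and N: "module S N"
    and Z: "submodule Z S U" and X: "submodule X S L"
    and p: "p \<in> lin S L X U" and g: "g \<in> lin S U Z N" and h: "h \<in> lin S L X N"
    and compat: "\<And>x. x \<in> X \<Longrightarrow> p x \<in> Z \<Longrightarrow> g (p x) = h x"
    and Y: "submodule Y S U" "Z \<subseteq> Y" "p ` X \<subseteq> Y"
    and cover: "\<And>y. y \<in> Y \<Longrightarrow> \<exists>z\<in>Z. \<exists>x\<in>X. y = z \<oplus>\<^bsub>U\<^esub> p x"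
  obtains c where "c \<in> lin S U Y N" "\<And>z. z \<in> Z \<Longrightarrow> c z = g z" "\<And>x. x \<in> X \<Longrightarrow> c (p x) = h x"
proof -
  interpret U: module S U by fact
  interpret N: module S N by fact
  interpret L: module S L by fact
  define c where "c y = (SOME n. \<exists>z\<in>Z. \<exists>x\<in>X. y = z \<oplus>\<^bsub>U\<^esub> p x \<and> n = g z \<oplus>\<^bsub>N\<^esub> h x)" for y
  note mem = submod_mem[OF U Z] lin_closed[OF p] lin_closed[OF g] lin_closed[OF h]
  \<comment> \<open>Two decompositions of one element differ by an element of \<open>Z\<close> that
    is also the \<open>p\<close>-image of an element of \<open>X\<close>; there
    \<open>compat\<close> makes \<open>g\<close> and \<open>h\<close> agree, so the chosen value is
    the only possible one.\<close>
  have c: "c (z \<oplus>\<^bsub>U\<^esub> p x) = g z \<oplus>\<^bsub>N\<^esub> h x" if "z \<in> Z" "x \<in> X" for z x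
  proof -
    have "n = g z \<oplus>\<^bsub>N\<^esub> h x" if H: "z' \<in> Z" "x' \<in> X" "z \<oplus>\<^bsub>U\<^esub> p x = z' \<oplus>\<^bsub>U\<^esub> p x'" "n = g z' \<oplus>\<^bsub>N\<^esub> h x'"
      for n z' x'
    proof -
      have px: "p (x \<ominus>\<^bsub>L\<^esub> x') = p x \<ominus>\<^bsub>U\<^esub> p x'"
        using lin_diff[OF L U p X] H \<open>x \<in> X\<close> by blast
      have "p x \<ominus>\<^bsub>U\<^esub> p x' = z' \<ominus>\<^bsub>U\<^esub> z"
        using mem \<open>z \<in> Z\<close> \<open>x \<in> X\<close> H by (simp add: U.add_eq_iff_minus_eq[symmetric])
      moreover have "z' \<ominus>\<^bsub>U\<^esub> z \<in> Z" using submod_diff[OF U Z] H \<open>z \<in> Z\<close> by blast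
      moreover have "x \<ominus>\<^bsub>L\<^esub> x' \<in> X" using submod_diff[OF L X] H \<open>x \<in> X\<close> by blast
      ultimately have "g (z' \<ominus>\<^bsub>U\<^esub> z) = h (x \<ominus>\<^bsub>L\<^esub> x')" using compat px by metis
      then have "g z' \<ominus>\<^bsub>N\<^esub> g z = h x \<ominus>\<^bsub>N\<^esub> h x'"
        using lin_diff[OF U N g Z] lin_diff[OF L N h X] H \<open>z \<in> Z\<close> \<open>x \<in> X\<close> by simp
      then have "g z' \<oplus>\<^bsub>N\<^esub> h x' = g z \<oplus>\<^bsub>N\<^esub> h x"
        using mem \<open>z \<in> Z\<close> \<open>x \<in> X\<close> H(1,2) N.add_eq_iff_minus_eq[of "g z" "h x" "g z'" "h x'"] by simp
      then show ?thesis using H by simp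
    qed
    then show ?thesis unfolding c_def using that by (intro some_equality) blast+
  qed
  have "c \<in> lin S U Y N"
  proof (rule linI)
    fix y assume "y \<in> Y"
    then obtain z x where "z \<in> Z" "x \<in> X" "y = z \<oplus>\<^bsub>U\<^esub> p x" using cover by blast
    then show "c y \<in> carrier N" using c mem by simp
  next
    fix y y' assume "y \<in> Y" "y' \<in> Y"
    then obtain z x z' x' where H: "z \<in> Z" "x \<in> X" "y = z \<oplus>\<^bsub>U\<^esub> p x" "z' \<in> Z" "x' \<in> X" "y' = z' \<oplus>\<^bsub>U\<^esub> p x'" using cover by metis
    have "y \<oplus>\<^bsub>U\<^esub> y' = (z \<oplus>\<^bsub>U\<^esub> z') \<oplus>\<^bsub>U\<^esub> p (x \<oplus>\<^bsub>L\<^esub> x')"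
      using H mem by (simp add: lin_add[OF p] U.a_ac)
    then show "c (y \<oplus>\<^bsub>U\<^esub> y') = c y \<oplus>\<^bsub>N\<^esub> c y'"
      using H mem c by (simp add: submod_add[OF U Z] submod_add[OF L X] lin_add[OF g] lin_add[OF h] N.a_ac)
  next
    fix a y assume "a \<in> carrier S" "y \<in> Y"
    then obtain z x where H: "z \<in> Z" "x \<in> X" "y = z \<oplus>\<^bsub>U\<^esub> p x" using cover by blast
    have "a \<odot>\<^bsub>U\<^esub> y = a \<odot>\<^bsub>U\<^esub> z \<oplus>\<^bsub>U\<^esub> p (a \<odot>\<^bsub>L\<^esub> x)"
      using H mem \<open>a \<in> _\<close> by (simp add: lin_smult[OF p] U.smult_r_distr)
    then show "c (a \<odot>\<^bsub>U\<^esub> y) = a \<odot>\<^bsub>N\<^esub> c y"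
      using H mem c \<open>a \<in> _\<close> by (simp add: submod_smult[OF U Z] submod_smult[OF L X] lin_smult[OF g] lin_smult[OF h] N.smult_r_distr)
  qed
  moreover have "c z = g z" if "z \<in> Z" for z
    using c[OF that submod_zero[OF L X]] that mem by (simp add: lin_zero[OF L U p X] lin_zero[OF L N h X])
  moreover have "c (p x) = h x" if "x \<in> X" for x
    using c[OF submod_zero[OF U Z] that] that mem by (simp add: lin_zero[OF U N g Z])
  ultimately show ?thesis using that by blast
qed

section \<open>Submodules\<close>

lemma module_self: "cring S \<Longrightarrow> module S (self_module S)"
proof -
  assume "cring S"
  then interpret cring S .
  show ?thesis
    by (rule moduleI[OF is_cring], rule abelian_groupI)
      (auto simp: self_module_def a_ac l_distr r_distr m_assoc intro: bexI[of _ "\<ominus>\<^bsub>S\<^esub> x" for x] l_neg)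
qed

lemma self_module_simps [simp]:
  "carrier (self_module S) = carrier S" "\<zero>\<^bsub>self_module S\<^esub> = \<zero>\<^bsub>S\<^esub>"
  "x \<oplus>\<^bsub>self_module S\<^esub> y = x \<oplus>\<^bsub>S\<^esub> y" "x \<odot>\<^bsub>self_module S\<^esub> y = x \<otimes>\<^bsub>S\<^esub> y"
  by (simp_all add: self_module_def)

text \<open>Makes preimages and images under linear maps available as sources of ideals.\<close>

lemma ideal_iff_submodule:
  assumes "cring S"
  shows "ideal I S \<longleftrightarrow> submodule I S (self_module S)"
proof -
  interpret cring S by fact
  note m = module_self[OF assms]
  show ?thesis
  proof
    assume "ideal I S"
    then interpret I: ideal I S .
    show "submodule I S (self_module S)"
      by (rule submodI[OF m]) (auto simp: I.I_l_closed)
  next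
    assume s: "submodule I S (self_module S)"
    have neg: "\<ominus>\<^bsub>S\<^esub> a \<in> I" if "a \<in> I" for a
      using submod_smult[OF m s, of "\<ominus>\<^bsub>S\<^esub> \<one>\<^bsub>S\<^esub>" a] submod_mem[OF m s, of a] that by (simp add: l_minus)
    show "ideal I S"
    proof (rule idealI[OF ring_axioms])
      show "subgroup I (add_monoid S)"
        by (rule subgroup.intro)
          (use submod_mem[OF m s] submod_add[OF m s] submod_zero[OF m s] neg in \<open>auto simp: a_inv_def\<close>)
    next
      fix a x assume a: "a \<in> I" "x \<in> carrier S"
      show "x \<otimes>\<^bsub>S\<^esub> a \<in> I" using submod_smult[OF m s a(2,1)] by simp
      then show "a \<otimes>\<^bsub>S\<^esub> x \<in> I" using submod_mem[OF m s a(1)] a(2) by (simp add: m_comm)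
    qed
  qed
qed

lemma lin_smult_vec:
  assumes "module S U" "y \<in> carrier U"
  shows "(\<lambda>s. s \<odot>\<^bsub>U\<^esub> y) \<in> lin S (self_module S) (carrier S) U"
proof -
  interpret module S U by fact
  show ?thesis using assms(2) by (intro linI) (auto simp: smult_l_distr smult_assoc1)
qed

lemma lin_smult_scalar:
  assumes "module S U" "submodule Y S U" "a \<in> carrier S"
  shows "(\<lambda>y. a \<odot>\<^bsub>U\<^esub> y) \<in> lin S U Y U"
proof -
  interpret module S U by fact
  show ?thesis using assms(3) submod_mem[OF assms(1,2)]
    by (intro linI) (auto simp: smult_r_distr smult_assoc1[symmetric] R.m_comm)
qed

text \<open>The conclusions are the hypotheses of \<open>lin_glue\<close> on its target
  \<open>Y\<close>, in the same order, so that maps can be glued on every sum of this form.\<close>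

lemma submod_sum_image:
  assumes U: "module S U" and L: "module S L" and Z: "submodule Z S U" and X: "submodule X S L"
    and p: "p \<in> lin S L X U"
  defines "W \<equiv> {z \<oplus>\<^bsub>U\<^esub> p x | z x. z \<in> Z \<and> x \<in> X}"
  shows "submodule W S U" "Z \<subseteq> W" "p ` X \<subseteq> W"
    "\<And>y. y \<in> W \<Longrightarrow> \<exists>z\<in>Z. \<exists>x\<in>X. y = z \<oplus>\<^bsub>U\<^esub> p x"
proof -
  interpret U: module S U by fact
  note mem = submod_mem[OF U Z] lin_closed[OF p]
  show Wex: "\<And>y. y \<in> W \<Longrightarrow> \<exists>z\<in>Z. \<exists>x\<in>X. y = z \<oplus>\<^bsub>U\<^esub> p x" by (auto simp: W_def)
  have WI: "\<And>z x. z \<in> Z \<Longrightarrow> x \<in> X \<Longrightarrow> z \<oplus>\<^bsub>U\<^esub> p x \<in> W" by (auto simp: W_def)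
  show ZW: "Z \<subseteq> W"
    using WI[OF _ submod_zero[OF L X]] mem by (auto simp: lin_zero[OF L U p X])
  show "p ` X \<subseteq> W" using WI[OF submod_zero[OF U Z]] mem by auto
  show "submodule W S U"
  proof (rule submodI[OF U])
    show "W \<subseteq> carrier U" using Wex mem by fastforce
    show "\<zero>\<^bsub>U\<^esub> \<in> W" using submod_zero[OF U Z] ZW by blast
  next
    fix y y' assume "y \<in> W" "y' \<in> W"
    then obtain z x z' x' where H: "z \<in> Z" "x \<in> X" "y = z \<oplus>\<^bsub>U\<^esub> p x" "z' \<in> Z" "x' \<in> X" "y' = z' \<oplus>\<^bsub>U\<^esub> p x'" using Wex by metis
    have "y \<oplus>\<^bsub>U\<^esub> y' = (z \<oplus>\<^bsub>U\<^esub> z') \<oplus>\<^bsub>U\<^esub> p (x \<oplus>\<^bsub>L\<^esub> x')"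
      using H mem by (simp add: lin_add[OF p] U.a_ac)
    then show "y \<oplus>\<^bsub>U\<^esub> y' \<in> W" using H WI submod_add[OF U Z] submod_add[OF L X] by simp
  next
    fix a y assume "a \<in> carrier S" "y \<in> W"
    then obtain z x where H: "z \<in> Z" "x \<in> X" "y = z \<oplus>\<^bsub>U\<^esub> p x" using Wex by blast
    have "a \<odot>\<^bsub>U\<^esub> y = a \<odot>\<^bsub>U\<^esub> z \<oplus>\<^bsub>U\<^esub> p (a \<odot>\<^bsub>L\<^esub> x)"
      using H mem \<open>a \<in> _\<close> by (simp add: lin_smult[OF p] U.smult_r_distr)
    then show "a \<odot>\<^bsub>U\<^esub> y \<in> W" using H WI \<open>a \<in> _\<close> submod_smult[OF U Z] submod_smult[OF L X] by simp
  qed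
qed

section \<open>Cyclic extensions of a submodule and their annihilators\<close>

definition adjoin :: "'s ring \<Rightarrow> ('s, 'u) module \<Rightarrow> 'u set \<Rightarrow> 'u \<Rightarrow> 'u set" where
  "adjoin S U Z y = {z \<oplus>\<^bsub>U\<^esub> s \<odot>\<^bsub>U\<^esub> y | z s. z \<in> Z \<and> s \<in> carrier S}"

lemma adjoin:
  assumes U: "module S U" and Z: "submodule Z S U" and y: "y \<in> carrier U"
  shows submod_adjoin: "submodule (adjoin S U Z y) S U"
    and subset_adjoin: "Z \<subseteq> adjoin S U Z y"
    and mem_adjoin: "y \<in> adjoin S U Z y"
    and adjoin_least: "\<And>Y. submodule Y S U \<Longrightarrow> Z \<subseteq> Y \<Longrightarrow> y \<in> Y \<Longrightarrow> adjoin S U Z y \<subseteq> Y"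
proof -
  interpret U: module S U by fact
  note m = module_self[OF U.is_cring]
  have X: "submodule (carrier S) S (self_module S)" using module.carrier_is_submodule[OF m] by simp
  note * = submod_sum_image[OF U m Z X lin_smult_vec[OF U y], folded adjoin_def]
  show "submodule (adjoin S U Z y) S U" "Z \<subseteq> adjoin S U Z y" using * by auto
  have "\<one>\<^bsub>S\<^esub> \<odot>\<^bsub>U\<^esub> y \<in> adjoin S U Z y" using *(3) by blast
  then show "y \<in> adjoin S U Z y" using y by simp
  show "\<And>Y. submodule Y S U \<Longrightarrow> Z \<subseteq> Y \<Longrightarrow> y \<in> Y \<Longrightarrow> adjoin S U Z y \<subseteq> Y"
    by (auto simp: adjoin_def intro!: submod_add[OF U] submod_smult[OF U])
qed

text \<open>The annihilator of the class of \<open>y\<close> in U/Z. The quotient of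
  \<open>adjoin S U Z y\<close> by \<open>Z\<close> is thus a copy of \<open>S\<close> modulo this
  ideal, which is how S/p and S/Q occur inside a fixed ambient module.\<close>

definition colon :: "'s ring \<Rightarrow> ('s, 'u) module \<Rightarrow> 'u set \<Rightarrow> 'u \<Rightarrow> 's set" where
  "colon S U Z y = {s \<in> carrier S. s \<odot>\<^bsub>U\<^esub> y \<in> Z}"

lemma ideal_colon:
  assumes U: "module S U" and Z: "submodule Z S U" and y: "y \<in> carrier U"
  shows "ideal (colon S U Z y) S"
proof -
  interpret U: module S U by fact
  note m = module_self[OF U.is_cring]
  have X: "submodule (carrier S) S (self_module S)" using module.carrier_is_submodule[OF m] by simp
  show ?thesis unfolding ideal_iff_submodule[OF U.is_cring] colon_def
    using submod_preimage[OF m U lin_smult_vec[OF U y] X Z] by simp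
qed

section \<open>Noetherian submodules and finite generation\<close>

definition noeth_sub :: "'s ring \<Rightarrow> ('s, 'u) module \<Rightarrow> 'u set \<Rightarrow> bool" where
  "noeth_sub S U Y \<longleftrightarrow> submodule Y S U \<and> acc {N. submodule N S U \<and> N \<subseteq> Y}"

lemma noeth_sub_submod: "noeth_sub S U Y \<Longrightarrow> submodule Y S U"
  by (simp add: noeth_sub_def)

lemma noeth_sub_subset:
  assumes "noeth_sub S U Y" "submodule Y' S U" "Y' \<subseteq> Y"
  shows "noeth_sub S U Y'"
proof -
  have "{N. submodule N S U \<and> N \<subseteq> Y'} \<subseteq> {N. submodule N S U \<and> N \<subseteq> Y}" using assms(3) by blast
  then show ?thesis using assms acc_subset unfolding noeth_sub_def by blast
qed

lemma noeth_sub_maximal: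
  assumes "noeth_sub S U Y" "\<And>N. N \<in> G \<Longrightarrow> submodule N S U \<and> N \<subseteq> Y" "N0 \<in> G"
  obtains N where "N \<in> G" "\<And>N'. N' \<in> G \<Longrightarrow> N \<subseteq> N' \<Longrightarrow> N' = N"
  using acc_maximal[of "{N. submodule N S U \<and> N \<subseteq> Y}" G N0] assms unfolding noeth_sub_def by blast

definition gen_sub :: "'s ring \<Rightarrow> ('s, 'u) module \<Rightarrow> 'u set \<Rightarrow> 'u set" where
  "gen_sub S U X = \<Inter>{N. submodule N S U \<and> X \<subseteq> N}"

lemma gen_sub:
  assumes U: "module S U" and X: "X \<subseteq> carrier U"
  shows "submodule (gen_sub S U X) S U" "X \<subseteq> gen_sub S U X"
    "\<And>N. submodule N S U \<Longrightarrow> X \<subseteq> N \<Longrightarrow> gen_sub S U X \<subseteq> N"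
proof -
  show "X \<subseteq> gen_sub S U X" "\<And>N. submodule N S U \<Longrightarrow> X \<subseteq> N \<Longrightarrow> gen_sub S U X \<subseteq> N"
    by (auto simp: gen_sub_def)
  have "submodule (carrier U) S U" using module.carrier_is_submodule[OF U] .
  then show "submodule (gen_sub S U X) S U" using X
    by (intro submodI[OF U]) (auto simp: gen_sub_def submod_facts[OF U])
qed

text \<open>A submodule that is maximal among the finitely generated ones absorbs every further
  generator, hence is all of \<open>Y\<close>.\<close>

lemma noeth_sub_finite_gen:
  assumes U: "module S U" and Y: "noeth_sub S U Y"
  obtains X where "finite X" "X \<subseteq> Y" "\<And>N. submodule N S U \<Longrightarrow> X \<subseteq> N \<Longrightarrow> Y \<subseteq> N"
proof -
  interpret U: module S U by fact
  have Ys: "submodule Y S U" using Y by (simp add: noeth_sub_def)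
  have Yc: "Y \<subseteq> carrier U" using submod_mem[OF U Ys] by blast
  let ?G = "gen_sub S U ` {X. finite X \<and> X \<subseteq> Y}"
  have 1: "\<And>N. N \<in> ?G \<Longrightarrow> submodule N S U \<and> N \<subseteq> Y"
    using gen_sub[OF U subset_trans[OF _ Yc]] Ys by blast
  have 2: "gen_sub S U {} \<in> ?G" by blast
  obtain N where N: "N \<in> ?G" "\<And>N'. N' \<in> ?G \<Longrightarrow> N \<subseteq> N' \<Longrightarrow> N' = N"
    using noeth_sub_maximal[OF Y 1 2] by metis
  then obtain X where X: "finite X" "X \<subseteq> Y" "N = gen_sub S U X" by blast
  have "Y \<subseteq> N"
  proof
    fix y assume "y \<in> Y"
    have "N \<subseteq> gen_sub S U (insert y X)" using X by (auto simp: gen_sub_def)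
    moreover have "gen_sub S U (insert y X) \<in> ?G" using X \<open>y \<in> Y\<close> by blast
    ultimately have "gen_sub S U (insert y X) = N" using N(2) by blast
    then show "y \<in> N" by (auto simp: gen_sub_def)
  qed
  then show ?thesis using that[of X] X gen_sub(3)[OF U, of X] Yc by blast
qed

text \<open>An annihilator that is maximal among those of nonzero classes of Y/Z is prime: if it
  contains the product of \<open>a\<close> and \<open>b\<close> but not \<open>b\<close>, then the
  annihilator of the class of \<open>b\<close> times \<open>y\<close> is at least as large, hence
  equal, and contains \<open>a\<close>. Each layer of a prime filtration is found this way.\<close>

lemma prime_colon:
  assumes nS: "noetherian_ring S" and U: "module S U"
    and Z: "submodule Z S U" "submodule Y S U" "Z \<subseteq> Y" "Z \<noteq> Y"
  obtains y where "y \<in> Y" "y \<notin> Z" "primeideal (colon S U Z y) S"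
proof -
  interpret U: module S U by fact
  interpret nS: noetherian_ring S by fact
  note Yc = submod_mem[OF U Z(2)]
  let ?G = "colon S U Z ` (Y - Z)"
  have 1: "?G \<subseteq> {I. ideal I S}" using ideal_colon[OF U Z(1)] Yc by blast
  obtain y0 where "y0 \<in> Y - Z" using Z by blast
  from acc_maximal[OF nS.acc_ideals 1 imageI[OF this]]
  obtain P where P: "P \<in> ?G" "\<And>P'. P' \<in> ?G \<Longrightarrow> P \<subseteq> P' \<Longrightarrow> P' = P" by blast
  then obtain y where y: "y \<in> Y" "y \<notin> Z" "P = colon S U Z y" by blast
  have "primeideal P S"
  proof (rule primeidealI)
    show "ideal P S" using 1 P by blast
    show "cring S" by (rule U.is_cring)
    have "\<one>\<^bsub>S\<^esub> \<notin> P" using y Yc by (simp add: colon_def)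
    then show "carrier S \<noteq> P" by blast
  next
    fix a b assume ab: "a \<in> carrier S" "b \<in> carrier S" "a \<otimes>\<^bsub>S\<^esub> b \<in> P"
    show "a \<in> P \<or> b \<in> P"
    proof (rule disjCI)
      assume b: "b \<notin> P"
      have bY: "b \<odot>\<^bsub>U\<^esub> y \<in> Y - Z" using submod_smult[OF U Z(2)] ab y b by (auto simp: colon_def)
      moreover have "P \<subseteq> colon S U Z (b \<odot>\<^bsub>U\<^esub> y)"
      proof
        fix s assume "s \<in> P"
        then have "s \<in> carrier S" "b \<odot>\<^bsub>U\<^esub> (s \<odot>\<^bsub>U\<^esub> y) \<in> Z" using y ab submod_smult[OF U Z(1)] by (auto simp: colon_def)
        then show "s \<in> colon S U Z (b \<odot>\<^bsub>U\<^esub> y)" using ab y Yc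
          by (simp add: colon_def U.smult_assoc1[symmetric] U.R.m_comm)
      qed
      ultimately have "colon S U Z (b \<odot>\<^bsub>U\<^esub> y) = P" using P(2) by blast
      moreover have "a \<in> colon S U Z (b \<odot>\<^bsub>U\<^esub> y)"
        using ab y Yc by (simp add: colon_def U.smult_assoc1[symmetric])
      ultimately show "a \<in> P" by simp
    qed
  qed
  then show ?thesis using that y by blast
qed

section \<open>Free modules\<close>

lemma free_module_simps [simp]:
  "\<zero>\<^bsub>free_module S B\<^esub> = (\<lambda>b. \<zero>\<^bsub>S\<^esub>)"
  "v \<oplus>\<^bsub>free_module S B\<^esub> w = (\<lambda>b. v b \<oplus>\<^bsub>S\<^esub> w b)" "a \<odot>\<^bsub>free_module S B\<^esub> w = (\<lambda>b. a \<otimes>\<^bsub>S\<^esub> w b)"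
  by (simp_all add: free_module_def)

text \<open>Vectors are functions on the whole index type that vanish off \<open>B\<close>, so
  enlarging \<open>B\<close> only enlarges this set, and all free modules over one index type lie in
  a single ambient module.\<close>

definition free_on :: "'s ring \<Rightarrow> 'b set \<Rightarrow> ('b \<Rightarrow> 's) set" where
  "free_on S B = carrier (free_module S B)"

lemma carrier_free_module [simp]: "carrier (free_module S B) = free_on S B"
  by (simp add: free_on_def)

lemma free_onD:
  assumes "cring S" "v \<in> free_on S B"
  shows "v b \<in> carrier S" "b \<notin> B \<Longrightarrow> v b = \<zero>\<^bsub>S\<^esub>" "finite {b. v b \<noteq> \<zero>\<^bsub>S\<^esub>}"
proof -
  interpret cring S by fact
  show "v b \<in> carrier S" "b \<notin> B \<Longrightarrow> v b = \<zero>\<^bsub>S\<^esub>" "finite {b. v b \<noteq> \<zero>\<^bsub>S\<^esub>}"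
    using assms(2) by (cases "b \<in> B"; auto simp: free_on_def free_module_def)+
qed

lemma free_onI:
  assumes "\<And>b. b \<in> B \<Longrightarrow> v b \<in> carrier S" "\<And>b. b \<notin> B \<Longrightarrow> v b = \<zero>\<^bsub>S\<^esub>" "finite {b. v b \<noteq> \<zero>\<^bsub>S\<^esub>}"
  shows "v \<in> free_on S B"
  using assms by (auto simp: free_on_def free_module_def)

lemma free_on_finiteI:
  assumes "\<And>b. b \<in> B \<Longrightarrow> v b \<in> carrier S" "\<And>b. b \<notin> B \<Longrightarrow> v b = \<zero>\<^bsub>S\<^esub>" "finite B"
  shows "v \<in> free_on S B"
proof (rule free_onI)
  show "finite {b. v b \<noteq> \<zero>\<^bsub>S\<^esub>}" using assms(2) by (intro finite_subset[OF _ assms(3)]) auto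
qed (use assms in auto)

lemma free_on_mono:
  assumes "cring S" "B \<subseteq> C"
  shows "free_on S B \<subseteq> free_on S C"
proof
  fix v assume "v \<in> free_on S B"
  note D = free_onD[OF assms(1) this]
  show "v \<in> free_on S C" using D(1,3) D(2) assms(2) by (intro free_onI) auto
qed

lemma module_free: "cring S \<Longrightarrow> module S (free_module S B)"
proof -
  assume S: "cring S"
  then interpret cring S .
  note D = free_onD[OF S]
  have Dc: "v b \<in> carrier S" if "v \<in> free_on S B" for v b using D[OF that] by simp
  have add: "(\<lambda>b. v b \<oplus>\<^bsub>S\<^esub> w b) \<in> free_on S B" if "v \<in> free_on S B" "w \<in> free_on S B" for v w
    using D[OF that(1)] D[OF that(2)]
    by (intro free_onI) (auto intro: finite_subset[of _ "{b. v b \<noteq> \<zero>\<^bsub>S\<^esub>} \<union> {b. w b \<noteq> \<zero>\<^bsub>S\<^esub>}"])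
  have sm: "(\<lambda>b. a \<otimes>\<^bsub>S\<^esub> w b) \<in> free_on S B" if "a \<in> carrier S" "w \<in> free_on S B" for a w
    using D[OF that(2)] that(1)
    by (intro free_onI) (auto intro: finite_subset[of _ "{b. w b \<noteq> \<zero>\<^bsub>S\<^esub>}"])
  have z: "(\<lambda>b. \<zero>\<^bsub>S\<^esub>) \<in> free_on S B" by (rule free_onI) auto
  show ?thesis
  proof (rule moduleI[OF S], rule abelian_groupI)
    fix v assume v: "v \<in> carrier (free_module S B)"
    show "\<exists>y\<in>carrier (free_module S B). y \<oplus>\<^bsub>free_module S B\<^esub> v = \<zero>\<^bsub>free_module S B\<^esub>"
    proof (intro bexI)
      show "(\<lambda>b. (\<ominus>\<^bsub>S\<^esub> \<one>\<^bsub>S\<^esub>) \<otimes>\<^bsub>S\<^esub> v b) \<in> carrier (free_module S B)" using v sm by auto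
      show "(\<lambda>b. (\<ominus>\<^bsub>S\<^esub> \<one>\<^bsub>S\<^esub>) \<otimes>\<^bsub>S\<^esub> v b) \<oplus>\<^bsub>free_module S B\<^esub> v = \<zero>\<^bsub>free_module S B\<^esub>"
        using D(1)[OF v[simplified]] by (simp add: l_minus l_neg)
    qed
  qed (simp_all add: add sm z Dc fun_eq_iff a_ac l_distr r_distr m_assoc)
qed

lemma submod_free_on:
  assumes S: "cring S" "B \<subseteq> C"
  shows "submodule (free_on S B) S (free_module S C)"
proof -
  note m = module_free[OF S(1)]
  have "submodule (free_on S B) S (free_module S B)"
    using module.carrier_is_submodule[OF m, of B] by simp
  note submod_facts[OF m this]
  then show ?thesis
    using free_on_mono[OF S]
    by (intro submodI[OF m]) auto
qed

text \<open>The operations of \<open>free_module\<close> do not mention the basis; only its carrier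
  does.\<close>

lemma lin_free_module: "lin S (free_module S B) Y N = lin S (free_module S C) Y N"
  by (simp add: lin_def module_hom_def)

lemma basis_vec_free_on: "cring S \<Longrightarrow> b \<in> B \<Longrightarrow> basis_vec S b \<in> free_on S B"
proof -
  assume S: "cring S" "b \<in> B"
  then interpret cring S by simp
  show ?thesis using S by (intro free_onI) (auto simp: basis_vec_def)
qed

text \<open>An induction over a finite set that contains the support, clearing one coordinate at a
  time. With a preimage or an equalizer as \<open>W\<close>, it reduces statements about vectors to
  basis vectors.\<close>

lemma free_on_induct:
  assumes S: "cring S" and W: "submodule W S (free_module S C)"
    and b: "\<And>b. b \<in> B \<Longrightarrow> basis_vec S b \<in> W"
  shows "free_on S B \<subseteq> W"
proof
  interpret cring S by fact
  note m = module_free[OF S]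
  fix v assume v: "v \<in> free_on S B"
  have "\<forall>v. v \<in> free_on S B \<and> {b. v b \<noteq> \<zero>\<^bsub>S\<^esub>} \<subseteq> D \<longrightarrow> v \<in> W" if "finite D" for D
    using that
  proof (induction D)
    case empty
    show ?case
    proof (intro allI impI)
      fix v assume "v \<in> free_on S B \<and> {b. v b \<noteq> \<zero>\<^bsub>S\<^esub>} \<subseteq> {}"
      then have "v = (\<lambda>b. \<zero>\<^bsub>S\<^esub>)" by auto
      then show "v \<in> W" using submod_zero[OF m W] by simp
    qed
  next
    case (insert c D)
    show ?case
    proof (intro allI impI)
      fix v assume v: "v \<in> free_on S B \<and> {b. v b \<noteq> \<zero>\<^bsub>S\<^esub>} \<subseteq> insert c D"
      note D = free_onD[OF S conjunct1[OF v]]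
      have 1: "v(c := \<zero>\<^bsub>S\<^esub>) \<in> free_on S B"
        using D by (intro free_onI) (auto elim: finite_subset[rotated])
      have "{b. (v(c := \<zero>\<^bsub>S\<^esub>)) b \<noteq> \<zero>\<^bsub>S\<^esub>} \<subseteq> D" using v by auto
      then have 2: "v(c := \<zero>\<^bsub>S\<^esub>) \<in> W" using insert.IH 1 by blast
      show "v \<in> W"
      \<comment> \<open>The set \<open>D\<close> is unrelated to \<open>B\<close>, so
        \<open>c\<close> may be no basis index; its coordinate is then already zero.\<close>
      proof (cases "c \<in> B")
        case True
        have "v = v(c := \<zero>\<^bsub>S\<^esub>) \<oplus>\<^bsub>free_module S C\<^esub> v c \<odot>\<^bsub>free_module S C\<^esub> basis_vec S c"
          using D by (auto simp: basis_vec_def)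
        then show ?thesis using submod_add[OF m W 2 submod_smult[OF m W D(1) b[OF True]]] by metis
      next
        case False
        then show ?thesis using 2 D(2)[OF False] by (metis fun_upd_triv)
      qed
    qed
  qed
  then show "v \<in> W" using v free_onD(3)[OF S v] by blast
qed

lemma free_on_lin_eq:
  assumes S: "cring S" and N: "module S N" and "g \<in> lin S (free_module S C) (free_on S B) N"
    "h \<in> lin S (free_module S C) (free_on S B) N"
    and "\<And>b. b \<in> B \<Longrightarrow> g (basis_vec S b) = h (basis_vec S b)" "B \<subseteq> C" "v \<in> free_on S B"
  shows "g v = h v"
proof -
  have "free_on S B \<subseteq> {v \<in> free_on S B. g v = h v}"
    by (rule free_on_induct[OF S submod_equalizer[OF module_free[OF S] N assms(3,4) submod_free_on[OF S assms(6)]]])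
      (use basis_vec_free_on[OF S] assms(5) in auto)
  then show ?thesis using assms(7) by blast
qed

text \<open>The defining sum of \<open>lin_ext\<close> runs over the support, which changes under
  addition and scaling; a common finite superset makes such sums comparable.\<close>

lemma lin_ext_superset:
  assumes S: "cring S" and N: "module S N" and g: "\<And>b. b \<in> B \<Longrightarrow> g b \<in> carrier N"
    and v: "v \<in> free_on S B" and D: "finite D" "{b. v b \<noteq> \<zero>\<^bsub>S\<^esub>} \<subseteq> D" "D \<subseteq> B"
  shows "lin_ext S N g v = (\<Oplus>\<^bsub>N\<^esub>b\<in>D. v b \<odot>\<^bsub>N\<^esub> g b)"
proof -
  interpret N: module S N by fact
  show ?thesis unfolding lin_ext_def
    using D g free_onD[OF S v] by (intro N.add.finprod_mono_neutral_cong_left) auto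
qed

lemma lin_ext_lin:
  assumes S: "cring S" and N: "module S N" and g: "\<And>b. b \<in> B \<Longrightarrow> g b \<in> carrier N"
  shows "lin_ext S N g \<in> lin S (free_module S C) (free_on S B) N"
proof (rule linI)
  interpret N: module S N by fact
  let ?s = "\<lambda>v. {b. v b \<noteq> \<zero>\<^bsub>S\<^esub>}"
  note D = free_onD[OF S]
  note E = lin_ext_superset[OF S N g]
  have sB: "?s v \<subseteq> B" if "v \<in> free_on S B" for v using D[OF that] by blast
  show "lin_ext S N g v \<in> carrier N" if v: "v \<in> free_on S B" for v
    unfolding lin_ext_def using D[OF v] g sB[OF v] by (intro N.finsum_closed) auto
  show "lin_ext S N g (v \<oplus>\<^bsub>free_module S C\<^esub> w) = lin_ext S N g v \<oplus>\<^bsub>N\<^esub> lin_ext S N g w"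
    if v: "v \<in> free_on S B" and w: "w \<in> free_on S B" for v w
  proof -
    let ?D = "?s v \<union> ?s w"
    have vw: "(\<lambda>b. v b \<oplus>\<^bsub>S\<^esub> w b) \<in> free_on S B"
      using submod_add[OF module_free[OF S] submod_free_on[OF S, of B B]] v w by simp
    have fin: "finite ?D" "?D \<subseteq> B" using D v w sB by auto
    have "lin_ext S N g (\<lambda>b. v b \<oplus>\<^bsub>S\<^esub> w b) = (\<Oplus>\<^bsub>N\<^esub>b\<in>?D. (v b \<oplus>\<^bsub>S\<^esub> w b) \<odot>\<^bsub>N\<^esub> g b)"
      by (rule E[OF _ vw fin(1) _ fin(2)]) (use D v w in auto)
    also have "\<dots> = (\<Oplus>\<^bsub>N\<^esub>b\<in>?D. v b \<odot>\<^bsub>N\<^esub> g b \<oplus>\<^bsub>N\<^esub> w b \<odot>\<^bsub>N\<^esub> g b)"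
      using fin(2) D[OF v] D[OF w] g by (intro N.finsum_cong') (auto intro!: N.smult_l_distr)
    also have "\<dots> = (\<Oplus>\<^bsub>N\<^esub>b\<in>?D. v b \<odot>\<^bsub>N\<^esub> g b) \<oplus>\<^bsub>N\<^esub> (\<Oplus>\<^bsub>N\<^esub>b\<in>?D. w b \<odot>\<^bsub>N\<^esub> g b)"
      using fin(2) D[OF v] D[OF w] g by (intro N.finsum_addf) auto
    also have "\<dots> = lin_ext S N g v \<oplus>\<^bsub>N\<^esub> lin_ext S N g w"
      using E[OF _ v fin(1) _ fin(2)] E[OF _ w fin(1) _ fin(2)] by simp
    finally show ?thesis by simp
  qed
  show "lin_ext S N g (a \<odot>\<^bsub>free_module S C\<^esub> v) = a \<odot>\<^bsub>N\<^esub> lin_ext S N g v"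
    if a: "a \<in> carrier S" and v: "v \<in> free_on S B" for a v
  proof -
    have av: "(\<lambda>b. a \<otimes>\<^bsub>S\<^esub> v b) \<in> free_on S B"
      using submod_smult[OF module_free[OF S] submod_free_on[OF S, of B B]] v a by simp
    have "lin_ext S N g (\<lambda>b. a \<otimes>\<^bsub>S\<^esub> v b) = (\<Oplus>\<^bsub>N\<^esub>b\<in>?s v. (a \<otimes>\<^bsub>S\<^esub> v b) \<odot>\<^bsub>N\<^esub> g b)"
      by (rule E[OF _ av D(3)[OF v] _ sB[OF v]]) (use a in auto)
    also have "\<dots> = (\<Oplus>\<^bsub>N\<^esub>b\<in>?s v. a \<odot>\<^bsub>N\<^esub> (v b \<odot>\<^bsub>N\<^esub> g b))"
      using sB[OF v] D[OF v] a g by (intro N.finsum_cong') (auto intro!: N.smult_assoc1)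
    also have "\<dots> = a \<odot>\<^bsub>N\<^esub> lin_ext S N g v" unfolding lin_ext_def
      using sB[OF v] D[OF v] a g by (intro N.finsum_smult_ldistr[symmetric]) auto
    finally show ?thesis by simp
  qed
qed

lemma lin_ext_basis_vec:
  assumes S: "cring S" and N: "module S N" and g: "g b \<in> carrier N"
  shows "lin_ext S N g (basis_vec S b) = g b"
proof -
  interpret N: module S N by fact
  have "lin_ext S N g (basis_vec S b) = (\<Oplus>\<^bsub>N\<^esub>c\<in>{b}. basis_vec S b c \<odot>\<^bsub>N\<^esub> g c)"
    by (rule lin_ext_superset[OF S N _ basis_vec_free_on[OF S], of "{b}"]) (use g in \<open>auto simp: basis_vec_def\<close>)
  then show ?thesis using g by (simp add: basis_vec_def)
qed

lemma lin_ext_mem: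
  assumes S: "cring S" and N: "module S N" and W: "submodule W S N" and g: "\<And>b. b \<in> B \<Longrightarrow> g b \<in> W"
    and v: "v \<in> free_on S B"
  shows "lin_ext S N g v \<in> W"
proof -
  have gc: "\<And>b. b \<in> B \<Longrightarrow> g b \<in> carrier N" using g submod_mem[OF N W] by blast
  note s = submod_preimage[OF module_free[OF S] N lin_ext_lin[OF S N gc] submod_free_on[OF S order_refl] W]
  have "free_on S B \<subseteq> {y \<in> free_on S B. lin_ext S N g y \<in> W}"
    by (rule free_on_induct[OF S s]) (use g gc in \<open>auto simp: basis_vec_free_on[OF S] lin_ext_basis_vec[OF S N]\<close>)
  then show ?thesis using v by blast
qed

lemma acc_singleton: "acc {N}"
  unfolding acc_def by (simp add: subset_singleton_iff)

text \<open>Induction on the basis. A submodule has two traces along one coordinate: its part where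
  the coordinate vanishes, which lies in a smaller free module, and the ideal of its coordinates.
  Nested submodules with the same two traces are equal.\<close>

lemma noeth_sub_free:
  fixes B :: "'b set"
  assumes S: "cring S" "noetherian_ring S" and B: "finite B" "B \<subseteq> C"
  shows "noeth_sub S (free_module S C) (free_on S B)"
proof -
  interpret cring S by fact
  note m = module_free[OF S(1)]
  interpret F: module S "free_module S C" by (rule m)
  have "acc {N. submodule N S (free_module S C) \<and> N \<subseteq> free_on S B}"
    using B
  proof (induction B)
    case empty
    have "N = {\<lambda>b. \<zero>\<^bsub>S\<^esub>}" if "submodule N S (free_module S C)" "N \<subseteq> free_on S {}" for N
    proof -
      have "v = (\<lambda>b. \<zero>\<^bsub>S\<^esub>)" if "v \<in> N" for v
        using free_onD(2)[OF S(1), of v "{}"] \<open>N \<subseteq> _\<close> that by auto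
      moreover have "(\<lambda>b. \<zero>\<^bsub>S\<^esub>) \<in> N" using submod_zero[OF m that(1)] by simp
      ultimately show ?thesis by blast
    qed
    then have *: "{N. submodule N S (free_module S C) \<and> N \<subseteq> free_on S {}} \<subseteq> {{\<lambda>b. \<zero>\<^bsub>S\<^esub>}}" by blast
    show ?case using acc_subset[OF acc_singleton *] .
  next
    case (insert b B)
    let ?F = "{N. submodule N S (free_module S C) \<and> N \<subseteq> free_on S (insert b B)}"
    let ?a = "{N. submodule N S (free_module S C) \<and> N \<subseteq> free_on S B}"
    have ev: "(\<lambda>v. v b) \<in> lin S (free_module S C) N (self_module S)" if "N \<in> ?F" for N
    proof (rule linI)
      fix v assume "v \<in> N"
      then have "v \<in> free_on S (insert b B)" using that by blast
      from free_onD(1)[OF S(1) this] show "v b \<in> carrier (self_module S)" by simp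
    qed auto
    show ?case
    proof (rule acc_transfer2[of ?a "{I. ideal I S}" _ "\<lambda>N. {v\<in>N. v b \<in> {\<zero>\<^bsub>S\<^esub>}}" "\<lambda>N. (\<lambda>v. v b) ` N"])
      show "acc ?a" using insert by blast
      show "acc {I. ideal I S}" using noetherian_ring.acc_ideals[OF S(2)] .
      fix N assume N: "N \<in> ?F"
      have "submodule {v\<in>N. v b \<in> {\<zero>\<^bsub>S\<^esub>}} S (free_module S C)"
        by (rule submod_preimage[OF m module_self[OF S(1)] ev[OF N]])
          (use N submod_trivial[OF module_self[OF S(1)]] in auto)
      moreover have "{v\<in>N. v b \<in> {\<zero>\<^bsub>S\<^esub>}} \<subseteq> free_on S B"
      proof
        fix v assume v: "v \<in> {v\<in>N. v b \<in> {\<zero>\<^bsub>S\<^esub>}}"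
        then have "v \<in> free_on S (insert b B)" using N by blast
        note vD = free_onD[OF S(1) this]
        have "v c = \<zero>\<^bsub>S\<^esub>" if "c \<notin> B" for c using v vD(2)[of c] that by (cases "c = b") auto
        then show "v \<in> free_on S B" using vD by (intro free_onI) auto
      qed
      ultimately show "{v\<in>N. v b \<in> {\<zero>\<^bsub>S\<^esub>}} \<in> ?a" by blast
      show "(\<lambda>v. v b) ` N \<in> {I. ideal I S}"
        using submod_image[OF m module_self[OF S(1)] ev[OF N]] N ideal_iff_submodule[OF S(1)] by blast
    next
      fix N N' assume H: "N \<in> ?F" "N' \<in> ?F" "N \<subseteq> N'" "{v\<in>N. v b \<in> {\<zero>\<^bsub>S\<^esub>}} = {v\<in>N'. v b \<in> {\<zero>\<^bsub>S\<^esub>}}"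
        "(\<lambda>v. v b) ` N = (\<lambda>v. v b) ` N'"
      have sN: "submodule N S (free_module S C)" "submodule N' S (free_module S C)" using H by auto
      show "N' \<subseteq> N"
      proof
        fix v assume v: "v \<in> N'"
        then have "v b \<in> (\<lambda>v. v b) ` N" using H(5) by blast
        then obtain w where w: "w \<in> N" "w b = v b" by auto
        \<comment> \<open>The vector \<open>w\<close> has the same coordinate at \<open>b\<close> as
          \<open>v\<close>, so the difference falls into the common part where that coordinate
          vanishes.\<close>
        let ?d = "v \<ominus>\<^bsub>free_module S C\<^esub> w"
        have dN': "?d \<in> N'" using submod_diff[OF m sN(2)] v w H(3) by blast
        have "?d b = v b \<ominus>\<^bsub>self_module S\<^esub> w b"
          using lin_diff[OF m module_self[OF S(1)] ev[OF H(2)] sN(2) v, of w] w H(3) by auto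
        also have "\<dots> = \<zero>\<^bsub>S\<^esub>" using w v H(2) free_onD(1)[OF S(1), of v _ b]
          abelian_group.r_neg[OF module.axioms(2)[OF module_self[OF S(1)]], of "v b"]
          by (auto simp: a_minus_def)
        finally have "?d \<in> N" using dN' H(4) by blast
        then have "?d \<oplus>\<^bsub>free_module S C\<^esub> w \<in> N" using submod_add[OF m sN(1)] w by blast
        moreover have "?d \<oplus>\<^bsub>free_module S C\<^esub> w = v"
        proof -
          have "v \<in> carrier (free_module S C)" "w \<in> carrier (free_module S C)"
            using submod_mem[OF m sN(2)] submod_mem[OF m sN(1)] v w by blast+
          then show ?thesis by (simp add: a_minus_def F.a_assoc F.l_neg del: free_module_simps carrier_free_module)
        qed
        ultimately show "v \<in> N" by simp
      qed
    qed auto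
  qed
  then show ?thesis unfolding noeth_sub_def using submod_free_on[OF S(1) B(2)] by blast
qed

lemma (in abelian_group) minus_eq_zero_iff:
  assumes "x \<in> carrier G" "y \<in> carrier G"
  shows "x \<ominus> y = \<zero> \<longleftrightarrow> x = y"
proof
  assume "x \<ominus> y = \<zero>"
  then have "(x \<ominus> y) \<oplus> y = \<zero> \<oplus> y" by simp
  then show "x = y" using assms by (simp add: a_minus_def a_assoc l_neg)
qed (use assms in \<open>simp add: a_minus_def r_neg\<close>)

section \<open>Complexes of injective modules\<close>

text \<open>
  The module \<open>J 0\<close> is zero and \<open>J (i + 1)\<close> is the term of degree \<open>i\<close> of an injective resolution of the
  localization of \<open>S\<close> at \<open>Q\<close>, in which \<open>e\<close> is the image of \<open>1\<close>. The shift of the index makes degree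
  \<open>0\<close> no exception in the definition of coboundaries.
\<close>

locale inj_complex =
  fixes S :: "'s ring" and Q :: "'s set" and J :: "nat \<Rightarrow> ('s, 'e) module" and D :: "nat \<Rightarrow> 'e \<Rightarrow> 'e"
    and e :: 'e and n :: nat
  assumes noeth: "noetherian_ring S" and prime: "primeideal Q S"
    and J: "module S (J i)"
    and D_hom: "D i \<in> module_hom S (J i) (J (Suc i))"
    and D_D: "x \<in> carrier (J i) \<Longrightarrow> D (Suc i) (D i x) = \<zero>\<^bsub>J (Suc (Suc i))\<^esub>"
    and J_0: "carrier (J 0) = {\<zero>\<^bsub>J 0\<^esub>}"
    and exact: "x \<in> carrier (J (Suc (Suc i))) \<Longrightarrow> D (Suc (Suc i)) x = \<zero>\<^bsub>J (Suc (Suc (Suc i)))\<^esub> \<Longrightarrow>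
      \<exists>y\<in>carrier (J (Suc i)). D (Suc i) y = x"
    and e: "e \<in> carrier (J 1)" "D 1 e = \<zero>\<^bsub>J 2\<^esub>"
    and aug: "x \<in> carrier (J 1) \<Longrightarrow> D 1 x = \<zero>\<^bsub>J 2\<^esub> \<Longrightarrow> \<exists>t\<in>carrier S - Q. \<exists>s\<in>carrier S. t \<odot>\<^bsub>J 1\<^esub> x = s \<odot>\<^bsub>J 1\<^esub> e"
    and torsion: "s \<in> carrier S \<Longrightarrow> s \<odot>\<^bsub>J 1\<^esub> e = \<zero>\<^bsub>J 1\<^esub> \<Longrightarrow> \<exists>t\<in>carrier S - Q. t \<otimes>\<^bsub>S\<^esub> s = \<zero>\<^bsub>S\<^esub>"
    and baer: "ideal I S \<Longrightarrow> g \<in> lin S (self_module S) I (J i) \<Longrightarrow> \<exists>x\<in>carrier (J i). \<forall>a\<in>I. g a = a \<odot>\<^bsub>J i\<^esub> x"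
    and unit_inj: "t \<in> carrier S - Q \<Longrightarrow> x \<in> carrier (J i) \<Longrightarrow> t \<odot>\<^bsub>J i\<^esub> x = \<zero>\<^bsub>J i\<^esub> \<Longrightarrow> x = \<zero>\<^bsub>J i\<^esub>"
    and unit_surj: "t \<in> carrier S - Q \<Longrightarrow> x \<in> carrier (J i) \<Longrightarrow> \<exists>y\<in>carrier (J i). t \<odot>\<^bsub>J i\<^esub> y = x"
    and bounded: "n < i \<Longrightarrow> carrier (J i) = {\<zero>\<^bsub>J i\<^esub>}"
begin

sublocale P: primeideal Q S by (rule prime)
sublocale J: module S "J i" for i by (rule J)

lemma cring_S: "cring S" by (rule P.is_cring)

lemma D_lin: "D i \<in> lin S (J i) (carrier (J i)) (J (Suc i))"
  using D_hom by (simp add: module_hom_eq_lin)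

lemma D_closed [simp, intro]: "x \<in> carrier (J i) \<Longrightarrow> D i x \<in> carrier (J (Suc i))"
  and D_add: "x \<in> carrier (J i) \<Longrightarrow> y \<in> carrier (J i) \<Longrightarrow> D i (x \<oplus>\<^bsub>J i\<^esub> y) = D i x \<oplus>\<^bsub>J (Suc i)\<^esub> D i y"
  and D_smult: "a \<in> carrier S \<Longrightarrow> x \<in> carrier (J i) \<Longrightarrow> D i (a \<odot>\<^bsub>J i\<^esub> x) = a \<odot>\<^bsub>J (Suc i)\<^esub> D i x"
  and D_zero [simp]: "D i \<zero>\<^bsub>J i\<^esub> = \<zero>\<^bsub>J (Suc i)\<^esub>"
  and D_diff: "x \<in> carrier (J i) \<Longrightarrow> y \<in> carrier (J i) \<Longrightarrow> D i (x \<ominus>\<^bsub>J i\<^esub> y) = D i x \<ominus>\<^bsub>J (Suc i)\<^esub> D i y"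
  using lin_closed[OF D_lin] lin_add[OF D_lin] lin_smult[OF D_lin]
    lin_zero[OF J J D_lin J.carrier_is_submodule] lin_diff[OF J J D_lin J.carrier_is_submodule] by auto

lemma lin_D: "h \<in> lin S U Y (J i) \<Longrightarrow> (\<lambda>y. D i (h y)) \<in> lin S U Y (J (Suc i))"
  by (rule lin_comp[OF _ _ D_lin]) (auto simp: lin_closed)

lemma mult_notin: "t \<in> carrier S - Q \<Longrightarrow> u \<in> carrier S - Q \<Longrightarrow> t \<otimes>\<^bsub>S\<^esub> u \<in> carrier S - Q"
  using P.I_prime by blast

lemma one_notin: "\<one>\<^bsub>S\<^esub> \<in> carrier S - Q"
  using P.I_notcarr P.one_imp_carrier by auto

lemma J_minus_self [simp]: "x \<in> carrier (J i) \<Longrightarrow> x \<ominus>\<^bsub>J i\<^esub> x = \<zero>\<^bsub>J i\<^esub>"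
  by (simp add: a_minus_def J.r_neg)

lemma unit_cancel:
  assumes "t \<in> carrier S - Q" "x \<in> carrier (J i)" "y \<in> carrier (J i)" "t \<odot>\<^bsub>J i\<^esub> x = t \<odot>\<^bsub>J i\<^esub> y"
  shows "x = y"
proof -
  have "t \<odot>\<^bsub>J i\<^esub> (x \<ominus>\<^bsub>J i\<^esub> y) = \<zero>\<^bsub>J i\<^esub>" using assms by (simp add: smult_minus[OF J])
  then have "x \<ominus>\<^bsub>J i\<^esub> y = \<zero>\<^bsub>J i\<^esub>" using unit_inj assms by blast
  then show ?thesis using assms by (simp add: J.minus_eq_zero_iff)
qed

text \<open>The argument of Baer's criterion, with the ascending chain condition on
  \<open>Y'\<close> in place of Zorn's lemma.\<close>

lemma J_extend:
  assumes U: "module S U" and Y': "noeth_sub S U Y'" and Y: "submodule Y S U" "Y \<subseteq> Y'" and g: "g \<in> lin S U Y (J i)"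
  obtains h where "h \<in> lin S U Y' (J i)" "\<And>y. y \<in> Y \<Longrightarrow> h y = g y"
proof -
  interpret U: module S U by fact
  note m = module_self[OF cring_S]
  have S: "submodule (carrier S) S (self_module S)" using module.carrier_is_submodule[OF m] by simp
  \<comment> \<open>Only the submodules are ordered, not the extensions on them: any extension on a
    maximal \<open>W\<close> can be prolonged by one more element.\<close>
  define G where "G = {W. submodule W S U \<and> Y \<subseteq> W \<and> W \<subseteq> Y' \<and> (\<exists>h\<in>lin S U W (J i). \<forall>y\<in>Y. h y = g y)}"
  have 1: "\<And>W. W \<in> G \<Longrightarrow> submodule W S U \<and> W \<subseteq> Y'" by (simp add: G_def)
  have 2: "Y \<in> G" using Y g unfolding G_def by blast
  obtain W where WG: "W \<in> G" "\<And>W'. W' \<in> G \<Longrightarrow> W \<subseteq> W' \<Longrightarrow> W' = W"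
    using noeth_sub_maximal[OF Y' 1 2] by metis
  then have W: "submodule W S U" "Y \<subseteq> W" "W \<subseteq> Y'" unfolding G_def by blast+
  obtain h where h: "h \<in> lin S U W (J i)" "\<And>y. y \<in> Y \<Longrightarrow> h y = g y" using WG(1) unfolding G_def by blast
  note Ws = W(1)
  have "Y' \<subseteq> W"
  proof
    fix y assume y: "y \<in> Y'"
    have yc: "y \<in> carrier U" using submod_mem[OF U noeth_sub_submod[OF Y'] y] .
    note p = lin_smult_vec[OF U yc]
    have I: "ideal (colon S U W y) S" by (rule ideal_colon[OF U Ws yc])
    have "(\<lambda>s. h (s \<odot>\<^bsub>U\<^esub> y)) \<in> lin S (self_module S) (colon S U W y) (J i)"
      by (rule lin_comp[OF lin_subset[OF p] _ h(1)]) (auto simp: colon_def)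
    \<comment> \<open>The map is already prescribed on the multiples of \<open>y\<close> that lie in
      \<open>W\<close>; the element \<open>x\<close> is a value at \<open>y\<close> compatible with
      all of them.\<close>
    from baer[OF I this] obtain x where x: "x \<in> carrier (J i)"
      "\<And>s. s \<in> colon S U W y \<Longrightarrow> h (s \<odot>\<^bsub>U\<^esub> y) = s \<odot>\<^bsub>J i\<^esub> x" by blast
    note A = submod_sum_image[OF U m Ws S p, folded adjoin_def]
    obtain c where c: "c \<in> lin S U (adjoin S U W y) (J i)" "\<And>w. w \<in> W \<Longrightarrow> c w = h w"
    proof (rule lin_glue[OF U m J Ws S p h(1) lin_smult_vec[OF J x(1)] _ A])
      fix s assume that: "s \<in> carrier S" "s \<odot>\<^bsub>U\<^esub> y \<in> W"
      show "h (s \<odot>\<^bsub>U\<^esub> y) = s \<odot>\<^bsub>J i\<^esub> x"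
        using x(2) that by (simp add: colon_def)
    next
      fix c assume "c \<in> lin S U (adjoin S U W y) (J i)" "\<And>z. z \<in> W \<Longrightarrow> c z = h z"
      then show thesis by (rule that)
    qed
    note A' = adjoin[OF U Ws yc]
    have "adjoin S U W y \<subseteq> Y'" using A'(4)[OF noeth_sub_submod[OF Y']] W y by blast
    moreover have "\<forall>y\<in>Y. c y = g y" using c(2) h(2) W(2) by auto
    ultimately have "adjoin S U W y \<in> G" unfolding G_def using A'(1,2) W(2) c(1) by (intro CollectI conjI bexI[of _ c]) auto
    then have "adjoin S U W y = W" using WG(2) A'(2) by blast
    then show "y \<in> W" using A'(3) by blast
  qed
  then have "h \<in> lin S U Y' (J i)" using h(1) lin_subset by blast
  then show ?thesis using that h(2) by blast
qed

text \<open>Elements outside \<open>Q\<close> act bijectively on \<open>J i\<close>, so the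
  pointwise quotient is unique, and its uniqueness makes it linear.\<close>

lemma J_divide:
  assumes U: "module S U" "submodule Y S U" and h: "h \<in> lin S U Y (J i)" and t: "t \<in> carrier S - Q"
  obtains g where "g \<in> lin S U Y (J i)" "\<And>y. y \<in> Y \<Longrightarrow> t \<odot>\<^bsub>J i\<^esub> g y = h y"
proof -
  define g where "g y = (SOME x. x \<in> carrier (J i) \<and> t \<odot>\<^bsub>J i\<^esub> x = h y)" for y
  have g: "g y \<in> carrier (J i)" "t \<odot>\<^bsub>J i\<^esub> g y = h y" if "y \<in> Y" for y
    using someI_ex[of "\<lambda>x. x \<in> carrier (J i) \<and> t \<odot>\<^bsub>J i\<^esub> x = h y"] unit_surj[OF t lin_closed[OF h that]]
    unfolding g_def by blast+
  have "g \<in> lin S U Y (J i)"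
  proof (rule linI)
    show "g y \<in> carrier (J i)" if "y \<in> Y" for y using g that by blast
    show "g (y \<oplus>\<^bsub>U\<^esub> z) = g y \<oplus>\<^bsub>J i\<^esub> g z" if yz: "y \<in> Y" "z \<in> Y" for y z
    proof (rule unit_cancel[OF t])
      show "t \<odot>\<^bsub>J i\<^esub> g (y \<oplus>\<^bsub>U\<^esub> z) = t \<odot>\<^bsub>J i\<^esub> (g y \<oplus>\<^bsub>J i\<^esub> g z)"
        using yz t g submod_add[OF U] lin_add[OF h] by (simp add: J.smult_r_distr)
    qed (use g yz submod_add[OF U] in auto)
    show "g (a \<odot>\<^bsub>U\<^esub> y) = a \<odot>\<^bsub>J i\<^esub> g y" if a: "a \<in> carrier S" "y \<in> Y" for a y
    proof (rule unit_cancel[OF t])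
      have "t \<odot>\<^bsub>J i\<^esub> (a \<odot>\<^bsub>J i\<^esub> g y) = a \<odot>\<^bsub>J i\<^esub> (t \<odot>\<^bsub>J i\<^esub> g y)"
        using a t g(1)[OF a(2)] by (simp add: J.smult_assoc1[symmetric] P.m_comm)
      then show "t \<odot>\<^bsub>J i\<^esub> g (a \<odot>\<^bsub>U\<^esub> y) = t \<odot>\<^bsub>J i\<^esub> (a \<odot>\<^bsub>J i\<^esub> g y)"
        using a t g submod_smult[OF U] lin_smult[OF h] by simp
    qed (use g a submod_smult[OF U] in auto)
  qed
  then show ?thesis using that g by blast
qed

end

text \<open>The modules under study must share a type, so one ambient module is fixed and they are
  its subquotients Y/Z.\<close>

locale inj_complex_over = inj_complex S Q J D e n
  for S :: "'s ring" and Q :: "'s set" and J :: "nat \<Rightarrow> ('s, 'e) module" and D :: "nat \<Rightarrow> 'e \<Rightarrow> 'e"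
    and e :: 'e and n :: nat +
  fixes U :: "('s, 'u) module"
  assumes U: "module S U"
begin

sublocale U: module S U by (rule U)

text \<open>Modulo \<open>cobd i Y Z\<close> these are the classes of E^i(Y/Z): a map out of the
  quotient is a map on \<open>Y\<close> that vanishes on \<open>Z\<close>. Degree \<open>i\<close>
  sits at index \<open>Suc i\<close> of \<open>J\<close>; as index \<open>0\<close> carries the zero
  module, a coboundary of degree \<open>0\<close> vanishes on \<open>Y\<close>.\<close>

definition cocyc :: "nat \<Rightarrow> 'u set \<Rightarrow> 'u set \<Rightarrow> ('u \<Rightarrow> 'e) set" where
  "cocyc i Y Z = {c \<in> lin S U Y (J (Suc i)). (\<forall>z\<in>Z. c z = \<zero>\<^bsub>J (Suc i)\<^esub>) \<and>
     (\<forall>y\<in>Y. D (Suc i) (c y) = \<zero>\<^bsub>J (Suc (Suc i))\<^esub>)}"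

definition cobd :: "nat \<Rightarrow> 'u set \<Rightarrow> 'u set \<Rightarrow> ('u \<Rightarrow> 'e) set" where
  "cobd i Y Z = {c \<in> lin S U Y (J (Suc i)). \<exists>h\<in>lin S U Y (J i). (\<forall>z\<in>Z. h z = \<zero>\<^bsub>J i\<^esub>) \<and>
     (\<forall>y\<in>Y. c y = D i (h y))}"

lemma cocycI:
  assumes "c \<in> lin S U Y (J (Suc i))" "\<And>z. z \<in> Z \<Longrightarrow> c z = \<zero>\<^bsub>J (Suc i)\<^esub>"
    "\<And>y. y \<in> Y \<Longrightarrow> D (Suc i) (c y) = \<zero>\<^bsub>J (Suc (Suc i))\<^esub>"
  shows "c \<in> cocyc i Y Z"
  using assms by (auto simp: cocyc_def)

lemma cocycD:
  assumes "c \<in> cocyc i Y Z"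
  shows "c \<in> lin S U Y (J (Suc i))" "\<And>z. z \<in> Z \<Longrightarrow> c z = \<zero>\<^bsub>J (Suc i)\<^esub>"
    "\<And>y. y \<in> Y \<Longrightarrow> D (Suc i) (c y) = \<zero>\<^bsub>J (Suc (Suc i))\<^esub>" "\<And>y. y \<in> Y \<Longrightarrow> c y \<in> carrier (J (Suc i))"
  using assms by (auto simp: cocyc_def lin_closed)

lemma cobdI:
  assumes "submodule Y S U" "h \<in> lin S U Y (J i)" "\<And>z. z \<in> Z \<Longrightarrow> h z = \<zero>\<^bsub>J i\<^esub>"
    "\<And>y. y \<in> Y \<Longrightarrow> c y = D i (h y)"
  shows "c \<in> cobd i Y Z"
proof -
  have "c \<in> lin S U Y (J (Suc i))" using lin_cong[OF U assms(1) lin_D[OF assms(2)]] assms(4) by simp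
  then show ?thesis using assms by (auto simp: cobd_def)
qed

lemma cobdE:
  assumes "c \<in> cobd i Y Z"
  obtains h where "h \<in> lin S U Y (J i)" "\<And>z. z \<in> Z \<Longrightarrow> h z = \<zero>\<^bsub>J i\<^esub>" "\<And>y. y \<in> Y \<Longrightarrow> c y = D i (h y)"
  using assms unfolding cobd_def by blast

lemma cobd_subset_cocyc:
  assumes "Z \<subseteq> Y"
  shows "cobd i Y Z \<subseteq> cocyc i Y Z"
proof
  fix c assume c: "c \<in> cobd i Y Z"
  then obtain h where h: "h \<in> lin S U Y (J i)" "\<And>z. z \<in> Z \<Longrightarrow> h z = \<zero>\<^bsub>J i\<^esub>" "\<And>y. y \<in> Y \<Longrightarrow> c y = D i (h y)"
    unfolding cobd_def by blast
  show "c \<in> cocyc i Y Z"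
    by (rule cocycI) (use c h assms lin_closed[OF h(1)] D_D in \<open>auto simp: cobd_def\<close>)
qed

lemma cocyc_restrict: "c \<in> cocyc i Y Z \<Longrightarrow> W \<subseteq> Y \<Longrightarrow> Z' \<subseteq> Z \<Longrightarrow> c \<in> cocyc i W Z'"
  by (auto intro!: cocycI simp: cocycD lin_subset[OF cocycD(1)] subset_iff)

lemma cocyc_add: "c \<in> cocyc i Y Z \<Longrightarrow> c' \<in> cocyc i Y Z \<Longrightarrow> (\<lambda>y. c y \<oplus>\<^bsub>J (Suc i)\<^esub> c' y) \<in> cocyc i Y Z"
  by (rule cocycI) (simp_all add: lin_plus[OF U J] cocycD D_add)

lemma cocyc_scale: "c \<in> cocyc i Y Z \<Longrightarrow> a \<in> carrier S \<Longrightarrow> (\<lambda>y. a \<odot>\<^bsub>J (Suc i)\<^esub> c y) \<in> cocyc i Y Z"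
  by (rule cocycI) (simp_all add: lin_scale[OF U J] cocycD D_smult)

lemma cocyc_cong:
  assumes "submodule Y S U" "Z \<subseteq> Y" "c \<in> cocyc i Y Z" "\<And>y. y \<in> Y \<Longrightarrow> c' y = c y"
  shows "c' \<in> cocyc i Y Z"
proof (rule cocycI)
  show "c' \<in> lin S U Y (J (Suc i))" using lin_cong[OF U assms(1) cocycD(1)[OF assms(3)]] assms(4) by simp
qed (use assms cocycD[OF assms(3)] in auto)

lemma cobd_cong:
  assumes "submodule Y S U" "c \<in> cobd i Y Z" "\<And>y. y \<in> Y \<Longrightarrow> c' y = c y"
  shows "c' \<in> cobd i Y Z"
  using assms(2) by (rule cobdE) (rule cobdI[OF assms(1)], use assms(3) in auto)

lemma cobd_zero: "submodule Y S U \<Longrightarrow> (\<And>y. y \<in> Y \<Longrightarrow> c y = \<zero>\<^bsub>J (Suc i)\<^esub>) \<Longrightarrow> c \<in> cobd i Y Z"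
  by (rule cobdI[of Y "\<lambda>_. \<zero>\<^bsub>J i\<^esub>"]) (auto simp: lin_const_zero[OF U J])

lemma cobd_add: "submodule Y S U \<Longrightarrow> c \<in> cobd i Y Z \<Longrightarrow> c' \<in> cobd i Y Z \<Longrightarrow> (\<lambda>y. c y \<oplus>\<^bsub>J (Suc i)\<^esub> c' y) \<in> cobd i Y Z"
proof -
  assume Y: "submodule Y S U" and c: "c \<in> cobd i Y Z" "c' \<in> cobd i Y Z"
  obtain h where h: "h \<in> lin S U Y (J i)" "\<And>z. z \<in> Z \<Longrightarrow> h z = \<zero>\<^bsub>J i\<^esub>" "\<And>y. y \<in> Y \<Longrightarrow> c y = D i (h y)" using c(1) unfolding cobd_def by blast
  obtain h' where h': "h' \<in> lin S U Y (J i)" "\<And>z. z \<in> Z \<Longrightarrow> h' z = \<zero>\<^bsub>J i\<^esub>" "\<And>y. y \<in> Y \<Longrightarrow> c' y = D i (h' y)" using c(2) unfolding cobd_def by blast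
  show ?thesis
    by (rule cobdI[OF Y lin_plus[OF U J h(1) h'(1)]])
      (simp_all add: h h' D_add lin_closed[OF h(1)] lin_closed[OF h'(1)])
qed

lemma cobd_scale: "submodule Y S U \<Longrightarrow> c \<in> cobd i Y Z \<Longrightarrow> a \<in> carrier S \<Longrightarrow> (\<lambda>y. a \<odot>\<^bsub>J (Suc i)\<^esub> c y) \<in> cobd i Y Z"
proof -
  assume Y: "submodule Y S U" and c: "c \<in> cobd i Y Z" and a: "a \<in> carrier S"
  obtain h where h: "h \<in> lin S U Y (J i)" "\<And>z. z \<in> Z \<Longrightarrow> h z = \<zero>\<^bsub>J i\<^esub>" "\<And>y. y \<in> Y \<Longrightarrow> c y = D i (h y)" using c(1) unfolding cobd_def by blast
  show ?thesis
    by (rule cobdI[OF Y lin_scale[OF U J h(1) a]])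
      (simp_all add: h D_smult a lin_closed[OF h(1)])
qed

text \<open>Elements outside \<open>Q\<close> act injectively on cohomology: a primitive of the
  multiple is itself divisible by \<open>t\<close>, and \<open>t\<close> cancels in
  \<open>J\<close>.\<close>

lemma cobd_divide:
  assumes Y: "submodule Y S U" and t: "t \<in> carrier S - Q" and c: "c \<in> cocyc i Y Z" and Z: "Z \<subseteq> Y"
    and tc: "(\<lambda>y. t \<odot>\<^bsub>J (Suc i)\<^esub> c y) \<in> cobd i Y Z"
  shows "c \<in> cobd i Y Z"
proof -
  obtain h where h: "h \<in> lin S U Y (J i)" "\<And>z. z \<in> Z \<Longrightarrow> h z = \<zero>\<^bsub>J i\<^esub>" "\<And>y. y \<in> Y \<Longrightarrow> t \<odot>\<^bsub>J (Suc i)\<^esub> c y = D i (h y)" using tc unfolding cobd_def by blast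
  obtain g where g: "g \<in> lin S U Y (J i)" "\<And>y. y \<in> Y \<Longrightarrow> t \<odot>\<^bsub>J i\<^esub> g y = h y" using J_divide[OF U Y h(1) t] by metis
  show ?thesis
  proof (rule cobdI[OF Y g(1)])
    show "g z = \<zero>\<^bsub>J i\<^esub>" if "z \<in> Z" for z
      by (rule unit_inj[OF t]) (use that Z g h lin_closed[OF g(1)] in auto)
    show "c y = D i (g y)" if "y \<in> Y" for y
    proof (rule unit_cancel[OF t])
      show "t \<odot>\<^bsub>J (Suc i)\<^esub> c y = t \<odot>\<^bsub>J (Suc i)\<^esub> D i (g y)"
        using that g h(3) t D_smult[of t "g y" i] lin_closed[OF g(1)] by simp
    qed (use that cocycD(4)[OF c] lin_closed[OF g(1)] in auto)
  qed
qed

text \<open>Dimension shifting along a presentation \<open>0 \<rightarrow> K \<rightarrow> X \<rightarrow> Y/Z \<rightarrow> 0\<close>, where the \<open>Ext\<close> of \<open>X\<close> vanishes in positive degree.\<close>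

definition acyclic :: "'u set \<Rightarrow> bool" where
  "acyclic X \<longleftrightarrow> noeth_sub S U X \<and> (\<forall>i. cocyc (Suc i) X {\<zero>\<^bsub>U\<^esub>} \<subseteq> cobd (Suc i) X {\<zero>\<^bsub>U\<^esub>})"

definition presents :: "'u set \<Rightarrow> ('u \<Rightarrow> 'u) \<Rightarrow> 'u set \<Rightarrow> 'u set \<Rightarrow> 'u set \<Rightarrow> bool" where
  "presents X p Y Z K \<longleftrightarrow> acyclic X \<and> p \<in> lin S U X U \<and> p ` X \<subseteq> Y \<and> submodule Y S U \<and> submodule Z S U \<and> Z \<subseteq> Y \<and>
     (\<forall>y\<in>Y. \<exists>z\<in>Z. \<exists>x\<in>X. y = z \<oplus>\<^bsub>U\<^esub> p x) \<and> K = {x \<in> X. p x \<in> Z}"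

text \<open>The connecting homomorphism from classes on \<open>K\<close> to classes on Y/Z one
  degree higher. It is kept as a relation because the cochain \<open>h\<close> on \<open>X\<close>
  between the two is a choice.\<close>

definition connects :: "nat \<Rightarrow> 'u set \<Rightarrow> ('u \<Rightarrow> 'u) \<Rightarrow> 'u set \<Rightarrow> ('u \<Rightarrow> 'e) \<Rightarrow> ('u \<Rightarrow> 'e) \<Rightarrow> bool" where
  "connects i X p K c k \<longleftrightarrow> (\<exists>h\<in>lin S U X (J (Suc i)). (\<forall>x\<in>K. h x = k x) \<and> (\<forall>x\<in>X. D (Suc i) (h x) = c (p x)))"

text \<open>The image of the classes on \<open>X\<close> among those on \<open>K\<close>, which is
  the kernel of the connecting homomorphism. In positive degree it consists of coboundaries because
  \<open>X\<close> is acyclic.\<close>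

definition restricted :: "nat \<Rightarrow> 'u set \<Rightarrow> 'u set \<Rightarrow> ('u \<Rightarrow> 'e) set" where
  "restricted i X K = {k. \<exists>v\<in>cocyc i X {\<zero>\<^bsub>U\<^esub>}. \<forall>x\<in>K. k x = v x}"

lemma connects_add:
  assumes "connects i X p K c k" "connects i X p K c' k'"
  shows "connects i X p K (\<lambda>y. c y \<oplus>\<^bsub>J (Suc (Suc i))\<^esub> c' y) (\<lambda>x. k x \<oplus>\<^bsub>J (Suc i)\<^esub> k' x)"
proof -
  obtain h where h: "h \<in> lin S U X (J (Suc i))" "\<And>x. x \<in> K \<Longrightarrow> h x = k x" "\<And>x. x \<in> X \<Longrightarrow> D (Suc i) (h x) = c (p x)"
    using assms(1) unfolding connects_def by blast
  obtain h' where h': "h' \<in> lin S U X (J (Suc i))" "\<And>x. x \<in> K \<Longrightarrow> h' x = k' x" "\<And>x. x \<in> X \<Longrightarrow> D (Suc i) (h' x) = c' (p x)"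
    using assms(2) unfolding connects_def by blast
  show ?thesis unfolding connects_def
    by (rule bexI[OF _ lin_plus[OF U J h(1) h'(1)]])
      (simp add: h h' D_add lin_closed[OF h(1)] lin_closed[OF h'(1)])
qed

lemma connects_scale:
  assumes "connects i X p K c k" "a \<in> carrier S"
  shows "connects i X p K (\<lambda>y. a \<odot>\<^bsub>J (Suc (Suc i))\<^esub> c y) (\<lambda>x. a \<odot>\<^bsub>J (Suc i)\<^esub> k x)"
proof -
  obtain h where h: "h \<in> lin S U X (J (Suc i))" "\<And>x. x \<in> K \<Longrightarrow> h x = k x" "\<And>x. x \<in> X \<Longrightarrow> D (Suc i) (h x) = c (p x)"
    using assms(1) unfolding connects_def by blast
  show ?thesis unfolding connects_def
    by (rule bexI[OF _ lin_scale[OF U J h(1) assms(2)]])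
      (simp add: h D_smult assms(2) lin_closed[OF h(1)])
qed

context
  fixes X p Y Z K
  assumes pr: "presents X p Y Z K"
begin

lemma presents_facts:
  shows pr_X: "noeth_sub S U X" "submodule X S U" and pr_p: "p \<in> lin S U X U" "x \<in> X \<Longrightarrow> p x \<in> Y"
    and pr_Y: "submodule Y S U" and pr_Z: "submodule Z S U" "Z \<subseteq> Y"
    and pr_cover: "y \<in> Y \<Longrightarrow> \<exists>z\<in>Z. \<exists>x\<in>X. y = z \<oplus>\<^bsub>U\<^esub> p x"
    and pr_K: "submodule K S U" "K \<subseteq> X" "x \<in> X \<Longrightarrow> p x \<in> Z \<longleftrightarrow> x \<in> K"
    and pr_cover2: "submodule Y S U" "Z \<subseteq> Y" "p ` X \<subseteq> Y"
    and pr_acyclic: "cocyc (Suc i) X {\<zero>\<^bsub>U\<^esub>} \<subseteq> cobd (Suc i) X {\<zero>\<^bsub>U\<^esub>}"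
proof -
  show *: "noeth_sub S U X" "submodule X S U" "p \<in> lin S U X U" "x \<in> X \<Longrightarrow> p x \<in> Y"
     "submodule Y S U" "submodule Z S U" "Z \<subseteq> Y" "K \<subseteq> X" "x \<in> X \<Longrightarrow> p x \<in> Z \<longleftrightarrow> x \<in> K"
     "submodule Y S U" "Z \<subseteq> Y" "p ` X \<subseteq> Y" "y \<in> Y \<Longrightarrow> \<exists>z\<in>Z. \<exists>x\<in>X. y = z \<oplus>\<^bsub>U\<^esub> p x"
     "cocyc (Suc i) X {\<zero>\<^bsub>U\<^esub>} \<subseteq> cobd (Suc i) X {\<zero>\<^bsub>U\<^esub>}"
    using pr unfolding presents_def acyclic_def noeth_sub_def by blast+
  show "submodule K S U" using submod_preimage[OF U U *(3,2,6)] pr by (simp add: presents_def)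
qed

lemma presents_descend:
  assumes h: "h \<in> lin S U X (J i)" "\<And>x. x \<in> K \<Longrightarrow> h x = \<zero>\<^bsub>J i\<^esub>"
  obtains c where "c \<in> lin S U Y (J i)" "\<And>z. z \<in> Z \<Longrightarrow> c z = \<zero>\<^bsub>J i\<^esub>" "\<And>x. x \<in> X \<Longrightarrow> c (p x) = h x"
  by (rule lin_glue[OF U U J pr_Z(1) pr_X(2) pr_p(1) lin_const_zero[OF U J] h(1) _ pr_cover2 pr_cover])
    (use h pr_K in auto)

lemma presents_eqI:
  assumes c: "c \<in> lin S U Y (J i)" "c' \<in> lin S U Y (J i)" "\<And>z. z \<in> Z \<Longrightarrow> c z = c' z" "\<And>x. x \<in> X \<Longrightarrow> c (p x) = c' (p x)"
    and y: "y \<in> Y"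
  shows "c y = c' y"
proof -
  obtain z x where zx: "z \<in> Z" "x \<in> X" "y = z \<oplus>\<^bsub>U\<^esub> p x" using pr_cover[OF y] by blast
  then have "z \<in> Y" "p x \<in> Y" using pr_Z pr_p by auto
  then show ?thesis using c zx by (simp add: lin_add[OF c(1)] lin_add[OF c(2)])
qed

text \<open>Pulled back to \<open>X\<close> the cocycle has a primitive \<open>h\<close>, since
  \<open>X\<close> is acyclic and the degree is positive. As \<open>p\<close> maps \<open>K\<close>
  into \<open>Z\<close>, where \<open>c\<close> vanishes, \<open>h\<close> is a cocycle on
  \<open>K\<close>.\<close>

lemma ex_connects1:
  assumes c: "c \<in> cocyc (Suc i) Y Z"
  shows "\<exists>k\<in>cocyc i K {\<zero>\<^bsub>U\<^esub>}. connects i X p K c k"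
proof -
  have "(\<lambda>x. c (p x)) \<in> cocyc (Suc i) X {\<zero>\<^bsub>U\<^esub>}"
  proof (rule cocycI)
    show l: "(\<lambda>x. c (p x)) \<in> lin S U X (J (Suc (Suc i)))" by (rule lin_comp[OF pr_p(1) pr_cover2(3) cocycD(1)[OF c]])
    show "c (p z) = \<zero>\<^bsub>J (Suc (Suc i))\<^esub>" if "z \<in> {\<zero>\<^bsub>U\<^esub>}" for z
      using lin_zero[OF U J l pr_X(2)] that by simp
  qed (use cocycD[OF c] pr_p in auto)
  then obtain h where h: "h \<in> lin S U X (J (Suc i))" "\<And>x. x \<in> X \<Longrightarrow> c (p x) = D (Suc i) (h x)"
    using pr_acyclic unfolding cobd_def by blast
  have "h \<in> cocyc i K {\<zero>\<^bsub>U\<^esub>}"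
  proof (rule cocycI)
    show "h \<in> lin S U K (J (Suc i))" using lin_subset[OF h(1) pr_K(2)] .
    show "h z = \<zero>\<^bsub>J (Suc i)\<^esub>" if "z \<in> {\<zero>\<^bsub>U\<^esub>}" for z
      using lin_zero[OF U J h(1) pr_X(2)] that by simp
    show "D (Suc i) (h x) = \<zero>\<^bsub>J (Suc (Suc i))\<^esub>" if "x \<in> K" for x
    proof -
      have "x \<in> X" "p x \<in> Z" using that pr_K by auto
      then show ?thesis using h(2) cocycD(2)[OF c] by metis
    qed
  qed
  then show ?thesis using h unfolding connects_def by auto
qed

text \<open>Injectivity extends \<open>k\<close> from \<open>K\<close> to \<open>X\<close>; the
  differential of the extension vanishes on \<open>K\<close> and hence factors through Y/Z.\<close>

lemma ex_connects2:
  assumes k: "k \<in> cocyc i K {\<zero>\<^bsub>U\<^esub>}"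
  shows "\<exists>c\<in>cocyc (Suc i) Y Z. connects i X p K c k"
proof -
  obtain h where h: "h \<in> lin S U X (J (Suc i))" "\<And>x. x \<in> K \<Longrightarrow> h x = k x"
    using J_extend[OF U pr_X(1) pr_K(1,2) cocycD(1)[OF k]] by metis
  obtain c where c: "c \<in> lin S U Y (J (Suc (Suc i)))" "\<And>z. z \<in> Z \<Longrightarrow> c z = \<zero>\<^bsub>J (Suc (Suc i))\<^esub>" "\<And>x. x \<in> X \<Longrightarrow> c (p x) = D (Suc i) (h x)"
  proof (rule presents_descend[OF lin_D[OF h(1)]])
    show "D (Suc i) (h x) = \<zero>\<^bsub>J (Suc (Suc i))\<^esub>" if "x \<in> K" for x using h(2) cocycD(3)[OF k] that by simp
  qed blast
  have "c \<in> cocyc (Suc i) Y Z"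
  proof (rule cocycI[OF c(1,2)])
    fix y assume y: "y \<in> Y"
    have "D (Suc (Suc i)) (c y) = (\<lambda>_. \<zero>\<^bsub>J (Suc (Suc (Suc i)))\<^esub>) y"
      by (rule presents_eqI[OF lin_D[OF c(1)] lin_const_zero[OF U J] _ _ y])
       (use c D_D lin_closed[OF h(1)] in auto)
    then show "D (Suc (Suc i)) (c y) = \<zero>\<^bsub>J (Suc (Suc (Suc i)))\<^esub>" .
  qed
  then show ?thesis using h c unfolding connects_def by metis
qed

text \<open>If \<open>k\<close> is the restriction of a cocycle \<open>v\<close> on
  \<open>X\<close>, then \<open>h\<close> minus \<open>v\<close> vanishes on \<open>K\<close> and
  descends to a primitive of \<open>c\<close>.\<close>

lemma connects_cobd:
  assumes c: "c \<in> cocyc (Suc i) Y Z" and r: "connects i X p K c k" "k \<in> restricted i X K"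
  shows "c \<in> cobd (Suc i) Y Z"
proof -
  obtain h where h: "h \<in> lin S U X (J (Suc i))" "\<And>x. x \<in> K \<Longrightarrow> h x = k x" "\<And>x. x \<in> X \<Longrightarrow> D (Suc i) (h x) = c (p x)"
    using r(1) unfolding connects_def by blast
  obtain v where v: "v \<in> cocyc i X {\<zero>\<^bsub>U\<^esub>}" "\<And>x. x \<in> K \<Longrightarrow> k x = v x" using r(2) unfolding restricted_def by blast
  note vD = cocycD[OF v(1)]
  obtain h' where h': "h' \<in> lin S U Y (J (Suc i))" "\<And>z. z \<in> Z \<Longrightarrow> h' z = \<zero>\<^bsub>J (Suc i)\<^esub>" "\<And>x. x \<in> X \<Longrightarrow> h' (p x) = h x \<ominus>\<^bsub>J (Suc i)\<^esub> v x"
  proof (rule presents_descend[OF lin_minus[OF U J h(1) vD(1)]])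
    show "h x \<ominus>\<^bsub>J (Suc i)\<^esub> v x = \<zero>\<^bsub>J (Suc i)\<^esub>" if "x \<in> K" for x
      using h(2)[OF that] v(2)[OF that] vD(4)[of x] pr_K(2) that by auto
  qed blast
  show ?thesis
  proof (rule cobdI[OF pr_Y h'(1,2)])
    fix y assume "y \<in> Y"
    then show "c y = D (Suc i) (h' y)"
    proof (rule presents_eqI[OF cocycD(1)[OF c] lin_D[OF h'(1)], rotated 2])
      show "c (p x) = D (Suc i) (h' (p x))" if "x \<in> X" for x
        using h'(3)[OF that] h(3)[OF that] vD(3)[OF that] vD(4)[OF that] lin_closed[OF h(1) that] cocycD(4)[OF c pr_p(2)[OF that]]
        by (simp add: D_diff) (simp add: a_minus_def)
    qed (use cocycD(2)[OF c] h' in auto)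
  qed
qed

text \<open>Given a primitive \<open>g\<close> of \<open>c\<close>, subtracting from
  \<open>h\<close> the composite of \<open>p\<close> and \<open>g\<close> leaves a cocycle on
  \<open>X\<close>; it still restricts to \<open>k\<close> because \<open>g\<close> vanishes on
  \<open>Z\<close>.\<close>

lemma connects_restricted:
  assumes c: "c \<in> cobd (Suc i) Y Z" and r: "connects i X p K c k"
  shows "k \<in> restricted i X K"
proof -
  obtain h where h: "h \<in> lin S U X (J (Suc i))" "\<And>x. x \<in> K \<Longrightarrow> h x = k x" "\<And>x. x \<in> X \<Longrightarrow> D (Suc i) (h x) = c (p x)"
    using r(1) unfolding connects_def by blast
  obtain g where g: "g \<in> lin S U Y (J (Suc i))" "\<And>z. z \<in> Z \<Longrightarrow> g z = \<zero>\<^bsub>J (Suc i)\<^esub>" "\<And>y. y \<in> Y \<Longrightarrow> c y = D (Suc i) (g y)"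
    using c unfolding cobd_def by blast
  let ?v = "\<lambda>x. h x \<ominus>\<^bsub>J (Suc i)\<^esub> g (p x)"
  have l: "?v \<in> lin S U X (J (Suc i))"
    by (rule lin_minus[OF U J h(1) lin_comp[OF pr_p(1) pr_cover2(3) g(1)]])
  have "?v \<in> cocyc i X {\<zero>\<^bsub>U\<^esub>}"
  proof (rule cocycI[OF l])
    show "?v z = \<zero>\<^bsub>J (Suc i)\<^esub>" if "z \<in> {\<zero>\<^bsub>U\<^esub>}" for z
      using lin_zero[OF U J l pr_X(2)] that by simp
    show "D (Suc i) (?v x) = \<zero>\<^bsub>J (Suc (Suc i))\<^esub>" if "x \<in> X" for x
      using that h(3)[OF that] g(3)[OF pr_p(2)[OF that]] lin_closed[OF h(1) that] lin_closed[OF g(1) pr_p(2)[OF that]]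
      by (simp add: D_diff)
  qed
  moreover have "k x = ?v x" if "x \<in> K" for x
  proof -
    have "x \<in> X" "p x \<in> Z" using that pr_K by auto
    then show ?thesis using g(2)[of "p x"] h(2)[OF that] lin_closed[OF h(1), of x] by (simp add: a_minus_def)
  qed
  ultimately show ?thesis unfolding restricted_def by (intro CollectI bexI[of _ ?v]) auto
qed

text \<open>A primitive on \<open>K\<close> extends to \<open>X\<close> by injectivity.\<close>

lemma cobd_subset_restricted:
  assumes k: "k \<in> cobd i K {\<zero>\<^bsub>U\<^esub>}"
  shows "k \<in> restricted i X K"
proof -
  obtain g where g: "g \<in> lin S U K (J i)" "\<And>y. y \<in> K \<Longrightarrow> k y = D i (g y)" using k unfolding cobd_def by blast
  obtain h where h: "h \<in> lin S U X (J i)" "\<And>x. x \<in> K \<Longrightarrow> h x = g x"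
    using J_extend[OF U pr_X(1) pr_K(1,2) g(1)] by metis
  have "(\<lambda>x. D i (h x)) \<in> cobd i X {\<zero>\<^bsub>U\<^esub>}"
    by (rule cobdI[OF pr_X(2) h(1)]) (use lin_zero[OF U J h(1) pr_X(2)] in auto)
  then have "(\<lambda>x. D i (h x)) \<in> cocyc i X {\<zero>\<^bsub>U\<^esub>}"
    using cobd_subset_cocyc[of "{\<zero>\<^bsub>U\<^esub>}" X] submod_zero[OF U pr_X(2)] by auto
  then show ?thesis unfolding restricted_def
    by (intro CollectI bexI[of _ "\<lambda>x. D i (h x)"]) (auto simp: g h)
qed

text \<open>In degree \<open>0\<close> this need not hold, since \<open>X\<close> may have
  cohomology there; hence the successor.\<close>

lemma restricted_cobd:
  assumes k: "k \<in> restricted (Suc i) X K"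
  shows "k \<in> cobd (Suc i) K {\<zero>\<^bsub>U\<^esub>}"
proof -
  obtain v where v: "v \<in> cocyc (Suc i) X {\<zero>\<^bsub>U\<^esub>}" "\<And>x. x \<in> K \<Longrightarrow> k x = v x" using k unfolding restricted_def by blast
  then obtain g where g: "g \<in> lin S U X (J (Suc i))" "\<And>z. z \<in> {\<zero>\<^bsub>U\<^esub>} \<Longrightarrow> g z = \<zero>\<^bsub>J (Suc i)\<^esub>" "\<And>y. y \<in> X \<Longrightarrow> v y = D (Suc i) (g y)"
    using pr_acyclic unfolding cobd_def by blast
  show ?thesis by (rule cobdI[OF pr_K(1) lin_subset[OF g(1) pr_K(2)]]) (use g v pr_K(2) in auto)
qed

end

end

section \<open>Noetherian properties of the cohomology\<close>

context inj_complex_over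
begin

text \<open>A submodule of E^i(Y/Z) over the localization, given by all cocycles that represent its
  elements. Closure under division by \<open>t\<close> outside \<open>Q\<close> stands for the
  scalars of the localization, and the last clause makes values off \<open>Y\<close>
  irrelevant.\<close>

definition sat_sub :: "nat \<Rightarrow> 'u set \<Rightarrow> 'u set \<Rightarrow> ('u \<Rightarrow> 'e) set \<Rightarrow> bool" where
  "sat_sub i Y Z N \<longleftrightarrow> N \<subseteq> cocyc i Y Z \<and> cobd i Y Z \<subseteq> N \<and>
     (\<forall>c\<in>N. \<forall>c'\<in>N. (\<lambda>y. c y \<oplus>\<^bsub>J (Suc i)\<^esub> c' y) \<in> N) \<and>
     (\<forall>a\<in>carrier S. \<forall>c\<in>N. (\<lambda>y. a \<odot>\<^bsub>J (Suc i)\<^esub> c y) \<in> N) \<and>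
     (\<forall>t\<in>carrier S - Q. \<forall>c\<in>cocyc i Y Z. (\<lambda>y. t \<odot>\<^bsub>J (Suc i)\<^esub> c y) \<in> N \<longrightarrow> c \<in> N) \<and>
     (\<forall>c\<in>N. \<forall>c'. (\<forall>y\<in>Y. c' y = c y) \<longrightarrow> c' \<in> N)"

lemma sat_subD:
  assumes "sat_sub i Y Z N"
  shows "N \<subseteq> cocyc i Y Z" "cobd i Y Z \<subseteq> N"
    "\<And>c c'. c \<in> N \<Longrightarrow> c' \<in> N \<Longrightarrow> (\<lambda>y. c y \<oplus>\<^bsub>J (Suc i)\<^esub> c' y) \<in> N"
    "\<And>a c. a \<in> carrier S \<Longrightarrow> c \<in> N \<Longrightarrow> (\<lambda>y. a \<odot>\<^bsub>J (Suc i)\<^esub> c y) \<in> N"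
    "\<And>t c. t \<in> carrier S - Q \<Longrightarrow> c \<in> cocyc i Y Z \<Longrightarrow> (\<lambda>y. t \<odot>\<^bsub>J (Suc i)\<^esub> c y) \<in> N \<Longrightarrow> c \<in> N"
    "\<And>c c'. c \<in> N \<Longrightarrow> (\<And>y. y \<in> Y \<Longrightarrow> c' y = c y) \<Longrightarrow> c' \<in> N"
proof -
  note a = assms[unfolded sat_sub_def]
  note a3 = a[THEN conjunct2, THEN conjunct2]
  note a5 = a3[THEN conjunct2, THEN conjunct2]
  note * = a[THEN conjunct1] a[THEN conjunct2, THEN conjunct1] a3[THEN conjunct1]
    a3[THEN conjunct2, THEN conjunct1] a5[THEN conjunct1] a5[THEN conjunct2]
  show "N \<subseteq> cocyc i Y Z" "cobd i Y Z \<subseteq> N" by (fact *)+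
  show "\<And>c c'. c \<in> N \<Longrightarrow> c' \<in> N \<Longrightarrow> (\<lambda>y. c y \<oplus>\<^bsub>J (Suc i)\<^esub> c' y) \<in> N"
    "\<And>a c. a \<in> carrier S \<Longrightarrow> c \<in> N \<Longrightarrow> (\<lambda>y. a \<odot>\<^bsub>J (Suc i)\<^esub> c y) \<in> N"
    by (simp_all only: *(3,4)[rule_format])
  show "c \<in> N" if "t \<in> carrier S - Q" "c \<in> cocyc i Y Z" "(\<lambda>y. t \<odot>\<^bsub>J (Suc i)\<^esub> c y) \<in> N" for t c
    using *(5)[rule_format, OF that] .
  show "c' \<in> N" if "c \<in> N" "\<And>y. y \<in> Y \<Longrightarrow> c' y = c y" for c c'
    by (rule *(6)[rule_format, OF that(1)]) (rule that(2))
qed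

lemma sat_sub_cobd:
  assumes "submodule Y S U" "Z \<subseteq> Y"
  shows "sat_sub i Y Z (cobd i Y Z)"
  unfolding sat_sub_def
proof (intro conjI ballI allI impI)
  show "cobd i Y Z \<subseteq> cocyc i Y Z" by (rule cobd_subset_cocyc[OF assms(2)])
qed (use cobd_add[OF assms(1)] cobd_scale[OF assms(1)] cobd_divide[OF assms(1) _ _ assms(2)] in
    \<open>blast intro: cobd_cong[OF assms(1)]\<close>)+

lemma multiples_submod: "submodule ((\<lambda>s. s \<odot>\<^bsub>J i\<^esub> x) ` carrier S) S (J i)" if "x \<in> carrier (J i)"
  using submod_image[OF module_self[OF cring_S] J lin_smult_vec[OF J that]]
    module.carrier_is_submodule[OF module_self[OF cring_S]] by simp

text \<open>A common denominator of the values of \<open>c\<close> exists because the sets of arguments where a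
  given denominator suffices have a maximal member.\<close>

lemma common_denominator:
  assumes Y: "noeth_sub S U Y" and c: "c \<in> cocyc 0 Y Z"
  obtains t where "t \<in> carrier S - Q" "\<And>y. y \<in> Y \<Longrightarrow> \<exists>s\<in>carrier S. t \<odot>\<^bsub>J 1\<^esub> c y = s \<odot>\<^bsub>J 1\<^esub> e"
proof -
  note Ys = noeth_sub_submod[OF Y]
  let ?E = "(\<lambda>s. s \<odot>\<^bsub>J 1\<^esub> e) ` carrier S"
  note E = multiples_submod[OF e(1)]
  have cl: "c \<in> lin S U Y (J 1)" using cocycD(1)[OF c] by simp
  define W where "W t = {y \<in> Y. t \<odot>\<^bsub>J 1\<^esub> c y \<in> ?E}" for t
  have W: "submodule (W t) S U" if "t \<in> carrier S" for t
    unfolding W_def by (rule submod_preimage[OF U J lin_scale[OF U J cl that] Ys E])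
  have 1: "\<And>N. N \<in> W ` (carrier S - Q) \<Longrightarrow> submodule N S U \<and> N \<subseteq> Y"
    using W by (auto simp: W_def)
  obtain N where N: "N \<in> W ` (carrier S - Q)" "\<And>N'. N' \<in> W ` (carrier S - Q) \<Longrightarrow> N \<subseteq> N' \<Longrightarrow> N' = N"
    using noeth_sub_maximal[OF Y 1 imageI[OF one_notin]] by metis
  then obtain t where tN: "t \<in> carrier S - Q" "N = W t" by (elim imageE)
  have tmax: "W t' = W t" if "t' \<in> carrier S - Q" "W t \<subseteq> W t'" for t'
    using N(2)[OF imageI[OF that(1)]] tN that(2) by simp
  note t = tN(1) tmax
  have "y \<in> W t" if y: "y \<in> Y" for y
  proof -
    have cy: "c y \<in> carrier (J 1)" "D 1 (c y) = \<zero>\<^bsub>J 2\<^esub>"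
      using cocycD(3,4)[OF c y] by (simp_all add: numeral_2_eq_2)
    obtain u s where u: "u \<in> carrier S - Q" "s \<in> carrier S" "u \<odot>\<^bsub>J 1\<^esub> c y = s \<odot>\<^bsub>J 1\<^esub> e"
      using aug[OF cy] by blast
    have ut: "(u \<otimes>\<^bsub>S\<^esub> t) \<odot>\<^bsub>J 1\<^esub> c x = u \<odot>\<^bsub>J 1\<^esub> (t \<odot>\<^bsub>J 1\<^esub> c x)"
      "(u \<otimes>\<^bsub>S\<^esub> t) \<odot>\<^bsub>J 1\<^esub> c x = t \<odot>\<^bsub>J 1\<^esub> (u \<odot>\<^bsub>J 1\<^esub> c x)" if "x \<in> Y" for x
      using u t lin_closed[OF cl that] by (simp_all add: J.smult_assoc1[symmetric] P.m_comm)
    \<comment> \<open>Passing from \<open>t\<close> to its product with \<open>u\<close> loses no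
      arguments and gains \<open>y\<close>; by maximality of \<open>W t\<close> nothing is gained,
      so \<open>y\<close> was there already.\<close>
    have "W t \<subseteq> W (u \<otimes>\<^bsub>S\<^esub> t)"
      using ut(1) submod_smult[OF J E, of u] u(1) unfolding W_def by auto
    then have "W (u \<otimes>\<^bsub>S\<^esub> t) = W t" using t(2)[OF mult_notin[OF u(1) t(1)]] by blast
    moreover have "y \<in> W (u \<otimes>\<^bsub>S\<^esub> t)"
      unfolding W_def using y ut(2)[OF y] u submod_smult[OF J E, of t "s \<odot>\<^bsub>J 1\<^esub> e"] t(1) by auto
    ultimately show ?thesis by blast
  qed
  then show ?thesis using that[OF t(1)] unfolding W_def by blast
qed

text \<open>After clearing denominators, a cocycle of degree \<open>0\<close> has multiples of
  \<open>e\<close> as its values on finitely many generators. The possible tuples of numerators form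
  a submodule of a free module of finite rank, and closure under division recovers \<open>N\<close>
  from them.\<close>

lemma acc_sat_0:
  assumes Y: "noeth_sub S U Y" and Z: "submodule Z S U" "Z \<subseteq> Y"
  shows "acc {N. sat_sub 0 Y Z N}"
proof -
  note Ys = noeth_sub_submod[OF Y]
  obtain X where X: "finite X" "X \<subseteq> Y" "\<And>N. submodule N S U \<Longrightarrow> X \<subseteq> N \<Longrightarrow> Y \<subseteq> N"
    using noeth_sub_finite_gen[OF U Y] by metis
  let ?F = "free_module S X"
  note mF = module_free[OF cring_S, of X]
  define T where "T N = {v \<in> free_on S X. \<exists>c\<in>N. \<forall>x\<in>X. c x = v x \<odot>\<^bsub>J 1\<^esub> e}" for N
  have ce: "e \<in> carrier (J (Suc 0))" using e by simp
  have sub: "submodule (T N) S ?F" if N: "sat_sub 0 Y Z N" for N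
  proof (rule submodI[OF mF])
    note ND = sat_subD[OF N]
    show "T N \<subseteq> carrier ?F" by (auto simp: T_def)
    have "(\<lambda>_. \<zero>\<^bsub>J 1\<^esub>) \<in> N" using cobd_zero[OF Ys] ND(2) by fastforce
    then show "\<zero>\<^bsub>?F\<^esub> \<in> T N" unfolding T_def using ce submod_zero[OF mF submod_free_on[OF cring_S order_refl]]
      by (auto intro!: bexI[of _ "\<lambda>_. \<zero>\<^bsub>J 1\<^esub>"])
    fix v w assume v: "v \<in> T N"
    then obtain c where c: "c \<in> N" "\<forall>x\<in>X. c x = v x \<odot>\<^bsub>J 1\<^esub> e" and vF: "v \<in> free_on S X" by (auto simp: T_def)
    { assume w: "w \<in> T N"
      then obtain c' where c': "c' \<in> N" "\<forall>x\<in>X. c' x = w x \<odot>\<^bsub>J 1\<^esub> e" and wF: "w \<in> free_on S X" by (auto simp: T_def)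
      have "\<forall>x\<in>X. c x \<oplus>\<^bsub>J (Suc 0)\<^esub> c' x = (v \<oplus>\<^bsub>?F\<^esub> w) x \<odot>\<^bsub>J 1\<^esub> e"
        using c c' ce free_onD(1)[OF cring_S vF] free_onD(1)[OF cring_S wF] by (simp add: J.smult_l_distr)
      then show "v \<oplus>\<^bsub>?F\<^esub> w \<in> T N" unfolding T_def
        using ND(3)[OF c(1) c'(1)] submod_add[OF mF submod_free_on[OF cring_S order_refl] vF wF] by fast }
    fix a assume a: "a \<in> carrier S"
    have "\<forall>x\<in>X. a \<odot>\<^bsub>J (Suc 0)\<^esub> c x = (a \<odot>\<^bsub>?F\<^esub> v) x \<odot>\<^bsub>J 1\<^esub> e"
      using c ce free_onD(1)[OF cring_S vF] a by (simp add: J.smult_assoc1)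
    then show "a \<odot>\<^bsub>?F\<^esub> v \<in> T N" unfolding T_def
      using ND(4)[OF a c(1)] submod_smult[OF mF submod_free_on[OF cring_S order_refl] a vF] by fast
  qed
  have nF: "noeth_sub S ?F (free_on S X)" by (rule noeth_sub_free[OF cring_S noeth X(1) order_refl])
  show ?thesis
  proof (rule acc_transfer[of "{N. submodule N S ?F \<and> N \<subseteq> free_on S X}" _ T])
    show "acc {N. submodule N S ?F \<and> N \<subseteq> free_on S X}" using nF by (simp add: noeth_sub_def)
    show "T N \<in> {N. submodule N S ?F \<and> N \<subseteq> free_on S X}" if "N \<in> {N. sat_sub 0 Y Z N}" for N
      using sub that by (auto simp: T_def)
    show "T N \<subseteq> T N'" if "N \<subseteq> N'" for N N' using that unfolding T_def by blast
    fix N N' assume N: "N \<in> {N. sat_sub 0 Y Z N}" "N' \<in> {N. sat_sub 0 Y Z N}" "T N = T N'"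
    show "N' \<subseteq> N"
    proof
      fix c assume c: "c \<in> N'"
      have cZ: "c \<in> cocyc 0 Y Z" using c N sat_subD(1) by blast
      obtain t where t: "t \<in> carrier S - Q" "\<And>y. y \<in> Y \<Longrightarrow> \<exists>s\<in>carrier S. t \<odot>\<^bsub>J 1\<^esub> c y = s \<odot>\<^bsub>J 1\<^esub> e"
        using common_denominator[OF Y cZ] by metis
      obtain w where w: "\<And>y. y \<in> Y \<Longrightarrow> w y \<in> carrier S \<and> t \<odot>\<^bsub>J 1\<^esub> c y = w y \<odot>\<^bsub>J 1\<^esub> e"
        using t(2) by metis
      define v where "v x = (if x \<in> X then w x else \<zero>\<^bsub>S\<^esub>)" for x
      have tc: "(\<lambda>y. t \<odot>\<^bsub>J (Suc 0)\<^esub> c y) \<in> N'" using sat_subD(4)[of 0 Y Z N'] N c t by blast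
      have "v \<in> free_on S X" by (rule free_on_finiteI) (use w X in \<open>auto simp: v_def\<close>)
      then have "v \<in> T N'" unfolding T_def using tc w X(2) by (auto simp: v_def intro!: bexI[OF _ tc])
      then obtain c' where c': "c' \<in> N" "\<And>x. x \<in> X \<Longrightarrow> c' x = v x \<odot>\<^bsub>J 1\<^esub> e" using N(3) unfolding T_def by blast
      have c'Z: "c' \<in> cocyc 0 Y Z" using c' N sat_subD(1) by blast
      \<comment> \<open>The member \<open>c'\<close> of \<open>N\<close> has the same numerators as
        the \<open>t\<close>-multiple of \<open>c\<close>, so both agree on the generators and hence
        on \<open>Y\<close>.\<close>
      have "submodule {y \<in> Y. t \<odot>\<^bsub>J (Suc 0)\<^esub> c y = c' y} S U"
        using submod_equalizer[OF U J lin_scale[OF U J cocycD(1)[OF cZ]] cocycD(1)[OF c'Z] Ys] t by simp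
      then have "Y \<subseteq> {y \<in> Y. t \<odot>\<^bsub>J (Suc 0)\<^esub> c y = c' y}"
      proof (rule X(3))
        show "X \<subseteq> {y \<in> Y. t \<odot>\<^bsub>J (Suc 0)\<^esub> c y = c' y}" using X(2) c' w by (auto simp: v_def)
      qed
      then have "(\<lambda>y. t \<odot>\<^bsub>J (Suc 0)\<^esub> c y) \<in> N"
        using N(1) by (intro sat_subD(6)[OF _ c'(1)]) auto
      then show "c \<in> N" using sat_subD(5)[of 0 Y Z N t c] N t cZ by blast
    qed
  qed
qed

text \<open>The connecting homomorphism is onto, so a submodule of E^(i+1)(Y/Z) is determined by its
  preimage \<open>T N\<close> among the cocycles on \<open>K\<close>, where the chain condition is
  known.\<close>

lemma acc_sat_Suc:
  assumes pr: "presents X p Y Z K" and acc: "acc {N. sat_sub i K {\<zero>\<^bsub>U\<^esub>} N}"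
  shows "acc {N. sat_sub (Suc i) Y Z N}"
proof -
  define T where "T N = {k \<in> cocyc i K {\<zero>\<^bsub>U\<^esub>}. \<exists>c\<in>N. connects i X p K c k}" for N
  note Ys = pr_Y[OF pr]
  have K0: "{\<zero>\<^bsub>U\<^esub>} \<subseteq> K" using submod_zero[OF U pr_K(1)[OF pr]] by simp
  have r0: "c \<in> cobd (Suc i) Y Z" if "connects i X p K c k" "c \<in> cocyc (Suc i) Y Z" "\<And>x. x \<in> K \<Longrightarrow> k x = \<zero>\<^bsub>J (Suc i)\<^esub>" for c k
  proof (rule connects_cobd[OF pr that(2,1) cobd_subset_restricted[OF pr]])
    show "k \<in> cobd i K {\<zero>\<^bsub>U\<^esub>}" by (rule cobd_zero[OF pr_K(1)[OF pr] that(3)])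
  qed
  \<comment> \<open>A cocycle on \<open>K\<close> connects to one class only: if \<open>c\<close>
    and \<open>c'\<close> lie over the same map on \<open>K\<close>, their difference connects to
    zero.\<close>
  have uniq: "(\<lambda>y. c y \<ominus>\<^bsub>J (Suc (Suc i))\<^esub> c' y) \<in> cobd (Suc i) Y Z"
    if c: "c \<in> cocyc (Suc i) Y Z" "c' \<in> cocyc (Suc i) Y Z" "connects i X p K c k" "connects i X p K c' k'"
      and k: "k \<in> cocyc i K {\<zero>\<^bsub>U\<^esub>}" "\<And>x. x \<in> K \<Longrightarrow> k' x = k x" for c c' k k'
  proof -
    have 1: "connects i X p K (\<lambda>y. c y \<oplus>\<^bsub>J (Suc (Suc i))\<^esub> (\<ominus>\<^bsub>S\<^esub> \<one>\<^bsub>S\<^esub>) \<odot>\<^bsub>J (Suc (Suc i))\<^esub> c' y)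
        (\<lambda>x. k x \<oplus>\<^bsub>J (Suc i)\<^esub> (\<ominus>\<^bsub>S\<^esub> \<one>\<^bsub>S\<^esub>) \<odot>\<^bsub>J (Suc i)\<^esub> k' x)"
      by (rule connects_add[OF c(3) connects_scale[OF c(4)]]) simp
    have "(\<lambda>y. c y \<oplus>\<^bsub>J (Suc (Suc i))\<^esub> (\<ominus>\<^bsub>S\<^esub> \<one>\<^bsub>S\<^esub>) \<odot>\<^bsub>J (Suc (Suc i))\<^esub> c' y) \<in> cobd (Suc i) Y Z"
    proof (rule r0[OF 1])
      show "(\<lambda>y. c y \<oplus>\<^bsub>J (Suc (Suc i))\<^esub> (\<ominus>\<^bsub>S\<^esub> \<one>\<^bsub>S\<^esub>) \<odot>\<^bsub>J (Suc (Suc i))\<^esub> c' y) \<in> cocyc (Suc i) Y Z"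
        by (rule cocyc_add[OF c(1) cocyc_scale[OF c(2)]]) simp
      show "k x \<oplus>\<^bsub>J (Suc i)\<^esub> (\<ominus>\<^bsub>S\<^esub> \<one>\<^bsub>S\<^esub>) \<odot>\<^bsub>J (Suc i)\<^esub> k' x = \<zero>\<^bsub>J (Suc i)\<^esub>" if "x \<in> K" for x
        using k(2)[OF that] cocycD(4)[OF k(1) that] by (simp add: J.smult_l_minus J.r_neg)
    qed
    then show ?thesis
      by (rule cobd_cong[OF Ys]) (use cocycD(4)[OF c(2)] in \<open>simp add: a_minus_def J.smult_l_minus\<close>)
  qed
  have memI: "c \<in> N" if N: "sat_sub (Suc i) Y Z N" and c: "c \<in> cocyc (Suc i) Y Z" "c' \<in> N" "(\<lambda>y. c y \<ominus>\<^bsub>J (Suc (Suc i))\<^esub> c' y) \<in> cobd (Suc i) Y Z" for N c c'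
  proof -
    note ND = sat_subD[OF N]
    have "(\<lambda>y. (c y \<ominus>\<^bsub>J (Suc (Suc i))\<^esub> c' y) \<oplus>\<^bsub>J (Suc (Suc i))\<^esub> c' y) \<in> N" using ND(3) c ND(2) by blast
    then show ?thesis
    proof (rule ND(6))
      fix y assume "y \<in> Y"
      then have "c y \<in> carrier (J (Suc (Suc i)))" "c' y \<in> carrier (J (Suc (Suc i)))"
        using cocycD(4) c ND(1) by blast+
      then show "c y = (c y \<ominus>\<^bsub>J (Suc (Suc i))\<^esub> c' y) \<oplus>\<^bsub>J (Suc (Suc i))\<^esub> c' y"
        by (simp add: a_minus_def J.a_assoc J.l_neg)
    qed
  qed
  have cong: "connects i X p K c k'" if "connects i X p K c k" "\<And>x. x \<in> K \<Longrightarrow> k' x = k x" for c k k'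
    using that unfolding connects_def by auto
  have sub: "sat_sub i K {\<zero>\<^bsub>U\<^esub>} (T N)" if N: "sat_sub (Suc i) Y Z N" for N
    unfolding sat_sub_def
  proof (intro conjI ballI allI impI subsetI)
    note ND = sat_subD[OF N]
    { fix k assume "k \<in> T N" then show "k \<in> cocyc i K {\<zero>\<^bsub>U\<^esub>}" by (simp add: T_def) }
    { fix k assume k: "k \<in> cobd i K {\<zero>\<^bsub>U\<^esub>}"
      then have kc: "k \<in> cocyc i K {\<zero>\<^bsub>U\<^esub>}" using cobd_subset_cocyc[OF K0] by blast
      obtain c where c: "c \<in> cocyc (Suc i) Y Z" "connects i X p K c k" using ex_connects2[OF pr kc] by blast
      have "c \<in> cobd (Suc i) Y Z" by (rule connects_cobd[OF pr c cobd_subset_restricted[OF pr k]])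
      then show "k \<in> T N" using c kc ND(2) by (auto simp: T_def) }
    { fix k k' assume "k \<in> T N" "k' \<in> T N"
      then show "(\<lambda>y. k y \<oplus>\<^bsub>J (Suc i)\<^esub> k' y) \<in> T N"
        unfolding T_def using connects_add ND(3) cocyc_add by blast }
    { fix a k assume "a \<in> carrier S" "k \<in> T N"
      then show "(\<lambda>y. a \<odot>\<^bsub>J (Suc i)\<^esub> k y) \<in> T N"
        unfolding T_def using connects_scale ND(4) cocyc_scale by blast }
    \<comment> \<open>Division is lifted along the connecting homomorphism: \<open>k\<close> itself
      connects to some \<open>c\<close>, whose \<open>t\<close>-multiple agrees with a member of
      \<open>N\<close> up to a coboundary, so that \<open>N\<close> contains
      \<open>c\<close>.\<close>
    { fix t k assume t: "t \<in> carrier S - Q" and k: "k \<in> cocyc i K {\<zero>\<^bsub>U\<^esub>}" "(\<lambda>y. t \<odot>\<^bsub>J (Suc i)\<^esub> k y) \<in> T N"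
      then obtain c' where c': "c' \<in> N" "connects i X p K c' (\<lambda>y. t \<odot>\<^bsub>J (Suc i)\<^esub> k y)" by (auto simp: T_def)
      obtain c where c: "c \<in> cocyc (Suc i) Y Z" "connects i X p K c k" using ex_connects2[OF pr k(1)] by blast
      let ?tc = "\<lambda>y. t \<odot>\<^bsub>J (Suc (Suc i))\<^esub> c y"
      have tS: "t \<in> carrier S" using t by blast
      have tc: "?tc \<in> cocyc (Suc i) Y Z" by (rule cocyc_scale[OF c(1) tS])
      have c'c: "c' \<in> cocyc (Suc i) Y Z" using c' ND(1) by blast
      have "?tc \<in> N"
        by (rule memI[OF N tc c'(1)], rule uniq[OF tc c'c connects_scale[OF c(2) tS] c'(2) cocyc_scale[OF k(1) tS]]) simp
      then have "c \<in> N" by (rule ND(5)[OF t c(1)])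
      then show "k \<in> T N" using c k by (auto simp: T_def) }
    { fix k k' assume k: "k \<in> T N" "\<forall>y\<in>K. k' y = k y"
      then obtain c where c: "c \<in> N" "connects i X p K c k" "k \<in> cocyc i K {\<zero>\<^bsub>U\<^esub>}" by (auto simp: T_def)
      have "k' \<in> cocyc i K {\<zero>\<^bsub>U\<^esub>}" by (rule cocyc_cong[OF pr_K(1)[OF pr] K0 c(3)]) (use k in auto)
      then show "k' \<in> T N" using c cong[OF c(2), of k'] k(2) by (auto simp: T_def) }
  qed
  show ?thesis
  proof (rule acc_transfer[OF acc, of _ T])
    show "T N \<in> {N. sat_sub i K {\<zero>\<^bsub>U\<^esub>} N}" if "N \<in> {N. sat_sub (Suc i) Y Z N}" for N using sub that by blast
    show "T N \<subseteq> T N'" if "N \<subseteq> N'" for N N' using that unfolding T_def by blast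
    fix N N' assume N: "N \<in> {N. sat_sub (Suc i) Y Z N}" "N' \<in> {N. sat_sub (Suc i) Y Z N}" "T N = T N'"
    then have N2: "sat_sub (Suc i) Y Z N" "sat_sub (Suc i) Y Z N'" by auto
    show "N' \<subseteq> N"
    proof
      fix c assume c: "c \<in> N'"
      then have cc: "c \<in> cocyc (Suc i) Y Z" using sat_subD(1)[OF N2(2)] by blast
      obtain k where k: "k \<in> cocyc i K {\<zero>\<^bsub>U\<^esub>}" "connects i X p K c k" using ex_connects1[OF pr cc] by blast
      then have "k \<in> T N" using c N(3) by (auto simp: T_def)
      then obtain c' where c': "c' \<in> N" "connects i X p K c' k" by (auto simp: T_def)
      have c'c: "c' \<in> cocyc (Suc i) Y Z" using c' sat_subD(1)[OF N2(1)] by blast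
      show "c \<in> N" by (rule memI[OF N2(1) cc c'(1)], rule uniq[OF cc c'c k(2) c'(2) k(1)]) simp
    qed
  qed
qed

section \<open>Vanishing of cohomology, and enough acyclic modules\<close>

definition vanish :: "nat \<Rightarrow> bool" where
  "vanish i \<longleftrightarrow> (\<forall>Y Z. noeth_sub S U Y \<longrightarrow> submodule Z S U \<longrightarrow> Z \<subseteq> Y \<longrightarrow> cocyc i Y Z \<subseteq> cobd i Y Z)"

lemma vanishD: "vanish i \<Longrightarrow> noeth_sub S U Y \<Longrightarrow> submodule Z S U \<Longrightarrow> Z \<subseteq> Y \<Longrightarrow> c \<in> cocyc i Y Z \<Longrightarrow> c \<in> cobd i Y Z"
  unfolding vanish_def by blast

text \<open>Degree \<open>i\<close> lives at index \<open>Suc i\<close>, so \<open>n \<le> i\<close>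
  already makes the module of values zero.\<close>

lemma vanish_above:
  assumes "n \<le> i"
  shows "vanish i"
  unfolding vanish_def
proof (intro allI impI subsetI)
  fix Y Z c assume "noeth_sub S U Y" "c \<in> cocyc i Y Z"
  then show "c \<in> cobd i Y Z"
    using bounded[of "Suc i"] assms by (intro cobd_zero noeth_sub_submod) (auto dest: cocycD(4))
qed

end

text \<open>Two properties of the ambient module: noetherian submodules are covered by acyclic ones
  within the same \<open>U\<close>, which permits dimension shifting, and degree \<open>0\<close>
  has cohomology, so that a largest nonzero degree exists.\<close>

locale inj_complex_enough = inj_complex_over S Q J D e n U
  for S :: "'s ring" and Q :: "'s set" and J :: "nat \<Rightarrow> ('s, 'e) module" and D :: "nat \<Rightarrow> 'e \<Rightarrow> 'e"
    and e :: 'e and n :: nat and U :: "('s, 'u) module" +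
  assumes enough: "noeth_sub S U Y \<Longrightarrow> \<exists>X p. acyclic X \<and> p \<in> lin S U X U \<and> p ` X = Y"
    and nontrivial: "\<not> vanish 0"
begin

lemma ex_presents:
  assumes "noeth_sub S U Y" "submodule Z S U" "Z \<subseteq> Y"
  obtains X p K where "presents X p Y Z K" "noeth_sub S U K"
proof -
  obtain X p where X: "acyclic X" "p \<in> lin S U X U" "p ` X = Y" using enough[OF assms(1)] by blast
  have Y: "submodule Y S U" by (rule noeth_sub_submod[OF assms(1)])
  have "y = \<zero>\<^bsub>U\<^esub> \<oplus>\<^bsub>U\<^esub> y" if "y \<in> Y" for y using submod_mem[OF U Y that] by simp
  then have "\<forall>y\<in>Y. \<exists>z\<in>Z. \<exists>x\<in>X. y = z \<oplus>\<^bsub>U\<^esub> p x"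
    using submod_zero[OF U assms(2)] X(3) by blast
  then have pr: "presents X p Y Z {x \<in> X. p x \<in> Z}" unfolding presents_def using X Y assms by blast
  then show ?thesis using that[OF pr] noeth_sub_subset[OF pr_X(1)[OF pr] pr_K(1)[OF pr] pr_K(2)[OF pr]] by blast
qed

lemma acc_sat:
  assumes "noeth_sub S U Y" "submodule Z S U" "Z \<subseteq> Y"
  shows "acc {N. sat_sub i Y Z N}"
  using assms
proof (induction i arbitrary: Y Z)
  case 0 then show ?case by (rule acc_sat_0)
next
  case (Suc i)
  obtain X p K where pr: "presents X p Y Z K" "noeth_sub S U K" using ex_presents[OF Suc.prems] by metis
  have "submodule {\<zero>\<^bsub>U\<^esub>} S U" "{\<zero>\<^bsub>U\<^esub>} \<subseteq> K" using submod_trivial[OF U] submod_zero[OF U pr_K(1)[OF pr(1)]] by auto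
  then show ?case using acc_sat_Suc[OF pr(1) Suc.IH[OF pr(2)]] by blast
qed

text \<open>The cohomology is finitely generated over the localization only, so the role of a
  maximal proper submodule falls to a maximal proper saturated one. Divisibility by \<open>x\<close>
  is assumed for the cocycles themselves and not merely for their classes.\<close>

lemma nakayama:
  assumes Y: "noeth_sub S U Y" "submodule Z S U" "Z \<subseteq> Y" and x: "x \<in> Q"
    and div: "\<And>c. c \<in> cocyc i Y Z \<Longrightarrow> \<exists>c'\<in>cocyc i Y Z. \<forall>y\<in>Y. c y = x \<odot>\<^bsub>J (Suc i)\<^esub> c' y"
  shows "cocyc i Y Z \<subseteq> cobd i Y Z"
proof (rule ccontr)
  note Ys = noeth_sub_submod[OF Y(1)]
  assume neg: "\<not> cocyc i Y Z \<subseteq> cobd i Y Z"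
  define G where "G = {N. sat_sub i Y Z N \<and> N \<noteq> cocyc i Y Z}"
  have G1: "G \<subseteq> {N. sat_sub i Y Z N}" by (auto simp: G_def)
  have G2: "cobd i Y Z \<in> G" using neg sat_sub_cobd[OF Ys Y(3)] by (auto simp: G_def)
  obtain N where N: "N \<in> G" "\<And>N'. N' \<in> G \<Longrightarrow> N \<subseteq> N' \<Longrightarrow> N' = N"
    using acc_maximal[OF acc_sat[OF Y] G1 G2] by metis
  then have Ns: "sat_sub i Y Z N" by (simp add: G_def)
  note ND = sat_subD[OF Ns]
  obtain g where g: "g \<in> cocyc i Y Z" "g \<notin> N" using N(1) ND(1) by (auto simp: G_def)
  note gc = cocycD(4)[OF g(1)]
  \<comment> \<open>The saturation of the span of \<open>N\<close> and \<open>g\<close>. By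
    maximality of \<open>N\<close> it consists of all cocycles.\<close>
  define B where "B = {c \<in> cocyc i Y Z. \<exists>t\<in>carrier S - Q. \<exists>s\<in>carrier S. \<exists>b\<in>N. \<forall>y\<in>Y. t \<odot>\<^bsub>J (Suc i)\<^esub> c y = b y \<oplus>\<^bsub>J (Suc i)\<^esub> s \<odot>\<^bsub>J (Suc i)\<^esub> g y}"
  have BI: "c \<in> B" if "c \<in> cocyc i Y Z" "t \<in> carrier S - Q" "s \<in> carrier S" "b \<in> N"
    "\<And>y. y \<in> Y \<Longrightarrow> t \<odot>\<^bsub>J (Suc i)\<^esub> c y = b y \<oplus>\<^bsub>J (Suc i)\<^esub> s \<odot>\<^bsub>J (Suc i)\<^esub> g y" for c t s b
    using that unfolding B_def by blast
  have BE: "\<exists>t s b. c \<in> cocyc i Y Z \<and> t \<in> carrier S - Q \<and> s \<in> carrier S \<and> b \<in> N \<and>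
     (\<forall>y\<in>Y. t \<odot>\<^bsub>J (Suc i)\<^esub> c y = b y \<oplus>\<^bsub>J (Suc i)\<^esub> s \<odot>\<^bsub>J (Suc i)\<^esub> g y)" if "c \<in> B" for c
    using that unfolding B_def by blast
  have Nc: "b y \<in> carrier (J (Suc i))" if "b \<in> N" "y \<in> Y" for b y using that ND(1) cocycD(4) by blast
  have NB: "N \<subseteq> B"
  proof
    fix c assume c: "c \<in> N"
    show "c \<in> B"
      by (rule BI[OF _ one_notin P.zero_closed c]) (use c ND(1) Nc[OF c] gc in auto)
  qed
  have Z0: "(\<lambda>_. \<zero>\<^bsub>J (Suc i)\<^esub>) \<in> N" using cobd_zero[OF Ys] ND(2) by fastforce
  have gB: "g \<in> B"
    by (rule BI[OF g(1) one_notin P.one_closed Z0]) (use gc in auto)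
  have "sat_sub i Y Z B"
    unfolding sat_sub_def
  proof (intro conjI ballI allI impI subsetI)
    { fix c assume "c \<in> B" then show "c \<in> cocyc i Y Z" by (simp add: B_def) }
    { fix c assume "c \<in> cobd i Y Z" then show "c \<in> B" using ND(2) NB by blast }
    { fix c c' assume "c \<in> B" "c' \<in> B"
      from BE[OF \<open>c \<in> B\<close>] BE[OF \<open>c' \<in> B\<close>] obtain t s b t' s' b' where H: "c \<in> cocyc i Y Z" "t \<in> carrier S - Q" "s \<in> carrier S" "b \<in> N"
        "\<And>y. y \<in> Y \<Longrightarrow> t \<odot>\<^bsub>J (Suc i)\<^esub> c y = b y \<oplus>\<^bsub>J (Suc i)\<^esub> s \<odot>\<^bsub>J (Suc i)\<^esub> g y"
        "c' \<in> cocyc i Y Z" "t' \<in> carrier S - Q" "s' \<in> carrier S" "b' \<in> N"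
        "\<And>y. y \<in> Y \<Longrightarrow> t' \<odot>\<^bsub>J (Suc i)\<^esub> c' y = b' y \<oplus>\<^bsub>J (Suc i)\<^esub> s' \<odot>\<^bsub>J (Suc i)\<^esub> g y" by meson
      show "(\<lambda>y. c y \<oplus>\<^bsub>J (Suc i)\<^esub> c' y) \<in> B"
      proof (rule BI[OF cocyc_add[OF H(1,6)] mult_notin[OF H(2,7)], of "t' \<otimes>\<^bsub>S\<^esub> s \<oplus>\<^bsub>S\<^esub> t \<otimes>\<^bsub>S\<^esub> s'"])
        show "(\<lambda>y. t' \<odot>\<^bsub>J (Suc i)\<^esub> b y \<oplus>\<^bsub>J (Suc i)\<^esub> t \<odot>\<^bsub>J (Suc i)\<^esub> b' y) \<in> N" using ND(3,4) H by blast
        fix y assume y: "y \<in> Y"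
        note cl = cocycD(4)[OF H(1) y] cocycD(4)[OF H(6) y] gc[OF y] Nc[OF H(4) y] Nc[OF H(9) y]
        have "(t \<otimes>\<^bsub>S\<^esub> t') \<odot>\<^bsub>J (Suc i)\<^esub> (c y \<oplus>\<^bsub>J (Suc i)\<^esub> c' y) = t' \<odot>\<^bsub>J (Suc i)\<^esub> (t \<odot>\<^bsub>J (Suc i)\<^esub> c y) \<oplus>\<^bsub>J (Suc i)\<^esub> t \<odot>\<^bsub>J (Suc i)\<^esub> (t' \<odot>\<^bsub>J (Suc i)\<^esub> c' y)"
          using cl H(2,7) by (simp add: J.smult_r_distr J.smult_assoc1[symmetric] P.m_comm)
        also have "\<dots> = t' \<odot>\<^bsub>J (Suc i)\<^esub> (b y \<oplus>\<^bsub>J (Suc i)\<^esub> s \<odot>\<^bsub>J (Suc i)\<^esub> g y) \<oplus>\<^bsub>J (Suc i)\<^esub> t \<odot>\<^bsub>J (Suc i)\<^esub> (b' y \<oplus>\<^bsub>J (Suc i)\<^esub> s' \<odot>\<^bsub>J (Suc i)\<^esub> g y)"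
          using H(5)[OF y] H(10)[OF y] by simp
        also have "\<dots> = (t' \<odot>\<^bsub>J (Suc i)\<^esub> b y \<oplus>\<^bsub>J (Suc i)\<^esub> t \<odot>\<^bsub>J (Suc i)\<^esub> b' y) \<oplus>\<^bsub>J (Suc i)\<^esub> (t' \<otimes>\<^bsub>S\<^esub> s \<oplus>\<^bsub>S\<^esub> t \<otimes>\<^bsub>S\<^esub> s') \<odot>\<^bsub>J (Suc i)\<^esub> g y"
          using cl H(2,7) H(3,8) by (simp add: J.smult_r_distr J.smult_l_distr J.smult_assoc1 J.a_ac)
        finally show "(t \<otimes>\<^bsub>S\<^esub> t') \<odot>\<^bsub>J (Suc i)\<^esub> (c y \<oplus>\<^bsub>J (Suc i)\<^esub> c' y) = (t' \<odot>\<^bsub>J (Suc i)\<^esub> b y \<oplus>\<^bsub>J (Suc i)\<^esub> t \<odot>\<^bsub>J (Suc i)\<^esub> b' y) \<oplus>\<^bsub>J (Suc i)\<^esub> (t' \<otimes>\<^bsub>S\<^esub> s \<oplus>\<^bsub>S\<^esub> t \<otimes>\<^bsub>S\<^esub> s') \<odot>\<^bsub>J (Suc i)\<^esub> g y" .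
      qed (use H in auto) }
    { fix a c assume a: "a \<in> carrier S" and "c \<in> B"
      then obtain t s b where H: "c \<in> cocyc i Y Z" "t \<in> carrier S - Q" "s \<in> carrier S" "b \<in> N"
        "\<And>y. y \<in> Y \<Longrightarrow> t \<odot>\<^bsub>J (Suc i)\<^esub> c y = b y \<oplus>\<^bsub>J (Suc i)\<^esub> s \<odot>\<^bsub>J (Suc i)\<^esub> g y" using BE by meson
      show "(\<lambda>y. a \<odot>\<^bsub>J (Suc i)\<^esub> c y) \<in> B"
      proof (rule BI[OF cocyc_scale[OF H(1) a] H(2), of "a \<otimes>\<^bsub>S\<^esub> s"])
        show "(\<lambda>y. a \<odot>\<^bsub>J (Suc i)\<^esub> b y) \<in> N" using ND(4) H a by blast
        fix y assume y: "y \<in> Y"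
        note cl = cocycD(4)[OF H(1) y] gc[OF y] Nc[OF H(4) y]
        have "t \<odot>\<^bsub>J (Suc i)\<^esub> (a \<odot>\<^bsub>J (Suc i)\<^esub> c y) = a \<odot>\<^bsub>J (Suc i)\<^esub> (t \<odot>\<^bsub>J (Suc i)\<^esub> c y)"
          using cl H(2) a by (simp add: J.smult_assoc1[symmetric] P.m_comm)
        also have "\<dots> = a \<odot>\<^bsub>J (Suc i)\<^esub> b y \<oplus>\<^bsub>J (Suc i)\<^esub> (a \<otimes>\<^bsub>S\<^esub> s) \<odot>\<^bsub>J (Suc i)\<^esub> g y"
          unfolding H(5)[OF y] using cl H(3) a by (simp add: J.smult_r_distr J.smult_assoc1)
        finally show "t \<odot>\<^bsub>J (Suc i)\<^esub> (a \<odot>\<^bsub>J (Suc i)\<^esub> c y) = a \<odot>\<^bsub>J (Suc i)\<^esub> b y \<oplus>\<^bsub>J (Suc i)\<^esub> (a \<otimes>\<^bsub>S\<^esub> s) \<odot>\<^bsub>J (Suc i)\<^esub> g y" .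
      qed (use H a in auto) }
    { fix u c assume u: "u \<in> carrier S - Q" and c: "c \<in> cocyc i Y Z" and "(\<lambda>y. u \<odot>\<^bsub>J (Suc i)\<^esub> c y) \<in> B"
      then obtain t s b where H: "t \<in> carrier S - Q" "s \<in> carrier S" "b \<in> N"
        "\<And>y. y \<in> Y \<Longrightarrow> t \<odot>\<^bsub>J (Suc i)\<^esub> (u \<odot>\<^bsub>J (Suc i)\<^esub> c y) = b y \<oplus>\<^bsub>J (Suc i)\<^esub> s \<odot>\<^bsub>J (Suc i)\<^esub> g y" using BE by meson
      show "c \<in> B"
        by (rule BI[OF c mult_notin[OF H(1) u] H(2,3)])
          (use H u cocycD(4)[OF c] in \<open>auto simp: J.smult_assoc1\<close>) }
    { fix c c' assume "c \<in> B" and c': "\<forall>y\<in>Y. c' y = c y"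
      then obtain t s b where H: "c \<in> cocyc i Y Z" "t \<in> carrier S - Q" "s \<in> carrier S" "b \<in> N"
        "\<And>y. y \<in> Y \<Longrightarrow> t \<odot>\<^bsub>J (Suc i)\<^esub> c y = b y \<oplus>\<^bsub>J (Suc i)\<^esub> s \<odot>\<^bsub>J (Suc i)\<^esub> g y" using BE by meson
      show "c' \<in> B"
        by (rule BI[OF cocyc_cong[OF Ys Y(3) H(1)] H(2,3,4)]) (use H(5) c' in auto) }
  qed
  then have Ball: "B = cocyc i Y Z"
    using N(2)[of B] NB gB g(2) unfolding G_def by blast
  obtain g' where g': "g' \<in> cocyc i Y Z" "\<And>y. y \<in> Y \<Longrightarrow> g y = x \<odot>\<^bsub>J (Suc i)\<^esub> g' y" using div[OF g(1)] by blast
  obtain t s b where H: "t \<in> carrier S - Q" "s \<in> carrier S" "b \<in> N"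
        "\<And>y. y \<in> Y \<Longrightarrow> t \<odot>\<^bsub>J (Suc i)\<^esub> g' y = b y \<oplus>\<^bsub>J (Suc i)\<^esub> s \<odot>\<^bsub>J (Suc i)\<^esub> g y"
    using BE[of g'] g'(1) Ball by meson
  have xS: "x \<in> carrier S" using x P.a_Hcarr by blast
  \<comment> \<open>Multiplying the expression of \<open>g'\<close> in terms of \<open>b\<close> and
    \<open>g\<close> by \<open>x\<close> gives \<open>(t - x s) g = x b\<close>. As \<open>t\<close>
    is outside \<open>Q\<close> and \<open>x\<close> inside, the factor on the left is outside
    \<open>Q\<close> and can be cancelled modulo \<open>N\<close>.\<close>
  let ?u = "t \<ominus>\<^bsub>S\<^esub> x \<otimes>\<^bsub>S\<^esub> s"
  have xs: "x \<otimes>\<^bsub>S\<^esub> s \<in> Q" using x H(2) P.I_r_closed by blast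
  have u: "?u \<in> carrier S - Q"
  proof
    show "?u \<in> carrier S" using H xS by simp
    show "?u \<notin> Q"
    proof
      assume "?u \<in> Q"
      then have "?u \<oplus>\<^bsub>S\<^esub> x \<otimes>\<^bsub>S\<^esub> s \<in> Q" using xs P.a_closed by blast
      moreover have "?u \<oplus>\<^bsub>S\<^esub> x \<otimes>\<^bsub>S\<^esub> s = t" using H xS by (simp add: a_minus_def P.a_assoc P.l_neg)
      ultimately show False using H(1) by simp
    qed
  qed
  have "(\<lambda>y. ?u \<odot>\<^bsub>J (Suc i)\<^esub> g y) \<in> N"
  proof (rule ND(6)[OF ND(4)[OF xS H(3)]])
    fix y assume y: "y \<in> Y"
    note cl = cocycD(4)[OF g'(1) y] gc[OF y] Nc[OF H(3) y]
    have "t \<odot>\<^bsub>J (Suc i)\<^esub> g y = x \<odot>\<^bsub>J (Suc i)\<^esub> (t \<odot>\<^bsub>J (Suc i)\<^esub> g' y)"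
      unfolding g'(2)[OF y] using cl xS H(1) by (simp add: J.smult_assoc1[symmetric] P.m_comm)
    also have "\<dots> = x \<odot>\<^bsub>J (Suc i)\<^esub> b y \<oplus>\<^bsub>J (Suc i)\<^esub> (x \<otimes>\<^bsub>S\<^esub> s) \<odot>\<^bsub>J (Suc i)\<^esub> g y"
      unfolding H(4)[OF y] using cl xS H(2) by (simp add: J.smult_r_distr J.smult_assoc1)
    finally have "t \<odot>\<^bsub>J (Suc i)\<^esub> g y \<ominus>\<^bsub>J (Suc i)\<^esub> (x \<otimes>\<^bsub>S\<^esub> s) \<odot>\<^bsub>J (Suc i)\<^esub> g y = x \<odot>\<^bsub>J (Suc i)\<^esub> b y"
      using cl xS H(2) by (simp add: a_minus_def J.a_assoc J.r_neg)
    then show "?u \<odot>\<^bsub>J (Suc i)\<^esub> g y = x \<odot>\<^bsub>J (Suc i)\<^esub> b y"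
      using cl xS H(1,2) by (simp add: smult_minus_l[OF J])
  qed
  then show False using ND(5)[OF u g(1)] g(2) by blast
qed

end

section \<open>Cohomology in the top degree\<close>

context inj_complex_over
begin

definition kills :: "'s \<Rightarrow> nat \<Rightarrow> 'u set \<Rightarrow> 'u set \<Rightarrow> bool" where
  "kills a i Y Z \<longleftrightarrow> (\<forall>c\<in>cocyc i Y Z. (\<lambda>y. a \<odot>\<^bsub>J (Suc i)\<^esub> c y) \<in> cobd i Y Z)"

text \<open>Maps into \<open>J i\<close> from a cyclic module correspond to the elements killed by
  the annihilator of its generator.\<close>

lemma cyclic_map:
  assumes Z: "submodule Z S U" and y: "y \<in> carrier U" and x: "x \<in> carrier (J i)"
    and ann: "\<And>q. q \<in> colon S U Z y \<Longrightarrow> q \<odot>\<^bsub>J i\<^esub> x = \<zero>\<^bsub>J i\<^esub>"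
  obtains c where "c \<in> lin S U (adjoin S U Z y) (J i)" "\<And>z. z \<in> Z \<Longrightarrow> c z = \<zero>\<^bsub>J i\<^esub>" "c y = x"
proof -
  note m = module_self[OF cring_S]
  have X: "submodule (carrier S) S (self_module S)" using module.carrier_is_submodule[OF m] by simp
  note p = lin_smult_vec[OF U y]
  note A = submod_sum_image[OF U m Z X p, folded adjoin_def]
  obtain c where c: "c \<in> lin S U (adjoin S U Z y) (J i)" "\<And>z. z \<in> Z \<Longrightarrow> c z = \<zero>\<^bsub>J i\<^esub>"
     "\<And>s. s \<in> carrier S \<Longrightarrow> c (s \<odot>\<^bsub>U\<^esub> y) = s \<odot>\<^bsub>J i\<^esub> x"
  proof (rule lin_glue[OF U m J Z X p lin_const_zero[OF U J] lin_smult_vec[OF J x] _ A])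
    fix s assume "s \<in> carrier S" "s \<odot>\<^bsub>U\<^esub> y \<in> Z"
    then show "\<zero>\<^bsub>J i\<^esub> = s \<odot>\<^bsub>J i\<^esub> x" using ann by (simp add: colon_def)
  next
    fix c assume "c \<in> lin S U (adjoin S U Z y) (J i)" "\<And>z. z \<in> Z \<Longrightarrow> c z = \<zero>\<^bsub>J i\<^esub>"
     "\<And>s. s \<in> carrier S \<Longrightarrow> c (s \<odot>\<^bsub>U\<^esub> y) = s \<odot>\<^bsub>J i\<^esub> x"
    then show thesis by (rule that)
  qed
  have "c y = x" using c(3)[OF P.one_closed] x y by simp
  then show ?thesis using that c by blast
qed

lemma adjoin_eqI:
  assumes Z: "submodule Z S U" and y: "y \<in> carrier U" and N: "module S N"
    and c: "c \<in> lin S U (adjoin S U Z y) N" "c' \<in> lin S U (adjoin S U Z y) N"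
    and eq: "\<And>z. z \<in> Z \<Longrightarrow> c z = c' z" "c y = c' y"
    and w: "w \<in> adjoin S U Z y"
  shows "c w = c' w"
proof -
  note A = adjoin[OF U Z y]
  have "submodule {w \<in> adjoin S U Z y. c w = c' w} S U" by (rule submod_equalizer[OF U N c A(1)])
  then have "adjoin S U Z y \<subseteq> {w \<in> adjoin S U Z y. c w = c' w}"
    by (rule A(4)) (use A(2,3) eq in auto)
  then show ?thesis using w by blast
qed

lemma colon_kills:
  assumes Z: "submodule Z S U" and y: "y \<in> carrier U" and q: "q \<in> colon S U Z y"
    and c: "c \<in> cocyc i (adjoin S U Z y) Z" and w: "w \<in> adjoin S U Z y"
  shows "q \<odot>\<^bsub>J (Suc i)\<^esub> c w = \<zero>\<^bsub>J (Suc i)\<^esub>"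
proof -
  have qS: "q \<in> carrier S" "q \<odot>\<^bsub>U\<^esub> y \<in> Z" using q by (auto simp: colon_def)
  note A = adjoin[OF U Z y]
  have "q \<odot>\<^bsub>J (Suc i)\<^esub> c w = (\<lambda>_. \<zero>\<^bsub>J (Suc i)\<^esub>) w"
  proof (rule adjoin_eqI[OF Z y J lin_scale[OF U J cocycD(1)[OF c] qS(1)] lin_const_zero[OF U J] _ _ w])
    show "q \<odot>\<^bsub>J (Suc i)\<^esub> c z = \<zero>\<^bsub>J (Suc i)\<^esub>" if "z \<in> Z" for z using cocycD(2)[OF c that] qS by simp
    show "q \<odot>\<^bsub>J (Suc i)\<^esub> c y = \<zero>\<^bsub>J (Suc i)\<^esub>"
      using cocycD(2)[OF c qS(2)] lin_smult[OF cocycD(1)[OF c] qS(1) A(3)] by simp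
  qed
  then show ?thesis .
qed

text \<open>E^i(S/Q) = 0, phrased through the elements of \<open>J\<close> killed by
  \<open>Q\<close>. No submodule of \<open>U\<close> occurs, so vanishing on one copy of S/Q among
  the subquotients carries over to every other copy.\<close>

definition residue_acyclic :: "nat \<Rightarrow> bool" where
  "residue_acyclic i \<longleftrightarrow> (\<forall>x\<in>carrier (J (Suc i)). (\<forall>q\<in>Q. q \<odot>\<^bsub>J (Suc i)\<^esub> x = \<zero>\<^bsub>J (Suc i)\<^esub>) \<longrightarrow>
    D (Suc i) x = \<zero>\<^bsub>J (Suc (Suc i))\<^esub> \<longrightarrow> (\<exists>x'\<in>carrier (J i). (\<forall>q\<in>Q. q \<odot>\<^bsub>J i\<^esub> x' = \<zero>\<^bsub>J i\<^esub>) \<and> D i x' = x))"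

lemma residue_acyclicD:
  assumes r: "residue_acyclic i" and Z: "submodule Z S U" and y: "y \<in> carrier U" and Q: "colon S U Z y = Q"
  shows "cocyc i (adjoin S U Z y) Z \<subseteq> cobd i (adjoin S U Z y) Z"
proof
  note A = adjoin[OF U Z y]
  fix c assume c: "c \<in> cocyc i (adjoin S U Z y) Z"
  have "\<forall>q\<in>Q. q \<odot>\<^bsub>J (Suc i)\<^esub> c y = \<zero>\<^bsub>J (Suc i)\<^esub>" using colon_kills[OF Z y _ c A(3)] Q by blast
  then obtain x' where x': "x' \<in> carrier (J i)" "\<And>q. q \<in> Q \<Longrightarrow> q \<odot>\<^bsub>J i\<^esub> x' = \<zero>\<^bsub>J i\<^esub>" "D i x' = c y"
    using r[unfolded residue_acyclic_def, rule_format, OF cocycD(4)[OF c A(3)] _ cocycD(3)[OF c A(3)]] by blast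
  obtain h where h: "h \<in> lin S U (adjoin S U Z y) (J i)" "\<And>z. z \<in> Z \<Longrightarrow> h z = \<zero>\<^bsub>J i\<^esub>" "h y = x'"
    using cyclic_map[OF Z y x'(1)] x'(2) Q by metis
  show "c \<in> cobd i (adjoin S U Z y) Z"
  proof (rule cobdI[OF A(1) h(1,2)])
    show "c w = D i (h w)" if "w \<in> adjoin S U Z y" for w
      by (rule adjoin_eqI[OF Z y J cocycD(1)[OF c] lin_D[OF h(1)] _ _ that])
        (use h x' cocycD(2)[OF c] in auto)
  qed
qed

lemma residue_acyclicI:
  assumes Z: "submodule Z S U" and y: "y \<in> carrier U" and Q: "colon S U Z y = Q"
   and v: "cocyc i (adjoin S U Z y) Z \<subseteq> cobd i (adjoin S U Z y) Z"
  shows "residue_acyclic i"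
  unfolding residue_acyclic_def
proof (intro ballI impI)
  note A = adjoin[OF U Z y]
  fix x assume x: "x \<in> carrier (J (Suc i))" "\<forall>q\<in>Q. q \<odot>\<^bsub>J (Suc i)\<^esub> x = \<zero>\<^bsub>J (Suc i)\<^esub>" "D (Suc i) x = \<zero>\<^bsub>J (Suc (Suc i))\<^esub>"
  obtain c where c: "c \<in> lin S U (adjoin S U Z y) (J (Suc i))" "\<And>z. z \<in> Z \<Longrightarrow> c z = \<zero>\<^bsub>J (Suc i)\<^esub>" "c y = x"
    using cyclic_map[OF Z y x(1)] x(2) Q by metis
  have "D (Suc i) (c w) = (\<lambda>_. \<zero>\<^bsub>J (Suc (Suc i))\<^esub>) w" if "w \<in> adjoin S U Z y" for w
    by (rule adjoin_eqI[OF Z y J lin_D[OF c(1)] lin_const_zero[OF U J] _ _ that]) (use c x in auto)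
  then have "c \<in> cocyc i (adjoin S U Z y) Z" using c by (intro cocycI) auto
  then have "c \<in> cobd i (adjoin S U Z y) Z" using v by blast
  then obtain h where h: "h \<in> lin S U (adjoin S U Z y) (J i)" "\<And>z. z \<in> Z \<Longrightarrow> h z = \<zero>\<^bsub>J i\<^esub>" "c y = D i (h y)"
    using A(3) unfolding cobd_def by blast
  have "q \<odot>\<^bsub>J i\<^esub> h y = \<zero>\<^bsub>J i\<^esub>" if "q \<in> Q" for q
  proof -
    have q: "q \<in> carrier S" "q \<odot>\<^bsub>U\<^esub> y \<in> Z" using that Q by (auto simp: colon_def)
    show ?thesis using lin_smult[OF h(1) q(1) A(3)] h(2)[OF q(2)] by simp
  qed
  then show "\<exists>x'\<in>carrier (J i). (\<forall>q\<in>Q. q \<odot>\<^bsub>J i\<^esub> x' = \<zero>\<^bsub>J i\<^esub>) \<and> D i x' = x"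
    using lin_closed[OF h(1) A(3)] h(3) c(3) by (intro bexI[of _ "h y"]) auto
qed

end

context inj_complex_enough
begin

text \<open>If the prime is not inside \<open>Q\<close>, one of its elements acts both as zero and
  injectively. Otherwise some \<open>x\<close> in \<open>Q\<close> acts injectively on S/p; the
  cokernel has no cohomology in degree \<open>Suc i\<close>, so \<open>x\<close> acts surjectively
  in degree \<open>i\<close>.\<close>

lemma other_primes:
  assumes v: "vanish (Suc i)" and Y: "noeth_sub S U (adjoin S U Z y)" and Z: "submodule Z S U" and y: "y \<in> carrier U"
    and p: "primeideal (colon S U Z y) S" "colon S U Z y \<noteq> Q"
  shows "cocyc i (adjoin S U Z y) Z \<subseteq> cobd i (adjoin S U Z y) Z"
proof -
  let ?W = "adjoin S U Z y"
  let ?p = "colon S U Z y"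
  interpret p: primeideal ?p S by fact
  note A = adjoin[OF U Z y]
  show ?thesis
  proof (cases "?p \<subseteq> Q")
    case False
    then obtain s where s: "s \<in> ?p" "s \<notin> Q" by blast
    have sS: "s \<in> carrier S - Q" using s p.a_Hcarr by blast
    have "c \<in> cobd i ?W Z" if c: "c \<in> cocyc i ?W Z" for c
    proof (rule cobd_zero[OF A(1)])
      fix w assume w: "w \<in> ?W"
      show "c w = \<zero>\<^bsub>J (Suc i)\<^esub>"
        by (rule unit_inj[OF sS cocycD(4)[OF c w] colon_kills[OF Z y s(1) c w]])
    qed
    then show ?thesis by blast
  next
    case True
    then obtain x where x: "x \<in> Q" "x \<notin> ?p" using p(2) by blast
    have xS: "x \<in> carrier S" using x P.a_Hcarr by blast
    note pl = lin_smult_scalar[OF U A(1) xS]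
    \<comment> \<open>W1/Z is \<open>x\<close> times the cyclic module W/Z, so W/W1 is the cokernel
      of multiplication by \<open>x\<close>.\<close>
    define W1 where "W1 = {z \<oplus>\<^bsub>U\<^esub> x \<odot>\<^bsub>U\<^esub> w | z w. z \<in> Z \<and> w \<in> ?W}"
    note B = submod_sum_image[OF U U Z A(1) pl, folded W1_def]
    have W1: "W1 \<subseteq> ?W" unfolding W1_def
      using A(2) submod_add[OF U A(1)] submod_smult[OF U A(1) xS] by blast
    have regular: "w \<in> Z" if w: "w \<in> ?W" "x \<odot>\<^bsub>U\<^esub> w \<in> Z" for w
    proof -
      obtain z a where za: "z \<in> Z" "a \<in> carrier S" "w = z \<oplus>\<^bsub>U\<^esub> a \<odot>\<^bsub>U\<^esub> y" using w(1) unfolding adjoin_def by blast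
      have zc: "z \<in> carrier U" using submod_mem[OF U Z za(1)] .
      have wz: "w \<ominus>\<^bsub>U\<^esub> z = a \<odot>\<^bsub>U\<^esub> y"
        using za zc y by (simp add: a_minus_def U.a_comm[of z] U.a_assoc U.r_neg)
      have "x \<odot>\<^bsub>U\<^esub> w \<ominus>\<^bsub>U\<^esub> x \<odot>\<^bsub>U\<^esub> z = x \<odot>\<^bsub>U\<^esub> (a \<odot>\<^bsub>U\<^esub> y)"
        unfolding wz[symmetric] by (rule smult_minus[OF U xS submod_mem[OF U A(1) w(1)] zc, symmetric])
      also have "\<dots> = (x \<otimes>\<^bsub>S\<^esub> a) \<odot>\<^bsub>U\<^esub> y" by (rule U.smult_assoc1[OF xS za(2) y, symmetric])
      finally have "x \<otimes>\<^bsub>S\<^esub> a \<in> ?p"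
        using submod_diff[OF U Z w(2) submod_smult[OF U Z xS za(1)]] P.m_closed[OF xS za(2)]
        unfolding colon_def by (metis (lifting) CollectI)
      then have "x \<in> ?p \<or> a \<in> ?p" by (rule p.I_prime[OF xS za(2)])
      with x(2) have "a \<in> ?p" by (metis (no_types))
      then have "a \<odot>\<^bsub>U\<^esub> y \<in> Z" unfolding colon_def by (elim CollectE conjE)
      then show "w \<in> Z" unfolding za(3) by (rule submod_add[OF U Z za(1)])
    qed
    show ?thesis
    proof (rule nakayama[OF Y Z A(2) x(1)])
      fix c assume c: "c \<in> cocyc i ?W Z"
      \<comment> \<open>The argument is divided by \<open>x\<close>. This is well defined on
        \<open>W1\<close>, because a multiple by \<open>x\<close> lies in \<open>Z\<close> only for
        arguments in \<open>Z\<close>, where \<open>c\<close> vanishes.\<close>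
      obtain c1 where c1: "c1 \<in> lin S U W1 (J (Suc i))" "\<And>z. z \<in> Z \<Longrightarrow> c1 z = \<zero>\<^bsub>J (Suc i)\<^esub>" "\<And>w. w \<in> ?W \<Longrightarrow> c1 (x \<odot>\<^bsub>U\<^esub> w) = c w"
      proof (rule lin_glue[OF U U J Z A(1) pl lin_const_zero[OF U J] cocycD(1)[OF c] _ B])
        show "\<zero>\<^bsub>J (Suc i)\<^esub> = c w" if "w \<in> ?W" "x \<odot>\<^bsub>U\<^esub> w \<in> Z" for w
          using cocycD(2)[OF c regular[OF that]] by simp
      next
        fix c1 assume "c1 \<in> lin S U W1 (J (Suc i))" "\<And>z. z \<in> Z \<Longrightarrow> c1 z = \<zero>\<^bsub>J (Suc i)\<^esub>" "\<And>w. w \<in> ?W \<Longrightarrow> c1 (x \<odot>\<^bsub>U\<^esub> w) = c w"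
        then show thesis by (rule that)
      qed
      obtain c2 where c2: "c2 \<in> lin S U ?W (J (Suc i))" "\<And>w. w \<in> W1 \<Longrightarrow> c2 w = c1 w"
        using J_extend[OF U Y B(1) W1 c1(1)] by metis
      have xW1: "x \<odot>\<^bsub>U\<^esub> w \<in> W1" if "w \<in> ?W" for w using B(3) that by blast
      \<comment> \<open>The extension \<open>c2\<close> need not be a cocycle, but its differential
        vanishes on \<open>W1\<close> and represents a class of W/W1 in the degree where cohomology
        vanishes. Subtracting the primitive \<open>h\<close>, which is zero on \<open>W1\<close>,
        repairs \<open>c2\<close> without changing it there.\<close>
      have "(\<lambda>w. D (Suc i) (c2 w)) \<in> cocyc (Suc i) ?W W1"
      proof (rule cocycI[OF lin_D[OF c2(1)]])
        show "D (Suc i) (c2 w) = \<zero>\<^bsub>J (Suc (Suc i))\<^esub>" if w: "w \<in> W1" for w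
        proof -
          obtain z w' where zw: "z \<in> Z" "w' \<in> ?W" "w = z \<oplus>\<^bsub>U\<^esub> x \<odot>\<^bsub>U\<^esub> w'" using B(4)[OF w] by blast
          have "c1 w = c w'"
            using lin_add[OF c1(1) subsetD[OF B(2) zw(1)] xW1[OF zw(2)]] c1(2)[OF zw(1)] c1(3)[OF zw(2)] zw(3) cocycD(4)[OF c zw(2)] by simp
          then show ?thesis using c2(2)[OF w] cocycD(3)[OF c zw(2)] by simp
        qed
      qed (use D_D lin_closed[OF c2(1)] in auto)
      from vanishD[OF v Y B(1) W1 this]
      obtain h where h: "h \<in> lin S U ?W (J (Suc i))" "\<And>w. w \<in> W1 \<Longrightarrow> h w = \<zero>\<^bsub>J (Suc i)\<^esub>"
        "\<And>w. w \<in> ?W \<Longrightarrow> D (Suc i) (c2 w) = D (Suc i) (h w)" unfolding cobd_def by blast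
      note lc = lin_closed[OF c2(1)] lin_closed[OF h(1)]
      let ?c = "\<lambda>w. c2 w \<ominus>\<^bsub>J (Suc i)\<^esub> h w"
      have c3: "?c \<in> cocyc i ?W Z"
      proof (rule cocycI[OF lin_minus[OF U J c2(1) h(1)]])
        show "?c z = \<zero>\<^bsub>J (Suc i)\<^esub>" if "z \<in> Z" for z
          using that B(2) c2(2)[of z] h(2)[of z] c1(2)[of z] by (auto simp: subset_iff)
        show "D (Suc i) (?c w) = \<zero>\<^bsub>J (Suc (Suc i))\<^esub>" if "w \<in> ?W" for w
          using lc[OF that] h(3)[OF that] by (simp add: D_diff)
      qed
      have c4: "c w = x \<odot>\<^bsub>J (Suc i)\<^esub> ?c w" if w: "w \<in> ?W" for w
      proof -
        have "x \<odot>\<^bsub>J (Suc i)\<^esub> c2 w = c w"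
          using lin_smult[OF c2(1) xS w] c2(2)[OF xW1[OF w]] c1(3)[OF w] by simp
        moreover have "x \<odot>\<^bsub>J (Suc i)\<^esub> h w = \<zero>\<^bsub>J (Suc i)\<^esub>"
          using lin_smult[OF h(1) xS w] h(2)[OF xW1[OF w]] by simp
        ultimately show ?thesis using lc[OF w] xS cocycD(4)[OF c w] by (simp add: smult_minus[OF J]) (simp add: a_minus_def)
      qed
      show "\<exists>c'\<in>cocyc i ?W Z. \<forall>y\<in>?W. c y = x \<odot>\<^bsub>J (Suc i)\<^esub> c' y"
        by (rule bexI[OF _ c3], rule ballI, rule c4)
    qed
  qed
qed

text \<open>Noetherian induction on \<open>Z\<close> from above. From a maximal counterexample
  \<open>N\<close> a prime cyclic module W/N is split off; \<open>a\<close> kills the cohomology of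
  W/N, its power \<open>m\<close> kills that of Y/W, and exactness in the middle gives the exponent
  \<open>Suc m\<close> for Y/N. The assumption on \<open>a\<close> concerns S/Q alone because other
  primes contribute nothing.\<close>

lemma power_kills:
  assumes v: "vanish (Suc i)" and a: "a \<in> carrier S"
    and k: "\<And>Z y. noeth_sub S U (adjoin S U Z y) \<Longrightarrow> submodule Z S U \<Longrightarrow> y \<in> carrier U \<Longrightarrow> colon S U Z y = Q \<Longrightarrow>
       kills a i (adjoin S U Z y) Z"
    and Y: "noeth_sub S U Y" "submodule Z S U" "Z \<subseteq> Y"
  shows "\<exists>m::nat. kills (a [^]\<^bsub>S\<^esub> m) i Y Z"
proof (rule ccontr)
  assume neg: "\<not> ?thesis"
  note Ys = noeth_sub_submod[OF Y(1)]
  define G where "G = {Z. submodule Z S U \<and> Z \<subseteq> Y \<and> \<not> (\<exists>m::nat. kills (a [^]\<^bsub>S\<^esub> m) i Y Z)}"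
  have 1: "\<And>N. N \<in> G \<Longrightarrow> submodule N S U \<and> N \<subseteq> Y" by (simp add: G_def)
  have 2: "Z \<in> G" using Y neg by (simp add: G_def)
  obtain N where N: "N \<in> G" "\<And>N'. N' \<in> G \<Longrightarrow> N \<subseteq> N' \<Longrightarrow> N' = N"
    using noeth_sub_maximal[OF Y(1) 1 2] by metis
  have Ns: "submodule N S U" "N \<subseteq> Y" using 1[OF N(1)] by auto
  have "N \<noteq> Y"
  proof
    assume NY: "N = Y"
    have "kills (a [^]\<^bsub>S\<^esub> (0::nat)) i Y Y"
      unfolding kills_def using a by (intro ballI cobd_zero[OF Ys]) (auto dest: cocycD(2))
    then show False using N(1) NY unfolding G_def by blast
  qed
  from prime_colon[OF noeth U Ns(1) Ys Ns(2) this]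
  obtain y where y: "y \<in> Y" "y \<notin> N" "primeideal (colon S U N y) S" by blast
  have yc: "y \<in> carrier U" using submod_mem[OF U Ys y(1)] .
  let ?W = "adjoin S U N y"
  note A = adjoin[OF U Ns(1) yc]
  have WY: "?W \<subseteq> Y" by (rule A(4)[OF Ys Ns(2) y(1)])
  have nW: "noeth_sub S U ?W" by (rule noeth_sub_subset[OF Y(1) A(1) WY])
  have "?W \<notin> G" using N(2)[of ?W] A(2,3) y(2) by blast
  then obtain m :: nat where m: "kills (a [^]\<^bsub>S\<^esub> m) i Y ?W" using A(1) WY unfolding G_def by blast
  have kW: "kills a i ?W N"
  proof (cases "colon S U N y = Q")
    case True then show ?thesis using k[OF nW Ns(1) yc] by blast
  next
    case False
    then have "cocyc i ?W N \<subseteq> cobd i ?W N" using other_primes[OF v nW Ns(1) yc y(3)] by blast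
    then show ?thesis unfolding kills_def using cobd_scale[OF A(1) _ a] by blast
  qed
  have am: "a [^]\<^bsub>S\<^esub> m \<in> carrier S" using a by simp
  have "kills (a [^]\<^bsub>S\<^esub> Suc m) i Y N"
    unfolding kills_def
  proof
    fix c assume c: "c \<in> cocyc i Y N"
    note cc = cocycD(4)[OF c]
    have "c \<in> cocyc i ?W N" using cocyc_restrict[OF c WY] by blast
    then have "(\<lambda>w. a \<odot>\<^bsub>J (Suc i)\<^esub> c w) \<in> cobd i ?W N" using kW unfolding kills_def by blast
    then obtain h where h: "h \<in> lin S U ?W (J i)" "\<And>z. z \<in> N \<Longrightarrow> h z = \<zero>\<^bsub>J i\<^esub>" "\<And>w. w \<in> ?W \<Longrightarrow> a \<odot>\<^bsub>J (Suc i)\<^esub> c w = D i (h w)"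
      unfolding cobd_def by blast
    obtain h' where h': "h' \<in> lin S U Y (J i)" "\<And>w. w \<in> ?W \<Longrightarrow> h' w = h w"
      using J_extend[OF U Y(1) A(1) WY h(1)] by metis
    note hc = lin_closed[OF h'(1)]
    \<comment> \<open>Subtracting the differential of the extended primitive makes the multiple of
      \<open>c\<close> vanish on \<open>W\<close>, so it represents a class of Y/W.\<close>
    let ?c = "\<lambda>y. a \<odot>\<^bsub>J (Suc i)\<^esub> c y \<ominus>\<^bsub>J (Suc i)\<^esub> D i (h' y)"
    have "?c \<in> cocyc i Y ?W"
    proof (rule cocycI[OF lin_minus[OF U J lin_scale[OF U J cocycD(1)[OF c] a] lin_D[OF h'(1)]]])
      show "?c w = \<zero>\<^bsub>J (Suc i)\<^esub>" if "w \<in> ?W" for w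
      proof -
        have "w \<in> Y" using that WY by blast
        then show ?thesis using h(3)[OF that] h'(2)[OF that] hc[of w] by simp
      qed
      show "D (Suc i) (?c y) = \<zero>\<^bsub>J (Suc (Suc i))\<^esub>" if "y \<in> Y" for y
        using cc[OF that] hc[OF that] a cocycD(3)[OF c that] by (simp add: D_diff D_smult D_D)
    qed
    with m have "(\<lambda>y. a [^]\<^bsub>S\<^esub> m \<odot>\<^bsub>J (Suc i)\<^esub> ?c y) \<in> cobd i Y ?W" unfolding kills_def by (rule bspec)
    then obtain g where g: "g \<in> lin S U Y (J i)" "\<And>w. w \<in> ?W \<Longrightarrow> g w = \<zero>\<^bsub>J i\<^esub>" "\<And>y. y \<in> Y \<Longrightarrow> a [^]\<^bsub>S\<^esub> m \<odot>\<^bsub>J (Suc i)\<^esub> ?c y = D i (g y)"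
      unfolding cobd_def by blast
    show "(\<lambda>y. a [^]\<^bsub>S\<^esub> Suc m \<odot>\<^bsub>J (Suc i)\<^esub> c y) \<in> cobd i Y N"
    proof (rule cobdI[OF Ys lin_plus[OF U J g(1) lin_scale[OF U J h'(1) am]]])
      show "g z \<oplus>\<^bsub>J i\<^esub> a [^]\<^bsub>S\<^esub> m \<odot>\<^bsub>J i\<^esub> h' z = \<zero>\<^bsub>J i\<^esub>" if "z \<in> N" for z
      proof -
        have "z \<in> ?W" using that A(2) by blast
        then show ?thesis using g(2) h'(2) h(2)[OF that] am by simp
      qed
      fix y assume y: "y \<in> Y"
      note cl = cc[OF y] hc[OF y] lin_closed[OF g(1) y]
      have "D i (g y) \<oplus>\<^bsub>J (Suc i)\<^esub> a [^]\<^bsub>S\<^esub> m \<odot>\<^bsub>J (Suc i)\<^esub> D i (h' y) = a [^]\<^bsub>S\<^esub> m \<odot>\<^bsub>J (Suc i)\<^esub> (a \<odot>\<^bsub>J (Suc i)\<^esub> c y)"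
        unfolding g(3)[OF y, symmetric]
        using cl am a D_closed[OF cl(2)] by (simp add: smult_minus[OF J] a_minus_def J.smult_r_distr J.smult_r_minus J.a_assoc J.l_neg del: P.nat_pow_closed)
      then show "a [^]\<^bsub>S\<^esub> Suc m \<odot>\<^bsub>J (Suc i)\<^esub> c y = D i (g y \<oplus>\<^bsub>J i\<^esub> a [^]\<^bsub>S\<^esub> m \<odot>\<^bsub>J i\<^esub> h' y)"
        using cl am a by (simp add: D_add D_smult J.smult_assoc1)
    qed
  qed
  then show False using N(1) unfolding G_def by blast
qed

text \<open>The degree \<open>d\<close> is the depth of the localization of \<open>S\<close> at \<open>Q\<close>.\<close>

lemma top_degree:
  obtains d where "\<And>Y Z y. noeth_sub S U Y \<Longrightarrow> submodule Z S U \<Longrightarrow> Z \<subseteq> Y \<Longrightarrow> y \<in> Y \<Longrightarrow> colon S U Z y = Q \<Longrightarrow>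
      \<not> cocyc d Y Z \<subseteq> cobd d Y Z"
    and "\<And>Y Z q. noeth_sub S U Y \<Longrightarrow> submodule Z S U \<Longrightarrow> Z \<subseteq> Y \<Longrightarrow> q \<in> Q \<Longrightarrow> \<exists>m::nat. kills (q [^]\<^bsub>S\<^esub> m) d Y Z"
proof -
  have fin: "finite {i. \<not> vanish i}"
    by (rule finite_subset[of _ "{..<n}"]) (auto simp: vanish_above not_le[symmetric])
  define d where "d = Max {i. \<not> vanish i}"
  have nd: "\<not> vanish d" using Max_in[OF fin] nontrivial unfolding d_def by blast
  have vd: "vanish (Suc d)" using Max_ge[OF fin, of "Suc d"] unfolding d_def[symmetric] by auto
  \<comment> \<open>If S/Q had no cohomology in degree \<open>d\<close>, then \<open>1\<close> would
    kill that of all prime quotients and hence of every Y/Z, against the choice of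
    \<open>d\<close>.\<close>
  have nr: "\<not> residue_acyclic d"
  proof
    assume r: "residue_acyclic d"
    have k1: "kills \<one>\<^bsub>S\<^esub> d (adjoin S U Z y) Z" if "noeth_sub S U (adjoin S U Z y)" "submodule Z S U" "y \<in> carrier U" "colon S U Z y = Q" for Z y
      unfolding kills_def
      using residue_acyclicD[OF r that(2,3,4)] cobd_scale[OF noeth_sub_submod[OF that(1)] _ P.one_closed] by blast
    have "vanish d"
      unfolding vanish_def
    proof (intro allI impI subsetI)
      fix Y Z c assume Y: "noeth_sub S U Y" "submodule Z S U" "Z \<subseteq> Y" and c: "c \<in> cocyc d Y Z"
      obtain m :: nat where "kills (\<one>\<^bsub>S\<^esub> [^]\<^bsub>S\<^esub> m) d Y Z" using power_kills[OF vd P.one_closed k1 Y] by blast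
      then have "(\<lambda>y. \<one>\<^bsub>S\<^esub> \<odot>\<^bsub>J (Suc d)\<^esub> c y) \<in> cobd d Y Z" using c unfolding kills_def by simp
      then show "c \<in> cobd d Y Z"
        by (rule cobd_cong[OF noeth_sub_submod[OF Y(1)]]) (use cocycD(4)[OF c] in auto)
    qed
    then show False using nd by blast
  qed
  show ?thesis
  proof (rule that[of d])
    fix Y Z q assume Y: "noeth_sub S U Y" "submodule Z S U" "Z \<subseteq> Y" and q: "q \<in> Q"
    show "\<exists>m::nat. kills (q [^]\<^bsub>S\<^esub> m) d Y Z"
    proof (rule power_kills[OF vd _ _ Y])
      show "q \<in> carrier S" using q P.a_Hcarr by blast
      fix Z y assume H: "noeth_sub S U (adjoin S U Z y)" "submodule Z S U" "y \<in> carrier U" "colon S U Z y = Q"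
      show "kills q d (adjoin S U Z y) Z"
        unfolding kills_def
        using colon_kills[OF H(2,3)] q H(4) by (intro ballI cobd_zero[OF noeth_sub_submod[OF H(1)]]) blast
    qed
  next
    fix Y Z y assume Y: "noeth_sub S U Y" "submodule Z S U" "Z \<subseteq> Y" and y: "y \<in> Y" "colon S U Z y = Q"
    note Ys = noeth_sub_submod[OF Y(1)]
    have yc: "y \<in> carrier U" using submod_mem[OF U Ys y(1)] .
    let ?W = "adjoin S U Z y"
    note A = adjoin[OF U Y(2) yc]
    have WY: "?W \<subseteq> Y" by (rule A(4)[OF Ys Y(3) y(1)])
    obtain c0 where c0: "c0 \<in> cocyc d ?W Z" "c0 \<notin> cobd d ?W Z" using residue_acyclicI[OF Y(2) yc y(2)] nr by blast
    obtain c where c: "c \<in> lin S U Y (J (Suc d))" "\<And>w. w \<in> ?W \<Longrightarrow> c w = c0 w"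
      using J_extend[OF U Y(1) A(1) WY cocycD(1)[OF c0(1)]] by metis
    \<comment> \<open>Surjectivity of E^d(Y/Z) onto E^d(W/Z): the obstruction to extending
      \<open>c0\<close> as a cocycle is a class of Y/W in degree \<open>Suc d\<close>, where
      cohomology vanishes.\<close>
    have "(\<lambda>y. D (Suc d) (c y)) \<in> cocyc (Suc d) Y ?W"
      by (rule cocycI[OF lin_D[OF c(1)]]) (use c cocycD(3)[OF c0(1)] D_D lin_closed[OF c(1)] in auto)
    from vanishD[OF vd Y(1) A(1) WY this]
    obtain h where h: "h \<in> lin S U Y (J (Suc d))" "\<And>w. w \<in> ?W \<Longrightarrow> h w = \<zero>\<^bsub>J (Suc d)\<^esub>"
      "\<And>y. y \<in> Y \<Longrightarrow> D (Suc d) (c y) = D (Suc d) (h y)" unfolding cobd_def by blast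
    let ?c = "\<lambda>y. c y \<ominus>\<^bsub>J (Suc d)\<^esub> h y"
    have cw: "?c w = c0 w" if "w \<in> ?W" for w
      using c(2)[OF that] h(2)[OF that] cocycD(4)[OF c0(1) that] by (simp add: a_minus_def)
    have "?c \<in> cocyc d Y Z"
    proof (rule cocycI[OF lin_minus[OF U J c(1) h(1)]])
      show "?c z = \<zero>\<^bsub>J (Suc d)\<^esub>" if "z \<in> Z" for z
        using cw[of z] cocycD(2)[OF c0(1) that] that A(2) by auto
      show "D (Suc d) (?c y) = \<zero>\<^bsub>J (Suc (Suc d))\<^esub>" if "y \<in> Y" for y
        using lin_closed[OF c(1) that] lin_closed[OF h(1) that] h(3)[OF that] by (simp add: D_diff)
    qed
    moreover have "?c \<notin> cobd d Y Z"
    proof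
      assume "?c \<in> cobd d Y Z"
      then obtain g where g: "g \<in> lin S U Y (J d)" "\<And>z. z \<in> Z \<Longrightarrow> g z = \<zero>\<^bsub>J d\<^esub>" "\<And>y. y \<in> Y \<Longrightarrow> ?c y = D d (g y)"
        unfolding cobd_def by blast
      have "c0 w = D d (g w)" if "w \<in> ?W" for w using cw[OF that] g(3)[of w] that WY by auto
      from cobdI[OF A(1) lin_subset[OF g(1) WY] g(2) this] show False using c0(2) by blast
    qed
    ultimately show "\<not> cocyc d Y Z \<subseteq> cobd d Y Z" by blast
  qed
qed

end

section \<open>Comparison with the cohomology of a free resolution\<close>

context inj_complex
begin

text \<open>\<open>I \<phi>\<close> stands for the annihilator of \<open>\<phi>\<close> and
  \<open>col\<close> for the passage to a multiple of \<open>\<phi>\<close>. A maximal ideal of the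
  family among those inside \<open>Q\<close> is unchanged by every colon that stays inside
  \<open>Q\<close>, and this forces it to be \<open>Q\<close>.\<close>

lemma ex_ideal_eq_prime:
  fixes \<Phi> :: "'f set" and I :: "'f \<Rightarrow> 's set"
  assumes id: "\<And>\<phi>. \<phi> \<in> \<Phi> \<Longrightarrow> ideal (I \<phi>) S"
    and col: "\<And>\<phi> a. \<phi> \<in> \<Phi> \<Longrightarrow> a \<in> carrier S \<Longrightarrow> \<exists>\<phi>'\<in>\<Phi>. I \<phi>' = {s \<in> carrier S. s \<otimes>\<^bsub>S\<^esub> a \<in> I \<phi>}"
    and ex: "\<phi>0 \<in> \<Phi>" "I \<phi>0 \<subseteq> Q"
    and pow: "\<And>\<phi> q. \<phi> \<in> \<Phi> \<Longrightarrow> q \<in> Q \<Longrightarrow> \<exists>m::nat. \<exists>t\<in>carrier S - Q. t \<otimes>\<^bsub>S\<^esub> q [^]\<^bsub>S\<^esub> m \<in> I \<phi>"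
  shows "\<exists>\<phi>\<in>\<Phi>. I \<phi> = Q"
proof -
  have G: "I ` {\<phi>\<in>\<Phi>. I \<phi> \<subseteq> Q} \<subseteq> {I. ideal I S}" using id by blast
  have "I \<phi>0 \<in> I ` {\<phi>\<in>\<Phi>. I \<phi> \<subseteq> Q}" using ex by blast
  from acc_maximal[OF noetherian_ring.acc_ideals[OF noeth] G this]
  obtain A where A: "A \<in> I ` {\<phi>\<in>\<Phi>. I \<phi> \<subseteq> Q}" "\<And>A'. A' \<in> I ` {\<phi>\<in>\<Phi>. I \<phi> \<subseteq> Q} \<Longrightarrow> A \<subseteq> A' \<Longrightarrow> A' = A" by blast
  from A(1) obtain \<phi> where f: "\<phi> \<in> \<Phi>" "I \<phi> \<subseteq> Q" "A = I \<phi>" by blast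
  interpret A: ideal A S using id f by blast
  have col': "s \<in> A" if a: "a \<in> carrier S" and sub: "\<And>s. s \<in> carrier S \<Longrightarrow> s \<otimes>\<^bsub>S\<^esub> a \<in> A \<Longrightarrow> s \<in> Q"
    and s: "s \<in> carrier S" "s \<otimes>\<^bsub>S\<^esub> a \<in> A" for a s
  proof -
    obtain \<phi>' where f': "\<phi>' \<in> \<Phi>" "I \<phi>' = {s \<in> carrier S. s \<otimes>\<^bsub>S\<^esub> a \<in> A}" using col[OF f(1) a] f(3) by auto
    have "A \<subseteq> I \<phi>'" unfolding f'(2) using A.I_r_closed a A.a_Hcarr by blast
    moreover have "I \<phi>' \<in> I ` {\<phi>\<in>\<Phi>. I \<phi> \<subseteq> Q}" using f' sub by blast
    ultimately have "I \<phi>' = A" using A(2) by blast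
    then show ?thesis using f'(2) s by blast
  qed
  \<comment> \<open>Since \<open>A\<close> lies in the prime \<open>Q\<close>, its colon by an
    element outside \<open>Q\<close> stays inside \<open>Q\<close>. This turns the given multiples
    of powers into pure powers.\<close>
  have unit: "s \<in> A" if t: "t \<in> carrier S - Q" and s: "s \<in> carrier S" "s \<otimes>\<^bsub>S\<^esub> t \<in> A" for s t
  proof (rule col'[OF _ _ s])
    show "t \<in> carrier S" using t by blast
    show "r \<in> Q" if "r \<in> carrier S" "r \<otimes>\<^bsub>S\<^esub> t \<in> A" for r
      using that f t P.I_prime by blast
  qed
  have "Q \<subseteq> A"
  proof
    fix q assume q: "q \<in> Q"
    have qS: "q \<in> carrier S" using q P.a_Hcarr by blast
    have "\<exists>m::nat. q [^]\<^bsub>S\<^esub> m \<in> A"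
    proof -
      obtain m :: nat and t where "t \<in> carrier S - Q" "t \<otimes>\<^bsub>S\<^esub> q [^]\<^bsub>S\<^esub> m \<in> A" using pow[OF f(1) q] f(3) by blast
      then show ?thesis using unit[of t "q [^]\<^bsub>S\<^esub> m"] qS P.m_comm by force
    qed
    then have L: "q [^]\<^bsub>S\<^esub> (LEAST m::nat. q [^]\<^bsub>S\<^esub> m \<in> A) \<in> A" by (rule LeastI_ex)
    have "\<one>\<^bsub>S\<^esub> \<notin> A" using f one_notin by blast
    then have "(LEAST m::nat. q [^]\<^bsub>S\<^esub> m \<in> A) \<noteq> 0" using L by (metis P.nat_pow_0)
    then obtain m where m: "(LEAST m::nat. q [^]\<^bsub>S\<^esub> m \<in> A) = Suc m" using not0_implies_Suc by blast
    \<comment> \<open>The exponent \<open>m\<close> gives the last power of \<open>q\<close> outside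
      \<open>A\<close>. The colon by it stays inside \<open>Q\<close>, for an element outside
      \<open>Q\<close> could be cancelled and would put that power into \<open>A\<close>; so the
      colon is \<open>A\<close>, and it contains \<open>q\<close>.\<close>
    have nm: "q [^]\<^bsub>S\<^esub> m \<notin> A" using not_less_Least[of m "\<lambda>m. q [^]\<^bsub>S\<^esub> m \<in> A"] m by simp
    show "q \<in> A"
    proof (rule col'[OF _ _ qS])
      show "q [^]\<^bsub>S\<^esub> m \<in> carrier S" using qS by simp
      show "q \<otimes>\<^bsub>S\<^esub> q [^]\<^bsub>S\<^esub> m \<in> A" using L m qS by (simp add: P.m_comm)
      show "r \<in> Q" if r: "r \<in> carrier S" "r \<otimes>\<^bsub>S\<^esub> q [^]\<^bsub>S\<^esub> m \<in> A" for r
      proof (rule ccontr)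
        assume "r \<notin> Q"
        then have "q [^]\<^bsub>S\<^esub> m \<in> A" using unit[of r "q [^]\<^bsub>S\<^esub> m"] r qS by (simp add: P.m_comm)
        then show False using nm by blast
      qed
    qed
  qed
  then show ?thesis using f by blast
qed

end

context inj_complex_over
begin

text \<open>The connecting homomorphism commutes with scalars and is onto, with the restricted
  classes as its kernel.\<close>

lemma kills_shift:
  assumes pr: "presents X p Y Z K" and a: "a \<in> carrier S"
  shows "kills a (Suc i) Y Z \<longleftrightarrow> (\<forall>k\<in>cocyc i K {\<zero>\<^bsub>U\<^esub>}. (\<lambda>x. a \<odot>\<^bsub>J (Suc i)\<^esub> k x) \<in> restricted i X K)"
proof
  assume k: "kills a (Suc i) Y Z"
  show "\<forall>k\<in>cocyc i K {\<zero>\<^bsub>U\<^esub>}. (\<lambda>x. a \<odot>\<^bsub>J (Suc i)\<^esub> k x) \<in> restricted i X K"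
  proof
    fix k assume "k \<in> cocyc i K {\<zero>\<^bsub>U\<^esub>}"
    then obtain c where c: "c \<in> cocyc (Suc i) Y Z" "connects i X p K c k" using ex_connects2[OF pr] by blast
    then show "(\<lambda>x. a \<odot>\<^bsub>J (Suc i)\<^esub> k x) \<in> restricted i X K"
      using connects_restricted[OF pr _ connects_scale[OF c(2) a]] k unfolding kills_def by blast
  qed
next
  assume k: "\<forall>k\<in>cocyc i K {\<zero>\<^bsub>U\<^esub>}. (\<lambda>x. a \<odot>\<^bsub>J (Suc i)\<^esub> k x) \<in> restricted i X K"
  show "kills a (Suc i) Y Z"
    unfolding kills_def
  proof
    fix c assume c: "c \<in> cocyc (Suc i) Y Z"
    obtain k' where k': "k' \<in> cocyc i K {\<zero>\<^bsub>U\<^esub>}" "connects i X p K c k'" using ex_connects1[OF pr c] by blast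
    show "(\<lambda>y. a \<odot>\<^bsub>J (Suc (Suc i))\<^esub> c y) \<in> cobd (Suc i) Y Z"
      using connects_cobd[OF pr cocyc_scale[OF c a] connects_scale[OF k'(2) a]] k k'(1) by blast
  qed
qed

text \<open>One degree higher, restricted cocycles and coboundaries on \<open>K\<close> are the
  same, so the criterion regains its own form and can be iterated.\<close>

lemma kills_shift_Suc:
  assumes pr: "presents X p Y Z K" and a: "a \<in> carrier S"
  shows "kills a (Suc (Suc i)) Y Z \<longleftrightarrow> kills a (Suc i) K {\<zero>\<^bsub>U\<^esub>}"
  unfolding kills_shift[OF pr a, of "Suc i"] kills_def[of a "Suc i" K] using restricted_cobd[OF pr] cobd_subset_restricted[OF pr] by blast

lemma kills_one: "submodule Y S U \<Longrightarrow> Z \<subseteq> Y \<Longrightarrow> kills \<one>\<^bsub>S\<^esub> i Y Z \<longleftrightarrow> cocyc i Y Z \<subseteq> cobd i Y Z"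
  unfolding kills_def
  using cobd_cong[of Y _ i Z] cocycD(4) by (auto dest!: bspec elim!: cobd_cong)

text \<open>The kernel of the map from \<open>S\<close> to its localization is finitely generated,
  hence killed by one element outside \<open>Q\<close>; here that element is found as one whose
  annihilator is maximal.\<close>

lemma torsion_bounded:
  obtains t where "t \<in> carrier S - Q" "\<And>s. s \<in> carrier S \<Longrightarrow> s \<odot>\<^bsub>J 1\<^esub> e = \<zero>\<^bsub>J 1\<^esub> \<Longrightarrow> t \<otimes>\<^bsub>S\<^esub> s = \<zero>\<^bsub>S\<^esub>"
proof -
  define A where "A t = {s \<in> carrier S. t \<otimes>\<^bsub>S\<^esub> s \<in> {\<zero>\<^bsub>S\<^esub>}}" for t
  note m = module_self[OF cring_S]
  have X: "submodule (carrier S) S (self_module S)" using module.carrier_is_submodule[OF m] by simp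
  have "ideal (A t) S" if "t \<in> carrier S" for t
    using submod_preimage[OF m m lin_smult_scalar[OF m X that] X submod_trivial[OF m]]
    unfolding A_def ideal_iff_submodule[OF cring_S] by simp
  then have "A ` (carrier S - Q) \<subseteq> {I. ideal I S}" by blast
  from acc_maximal[OF noetherian_ring.acc_ideals[OF noeth] this imageI[OF one_notin]]
  obtain N where N: "N \<in> A ` (carrier S - Q)" "\<And>N'. N' \<in> A ` (carrier S - Q) \<Longrightarrow> N \<subseteq> N' \<Longrightarrow> N' = N" by blast
  then obtain t where t: "t \<in> carrier S - Q" "N = A t" by blast
  have "t \<otimes>\<^bsub>S\<^esub> s = \<zero>\<^bsub>S\<^esub>" if s: "s \<in> carrier S" "s \<odot>\<^bsub>J 1\<^esub> e = \<zero>\<^bsub>J 1\<^esub>" for s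
  proof -
    obtain u where u: "u \<in> carrier S - Q" "u \<otimes>\<^bsub>S\<^esub> s = \<zero>\<^bsub>S\<^esub>" using torsion[OF s] by blast
    have ut: "(u \<otimes>\<^bsub>S\<^esub> t) \<otimes>\<^bsub>S\<^esub> r = u \<otimes>\<^bsub>S\<^esub> (t \<otimes>\<^bsub>S\<^esub> r)" "(u \<otimes>\<^bsub>S\<^esub> t) \<otimes>\<^bsub>S\<^esub> r = t \<otimes>\<^bsub>S\<^esub> (u \<otimes>\<^bsub>S\<^esub> r)" if "r \<in> carrier S" for r
      using that u t by (simp_all add: P.m_ac)
    have "N \<subseteq> A (u \<otimes>\<^bsub>S\<^esub> t)" unfolding t(2) A_def using ut(1) u by auto
    then have "A (u \<otimes>\<^bsub>S\<^esub> t) = N" using N(2) mult_notin[OF u(1) t(1)] by blast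
    moreover have "s \<in> A (u \<otimes>\<^bsub>S\<^esub> t)" unfolding A_def using s ut(2) u(2) t(1) by simp
    ultimately show ?thesis unfolding t(2) A_def by blast
  qed
  then show ?thesis using that[OF t(1)] by blast
qed

text \<open>Numerators chosen for a common denominator depend linearly on \<open>y\<close> only up
  to torsion. Multiplying them by \<open>u\<close>, which kills the torsion, makes the map linear,
  at the cost of the factor \<open>u\<close> in the denominator.\<close>

lemma lift_to_ring:
  assumes K: "noeth_sub S U K" and k: "k \<in> cocyc 0 K Z" and Z: "Z \<subseteq> K"
  obtains t \<phi> where "t \<in> carrier S - Q" "\<phi> \<in> lin S U K (self_module S)" "\<And>z. z \<in> Z \<Longrightarrow> \<phi> z = \<zero>\<^bsub>S\<^esub>"
    "\<And>y. y \<in> K \<Longrightarrow> \<phi> y \<odot>\<^bsub>J 1\<^esub> e = t \<odot>\<^bsub>J 1\<^esub> k y"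
proof -
  note Ks = noeth_sub_submod[OF K]
  note kl = cocycD(1)[OF k, folded One_nat_def]
  obtain t where t: "t \<in> carrier S - Q" "\<And>y. y \<in> K \<Longrightarrow> \<exists>s\<in>carrier S. t \<odot>\<^bsub>J 1\<^esub> k y = s \<odot>\<^bsub>J 1\<^esub> e"
    using common_denominator[OF K k] by metis
  then obtain s where s: "\<And>y. y \<in> K \<Longrightarrow> s y \<in> carrier S" "\<And>y. y \<in> K \<Longrightarrow> t \<odot>\<^bsub>J 1\<^esub> k y = s y \<odot>\<^bsub>J 1\<^esub> e" by metis
  obtain u where u: "u \<in> carrier S - Q" "\<And>s. s \<in> carrier S \<Longrightarrow> s \<odot>\<^bsub>J 1\<^esub> e = \<zero>\<^bsub>J 1\<^esub> \<Longrightarrow> u \<otimes>\<^bsub>S\<^esub> s = \<zero>\<^bsub>S\<^esub>"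
    using torsion_bounded by metis
  have uS: "u \<in> carrier S" and tS: "t \<in> carrier S" using u t by auto
  have eq: "u \<otimes>\<^bsub>S\<^esub> a = u \<otimes>\<^bsub>S\<^esub> b" if "a \<in> carrier S" "b \<in> carrier S" "a \<odot>\<^bsub>J 1\<^esub> e = b \<odot>\<^bsub>J 1\<^esub> e" for a b
  proof -
    have "u \<otimes>\<^bsub>S\<^esub> (a \<ominus>\<^bsub>S\<^esub> b) = \<zero>\<^bsub>S\<^esub>"
      by (rule u(2)) (use that e in \<open>auto simp: smult_minus_l[OF J]\<close>)
    then have "u \<otimes>\<^bsub>S\<^esub> a \<ominus>\<^bsub>S\<^esub> u \<otimes>\<^bsub>S\<^esub> b = \<zero>\<^bsub>S\<^esub>" using that uS by (simp add: a_minus_def P.r_distr P.r_minus)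
    then show ?thesis using that uS P.minus_eq_zero_iff by simp
  qed
  show ?thesis
  proof (rule that[OF mult_notin[OF u(1) t(1)], of "\<lambda>y. u \<otimes>\<^bsub>S\<^esub> s y"])
    show "(\<lambda>y. u \<otimes>\<^bsub>S\<^esub> s y) \<in> lin S U K (self_module S)"
    proof (rule linI)
      show "u \<otimes>\<^bsub>S\<^esub> s y \<in> carrier (self_module S)" if "y \<in> K" for y using s[OF that] uS by simp
      show "u \<otimes>\<^bsub>S\<^esub> s (y \<oplus>\<^bsub>U\<^esub> z) = u \<otimes>\<^bsub>S\<^esub> s y \<oplus>\<^bsub>self_module S\<^esub> u \<otimes>\<^bsub>S\<^esub> s z" if yz: "y \<in> K" "z \<in> K" for y z
      proof -
        have "s (y \<oplus>\<^bsub>U\<^esub> z) \<odot>\<^bsub>J 1\<^esub> e = (s y \<oplus>\<^bsub>S\<^esub> s z) \<odot>\<^bsub>J 1\<^esub> e"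
          using s(2)[OF yz(1)] s(2)[OF yz(2)] s(2)[OF submod_add[OF U Ks yz]] s(1)[OF yz(1)] s(1)[OF yz(2)] e tS
            lin_closed[OF kl yz(1)] lin_closed[OF kl yz(2)]
          by (simp add: lin_add[OF kl yz] J.smult_l_distr J.smult_r_distr)
        then show ?thesis using eq s(1) yz submod_add[OF U Ks] uS by (simp add: P.r_distr[symmetric])
      qed
      show "u \<otimes>\<^bsub>S\<^esub> s (a \<odot>\<^bsub>U\<^esub> y) = a \<odot>\<^bsub>self_module S\<^esub> (u \<otimes>\<^bsub>S\<^esub> s y)" if ay: "a \<in> carrier S" "y \<in> K" for a y
      proof -
        have "s (a \<odot>\<^bsub>U\<^esub> y) \<odot>\<^bsub>J 1\<^esub> e = t \<odot>\<^bsub>J 1\<^esub> (a \<odot>\<^bsub>J 1\<^esub> k y)"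
          using s(2)[OF submod_smult[OF U Ks ay]] by (simp add: lin_smult[OF kl ay])
        also have "\<dots> = a \<odot>\<^bsub>J 1\<^esub> (t \<odot>\<^bsub>J 1\<^esub> k y)"
          using ay tS lin_closed[OF kl ay(2)] by (simp add: J.smult_assoc1[symmetric] P.m_comm)
        also have "\<dots> = (a \<otimes>\<^bsub>S\<^esub> s y) \<odot>\<^bsub>J 1\<^esub> e" using s[OF ay(2)] ay e by (simp add: J.smult_assoc1)
        finally have "u \<otimes>\<^bsub>S\<^esub> s (a \<odot>\<^bsub>U\<^esub> y) = u \<otimes>\<^bsub>S\<^esub> (a \<otimes>\<^bsub>S\<^esub> s y)"
          using eq s(1) ay submod_smult[OF U Ks] by simp
        then show ?thesis using ay s(1) uS by (simp add: P.m_lcomm)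
      qed
    qed
    show "u \<otimes>\<^bsub>S\<^esub> s z = \<zero>\<^bsub>S\<^esub>" if "z \<in> Z" for z
    proof (rule u(2))
      have "z \<in> K" using that Z by blast
      then show "s z \<in> carrier S" "s z \<odot>\<^bsub>J 1\<^esub> e = \<zero>\<^bsub>J 1\<^esub>"
        using s[of z] cocycD(2)[OF k that] tS by (auto simp del: s(2) intro: s(1))
    qed
    show "(u \<otimes>\<^bsub>S\<^esub> s y) \<odot>\<^bsub>J 1\<^esub> e = (u \<otimes>\<^bsub>S\<^esub> t) \<odot>\<^bsub>J 1\<^esub> k y" if "y \<in> K" for y
      using s[OF that] e uS tS lin_closed[OF kl that] by (simp add: J.smult_assoc1)
  qed
qed

lemma ideal_trivial:
  assumes "\<phi> \<in> lin S U Y (self_module S)"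
  shows "ideal {s \<in> carrier S. \<forall>y\<in>Y. s \<otimes>\<^bsub>S\<^esub> \<phi> y = \<zero>\<^bsub>S\<^esub>} S"
  unfolding ideal_iff_submodule[OF cring_S]
  using lin_closed[OF assms]
  by (intro submodI[OF module_self[OF cring_S]]) (auto simp: P.l_distr P.m_assoc)

text \<open>The annihilator of the class of \<open>\<phi>\<close> in the cokernel of restriction
  from \<open>X\<close> to \<open>K\<close>. For a term of a free resolution and its cycles, this
  cokernel is \<open>Ext\<close> in positive degree.\<close>

lemma ideal_extendable:
  assumes f: "\<phi> \<in> lin S U K (self_module S)"
  shows "ideal {s \<in> carrier S. \<exists>\<gamma>\<in>lin S U X (self_module S). \<forall>x\<in>K. s \<otimes>\<^bsub>S\<^esub> \<phi> x = \<gamma> x} S"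
  unfolding ideal_iff_submodule[OF cring_S]
proof (rule submodI[OF module_self[OF cring_S]])
  note m = module_self[OF cring_S]
  have fc: "\<phi> x \<in> carrier S" if "x \<in> K" for x using lin_closed[OF f that] by simp
  let ?I = "{s \<in> carrier S. \<exists>\<gamma>\<in>lin S U X (self_module S). \<forall>x\<in>K. s \<otimes>\<^bsub>S\<^esub> \<phi> x = \<gamma> x}"
  show "?I \<subseteq> carrier (self_module S)" by auto
  show "\<zero>\<^bsub>self_module S\<^esub> \<in> ?I" using fc by (auto intro!: bexI[OF _ lin_const_zero[OF U m]])
  fix a b assume b: "b \<in> ?I"
  then obtain g where g: "g \<in> lin S U X (self_module S)" "\<And>x. x \<in> K \<Longrightarrow> b \<otimes>\<^bsub>S\<^esub> \<phi> x = g x" "b \<in> carrier S" by blast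
  { assume a: "a \<in> ?I"
    then obtain h where h: "h \<in> lin S U X (self_module S)" "\<And>x. x \<in> K \<Longrightarrow> a \<otimes>\<^bsub>S\<^esub> \<phi> x = h x" "a \<in> carrier S" by blast
    have "\<forall>x\<in>K. (a \<oplus>\<^bsub>S\<^esub> b) \<otimes>\<^bsub>S\<^esub> \<phi> x = h x \<oplus>\<^bsub>self_module S\<^esub> g x"
      using g h fc by (simp add: P.l_distr)
    then show "a \<oplus>\<^bsub>self_module S\<^esub> b \<in> ?I" using lin_plus[OF U m h(1) g(1)] g(3) h(3) by auto }
  { assume a: "a \<in> carrier S"
    have "\<forall>x\<in>K. (a \<otimes>\<^bsub>S\<^esub> b) \<otimes>\<^bsub>S\<^esub> \<phi> x = a \<odot>\<^bsub>self_module S\<^esub> g x"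
      using g a fc by (simp add: P.m_assoc)
    then show "a \<odot>\<^bsub>self_module S\<^esub> b \<in> ?I" using lin_scale[OF U m g(1) a] g(3) a by auto }
qed

text \<open>Composition with the map from \<open>S\<close> to its localization, seen inside
  \<open>J 1\<close>.\<close>

lemma times_e_cocyc:
  assumes f: "\<phi> \<in> lin S U K (self_module S)" and z: "\<And>z. z \<in> Z \<Longrightarrow> \<phi> z = \<zero>\<^bsub>S\<^esub>"
  shows "(\<lambda>x. \<phi> x \<odot>\<^bsub>J 1\<^esub> e) \<in> cocyc 0 K Z"
proof (rule cocycI)
  have "(\<lambda>x. \<phi> x \<odot>\<^bsub>J 1\<^esub> e) \<in> lin S U K (J 1)"
    by (rule lin_comp[OF f _ lin_smult_vec[OF J e(1)]]) (use lin_closed[OF f] in auto)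
  then show "(\<lambda>x. \<phi> x \<odot>\<^bsub>J 1\<^esub> e) \<in> lin S U K (J (Suc 0))" by simp
  show "\<phi> x \<odot>\<^bsub>J 1\<^esub> e = \<zero>\<^bsub>J (Suc 0)\<^esub>" if "x \<in> Z" for x using z[OF that] e by simp
  show "D (Suc 0) (\<phi> x \<odot>\<^bsub>J 1\<^esub> e) = \<zero>\<^bsub>J (Suc (Suc 0))\<^esub>" if "x \<in> K" for x
    using D_smult[of "\<phi> x" e 1] lin_closed[OF f that] e by (simp add: numeral_2_eq_2)
qed

text \<open>Degree \<open>0\<close> and positive degree are two instances of the same argument: a cocycle with values
  in the localization is a fraction of a homomorphism into \<open>S\<close>, and the ideals of multipliers that make
  such a homomorphism trivial include one that equals \<open>Q\<close>.\<close>

lemma annihilator_degree_0: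
  assumes Y: "noeth_sub S U Y" "Z \<subseteq> Y"
    and nz: "\<not> cocyc 0 Y Z \<subseteq> cobd 0 Y Z"
    and pow: "\<And>q. q \<in> Q \<Longrightarrow> \<exists>m::nat. kills (q [^]\<^bsub>S\<^esub> m) 0 Y Z"
  shows "\<exists>\<phi>\<in>lin S U Y (self_module S). (\<forall>z\<in>Z. \<phi> z = \<zero>\<^bsub>S\<^esub>) \<and> {s \<in> carrier S. \<forall>y\<in>Y. s \<otimes>\<^bsub>S\<^esub> \<phi> y = \<zero>\<^bsub>S\<^esub>} = Q"
proof -
  note m = module_self[OF cring_S]
  note Ys = noeth_sub_submod[OF Y(1)]
  have cobd0: "c y = \<zero>\<^bsub>J 1\<^esub>" if cy: "c \<in> cobd 0 Y Z" "y \<in> Y" for c y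
  proof -
    obtain h where h: "h \<in> lin S U Y (J 0)" "\<And>y. y \<in> Y \<Longrightarrow> c y = D 0 (h y)" using cy(1) unfolding cobd_def by blast
    have "h y = \<zero>\<^bsub>J 0\<^esub>" using lin_closed[OF h(1) cy(2)] J_0 by simp
    then show ?thesis using h(2)[OF cy(2)] by simp
  qed
  let ?F = "{\<phi> \<in> lin S U Y (self_module S). \<forall>z\<in>Z. \<phi> z = \<zero>\<^bsub>S\<^esub>}"
  let ?I = "\<lambda>\<phi>. {s \<in> carrier S. \<forall>y\<in>Y. s \<otimes>\<^bsub>S\<^esub> \<phi> y = \<zero>\<^bsub>S\<^esub>}"
  obtain c where c: "c \<in> cocyc 0 Y Z" "c \<notin> cobd 0 Y Z" using nz by blast
  obtain t f where f: "t \<in> carrier S - Q" "f \<in> lin S U Y (self_module S)" "\<And>z. z \<in> Z \<Longrightarrow> f z = \<zero>\<^bsub>S\<^esub>"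
    "\<And>y. y \<in> Y \<Longrightarrow> f y \<odot>\<^bsub>J 1\<^esub> e = t \<odot>\<^bsub>J 1\<^esub> c y" using lift_to_ring[OF Y(1) c(1) Y(2)] by metis
  have cc: "c y \<in> carrier (J 1)" if "y \<in> Y" for y using cocycD(4)[OF c(1) that] by simp
  obtain u where u: "u \<in> carrier S - Q" "\<And>s. s \<in> carrier S \<Longrightarrow> s \<odot>\<^bsub>J 1\<^esub> e = \<zero>\<^bsub>J 1\<^esub> \<Longrightarrow> u \<otimes>\<^bsub>S\<^esub> s = \<zero>\<^bsub>S\<^esub>"
    using torsion_bounded by metis
  have "\<exists>\<phi>\<in>?F. ?I \<phi> = Q"
  proof (rule ex_ideal_eq_prime[of ?F ?I f])
    show "ideal (?I \<phi>) S" if "\<phi> \<in> ?F" for \<phi> using ideal_trivial that by blast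
    show "\<exists>\<phi>'\<in>?F. ?I \<phi>' = {s \<in> carrier S. s \<otimes>\<^bsub>S\<^esub> a \<in> ?I \<phi>}" if p: "\<phi> \<in> ?F" and a: "a \<in> carrier S" for \<phi> a
    proof (rule bexI[of _ "\<lambda>y. a \<otimes>\<^bsub>S\<^esub> \<phi> y"])
      have "\<phi> y \<in> carrier S" if "y \<in> Y" for y using lin_closed[of \<phi> S U Y "self_module S" y] p that by simp
      then show "?I (\<lambda>y. a \<otimes>\<^bsub>S\<^esub> \<phi> y) = {s \<in> carrier S. s \<otimes>\<^bsub>S\<^esub> a \<in> ?I \<phi>}" using a by (auto simp: P.m_assoc)
      show "(\<lambda>y. a \<otimes>\<^bsub>S\<^esub> \<phi> y) \<in> ?F" using lin_scale[OF U m, of \<phi> Y a] p a by simp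
    qed
    show "f \<in> ?F" using f by blast
    \<comment> \<open>A multiplier outside \<open>Q\<close> that kills \<open>f\<close> would,
      together with the denominator \<open>t\<close>, kill \<open>c\<close>.\<close>
    show "?I f \<subseteq> Q"
    proof (rule subsetI, rule ccontr)
      fix s assume s: "s \<in> ?I f" "s \<notin> Q"
      have st: "s \<in> carrier S - Q" using s by blast
      have "c y = \<zero>\<^bsub>J 1\<^esub>" if y: "y \<in> Y" for y
      proof (rule unit_inj[OF mult_notin[OF st f(1)] cc[OF y]])
        have "(s \<otimes>\<^bsub>S\<^esub> t) \<odot>\<^bsub>J 1\<^esub> c y = s \<odot>\<^bsub>J 1\<^esub> (f y \<odot>\<^bsub>J 1\<^esub> e)" using f(1,4) st cc[OF y] y by (simp add: J.smult_assoc1)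
        also have "\<dots> = (s \<otimes>\<^bsub>S\<^esub> f y) \<odot>\<^bsub>J 1\<^esub> e" using lin_closed[OF f(2) y] e st by (simp add: J.smult_assoc1)
        also have "\<dots> = \<zero>\<^bsub>J 1\<^esub>" using s(1) y e by simp
        finally show "(s \<otimes>\<^bsub>S\<^esub> t) \<odot>\<^bsub>J 1\<^esub> c y = \<zero>\<^bsub>J 1\<^esub>" .
      qed
      then have "c \<in> cobd 0 Y Z" by (intro cobd_zero[OF Ys]) simp
      then show False using c(2) by blast
    qed
    fix \<phi> q assume p: "\<phi> \<in> ?F" and q: "q \<in> Q"
    then have p': "\<phi> \<in> lin S U Y (self_module S)" by blast
    obtain m :: nat where m: "kills (q [^]\<^bsub>S\<^esub> m) 0 Y Z" using pow[OF q] by blast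
    have qm: "q [^]\<^bsub>S\<^esub> m \<in> carrier S" using q P.a_Hcarr by simp
    have "(\<lambda>x. \<phi> x \<odot>\<^bsub>J 1\<^esub> e) \<in> cocyc 0 Y Z" using times_e_cocyc[of \<phi> Y Z] p by blast
    with m have z: "(\<lambda>x. q [^]\<^bsub>S\<^esub> m \<odot>\<^bsub>J (Suc 0)\<^esub> (\<phi> x \<odot>\<^bsub>J 1\<^esub> e)) \<in> cobd 0 Y Z" unfolding kills_def by (rule bspec)
    \<comment> \<open>The power of \<open>q\<close> makes the map zero only after passage to the
      localization; \<open>u\<close> removes the torsion that is left in \<open>S\<close>.\<close>
    have "u \<otimes>\<^bsub>S\<^esub> q [^]\<^bsub>S\<^esub> m \<in> ?I \<phi>"
    proof (intro CollectI conjI ballI)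
      show "u \<otimes>\<^bsub>S\<^esub> q [^]\<^bsub>S\<^esub> m \<in> carrier S" using u qm by blast
      fix y assume y: "y \<in> Y"
      have py: "\<phi> y \<in> carrier S" using lin_closed[OF p' y] by simp
      have "(q [^]\<^bsub>S\<^esub> m \<otimes>\<^bsub>S\<^esub> \<phi> y) \<odot>\<^bsub>J 1\<^esub> e = \<zero>\<^bsub>J 1\<^esub>" using cobd0[OF z y] py qm e by (simp add: J.smult_assoc1)
      then show "u \<otimes>\<^bsub>S\<^esub> q [^]\<^bsub>S\<^esub> m \<otimes>\<^bsub>S\<^esub> \<phi> y = \<zero>\<^bsub>S\<^esub>" using u(2)[of "q [^]\<^bsub>S\<^esub> m \<otimes>\<^bsub>S\<^esub> \<phi> y"] py qm u(1) by (simp add: P.m_assoc)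
    qed
    then show "\<exists>m::nat. \<exists>t\<in>carrier S - Q. t \<otimes>\<^bsub>S\<^esub> q [^]\<^bsub>S\<^esub> m \<in> ?I \<phi>" using u(1) by blast
  qed
  then show ?thesis by blast
qed

lemma annihilator_degree_Suc:
  assumes X: "noeth_sub S U X" and K: "submodule K S U" "K \<subseteq> X"
    and nz: "\<not> (\<forall>k\<in>cocyc 0 K {\<zero>\<^bsub>U\<^esub>}. (\<lambda>x. \<one>\<^bsub>S\<^esub> \<odot>\<^bsub>J (Suc 0)\<^esub> k x) \<in> restricted 0 X K)"
    and pow: "\<And>q. q \<in> Q \<Longrightarrow> \<exists>m::nat. \<forall>k\<in>cocyc 0 K {\<zero>\<^bsub>U\<^esub>}. (\<lambda>x. q [^]\<^bsub>S\<^esub> m \<odot>\<^bsub>J (Suc 0)\<^esub> k x) \<in> restricted 0 X K"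
  shows "\<exists>\<phi>\<in>lin S U K (self_module S).
    {s \<in> carrier S. \<exists>\<gamma>\<in>lin S U X (self_module S). \<forall>x\<in>K. s \<otimes>\<^bsub>S\<^esub> \<phi> x = \<gamma> x} = Q"
proof -
  note m = module_self[OF cring_S]
  note Xs = noeth_sub_submod[OF X]
  have nK: "noeth_sub S U K" by (rule noeth_sub_subset[OF X K])
  have K0: "{\<zero>\<^bsub>U\<^esub>} \<subseteq> K" "{\<zero>\<^bsub>U\<^esub>} \<subseteq> X" using submod_zero[OF U K(1)] K(2) by auto
  let ?F = "lin S U K (self_module S)"
  let ?I = "\<lambda>\<phi>. {s \<in> carrier S. \<exists>\<gamma>\<in>lin S U X (self_module S). \<forall>x\<in>K. s \<otimes>\<^bsub>S\<^esub> \<phi> x = \<gamma> x}"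
  obtain c where c: "c \<in> cocyc 0 K {\<zero>\<^bsub>U\<^esub>}" "(\<lambda>x. \<one>\<^bsub>S\<^esub> \<odot>\<^bsub>J (Suc 0)\<^esub> c x) \<notin> restricted 0 X K" using nz by blast
  obtain t f where f: "t \<in> carrier S - Q" "f \<in> ?F"
    "\<And>y. y \<in> K \<Longrightarrow> f y \<odot>\<^bsub>J 1\<^esub> e = t \<odot>\<^bsub>J 1\<^esub> c y" using lift_to_ring[OF nK c(1) K0(1)] by metis
  have cc: "c y \<in> carrier (J 1)" if "y \<in> K" for y using cocycD(4)[OF c(1) that] by simp
  obtain u where u: "u \<in> carrier S - Q" "\<And>s. s \<in> carrier S \<Longrightarrow> s \<odot>\<^bsub>J 1\<^esub> e = \<zero>\<^bsub>J 1\<^esub> \<Longrightarrow> u \<otimes>\<^bsub>S\<^esub> s = \<zero>\<^bsub>S\<^esub>"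
    using torsion_bounded by metis
  show ?thesis
  proof (rule ex_ideal_eq_prime[of ?F ?I f])
    show "ideal (?I \<phi>) S" if "\<phi> \<in> ?F" for \<phi> by (rule ideal_extendable[OF that])
    show "\<exists>\<phi>'\<in>?F. ?I \<phi>' = {s \<in> carrier S. s \<otimes>\<^bsub>S\<^esub> a \<in> ?I \<phi>}" if p: "\<phi> \<in> ?F" and a: "a \<in> carrier S" for \<phi> a
    proof (rule bexI[of _ "\<lambda>y. a \<otimes>\<^bsub>S\<^esub> \<phi> y"])
      have "\<phi> y \<in> carrier S" if "y \<in> K" for y using lin_closed[of \<phi> S U K "self_module S" y] p that by simp
      then show "?I (\<lambda>y. a \<otimes>\<^bsub>S\<^esub> \<phi> y) = {s \<in> carrier S. s \<otimes>\<^bsub>S\<^esub> a \<in> ?I \<phi>}" using a by (auto simp: P.m_assoc)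
      show "(\<lambda>y. a \<otimes>\<^bsub>S\<^esub> \<phi> y) \<in> ?F" using lin_scale[OF U m p a] by simp
    qed
    show "f \<in> ?F" by (rule f(2))
    \<comment> \<open>If a multiple of \<open>f\<close> by some \<open>s\<close> outside
      \<open>Q\<close> extended to \<open>g\<close> on \<open>X\<close>, then dividing the multiples
      of \<open>e\<close> by \<open>g\<close> by the product of \<open>s\<close> and
      \<open>t\<close> would give a cocycle on \<open>X\<close> that restricts to
      \<open>c\<close>.\<close>
    show "?I f \<subseteq> Q"
    proof (rule subsetI, rule ccontr)
      fix s assume s: "s \<in> ?I f" "s \<notin> Q"
      then obtain g where g: "g \<in> lin S U X (self_module S)" "\<And>x. x \<in> K \<Longrightarrow> s \<otimes>\<^bsub>S\<^esub> f x = g x" by blast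
      have st: "s \<otimes>\<^bsub>S\<^esub> t \<in> carrier S - Q" using s mult_notin[OF _ f(1)] by blast
      have v: "(\<lambda>x. g x \<odot>\<^bsub>J 1\<^esub> e) \<in> cocyc 0 X {\<zero>\<^bsub>U\<^esub>}"
        by (rule times_e_cocyc[OF g(1)]) (use lin_zero[OF U m g(1) Xs] in simp)
      obtain w where w: "w \<in> lin S U X (J 1)" "\<And>x. x \<in> X \<Longrightarrow> (s \<otimes>\<^bsub>S\<^esub> t) \<odot>\<^bsub>J 1\<^esub> w x = g x \<odot>\<^bsub>J 1\<^esub> e"
        using J_divide[OF U Xs cocycD(1)[OF v, folded One_nat_def] st] by metis
      have wc: "w \<in> cocyc 0 X {\<zero>\<^bsub>U\<^esub>}"
      proof (rule cocycI)
        show "w \<in> lin S U X (J (Suc 0))" using w by simp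
        show "w z = \<zero>\<^bsub>J (Suc 0)\<^esub>" if "z \<in> {\<zero>\<^bsub>U\<^esub>}" for z using lin_zero[OF U J w(1) Xs] that by simp
        show "D (Suc 0) (w x) = \<zero>\<^bsub>J (Suc (Suc 0))\<^esub>" if x: "x \<in> X" for x
        proof (rule unit_inj[OF st])
          have wx: "w x \<in> carrier (J (Suc 0))" using lin_closed[OF w(1) x] by simp
          then show "D (Suc 0) (w x) \<in> carrier (J (Suc (Suc 0)))" by blast
          show "(s \<otimes>\<^bsub>S\<^esub> t) \<odot>\<^bsub>J (Suc (Suc 0))\<^esub> D (Suc 0) (w x) = \<zero>\<^bsub>J (Suc (Suc 0))\<^esub>"
            using D_smult[OF _ wx, of "s \<otimes>\<^bsub>S\<^esub> t"] st w(2)[OF x] cocycD(3)[OF v x] by simp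
        qed
      qed
      have "c x = w x" if x: "x \<in> K" for x
      proof (rule unit_cancel[OF st cc[OF x]])
        show "w x \<in> carrier (J 1)" using lin_closed[OF w(1)] x K(2) by blast
        have sS: "s \<in> carrier S" "t \<in> carrier S" using s f(1) by auto
        have "(s \<otimes>\<^bsub>S\<^esub> t) \<odot>\<^bsub>J 1\<^esub> c x = s \<odot>\<^bsub>J 1\<^esub> (f x \<odot>\<^bsub>J 1\<^esub> e)" using f(3) sS cc[OF x] x by (simp add: J.smult_assoc1)
        also have "\<dots> = (s \<otimes>\<^bsub>S\<^esub> f x) \<odot>\<^bsub>J 1\<^esub> e" using lin_closed[OF f(2) x] e sS by (simp add: J.smult_assoc1)
        also have "\<dots> = (s \<otimes>\<^bsub>S\<^esub> t) \<odot>\<^bsub>J 1\<^esub> w x" using g(2)[OF x] w(2)[of x] x K(2) by auto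
        finally show "(s \<otimes>\<^bsub>S\<^esub> t) \<odot>\<^bsub>J 1\<^esub> c x = (s \<otimes>\<^bsub>S\<^esub> t) \<odot>\<^bsub>J 1\<^esub> w x" .
      qed
      then have "\<forall>x\<in>K. \<one>\<^bsub>S\<^esub> \<odot>\<^bsub>J (Suc 0)\<^esub> c x = w x" using cc by simp
      then show False using c(2) wc unfolding restricted_def by blast
    qed
    fix \<phi> q assume p: "\<phi> \<in> ?F" and q: "q \<in> Q"
    obtain m' :: nat where m': "\<forall>k\<in>cocyc 0 K {\<zero>\<^bsub>U\<^esub>}. (\<lambda>x. q [^]\<^bsub>S\<^esub> m' \<odot>\<^bsub>J (Suc 0)\<^esub> k x) \<in> restricted 0 X K" using pow[OF q] by blast
    let ?q = "q [^]\<^bsub>S\<^esub> m'"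
    have qm: "?q \<in> carrier S" using q P.a_Hcarr by simp
    have pc: "(\<lambda>x. \<phi> x \<odot>\<^bsub>J 1\<^esub> e) \<in> cocyc 0 K {\<zero>\<^bsub>U\<^esub>}"
      by (rule times_e_cocyc[OF p]) (use lin_zero[OF U m p K(1)] in simp)
    obtain v where v: "v \<in> cocyc 0 X {\<zero>\<^bsub>U\<^esub>}" "\<And>x. x \<in> K \<Longrightarrow> ?q \<odot>\<^bsub>J (Suc 0)\<^esub> (\<phi> x \<odot>\<^bsub>J 1\<^esub> e) = v x"
      using m'[rule_format, OF pc] unfolding restricted_def by blast
    \<comment> \<open>Turning \<open>v\<close> into a map to \<open>S\<close> costs a denominator
      \<open>r\<close>, and passing from equality in the localization to equality in
      \<open>S\<close> costs the factor \<open>u\<close>; this explains the multiplier of the power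
      of \<open>q\<close>.\<close>
    obtain r g where g: "r \<in> carrier S - Q" "g \<in> lin S U X (self_module S)"
      "\<And>y. y \<in> X \<Longrightarrow> g y \<odot>\<^bsub>J 1\<^esub> e = r \<odot>\<^bsub>J 1\<^esub> v y" using lift_to_ring[OF X v(1) K0(2)] by metis
    have uS: "u \<in> carrier S" and rS: "r \<in> carrier S" using u g by auto
    have "((u \<otimes>\<^bsub>S\<^esub> r) \<otimes>\<^bsub>S\<^esub> ?q) \<otimes>\<^bsub>S\<^esub> \<phi> x = u \<odot>\<^bsub>self_module S\<^esub> g x" if x: "x \<in> K" for x
    proof -
      have xX: "x \<in> X" using x K(2) by blast
      have cl: "\<phi> x \<in> carrier S" "g x \<in> carrier S" using lin_closed[OF p x] lin_closed[OF g(2) xX] by simp_all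
      have "(r \<otimes>\<^bsub>S\<^esub> (?q \<otimes>\<^bsub>S\<^esub> \<phi> x)) \<odot>\<^bsub>J 1\<^esub> e = r \<odot>\<^bsub>J 1\<^esub> (?q \<odot>\<^bsub>J 1\<^esub> (\<phi> x \<odot>\<^bsub>J 1\<^esub> e))"
        using cl rS qm e by (simp add: J.smult_assoc1)
      also have "\<dots> = g x \<odot>\<^bsub>J 1\<^esub> e" using v(2)[OF x] g(3)[OF xX] by simp
      finally have eq: "(r \<otimes>\<^bsub>S\<^esub> (?q \<otimes>\<^bsub>S\<^esub> \<phi> x)) \<odot>\<^bsub>J 1\<^esub> e = g x \<odot>\<^bsub>J 1\<^esub> e" .
      have "u \<otimes>\<^bsub>S\<^esub> ((r \<otimes>\<^bsub>S\<^esub> (?q \<otimes>\<^bsub>S\<^esub> \<phi> x)) \<ominus>\<^bsub>S\<^esub> g x) = \<zero>\<^bsub>S\<^esub>"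
        by (rule u(2)) (use cl rS qm e eq in \<open>simp_all add: smult_minus_l[OF J]\<close>)
      then have "u \<otimes>\<^bsub>S\<^esub> (r \<otimes>\<^bsub>S\<^esub> (?q \<otimes>\<^bsub>S\<^esub> \<phi> x)) \<ominus>\<^bsub>S\<^esub> u \<otimes>\<^bsub>S\<^esub> g x = \<zero>\<^bsub>S\<^esub>"
        using cl rS qm uS by (simp add: a_minus_def P.r_distr P.r_minus)
      then have "u \<otimes>\<^bsub>S\<^esub> (r \<otimes>\<^bsub>S\<^esub> (?q \<otimes>\<^bsub>S\<^esub> \<phi> x)) = u \<otimes>\<^bsub>S\<^esub> g x"
        using cl rS qm uS P.minus_eq_zero_iff by simp
      then show ?thesis using cl rS qm uS by (simp add: P.m_assoc)
    qed
    then have "(u \<otimes>\<^bsub>S\<^esub> r) \<otimes>\<^bsub>S\<^esub> ?q \<in> ?I \<phi>"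
      using lin_scale[OF U m g(2) uS] uS rS qm by (intro CollectI conjI bexI[of _ "\<lambda>x. u \<odot>\<^bsub>self_module S\<^esub> g x"]) auto
    then show "\<exists>m::nat. \<exists>t\<in>carrier S - Q. t \<otimes>\<^bsub>S\<^esub> q [^]\<^bsub>S\<^esub> m \<in> ?I \<phi>" using mult_notin[OF u(1) g(1)] by blast
  qed
qed

end

context inj_complex_enough
begin

text \<open>The presentations are spliced into a resolution of Y 0 modulo Z 0. If the top degree is
  \<open>0\<close>, the first alternative holds. If it is \<open>Suc j\<close>, shifts lower it to
  degree \<open>1\<close>, and the last shift meets \<open>X j\<close> in degree \<open>0\<close>,
  where it may have cohomology, so it ends in a cokernel and gives the second alternative.\<close>

theorem annihilator_in_resolution:
  fixes X Y Z K :: "nat \<Rightarrow> 'u set" and p :: "nat \<Rightarrow> 'u \<Rightarrow> 'u"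
  assumes pr: "\<And>j. presents (X j) (p j) (Y j) (Z j) (K j)"
    and step: "\<And>j. Y (Suc j) = K j" "\<And>j. Z (Suc j) = {\<zero>\<^bsub>U\<^esub>}"
    and Y0: "noeth_sub S U (Y 0)" and y: "y \<in> Y 0" "colon S U (Z 0) y = Q"
  shows "(\<exists>\<phi>\<in>lin S U (Y 0) (self_module S). (\<forall>z\<in>Z 0. \<phi> z = \<zero>\<^bsub>S\<^esub>) \<and>
       {s \<in> carrier S. \<forall>y\<in>Y 0. s \<otimes>\<^bsub>S\<^esub> \<phi> y = \<zero>\<^bsub>S\<^esub>} = Q) \<or>
    (\<exists>j. \<exists>\<phi>\<in>lin S U (K j) (self_module S).
       {s \<in> carrier S. \<exists>\<gamma>\<in>lin S U (X j) (self_module S). \<forall>x\<in>K j. s \<otimes>\<^bsub>S\<^esub> \<phi> x = \<gamma> x} = Q)"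
proof -
  obtain d where d: "\<And>Y Z y. noeth_sub S U Y \<Longrightarrow> submodule Z S U \<Longrightarrow> Z \<subseteq> Y \<Longrightarrow> y \<in> Y \<Longrightarrow> colon S U Z y = Q \<Longrightarrow>
      \<not> cocyc d Y Z \<subseteq> cobd d Y Z"
    "\<And>Y Z q. noeth_sub S U Y \<Longrightarrow> submodule Z S U \<Longrightarrow> Z \<subseteq> Y \<Longrightarrow> q \<in> Q \<Longrightarrow> \<exists>m::nat. kills (q [^]\<^bsub>S\<^esub> m) d Y Z"
    using top_degree by metis
  note Z0 = pr_Z[OF pr[of 0]]
  note Ys = pr_Y[OF pr]
  have nz: "\<not> kills \<one>\<^bsub>S\<^esub> d (Y 0) (Z 0)" using d(1)[OF Y0 Z0 y] kills_one[OF Ys Z0(2)] by blast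
  show ?thesis
  proof (cases d)
    case 0
    then show ?thesis using annihilator_degree_0[OF Y0 Z0(2)] d(1)[OF Y0 Z0 y] d(2)[OF Y0 Z0] by blast
  next
    case (Suc j)
    \<comment> \<open>The module presented at index \<open>Suc k\<close> is the kernel
      \<open>K k\<close> of the presentation before, so each step trades one degree for one
      index.\<close>
    have shift: "kills a (Suc (i + k)) (Y 0) (Z 0) \<longleftrightarrow> kills a (Suc i) (Y k) (Z k)" if "a \<in> carrier S" for a i k
    proof (induction k arbitrary: i)
      case (Suc k)
      then show ?case using Suc[of "Suc i"] kills_shift_Suc[OF pr[of k] that, of i] step by simp
    qed simp
    have kj: "kills a d (Y 0) (Z 0) \<longleftrightarrow> (\<forall>k\<in>cocyc 0 (K j) {\<zero>\<^bsub>U\<^esub>}. (\<lambda>x. a \<odot>\<^bsub>J (Suc 0)\<^esub> k x) \<in> restricted 0 (X j) (K j))" if "a \<in> carrier S" for a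
      using shift[OF that, of 0 j] kills_shift[OF pr[of j] that, of 0] Suc by simp
    have "\<exists>\<phi>\<in>lin S U (K j) (self_module S).
       {s \<in> carrier S. \<exists>\<gamma>\<in>lin S U (X j) (self_module S). \<forall>x\<in>K j. s \<otimes>\<^bsub>S\<^esub> \<phi> x = \<gamma> x} = Q"
    proof (rule annihilator_degree_Suc[OF pr_X(1)[OF pr] pr_K(1,2)[OF pr]])
      show "\<not> (\<forall>k\<in>cocyc 0 (K j) {\<zero>\<^bsub>U\<^esub>}. (\<lambda>x. \<one>\<^bsub>S\<^esub> \<odot>\<^bsub>J (Suc 0)\<^esub> k x) \<in> restricted 0 (X j) (K j))"
        using nz kj[OF P.one_closed] by blast
      fix q assume q: "q \<in> Q"
      then have "q [^]\<^bsub>S\<^esub> m \<in> carrier S" for m :: nat using P.a_Hcarr by simp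
      then show "\<exists>m::nat. \<forall>k\<in>cocyc 0 (K j) {\<zero>\<^bsub>U\<^esub>}. (\<lambda>x. q [^]\<^bsub>S\<^esub> m \<odot>\<^bsub>J (Suc 0)\<^esub> k x) \<in> restricted 0 (X j) (K j)"
        using d(2)[OF Y0 Z0 q] kj by blast
    qed
    then show ?thesis by blast
  qed
qed

end

section \<open>Free modules as an ambient module\<close>

context inj_complex
begin

lemma over_free: "inj_complex_over S Q J D e n (free_module S B)"
  by (intro inj_complex_over.intro inj_complex_over_axioms.intro inj_complex_axioms module_free[OF cring_S])

text \<open>Primitives are chosen on the basis and extended linearly. Positive degree is essential,
  since degree \<open>0\<close> of the complex carries the localization as its cohomology.\<close>

lemma acyclic_free_on:
  assumes B: "finite B" "B \<subseteq> C"
  shows "inj_complex_over.acyclic S J D (free_module S C) (free_on S B)"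
proof -
  interpret F: inj_complex_over S Q J D e n "free_module S C" by (rule over_free)
  note Xs = submod_free_on[OF cring_S B(2)]
  show ?thesis
    unfolding F.acyclic_def
  proof (intro conjI allI subsetI)
    show "noeth_sub S (free_module S C) (free_on S B)" by (rule noeth_sub_free[OF cring_S noeth B])
    fix i c assume c: "c \<in> F.cocyc (Suc i) (free_on S B) {\<zero>\<^bsub>free_module S C\<^esub>}"
    note cD = F.cocycD[OF c]
    have "\<exists>y\<in>carrier (J (Suc i)). D (Suc i) y = c (basis_vec S b)" if "b \<in> B" for b
      using exact cD(3,4) basis_vec_free_on[OF cring_S that] by blast
    then obtain g where g: "\<And>b. b \<in> B \<Longrightarrow> g b \<in> carrier (J (Suc i))" "\<And>b. b \<in> B \<Longrightarrow> D (Suc i) (g b) = c (basis_vec S b)" by metis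
    have h: "lin_ext S (J (Suc i)) g \<in> lin S (free_module S C) (free_on S B) (J (Suc i))"
      by (rule lin_ext_lin[OF cring_S J g(1)])
    show "c \<in> F.cobd (Suc i) (free_on S B) {\<zero>\<^bsub>free_module S C\<^esub>}"
    proof (rule F.cobdI[OF Xs h])
      show "lin_ext S (J (Suc i)) g z = \<zero>\<^bsub>J (Suc i)\<^esub>" if "z \<in> {\<zero>\<^bsub>free_module S C\<^esub>}" for z
        using lin_zero[OF F.U J h Xs] that by simp
      show "c y = D (Suc i) (lin_ext S (J (Suc i)) g y)" if "y \<in> free_on S B" for y
        by (rule free_on_lin_eq[OF cring_S J cD(1) lin_D[OF h] _ B(2) that])
          (simp add: lin_ext_basis_vec[OF cring_S J] g)
    qed
  qed
qed

text \<open>Infinitely many indices leave room for a finite free cover of every noetherian submodule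
  inside the same ambient module. Degree \<open>0\<close> is not zero, because \<open>e\<close>
  defines a nonzero map on a free module of rank one.\<close>

lemma enough_free:
  assumes "infinite (UNIV :: 'b set)"
  shows "inj_complex_enough S Q J D e n (free_module S (UNIV :: 'b set))"
proof -
  let ?U = "free_module S (UNIV :: 'b set)"
  interpret F: inj_complex_over S Q J D e n ?U by (rule over_free)
  show ?thesis
  proof (intro inj_complex_enough.intro inj_complex_enough_axioms.intro over_free)
    fix Y assume Y: "noeth_sub S ?U Y"
    note Ys = noeth_sub_submod[OF Y]
    obtain X where X: "finite X" "X \<subseteq> Y" "\<And>N. submodule N S ?U \<Longrightarrow> X \<subseteq> N \<Longrightarrow> Y \<subseteq> N"
      using noeth_sub_finite_gen[OF F.U Y] by metis
    obtain B :: "'b set" where B: "finite B" "card B = card X"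
      using infinite_arbitrarily_large[OF assms] by metis
    obtain \<beta> where \<beta>: "bij_betw \<beta> B X" using finite_same_card_bij[OF B(1) X(1) B(2)] by blast
    then have bX: "\<beta> ` B = X" by (simp add: bij_betw_def)
    have bY: "\<beta> b \<in> Y" if "b \<in> B" for b using bX X(2) that by blast
    have bU: "\<beta> b \<in> carrier ?U" if "b \<in> B" for b by (rule submod_mem[OF F.U Ys bY[OF that]])
    let ?p = "lin_ext S ?U \<beta>"
    have p: "?p \<in> lin S ?U (free_on S B) ?U" by (rule lin_ext_lin[OF cring_S F.U bU])
    have "?p ` free_on S B = Y"
    proof
      show "?p ` free_on S B \<subseteq> Y" by (rule image_subsetI, rule lin_ext_mem[OF cring_S F.U Ys bY])
      show "Y \<subseteq> ?p ` free_on S B"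
      proof (rule X(3)[OF submod_image[OF F.U F.U p submod_free_on[OF cring_S subset_UNIV]]])
        show "X \<subseteq> ?p ` free_on S B"
        proof
          fix x assume "x \<in> X"
          then obtain b where b: "b \<in> B" "x = \<beta> b" using bX by blast
          have "x = ?p (basis_vec S b)" using lin_ext_basis_vec[OF cring_S F.U, where g = \<beta> and b = b] bU[OF b(1)] b(2) by simp
          then show "x \<in> ?p ` free_on S B" using basis_vec_free_on[OF cring_S b(1)] by (rule image_eqI)
        qed
      qed
    qed
    then show "\<exists>X p. F.acyclic X \<and> p \<in> lin S ?U X ?U \<and> p ` X = Y"
      using acyclic_free_on[OF B(1) subset_UNIV] p by blast
  next
    let ?Y = "free_on S {undefined :: 'b}"
    let ?c = "lin_ext S (J 1) (\<lambda>_. e)"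
    have Y: "noeth_sub S ?U ?Y" by (rule noeth_sub_free[OF cring_S noeth]) auto
    note Ys = noeth_sub_submod[OF Y]
    have c: "?c \<in> lin S ?U ?Y (J 1)" by (rule lin_ext_lin[OF cring_S J e(1)])
    have "?c \<in> F.cocyc 0 ?Y {\<zero>\<^bsub>?U\<^esub>}"
    proof (rule F.cocycI)
      show "?c \<in> lin S ?U ?Y (J (Suc 0))" using c by simp
      show "?c z = \<zero>\<^bsub>J (Suc 0)\<^esub>" if "z \<in> {\<zero>\<^bsub>?U\<^esub>}" for z using lin_zero[OF F.U J c Ys] that by simp
      show "D (Suc 0) (?c y) = \<zero>\<^bsub>J (Suc (Suc 0))\<^esub>" if "y \<in> ?Y" for y
      proof -
        have "D 1 (?c y) = (\<lambda>_. \<zero>\<^bsub>J (Suc 1)\<^esub>) y"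
          by (rule free_on_lin_eq[OF cring_S J lin_D[OF c] lin_const_zero[OF F.U J] _ subset_UNIV that])
            (use lin_ext_basis_vec[OF cring_S J[of 1], where g = "\<lambda>_. e" and b = "undefined :: 'b"] e in \<open>simp add: numeral_2_eq_2\<close>)
        then show ?thesis by simp
      qed
    qed
    moreover have "?c \<notin> F.cobd 0 ?Y {\<zero>\<^bsub>?U\<^esub>}"
    proof
      assume "?c \<in> F.cobd 0 ?Y {\<zero>\<^bsub>?U\<^esub>}"
      then obtain h where h: "h \<in> lin S ?U ?Y (J 0)" "\<And>y. y \<in> ?Y \<Longrightarrow> ?c y = D 0 (h y)" unfolding F.cobd_def by blast
      let ?b = "basis_vec S (undefined :: 'b)"
      have b: "?b \<in> ?Y" by (rule basis_vec_free_on[OF cring_S]) simp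
      have "h ?b = \<zero>\<^bsub>J 0\<^esub>" using lin_closed[OF h(1) b] J_0 by simp
      then have "e = \<zero>\<^bsub>J 1\<^esub>" using h(2)[OF b] lin_ext_basis_vec[OF cring_S J, of "\<lambda>_. e" "undefined :: 'b" 1] e by simp
      \<comment> \<open>Were \<open>e\<close> zero, then \<open>1\<close> would be torsion and zero
        would lie outside \<open>Q\<close>.\<close>
      then obtain t where "t \<in> carrier S - Q" "t \<otimes>\<^bsub>S\<^esub> \<one>\<^bsub>S\<^esub> = \<zero>\<^bsub>S\<^esub>" using torsion[of "\<one>\<^bsub>S\<^esub>"] e by auto
      then show False using P.a_subgroup P.zero_closed by auto
    qed
    ultimately show "\<not> F.vanish 0"
      using Y submod_trivial[OF F.U] submod_zero[OF F.U Ys] unfolding F.vanish_def by blast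
  qed
qed

end

section \<open>Restriction of scalars and localization\<close>

lemma restrict_scalars_simps [simp]:
  "carrier (restrict_scalars f M) = carrier M" "\<zero>\<^bsub>restrict_scalars f M\<^esub> = \<zero>\<^bsub>M\<^esub>"
  "x \<oplus>\<^bsub>restrict_scalars f M\<^esub> y = x \<oplus>\<^bsub>M\<^esub> y" "s \<odot>\<^bsub>restrict_scalars f M\<^esub> y = f s \<odot>\<^bsub>M\<^esub> y"
  by (simp_all add: restrict_scalars_def)

lemma module_restrict_scalars:
  assumes "cring S" "f \<in> ring_hom S R" "module R M"
  shows "module S (restrict_scalars f M)"
proof -
  interpret S: cring S by fact
  interpret M: module R M by fact
  note h = ring_hom_memE[OF assms(2)]
  show ?thesis
  proof (rule moduleI[OF assms(1)], rule abelian_groupI)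
    fix x assume "x \<in> carrier (restrict_scalars f M)"
    then show "\<exists>y\<in>carrier (restrict_scalars f M). y \<oplus>\<^bsub>restrict_scalars f M\<^esub> x = \<zero>\<^bsub>restrict_scalars f M\<^esub>"
      by (intro bexI[of _ "\<ominus>\<^bsub>M\<^esub> x"]) (auto simp: M.M.l_neg)
  qed (use h in \<open>auto simp: M.M.a_ac M.smult_l_distr M.smult_r_distr M.smult_assoc1\<close>)
qed

lemma hom_restrict_scalars:
  assumes "f \<in> ring_hom S R" "h \<in> module_hom R M N"
  shows "h \<in> module_hom S (restrict_scalars f M) (restrict_scalars f N)"
  using assms ring_hom_memE(1)[OF assms(1)] by (auto simp: module_hom_def)

section \<open>Arithmetic of fractions\<close>

locale prime_localization = primeideal Q S for Q and S :: "'s ring"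
begin

abbreviation A where "A \<equiv> localization S Q"

abbreviation frac where "frac \<equiv> loc_frac S Q"

lemma mult_notin: "s \<in> carrier S - Q \<Longrightarrow> t \<in> carrier S - Q \<Longrightarrow> s \<otimes>\<^bsub>S\<^esub> t \<in> carrier S - Q"
  using I_prime by blast

lemma one_notin: "\<one>\<^bsub>S\<^esub> \<in> carrier S - Q"
  using I_notcarr one_imp_carrier by auto

lemma frac_rel_iff: "((a, s), (b, t)) \<in> frac_rel S Q \<longleftrightarrow> a \<in> carrier S \<and> s \<in> carrier S - Q \<and> b \<in> carrier S \<and> t \<in> carrier S - Q \<and>
      (\<exists>u\<in>carrier S - Q. u \<otimes>\<^bsub>S\<^esub> (a \<otimes>\<^bsub>S\<^esub> t) = u \<otimes>\<^bsub>S\<^esub> (b \<otimes>\<^bsub>S\<^esub> s))"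
  by (simp add: frac_rel_def)

lemma equiv_frac_rel: "equiv (carrier S \<times> (carrier S - Q)) (frac_rel S Q)"
proof (rule equivI)
  show "frac_rel S Q \<subseteq> (carrier S \<times> (carrier S - Q)) \<times> (carrier S \<times> (carrier S - Q))"
    by (auto simp: frac_rel_def)
  show "refl_on (carrier S \<times> (carrier S - Q)) (frac_rel S Q)"
    by (rule refl_onI) (use one_notin in \<open>auto simp: frac_rel_iff\<close>)
  show "sym (frac_rel S Q)"
    by (rule symI) (force simp: frac_rel_def)
  show "trans (frac_rel S Q)"
  proof (rule transI)
    fix x y z assume xyz: "(x, y) \<in> frac_rel S Q" "(y, z) \<in> frac_rel S Q"
    obtain a s b t c r where [simp]: "x = (a, s)" "y = (b, t)" "z = (c, r)" by (metis surj_pair)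
    obtain u where u: "u \<in> carrier S - Q" "u \<otimes>\<^bsub>S\<^esub> (a \<otimes>\<^bsub>S\<^esub> t) = u \<otimes>\<^bsub>S\<^esub> (b \<otimes>\<^bsub>S\<^esub> s)" using xyz(1) by (auto simp: frac_rel_iff)
    obtain v where v: "v \<in> carrier S - Q" "v \<otimes>\<^bsub>S\<^esub> (b \<otimes>\<^bsub>S\<^esub> r) = v \<otimes>\<^bsub>S\<^esub> (c \<otimes>\<^bsub>S\<^esub> t)" using xyz(2) by (auto simp: frac_rel_iff)
    have cl: "a \<in> carrier S" "s \<in> carrier S" "b \<in> carrier S" "t \<in> carrier S" "c \<in> carrier S" "r \<in> carrier S"
        "u \<in> carrier S" "v \<in> carrier S" "t \<in> carrier S - Q"
      using xyz u v by (auto simp: frac_rel_iff)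
    \<comment> \<open>The product of both witnesses does not suffice: the middle denominator
      \<open>t\<close> has to be a factor as well, and it is outside \<open>Q\<close>.\<close>
    have "(u \<otimes>\<^bsub>S\<^esub> v \<otimes>\<^bsub>S\<^esub> t) \<otimes>\<^bsub>S\<^esub> (a \<otimes>\<^bsub>S\<^esub> r) = v \<otimes>\<^bsub>S\<^esub> r \<otimes>\<^bsub>S\<^esub> (u \<otimes>\<^bsub>S\<^esub> (a \<otimes>\<^bsub>S\<^esub> t))" using cl by (simp add: m_ac)
    also have "\<dots> = u \<otimes>\<^bsub>S\<^esub> s \<otimes>\<^bsub>S\<^esub> (v \<otimes>\<^bsub>S\<^esub> (b \<otimes>\<^bsub>S\<^esub> r))" unfolding u(2) using cl by (simp add: m_ac)
    also have "\<dots> = (u \<otimes>\<^bsub>S\<^esub> v \<otimes>\<^bsub>S\<^esub> t) \<otimes>\<^bsub>S\<^esub> (c \<otimes>\<^bsub>S\<^esub> s)" unfolding v(2) using cl by (simp add: m_ac)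
    finally have "(u \<otimes>\<^bsub>S\<^esub> v \<otimes>\<^bsub>S\<^esub> t) \<otimes>\<^bsub>S\<^esub> (a \<otimes>\<^bsub>S\<^esub> r) = (u \<otimes>\<^bsub>S\<^esub> v \<otimes>\<^bsub>S\<^esub> t) \<otimes>\<^bsub>S\<^esub> (c \<otimes>\<^bsub>S\<^esub> s)" .
    moreover have "u \<otimes>\<^bsub>S\<^esub> v \<otimes>\<^bsub>S\<^esub> t \<in> carrier S - Q" by (intro mult_notin u v cl)
    ultimately show "(x, z) \<in> frac_rel S Q" using xyz by (auto simp: frac_rel_iff)
  qed
qed

lemma frac_eq_iff:
  assumes "a \<in> carrier S" "s \<in> carrier S - Q" "b \<in> carrier S" "t \<in> carrier S - Q"
  shows "frac a s = frac b t \<longleftrightarrow> (\<exists>u\<in>carrier S - Q. u \<otimes>\<^bsub>S\<^esub> (a \<otimes>\<^bsub>S\<^esub> t) = u \<otimes>\<^bsub>S\<^esub> (b \<otimes>\<^bsub>S\<^esub> s))"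
  unfolding loc_frac_def using eq_equiv_class_iff[OF equiv_frac_rel, of "(a, s)" "(b, t)"] assms
  by (simp add: frac_rel_iff)

lemma mem_frac_iff: "(b, t) \<in> frac a s \<longleftrightarrow> ((a, s), (b, t)) \<in> frac_rel S Q"
  by (simp add: loc_frac_def)

lemma frac_self: "a \<in> carrier S \<Longrightarrow> s \<in> carrier S - Q \<Longrightarrow> (a, s) \<in> frac a s"
  unfolding mem_frac_iff using one_notin by (auto simp: frac_rel_iff)

lemma mem_fracD:
  assumes "(b, t) \<in> frac a s"
  shows "b \<in> carrier S" "t \<in> carrier S - Q" "a \<in> carrier S" "s \<in> carrier S - Q"
    "\<exists>u\<in>carrier S - Q. u \<otimes>\<^bsub>S\<^esub> (a \<otimes>\<^bsub>S\<^esub> t) = u \<otimes>\<^bsub>S\<^esub> (b \<otimes>\<^bsub>S\<^esub> s)"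
  using assms by (auto simp: mem_frac_iff frac_rel_iff)

lemma carrier_A: "X \<in> carrier A \<longleftrightarrow> (\<exists>a\<in>carrier S. \<exists>s\<in>carrier S - Q. X = frac a s)"
  by (auto simp: localization_def quotient_def loc_frac_def)

lemma one_A: "\<one>\<^bsub>A\<^esub> = frac \<one>\<^bsub>S\<^esub> \<one>\<^bsub>S\<^esub>" and zero_A: "\<zero>\<^bsub>A\<^esub> = frac \<zero>\<^bsub>S\<^esub> \<one>\<^bsub>S\<^esub>"
  by (simp_all add: localization_def)

text \<open>The operations of \<open>localization\<close> are unions over representatives. Once all
  terms are shown to be the same class, the union collapses to it.\<close>

lemma UN_const_pairs:
  assumes "x \<in> X" "y \<in> Y" "\<And>p q. p \<in> X \<Longrightarrow> q \<in> Y \<Longrightarrow> F p q = C"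
  shows "(\<Union>p\<in>X. \<Union>q\<in>Y. F p q) = C"
  using assms by auto

lemma mult_A:
  assumes "a \<in> carrier S" "s \<in> carrier S - Q" "b \<in> carrier S" "t \<in> carrier S - Q"
  shows "frac a s \<otimes>\<^bsub>A\<^esub> frac b t = frac (a \<otimes>\<^bsub>S\<^esub> b) (s \<otimes>\<^bsub>S\<^esub> t)"
proof -
  have "frac a s \<otimes>\<^bsub>A\<^esub> frac b t = (\<Union>p\<in>frac a s. \<Union>q\<in>frac b t. frac (fst p \<otimes>\<^bsub>S\<^esub> fst q) (snd p \<otimes>\<^bsub>S\<^esub> snd q))"
    by (simp add: localization_def case_prod_beta)
  also have "\<dots> = frac (a \<otimes>\<^bsub>S\<^esub> b) (s \<otimes>\<^bsub>S\<^esub> t)"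
  proof (rule UN_const_pairs[OF frac_self[OF assms(1,2)] frac_self[OF assms(3,4)]])
    fix p q assume pq: "p \<in> frac a s" "q \<in> frac b t"
    obtain a' s' b' t' where [simp]: "p = (a', s')" "q = (b', t')" by (metis surj_pair)
    note m = mem_fracD[OF pq(1)[simplified]] mem_fracD[OF pq(2)[simplified]]
    obtain u where u: "u \<in> carrier S - Q" "u \<otimes>\<^bsub>S\<^esub> (a \<otimes>\<^bsub>S\<^esub> s') = u \<otimes>\<^bsub>S\<^esub> (a' \<otimes>\<^bsub>S\<^esub> s)" using m(5) by blast
    obtain v where v: "v \<in> carrier S - Q" "v \<otimes>\<^bsub>S\<^esub> (b \<otimes>\<^bsub>S\<^esub> t') = v \<otimes>\<^bsub>S\<^esub> (b' \<otimes>\<^bsub>S\<^esub> t)" using m(10) by blast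
    have cl: "a \<in> carrier S" "s \<in> carrier S" "b \<in> carrier S" "t \<in> carrier S" "a' \<in> carrier S" "s' \<in> carrier S" "b' \<in> carrier S" "t' \<in> carrier S"
        "u \<in> carrier S" "v \<in> carrier S" using assms m u v by auto
    have "(u \<otimes>\<^bsub>S\<^esub> v) \<otimes>\<^bsub>S\<^esub> ((a' \<otimes>\<^bsub>S\<^esub> b') \<otimes>\<^bsub>S\<^esub> (s \<otimes>\<^bsub>S\<^esub> t)) = (u \<otimes>\<^bsub>S\<^esub> (a' \<otimes>\<^bsub>S\<^esub> s)) \<otimes>\<^bsub>S\<^esub> (v \<otimes>\<^bsub>S\<^esub> (b' \<otimes>\<^bsub>S\<^esub> t))"
      using cl by (simp add: m_ac)
    also have "\<dots> = (u \<otimes>\<^bsub>S\<^esub> v) \<otimes>\<^bsub>S\<^esub> ((a \<otimes>\<^bsub>S\<^esub> b) \<otimes>\<^bsub>S\<^esub> (s' \<otimes>\<^bsub>S\<^esub> t'))"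
      unfolding u(2)[symmetric] v(2)[symmetric] using cl by (simp add: m_ac)
    finally have "(u \<otimes>\<^bsub>S\<^esub> v) \<otimes>\<^bsub>S\<^esub> ((a' \<otimes>\<^bsub>S\<^esub> b') \<otimes>\<^bsub>S\<^esub> (s \<otimes>\<^bsub>S\<^esub> t)) = (u \<otimes>\<^bsub>S\<^esub> v) \<otimes>\<^bsub>S\<^esub> ((a \<otimes>\<^bsub>S\<^esub> b) \<otimes>\<^bsub>S\<^esub> (s' \<otimes>\<^bsub>S\<^esub> t'))" .
    then have "frac (a' \<otimes>\<^bsub>S\<^esub> b') (s' \<otimes>\<^bsub>S\<^esub> t') = frac (a \<otimes>\<^bsub>S\<^esub> b) (s \<otimes>\<^bsub>S\<^esub> t)"
      using mult_notin[OF u(1) v(1)] mult_notin[OF assms(2,4)] mult_notin[OF m(2) m(7)] cl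
      by (subst frac_eq_iff) auto
    then show "frac (fst p \<otimes>\<^bsub>S\<^esub> fst q) (snd p \<otimes>\<^bsub>S\<^esub> snd q) = frac (a \<otimes>\<^bsub>S\<^esub> b) (s \<otimes>\<^bsub>S\<^esub> t)" by simp
  qed
  finally show ?thesis .
qed

lemma add_A:
  assumes "a \<in> carrier S" "s \<in> carrier S - Q" "b \<in> carrier S" "t \<in> carrier S - Q"
  shows "frac a s \<oplus>\<^bsub>A\<^esub> frac b t = frac (a \<otimes>\<^bsub>S\<^esub> t \<oplus>\<^bsub>S\<^esub> b \<otimes>\<^bsub>S\<^esub> s) (s \<otimes>\<^bsub>S\<^esub> t)"
proof -
  have "frac a s \<oplus>\<^bsub>A\<^esub> frac b t = (\<Union>p\<in>frac a s. \<Union>q\<in>frac b t. frac (fst p \<otimes>\<^bsub>S\<^esub> snd q \<oplus>\<^bsub>S\<^esub> fst q \<otimes>\<^bsub>S\<^esub> snd p) (snd p \<otimes>\<^bsub>S\<^esub> snd q))"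
    by (simp add: localization_def case_prod_beta)
  also have "\<dots> = frac (a \<otimes>\<^bsub>S\<^esub> t \<oplus>\<^bsub>S\<^esub> b \<otimes>\<^bsub>S\<^esub> s) (s \<otimes>\<^bsub>S\<^esub> t)"
  proof (rule UN_const_pairs[OF frac_self[OF assms(1,2)] frac_self[OF assms(3,4)]])
    fix p q assume pq: "p \<in> frac a s" "q \<in> frac b t"
    obtain a' s' b' t' where [simp]: "p = (a', s')" "q = (b', t')" by (metis surj_pair)
    note m = mem_fracD[OF pq(1)[simplified]] mem_fracD[OF pq(2)[simplified]]
    obtain u where u: "u \<in> carrier S - Q" "u \<otimes>\<^bsub>S\<^esub> (a \<otimes>\<^bsub>S\<^esub> s') = u \<otimes>\<^bsub>S\<^esub> (a' \<otimes>\<^bsub>S\<^esub> s)" using m(5) by blast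
    obtain v where v: "v \<in> carrier S - Q" "v \<otimes>\<^bsub>S\<^esub> (b \<otimes>\<^bsub>S\<^esub> t') = v \<otimes>\<^bsub>S\<^esub> (b' \<otimes>\<^bsub>S\<^esub> t)" using m(10) by blast
    have cl: "a \<in> carrier S" "s \<in> carrier S" "b \<in> carrier S" "t \<in> carrier S" "a' \<in> carrier S" "s' \<in> carrier S" "b' \<in> carrier S" "t' \<in> carrier S"
        "u \<in> carrier S" "v \<in> carrier S" using assms m u v by auto
    have "(u \<otimes>\<^bsub>S\<^esub> v) \<otimes>\<^bsub>S\<^esub> ((a' \<otimes>\<^bsub>S\<^esub> t' \<oplus>\<^bsub>S\<^esub> b' \<otimes>\<^bsub>S\<^esub> s') \<otimes>\<^bsub>S\<^esub> (s \<otimes>\<^bsub>S\<^esub> t)) =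
        (u \<otimes>\<^bsub>S\<^esub> (a' \<otimes>\<^bsub>S\<^esub> s)) \<otimes>\<^bsub>S\<^esub> (v \<otimes>\<^bsub>S\<^esub> t' \<otimes>\<^bsub>S\<^esub> t) \<oplus>\<^bsub>S\<^esub> (v \<otimes>\<^bsub>S\<^esub> (b' \<otimes>\<^bsub>S\<^esub> t)) \<otimes>\<^bsub>S\<^esub> (u \<otimes>\<^bsub>S\<^esub> s' \<otimes>\<^bsub>S\<^esub> s)"
      using cl by (simp add: m_ac l_distr r_distr)
    also have "\<dots> = (u \<otimes>\<^bsub>S\<^esub> v) \<otimes>\<^bsub>S\<^esub> ((a \<otimes>\<^bsub>S\<^esub> t \<oplus>\<^bsub>S\<^esub> b \<otimes>\<^bsub>S\<^esub> s) \<otimes>\<^bsub>S\<^esub> (s' \<otimes>\<^bsub>S\<^esub> t'))"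
      unfolding u(2)[symmetric] v(2)[symmetric] using cl by (simp add: m_ac l_distr r_distr)
    finally have "(u \<otimes>\<^bsub>S\<^esub> v) \<otimes>\<^bsub>S\<^esub> ((a' \<otimes>\<^bsub>S\<^esub> t' \<oplus>\<^bsub>S\<^esub> b' \<otimes>\<^bsub>S\<^esub> s') \<otimes>\<^bsub>S\<^esub> (s \<otimes>\<^bsub>S\<^esub> t)) = (u \<otimes>\<^bsub>S\<^esub> v) \<otimes>\<^bsub>S\<^esub> ((a \<otimes>\<^bsub>S\<^esub> t \<oplus>\<^bsub>S\<^esub> b \<otimes>\<^bsub>S\<^esub> s) \<otimes>\<^bsub>S\<^esub> (s' \<otimes>\<^bsub>S\<^esub> t'))" .
    then have "frac (a' \<otimes>\<^bsub>S\<^esub> t' \<oplus>\<^bsub>S\<^esub> b' \<otimes>\<^bsub>S\<^esub> s') (s' \<otimes>\<^bsub>S\<^esub> t') = frac (a \<otimes>\<^bsub>S\<^esub> t \<oplus>\<^bsub>S\<^esub> b \<otimes>\<^bsub>S\<^esub> s) (s \<otimes>\<^bsub>S\<^esub> t)"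
      using mult_notin[OF u(1) v(1)] mult_notin[OF assms(2,4)] mult_notin[OF m(2) m(7)] cl
      by (subst frac_eq_iff) auto
    then show "frac (fst p \<otimes>\<^bsub>S\<^esub> snd q \<oplus>\<^bsub>S\<^esub> fst q \<otimes>\<^bsub>S\<^esub> snd p) (snd p \<otimes>\<^bsub>S\<^esub> snd q) = frac (a \<otimes>\<^bsub>S\<^esub> t \<oplus>\<^bsub>S\<^esub> b \<otimes>\<^bsub>S\<^esub> s) (s \<otimes>\<^bsub>S\<^esub> t)" by simp
  qed
  finally show ?thesis .
qed

definition \<iota> where "\<iota> s = frac s \<one>\<^bsub>S\<^esub>"

lemma iota_hom: "\<iota> \<in> ring_hom S A"
proof (rule ring_hom_memI)
  show "\<iota> s \<in> carrier A" if "s \<in> carrier S" for s using that one_notin unfolding carrier_A \<iota>_def by blast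
  show "\<iota> (s \<otimes>\<^bsub>S\<^esub> t) = \<iota> s \<otimes>\<^bsub>A\<^esub> \<iota> t" "\<iota> (s \<oplus>\<^bsub>S\<^esub> t) = \<iota> s \<oplus>\<^bsub>A\<^esub> \<iota> t" if "s \<in> carrier S" "t \<in> carrier S" for s t
    using that by (simp_all add: \<iota>_def mult_A[OF _ one_notin _ one_notin] add_A[OF _ one_notin _ one_notin])
  show "\<iota> \<one>\<^bsub>S\<^esub> = \<one>\<^bsub>A\<^esub>" by (simp add: \<iota>_def one_A)
qed

lemma frac_cancel:
  assumes "a \<in> carrier S" "t \<in> carrier S - Q" "s \<in> carrier S - Q"
  shows "frac (t \<otimes>\<^bsub>S\<^esub> a) (t \<otimes>\<^bsub>S\<^esub> s) = frac a s"
  using assms one_notin mult_notin[OF assms(2,3)] by (subst frac_eq_iff) (auto simp: m_ac intro!: bexI[OF _ one_notin])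

lemma iota_frac:
  assumes "a \<in> carrier S" "t \<in> carrier S - Q"
  shows "\<iota> t \<otimes>\<^bsub>A\<^esub> frac a t = \<iota> a"
proof -
  have "\<iota> t \<otimes>\<^bsub>A\<^esub> frac a t = frac (t \<otimes>\<^bsub>S\<^esub> a) (\<one>\<^bsub>S\<^esub> \<otimes>\<^bsub>S\<^esub> t)"
    unfolding \<iota>_def using assms one_notin by (intro mult_A) auto
  also have "\<dots> = frac (t \<otimes>\<^bsub>S\<^esub> a) (t \<otimes>\<^bsub>S\<^esub> \<one>\<^bsub>S\<^esub>)" using assms by simp
  also have "\<dots> = frac a \<one>\<^bsub>S\<^esub>" by (rule frac_cancel[OF assms one_notin])
  finally show ?thesis by (simp add: \<iota>_def)
qed

lemma iota_inverse: "t \<in> carrier S - Q \<Longrightarrow> \<iota> t \<otimes>\<^bsub>A\<^esub> frac \<one>\<^bsub>S\<^esub> t = \<one>\<^bsub>A\<^esub>"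
  using iota_frac[of "\<one>\<^bsub>S\<^esub>" t] by (simp add: \<iota>_def one_A)

lemma frac_in_A: "a \<in> carrier S \<Longrightarrow> t \<in> carrier S - Q \<Longrightarrow> frac a t \<in> carrier A"
  unfolding carrier_A by blast

lemma iota_in_A: "a \<in> carrier S \<Longrightarrow> \<iota> a \<in> carrier A"
  by (rule ring_hom_memE(1)[OF iota_hom])

lemma frac_eq_mult: "a \<in> carrier S \<Longrightarrow> t \<in> carrier S - Q \<Longrightarrow> frac a t = frac \<one>\<^bsub>S\<^esub> t \<otimes>\<^bsub>A\<^esub> \<iota> a"
  unfolding \<iota>_def using one_notin by (subst mult_A) auto

section \<open>Injective modules over the localization as modules over the original ring\<close>

context
  fixes N :: "(('s \<times> 's) set, 'n) module"
  assumes N: "module A N"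
begin

interpretation N: module A N by (rule N)

lemma iota_smult_inverse:
  assumes "t \<in> carrier S - Q" "x \<in> carrier N"
  shows "\<iota> t \<odot>\<^bsub>N\<^esub> (frac \<one>\<^bsub>S\<^esub> t \<odot>\<^bsub>N\<^esub> x) = x" "frac \<one>\<^bsub>S\<^esub> t \<odot>\<^bsub>N\<^esub> (\<iota> t \<odot>\<^bsub>N\<^esub> x) = x"
proof -
  have c: "\<iota> t \<in> carrier A" "frac \<one>\<^bsub>S\<^esub> t \<in> carrier A" using assms(1) iota_in_A frac_in_A by auto
  show "\<iota> t \<odot>\<^bsub>N\<^esub> (frac \<one>\<^bsub>S\<^esub> t \<odot>\<^bsub>N\<^esub> x) = x" "frac \<one>\<^bsub>S\<^esub> t \<odot>\<^bsub>N\<^esub> (\<iota> t \<odot>\<^bsub>N\<^esub> x) = x"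
    using c assms iota_inverse[OF assms(1)] by (simp_all add: N.smult_assoc1[symmetric] N.R.m_comm[OF c(2,1)])
qed

text \<open>The given map extends to the ideal of fractions with numerator in \<open>I\<close>, to which the injectivity
  of \<open>N\<close> over the localization applies.\<close>

lemma baer_localization:
  assumes inj: "injective_module A N" and I: "ideal I S"
    and g: "g \<in> lin S (self_module S) I (restrict_scalars \<iota> N)"
  shows "\<exists>x\<in>carrier N. \<forall>a\<in>I. g a = \<iota> a \<odot>\<^bsub>N\<^esub> x"
proof -
  interpret I: ideal I S by fact
  note gc = lin_closed[OF g, simplified]
  note mA = module_self[OF N.R.is_cring]
  define Y where "Y = {frac a t | a t. a \<in> I \<and> t \<in> carrier S - Q}"
  have IS: "a \<in> carrier S" if "a \<in> I" for a using that I.a_Hcarr by blast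
  have gs: "g (s \<otimes>\<^bsub>S\<^esub> a) = \<iota> s \<odot>\<^bsub>N\<^esub> g a" if "s \<in> carrier S" "a \<in> I" for s a using lin_smult[OF g that] by simp
  define h where "h X = (SOME x. \<exists>a t. a \<in> I \<and> t \<in> carrier S - Q \<and> X = frac a t \<and> x = frac \<one>\<^bsub>S\<^esub> t \<odot>\<^bsub>N\<^esub> g a)" for X
  have h: "h (frac a t) = frac \<one>\<^bsub>S\<^esub> t \<odot>\<^bsub>N\<^esub> g a" if a: "a \<in> I" "t \<in> carrier S - Q" for a t
  proof -
    \<comment> \<open>Independence of the representative: the numerators agree after cross
      multiplication up to some \<open>u\<close> outside \<open>Q\<close>, which acts invertibly on
      \<open>N\<close> and cancels.\<close>
    have "x = frac \<one>\<^bsub>S\<^esub> t \<odot>\<^bsub>N\<^esub> g a" if b: "b \<in> I" "r \<in> carrier S - Q" "frac a t = frac b r" "x = frac \<one>\<^bsub>S\<^esub> r \<odot>\<^bsub>N\<^esub> g b" for x b r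
    proof -
      obtain u where u: "u \<in> carrier S - Q" "u \<otimes>\<^bsub>S\<^esub> (a \<otimes>\<^bsub>S\<^esub> r) = u \<otimes>\<^bsub>S\<^esub> (b \<otimes>\<^bsub>S\<^esub> t)"
        using b(3) frac_eq_iff[OF IS[OF a(1)] a(2) IS[OF b(1)] b(2)] by blast
      have cl: "u \<in> carrier S" "r \<in> carrier S" "t \<in> carrier S" using u a b by auto
      note ic = iota_in_A[OF cl(1)] iota_in_A[OF cl(2)] iota_in_A[OF cl(3)]
      have fc: "frac \<one>\<^bsub>S\<^esub> t \<in> carrier A" "frac \<one>\<^bsub>S\<^esub> r \<in> carrier A" "frac \<one>\<^bsub>S\<^esub> u \<in> carrier A" using frac_in_A a b u by auto
      have "g ((u \<otimes>\<^bsub>S\<^esub> r) \<otimes>\<^bsub>S\<^esub> a) = g ((u \<otimes>\<^bsub>S\<^esub> t) \<otimes>\<^bsub>S\<^esub> b)"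
        using u(2) cl IS[OF a(1)] IS[OF b(1)] by (simp add: m_ac)
      then have "\<iota> (u \<otimes>\<^bsub>S\<^esub> r) \<odot>\<^bsub>N\<^esub> g a = \<iota> (u \<otimes>\<^bsub>S\<^esub> t) \<odot>\<^bsub>N\<^esub> g b" using gs a b cl by simp
      then have "\<iota> u \<odot>\<^bsub>N\<^esub> (\<iota> r \<odot>\<^bsub>N\<^esub> g a) = \<iota> u \<odot>\<^bsub>N\<^esub> (\<iota> t \<odot>\<^bsub>N\<^esub> g b)"
        using cl ring_hom_memE(2)[OF iota_hom] ic gc a b by (simp add: N.smult_assoc1)
      then have eq: "\<iota> r \<odot>\<^bsub>N\<^esub> g a = \<iota> t \<odot>\<^bsub>N\<^esub> g b"
        using iota_smult_inverse(2)[OF u(1)] ic gc a b N.smult_closed by metis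
      have "frac \<one>\<^bsub>S\<^esub> r \<odot>\<^bsub>N\<^esub> g b = frac \<one>\<^bsub>S\<^esub> r \<odot>\<^bsub>N\<^esub> (frac \<one>\<^bsub>S\<^esub> t \<odot>\<^bsub>N\<^esub> (\<iota> t \<odot>\<^bsub>N\<^esub> g b))"
        using iota_smult_inverse(2)[OF a(2)] gc b by simp
      also have "\<dots> = frac \<one>\<^bsub>S\<^esub> t \<odot>\<^bsub>N\<^esub> (frac \<one>\<^bsub>S\<^esub> r \<odot>\<^bsub>N\<^esub> (\<iota> r \<odot>\<^bsub>N\<^esub> g a))"
        unfolding eq[symmetric] using fc ic gc a by (simp add: N.smult_assoc1[symmetric] N.R.m_ac)
      also have "\<dots> = frac \<one>\<^bsub>S\<^esub> t \<odot>\<^bsub>N\<^esub> g a" using iota_smult_inverse(2)[OF b(2)] gc a by simp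
      finally show ?thesis using b(4) by simp
    qed
    then show ?thesis unfolding h_def using a by (intro some_equality) blast+
  qed
  have Ys: "submodule Y A (self_module A)"
  proof (rule submodI[OF mA])
    show "Y \<subseteq> carrier (self_module A)" using frac_in_A IS by (auto simp: Y_def)
    have "frac \<zero>\<^bsub>S\<^esub> \<one>\<^bsub>S\<^esub> \<in> Y" unfolding Y_def using one_notin I.zero_closed by blast
    then show "\<zero>\<^bsub>self_module A\<^esub> \<in> Y" by (simp add: zero_A)
    fix x y assume y: "y \<in> Y"
    then obtain b r where b: "b \<in> I" "r \<in> carrier S - Q" "y = frac b r" by (auto simp: Y_def)
    { assume "x \<in> Y"
      then obtain a t where a: "a \<in> I" "t \<in> carrier S - Q" "x = frac a t" by (auto simp: Y_def)
      have "a \<otimes>\<^bsub>S\<^esub> r \<oplus>\<^bsub>S\<^esub> b \<otimes>\<^bsub>S\<^esub> t \<in> I" using a b by (auto intro!: I.a_closed I.I_r_closed)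
      then show "x \<oplus>\<^bsub>self_module A\<^esub> y \<in> Y"
        using add_A[OF IS[OF a(1)] a(2) IS[OF b(1)] b(2)] a(3) b(3) mult_notin[OF a(2) b(2)] by (auto simp: Y_def) }
    { assume "x \<in> carrier A"
      then obtain a t where a: "a \<in> carrier S" "t \<in> carrier S - Q" "x = frac a t" by (auto simp: carrier_A)
      have "a \<otimes>\<^bsub>S\<^esub> b \<in> I" using a b by (auto intro!: I.I_l_closed)
      then show "x \<odot>\<^bsub>self_module A\<^esub> y \<in> Y"
        using mult_A[OF a(1) a(2) IS[OF b(1)] b(2)] a(3) b(3) mult_notin[OF a(2) b(2)] by (auto simp: Y_def) }
  qed
  have frac_mult: "frac \<one>\<^bsub>S\<^esub> (t \<otimes>\<^bsub>S\<^esub> r) = frac \<one>\<^bsub>S\<^esub> t \<otimes>\<^bsub>A\<^esub> frac \<one>\<^bsub>S\<^esub> r" if "t \<in> carrier S - Q" "r \<in> carrier S - Q" for t r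
    using mult_A[OF one_closed that(1) one_closed that(2)] by simp
  have hl: "h \<in> lin A (self_module A) Y N"
  proof (rule linI)
    fix y assume y: "y \<in> Y"
    then obtain b r where b: "b \<in> I" "r \<in> carrier S - Q" "y = frac b r" by (auto simp: Y_def)
    have rc: "frac \<one>\<^bsub>S\<^esub> r \<in> carrier A" "\<iota> r \<in> carrier A" using frac_in_A iota_in_A b by auto
    show "h y \<in> carrier N" using h[OF b(1,2)] b(3) gc[OF b(1)] rc by simp
    { fix x assume "x \<in> carrier A"
      then obtain a t where a: "a \<in> carrier S" "t \<in> carrier S - Q" "x = frac a t" by (auto simp: carrier_A)
      have tc: "frac \<one>\<^bsub>S\<^esub> t \<in> carrier A" using frac_in_A a by auto
      have ab: "a \<otimes>\<^bsub>S\<^esub> b \<in> I" using a b by (auto intro!: I.I_l_closed)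
      have "x \<otimes>\<^bsub>A\<^esub> y = frac (a \<otimes>\<^bsub>S\<^esub> b) (t \<otimes>\<^bsub>S\<^esub> r)" using mult_A[OF a(1) a(2) IS[OF b(1)] b(2)] a(3) b(3) by simp
      then have "h (x \<otimes>\<^bsub>A\<^esub> y) = frac \<one>\<^bsub>S\<^esub> (t \<otimes>\<^bsub>S\<^esub> r) \<odot>\<^bsub>N\<^esub> (\<iota> a \<odot>\<^bsub>N\<^esub> g b)"
        using h[OF ab mult_notin[OF a(2) b(2)]] gs[OF a(1) b(1)] by simp
      also have "\<dots> = (frac \<one>\<^bsub>S\<^esub> t \<otimes>\<^bsub>A\<^esub> \<iota> a) \<odot>\<^bsub>N\<^esub> (frac \<one>\<^bsub>S\<^esub> r \<odot>\<^bsub>N\<^esub> g b)"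
        unfolding frac_mult[OF a(2) b(2)] using tc rc iota_in_A[OF a(1)] gc[OF b(1)]
        by (simp add: N.smult_assoc1[symmetric] N.R.m_ac)
      also have "\<dots> = x \<odot>\<^bsub>N\<^esub> h y" using frac_eq_mult[OF a(1,2)] a(3) h[OF b(1,2)] b(3) by simp
      finally show "h (x \<odot>\<^bsub>self_module A\<^esub> y) = x \<odot>\<^bsub>N\<^esub> h y" by simp }
    { fix x assume "x \<in> Y"
      then obtain a t where a: "a \<in> I" "t \<in> carrier S - Q" "x = frac a t" by (auto simp: Y_def)
      have tc: "frac \<one>\<^bsub>S\<^esub> t \<in> carrier A" "\<iota> t \<in> carrier A" using frac_in_A iota_in_A a by auto
      have rt: "r \<in> carrier S" "t \<in> carrier S" using a b by auto
      have ab: "a \<otimes>\<^bsub>S\<^esub> r \<in> I" "b \<otimes>\<^bsub>S\<^esub> t \<in> I" using a b by (auto intro!: I.I_r_closed)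
      have "h (x \<oplus>\<^bsub>A\<^esub> y) = h (frac (a \<otimes>\<^bsub>S\<^esub> r \<oplus>\<^bsub>S\<^esub> b \<otimes>\<^bsub>S\<^esub> t) (t \<otimes>\<^bsub>S\<^esub> r))"
        using add_A[OF IS[OF a(1)] a(2) IS[OF b(1)] b(2)] a(3) b(3) by simp
      also have "\<dots> = frac \<one>\<^bsub>S\<^esub> (t \<otimes>\<^bsub>S\<^esub> r) \<odot>\<^bsub>N\<^esub> (g (r \<otimes>\<^bsub>S\<^esub> a) \<oplus>\<^bsub>N\<^esub> g (t \<otimes>\<^bsub>S\<^esub> b))"
        using h[OF I.a_closed[OF ab] mult_notin[OF a(2) b(2)]] lin_add[OF g ab] rt IS[OF a(1)] IS[OF b(1)] by (simp add: m_comm)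
      also have "\<dots> = frac \<one>\<^bsub>S\<^esub> t \<odot>\<^bsub>N\<^esub> (frac \<one>\<^bsub>S\<^esub> r \<odot>\<^bsub>N\<^esub> (\<iota> r \<odot>\<^bsub>N\<^esub> g a)) \<oplus>\<^bsub>N\<^esub> frac \<one>\<^bsub>S\<^esub> r \<odot>\<^bsub>N\<^esub> (frac \<one>\<^bsub>S\<^esub> t \<odot>\<^bsub>N\<^esub> (\<iota> t \<odot>\<^bsub>N\<^esub> g b))"
        unfolding frac_mult[OF a(2) b(2)] gs[OF rt(1) a(1)] gs[OF rt(2) b(1)] using tc rc gc[OF a(1)] gc[OF b(1)]
        by (simp add: N.smult_r_distr N.smult_assoc1[symmetric] N.R.m_ac)
      also have "\<dots> = h x \<oplus>\<^bsub>N\<^esub> h y"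
        using iota_smult_inverse(2)[OF b(2) gc[OF a(1)]] iota_smult_inverse(2)[OF a(2) gc[OF b(1)]] h[OF a(1,2)] h[OF b(1,2)] a(3) b(3) by simp
      finally show "h (x \<oplus>\<^bsub>self_module A\<^esub> y) = h x \<oplus>\<^bsub>N\<^esub> h y" by simp }
  qed
  \<comment> \<open>The localization is a module on the type of its own elements, the type for which
    \<open>injective_module\<close> provides extensions.\<close>
  then obtain k where k: "k \<in> module_hom A (self_module A) N" "\<And>y. y \<in> Y \<Longrightarrow> k y = h y"
    using inj mA Ys unfolding injective_module_def lin_def by blast
  then have kl: "k \<in> lin A (self_module A) (carrier A) N" by (simp add: module_hom_eq_lin)
  \<comment> \<open>The element required by Baer's criterion is the value of the extension at
    \<open>1\<close>.\<close>
  have "g a = \<iota> a \<odot>\<^bsub>N\<^esub> k \<one>\<^bsub>A\<^esub>" if a: "a \<in> I" for a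
  proof -
    have aY: "\<iota> a \<in> Y" unfolding Y_def \<iota>_def using a one_notin by blast
    have "g a = h (\<iota> a)"
      using h[OF a one_notin] gc[OF a] by (simp add: \<iota>_def one_A[symmetric])
    also have "\<dots> = k (\<iota> a \<otimes>\<^bsub>A\<^esub> \<one>\<^bsub>A\<^esub>)" using k(2)[OF aY] iota_in_A[OF IS[OF a]] by simp
    also have "\<dots> = \<iota> a \<odot>\<^bsub>N\<^esub> k \<one>\<^bsub>A\<^esub>" using lin_smult[OF kl iota_in_A[OF IS[OF a]] N.R.one_closed] by simp
    finally show ?thesis .
  qed
  then show ?thesis using lin_closed[OF kl N.R.one_closed] by blast
qed

end

end

text \<open>Restriction along \<open>\<iota>\<close> turns the injective resolution of the
  localization into a complex over \<open>S\<close>. Elements outside \<open>Q\<close> become units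
  and so act bijectively; \<open>aug\<close> comes from exactness at the augmentation
  \<open>\<eta>\<close>, and \<open>torsion\<close> from its injectivity.\<close>

lemma gorenstein_inj_complex:
  fixes S :: "'s ring"
  assumes g: "gorenstein_ring TYPE('e) S" and Q: "primeideal Q S"
  obtains J :: "nat \<Rightarrow> ('s, 'e) module" and D e n where "inj_complex S Q J D e n"
proof -
  interpret prime_localization Q S using Q by (simp add: prime_localization_def)
  have noeth: "noetherian_ring S" using g by (simp add: gorenstein_ring_def)
  have cS: "cring S" by (rule is_cring)
  obtain I :: "nat \<Rightarrow> (('s \<times> 's) set, 'e) module" and \<eta> d n where res: "injective_resolution A (self_module A) I \<eta> d"
    and fin: "\<And>k. k > n \<Longrightarrow> carrier (I k) = {\<zero>\<^bsub>I k\<^esub>}"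
    using g Q unfolding gorenstein_ring_def finite_injective_dimension_def by blast
  note r = res[unfolded injective_resolution_def]
  have inj: "injective_module A (I k)" for k using r by blast
  have mod: "module A (I k)" for k using inj by (simp add: injective_module_def)
  have eta: "\<eta> \<in> module_hom A (self_module A) (I 0)" "inj_on \<eta> (carrier A)"
    "\<eta> ` carrier A = {x \<in> carrier (I 0). d 0 x = \<zero>\<^bsub>I 1\<^esub>}" using r by simp_all
  have d: "d k \<in> module_hom A (I k) (I (Suc k))" for k using r by blast
  have ex: "d k ` carrier (I k) = {x \<in> carrier (I (Suc k)). d (Suc k) x = \<zero>\<^bsub>I (Suc (Suc k))\<^esub>}" for k using r by blast
  interpret I: module A "I k" for k by (rule mod)
  let ?R = "\<lambda>k. restrict_scalars \<iota> (I k)"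
  have modR: "module S (?R k)" for k by (rule module_restrict_scalars[OF cS iota_hom mod])
  \<comment> \<open>All terms of \<open>J\<close> share the type of the resolution, so the zero
    module of index \<open>0\<close> is taken as the zero submodule of the first term.\<close>
  define T where "T = (?R 0)\<lparr>carrier := {\<zero>\<^bsub>I 0\<^esub>}\<rparr>"
  have modT: "module S T" unfolding T_def
    using submodule.submodule_is_module[OF submod_trivial[OF modR] modR, of 0] by simp
  have T: "carrier T = {\<zero>\<^bsub>I 0\<^esub>}" "\<zero>\<^bsub>T\<^esub> = \<zero>\<^bsub>I 0\<^esub>" by (simp_all add: T_def)
  define J where "J i = (case i of 0 \<Rightarrow> T | Suc k \<Rightarrow> ?R k)" for i
  define D where "D i = (case i of 0 \<Rightarrow> (\<lambda>_. \<zero>\<^bsub>I 0\<^esub>) | Suc k \<Rightarrow> d k)" for i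
  have J: "J 0 = T" "\<And>k. J (Suc k) = ?R k" by (simp_all add: J_def)
  have D: "D 0 = (\<lambda>_. \<zero>\<^bsub>I 0\<^esub>)" "\<And>k. D (Suc k) = d k" by (simp_all add: D_def)
  have dl: "d k \<in> lin A (I k) (carrier (I k)) (I (Suc k))" for k using d by (simp add: module_hom_eq_lin)
  have el: "\<eta> \<in> lin A (self_module A) (carrier A) (I 0)" using eta(1) by (simp add: module_hom_eq_lin)
  have d0: "d k \<zero>\<^bsub>I k\<^esub> = \<zero>\<^bsub>I (Suc k)\<^esub>" for k
    by (rule lin_zero[OF mod mod dl I.carrier_is_submodule])
  have one: "\<one>\<^bsub>A\<^esub> \<in> carrier A" by simp
  have ei: "\<eta> (\<iota> s \<otimes>\<^bsub>A\<^esub> x) = \<iota> s \<odot>\<^bsub>I 0\<^esub> \<eta> x" if "s \<in> carrier S" "x \<in> carrier A" for s x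
    using lin_smult[OF el iota_in_A[OF that(1)] that(2)] by simp
  \<comment> \<open>The bound grows by one with the shift of the index, and \<open>e\<close> is the
    image of \<open>1\<close> under the augmentation.\<close>
  have "inj_complex S Q J D (\<eta> \<one>\<^bsub>A\<^esub>) (Suc n)"
  proof (rule inj_complex.intro)
    show "noetherian_ring S" by fact
    show "primeideal Q S" by fact
    show "module S (J i)" for i by (cases i) (simp_all add: J modT modR)
    show "D i \<in> module_hom S (J i) (J (Suc i))" for i
    proof (cases i)
      case 0
      have "D 0 \<in> lin S (J 0) (carrier (J 0)) (J 1)" using modT modR[of 0] lin_const_zero[of S T "?R 0"] by (simp add: J D)
      then show ?thesis using 0 by (simp add: module_hom_eq_lin)
    qed (simp add: J D hom_restrict_scalars[OF iota_hom d])
    show "D (Suc i) (D i x) = \<zero>\<^bsub>J (Suc (Suc i))\<^esub>" if "x \<in> carrier (J i)" for x i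
    proof (cases i)
      case (Suc k)
      then have "d k x \<in> d k ` carrier (I k)" using that by (simp add: J)
      then show ?thesis using Suc ex[of k] by (simp add: J D)
    qed (simp add: J D d0)
    show "carrier (J 0) = {\<zero>\<^bsub>J 0\<^esub>}" by (simp add: J T)
    show "\<exists>y\<in>carrier (J (Suc i)). D (Suc i) y = x"
      if "x \<in> carrier (J (Suc (Suc i)))" "D (Suc (Suc i)) x = \<zero>\<^bsub>J (Suc (Suc (Suc i)))\<^esub>" for x i
    proof -
      have "x \<in> d i ` carrier (I i)" using ex[of i] that by (simp add: J D)
      then show ?thesis by (auto simp: J D)
    qed
    have "\<eta> \<one>\<^bsub>A\<^esub> \<in> \<eta> ` carrier A" using one by blast
    then show "\<eta> \<one>\<^bsub>A\<^esub> \<in> carrier (J 1)" "D 1 (\<eta> \<one>\<^bsub>A\<^esub>) = \<zero>\<^bsub>J 2\<^esub>"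
      unfolding eta(3) by (simp_all add: J D numeral_2_eq_2)
    show "\<exists>t\<in>carrier S - Q. \<exists>s\<in>carrier S. t \<odot>\<^bsub>J 1\<^esub> x = s \<odot>\<^bsub>J 1\<^esub> \<eta> \<one>\<^bsub>A\<^esub>"
      if "x \<in> carrier (J 1)" "D 1 x = \<zero>\<^bsub>J 2\<^esub>" for x
    proof -
      have "x \<in> \<eta> ` carrier A" unfolding eta(3) using that by (simp add: J D numeral_2_eq_2)
      then obtain s t where st: "s \<in> carrier S" "t \<in> carrier S - Q" "x = \<eta> (frac s t)" by (auto simp: carrier_A)
      have "\<iota> t \<odot>\<^bsub>I 0\<^esub> x = \<iota> s \<odot>\<^bsub>I 0\<^esub> \<eta> \<one>\<^bsub>A\<^esub>"
        using ei[of t "frac s t"] ei[OF st(1) one] iota_frac[OF st(1,2)] st frac_in_A[OF st(1,2)] iota_in_A[OF st(1)] by simp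
      then show ?thesis using st by (auto simp: J)
    qed
    show "\<exists>t\<in>carrier S - Q. t \<otimes>\<^bsub>S\<^esub> s = \<zero>\<^bsub>S\<^esub>" if s: "s \<in> carrier S" "s \<odot>\<^bsub>J 1\<^esub> \<eta> \<one>\<^bsub>A\<^esub> = \<zero>\<^bsub>J 1\<^esub>" for s
    proof -
      have "\<eta> (\<iota> s) = \<zero>\<^bsub>I 0\<^esub>" using ei[OF s(1) one] s(2) iota_in_A[OF s(1)] by (simp add: J)
      also have "\<dots> = \<eta> \<zero>\<^bsub>A\<^esub>"
        using lin_zero[OF module_self[OF I.R.is_cring] mod el] module.carrier_is_submodule[OF module_self[OF I.R.is_cring]] by simp
      finally have "\<iota> s = \<zero>\<^bsub>A\<^esub>" using eta(2) iota_in_A[OF s(1)] by (auto dest: inj_onD)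
      then show ?thesis
        using frac_eq_iff[OF s(1) one_notin zero_closed one_notin] s(1) by (auto simp: \<iota>_def zero_A)
    qed
    show "\<exists>x\<in>carrier (J i). \<forall>a\<in>K. g a = a \<odot>\<^bsub>J i\<^esub> x" if K: "ideal K S" "g \<in> lin S (self_module S) K (J i)" for K g i
    proof (cases i)
      case 0
      have "g a = \<zero>\<^bsub>T\<^esub>" if "a \<in> K" for a using lin_closed[OF K(2) that] 0 T J by simp
      moreover have "a \<odot>\<^bsub>T\<^esub> \<zero>\<^bsub>T\<^esub> = \<zero>\<^bsub>T\<^esub>" if "a \<in> K" for a
        using module.smult_r_null[OF modT] additive_subgroup.a_Hcarr[OF ideal.axioms(1)[OF K(1)] that] by blast
      ultimately show ?thesis using 0 T by (intro bexI[of _ "\<zero>\<^bsub>T\<^esub>"]) (simp_all add: J)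
    next
      case (Suc k)
      then show ?thesis using baer_localization[OF mod inj K(1), of g k] K(2) by (simp add: J)
    qed
    show "x = \<zero>\<^bsub>J i\<^esub>" if t: "t \<in> carrier S - Q" and x: "x \<in> carrier (J i)" "t \<odot>\<^bsub>J i\<^esub> x = \<zero>\<^bsub>J i\<^esub>" for t x i
    proof (cases i)
      case (Suc k)
      have "frac \<one>\<^bsub>S\<^esub> t \<in> carrier A" using t by (intro frac_in_A) auto
      then show ?thesis using iota_smult_inverse(2)[OF mod t, of x k] x Suc by (simp add: J)
    qed (use x in \<open>simp add: J T\<close>)
    show "\<exists>y\<in>carrier (J i). t \<odot>\<^bsub>J i\<^esub> y = x" if t: "t \<in> carrier S - Q" and x: "x \<in> carrier (J i)" for t x i
    proof (cases i)
      case 0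
      then show ?thesis using x t module.smult_r_null[OF modT, of t] by (auto simp: J T)
    next
      case (Suc k)
      have "frac \<one>\<^bsub>S\<^esub> t \<in> carrier A" using t by (intro frac_in_A) auto
      then show ?thesis using iota_smult_inverse(1)[OF mod t, of x k] x Suc
        by (intro bexI[of _ "frac \<one>\<^bsub>S\<^esub> t \<odot>\<^bsub>I k\<^esub> x"]) (simp_all add: J)
    qed
    show "carrier (J i) = {\<zero>\<^bsub>J i\<^esub>}" if "Suc n < i" for i
      using that fin by (cases i) (simp_all add: J)
  qed
  then show ?thesis using that by blast
qed

section \<open>The standard resolution\<close>

lemma (in abelian_group) minus_zero_right: "x \<in> carrier G \<Longrightarrow> x \<ominus> \<zero> = x"
  by (metis a_minus_def minus_equality r_zero zero_closed)

declare free_module_simps [simp del] carrier_free_module [simp del]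

lemma lin_free_codomain: "g \<in> lin S L Y (free_module S B) \<Longrightarrow> cring S \<Longrightarrow> B \<subseteq> C \<Longrightarrow> g \<in> lin S L Y (free_module S C)"
  using free_on_mono[of S B C]
  by (intro linI) (auto simp: lin_add lin_smult carrier_free_module free_module_simps dest!: lin_closed)

locale standard_resolution =
  fixes S :: "'s ring" and X :: "('s, 'm) module"
  assumes S: "cring S" and X: "module S X"
begin

sublocale S: cring S by (rule S)
sublocale X: module S X by (rule X)

abbreviation U :: "('s, ('s, 'm) gen \<Rightarrow> 's) module" where "U \<equiv> free_module S UNIV"
abbreviation F where "F n \<equiv> free_on S (res_basis S X n)"
abbreviation bas where "bas \<equiv> res_basis S X"
abbreviation bd where "bd \<equiv> res_bdry S X"
abbreviation eps :: "(('s, 'm) gen \<Rightarrow> 's) \<Rightarrow> 'm" where "eps \<equiv> lin_ext S X elt_val"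

lemma U: "module S U" by (rule module_free[OF S])

sublocale U: module S U by (rule U)

lemma F_sub: "submodule (F n) S U" by (rule submod_free_on[OF S subset_UNIV])

lemma F_U: "v \<in> F n \<Longrightarrow> v \<in> carrier U" by (rule submod_mem[OF U F_sub])

text \<open>Degree \<open>0\<close> takes the kernel of the augmentation, so that in every degree
  \<open>cyc n\<close> is the image of \<open>bd n\<close>.\<close>

fun cyc :: "nat \<Rightarrow> (('s, 'm) gen \<Rightarrow> 's) set" where
  "cyc 0 = {v \<in> F 0. eps v = \<zero>\<^bsub>X\<^esub>}"
| "cyc (Suc n) = {v \<in> F (Suc n). bd n v = \<zero>\<^bsub>U\<^esub>}"

lemma cyc_F: "v \<in> cyc n \<Longrightarrow> v \<in> F n"
  by (cases n) auto

section \<open>Values of formal linear combinations\<close>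

lemma comb_val_Cons:
  assumes "a \<in> carrier S" "comb_val S xs \<in> carrier U"
  shows "comb_val S ((a, b) # xs) = a \<odot>\<^bsub>U\<^esub> basis_vec S b \<oplus>\<^bsub>U\<^esub> comb_val S xs"
  using assms free_onD(1)[OF S, of "comb_val S xs" UNIV]
  by (auto simp: comb_val_def basis_vec_def free_module_simps carrier_free_module)

lemma comb_val_Nil: "comb_val S [] = \<zero>\<^bsub>U\<^esub>"
  by (simp add: comb_val_def free_module_simps)

lemma basis_U [simp]: "basis_vec S b \<in> carrier U"
  using basis_vec_free_on[OF S, of b UNIV] by (simp add: carrier_free_module)

lemma comb_val_mem:
  assumes "submodule W S U" "\<And>b. b \<in> B \<Longrightarrow> basis_vec S b \<in> W" "set xs \<subseteq> carrier S \<times> B"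
  shows "comb_val S xs \<in> W"
  using assms(3)
proof (induction xs)
  case (Cons x xs)
  then have W: "comb_val S xs \<in> W" "fst x \<in> carrier S" "snd x \<in> B" by auto
  then show ?case using comb_val_Cons[OF W(2) submod_mem[OF U assms(1) W(1)], of "snd x"] assms(2)[OF W(3)]
    by (simp add: submod_add[OF U assms(1)] submod_smult[OF U assms(1)])
qed (simp add: comb_val_Nil submod_zero[OF U assms(1)])

lemma comb_val_free:
  fixes B :: "('s, 'm) gen set"
  shows "set xs \<subseteq> carrier S \<times> B \<Longrightarrow> comb_val S xs \<in> free_on S B"
  by (rule comb_val_mem[OF submod_free_on[OF S subset_UNIV] basis_vec_free_on[OF S]])

text \<open>A linear map that sends basis vectors to basis vectors acts on a formal combination by
  relabelling it. The chain map on syzygies is of this kind.\<close>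

lemma lin_comb_val:
  fixes B :: "('s, 'm) gen set"
  assumes p: "p \<in> lin S U (free_on S B) U" and q: "\<And>b. b \<in> B \<Longrightarrow> p (basis_vec S b) = basis_vec S (q b)"
    and xs: "set xs \<subseteq> carrier S \<times> B"
  shows "p (comb_val S xs) = comb_val S (map (map_prod id q) xs)"
  using xs
proof (induction xs)
  case Nil
  show ?case using lin_zero[OF U U p submod_free_on[OF S subset_UNIV]] by (simp add: comb_val_Nil)
next
  case (Cons x xs)
  obtain a b where x: "x = (a, b)" by force
  have W: "comb_val S xs \<in> free_on S B" "a \<in> carrier S" "b \<in> B" using Cons.prems x comb_val_free[of xs B] by auto
  note FB = submod_free_on[OF S subset_UNIV, of B]
  have c: "comb_val S (map (map_prod id q) xs) \<in> carrier U"
  proof -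
    have "set (map (map_prod id q) xs) \<subseteq> carrier S \<times> UNIV" using Cons.prems by auto
    from comb_val_free[OF this] show ?thesis by (simp add: carrier_free_module)
  qed
  have "p (comb_val S (x # xs)) = p (a \<odot>\<^bsub>U\<^esub> basis_vec S b \<oplus>\<^bsub>U\<^esub> comb_val S xs)"
    using comb_val_Cons[OF W(2) submod_mem[OF U FB W(1)]] x by simp
  also have "\<dots> = a \<odot>\<^bsub>U\<^esub> basis_vec S (q b) \<oplus>\<^bsub>U\<^esub> p (comb_val S xs)"
    using W basis_vec_free_on[OF S W(3)] q[OF W(3)]
    by (simp add: lin_add[OF p] lin_smult[OF p] submod_smult[OF U FB])
  also have "\<dots> = comb_val S (map (map_prod id q) (x # xs))"
    using Cons W(2) x comb_val_Cons[OF W(2) c] by (simp add: id_def)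
  finally show ?case .
qed

text \<open>The source of exactness: every cycle is the value of some formal combination
  \<open>xs\<close>, hence the boundary of the basis vector of \<open>Syz xs\<close>.\<close>

lemma ex_comb_val:
  fixes B :: "('s, 'm) gen set"
  assumes v: "v \<in> free_on S B"
  shows "\<exists>xs. set xs \<subseteq> carrier S \<times> B \<and> comb_val S xs = v"
proof -
  let ?W = "{comb_val S xs | xs. set xs \<subseteq> carrier S \<times> B}"
  have U': "comb_val S xs \<in> carrier U" if "set xs \<subseteq> carrier S \<times> B" for xs
    using submod_mem[OF U submod_free_on[OF S subset_UNIV] comb_val_free[OF that]] .
  have app: "comb_val S (xs @ ys) = comb_val S xs \<oplus>\<^bsub>U\<^esub> comb_val S ys"
    if "set xs \<subseteq> carrier S \<times> B" "set ys \<subseteq> carrier S \<times> B" for xs ys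
    using that
  proof (induction xs)
    case (Cons x xs)
    obtain a b where x: "x = (a, b)" by force
    have H: "a \<in> carrier S" "set (xs @ ys) \<subseteq> carrier S \<times> B" "set xs \<subseteq> carrier S \<times> B" using Cons.prems x by auto
    show ?case using Cons.IH[OF H(3) Cons.prems(2)] comb_val_Cons[OF H(1) U'[OF H(2)]] comb_val_Cons[OF H(1) U'[OF H(3)]] x
      U'[OF H(3)] U'[OF Cons.prems(2)] H(1) by (simp add: U.a_assoc)
  qed (simp add: comb_val_Nil U')
  have sm: "comb_val S (map (map_prod (\<lambda>b. a \<otimes>\<^bsub>S\<^esub> b) id) xs) = a \<odot>\<^bsub>U\<^esub> comb_val S xs"
    if "a \<in> carrier S" "set xs \<subseteq> carrier S \<times> B" for a xs
    using that(2)
  proof (induction xs)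
    case (Cons x xs)
    obtain c b where x: "x = (c, b)" by force
    have H: "c \<in> carrier S" "set xs \<subseteq> carrier S \<times> B" "set (map (map_prod (\<lambda>b. a \<otimes>\<^bsub>S\<^esub> b) id) xs) \<subseteq> carrier S \<times> B"
      "a \<otimes>\<^bsub>S\<^esub> c \<in> carrier S"
      using Cons.prems x that(1) by auto
    show ?case using Cons.IH[OF H(2)] comb_val_Cons[OF H(4) U'[OF H(3)], of b] comb_val_Cons[OF H(1) U'[OF H(2)], of b] x
      U'[OF H(2)] H(1) that(1) by (simp add: U.smult_r_distr U.smult_assoc1 id_def)
  qed (simp add: comb_val_Nil that(1))
  have "submodule ?W S U"
  proof (rule submodI[OF U])
    show "?W \<subseteq> carrier U" using U' by blast
    show "\<zero>\<^bsub>U\<^esub> \<in> ?W" using comb_val_Nil by (intro CollectI exI[of _ "[]"]) simp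
    fix x y assume y: "y \<in> ?W"
    then obtain ys where ys: "y = comb_val S ys" "set ys \<subseteq> carrier S \<times> B" by blast
    { assume "x \<in> ?W"
      then obtain xs where xs: "x = comb_val S xs" "set xs \<subseteq> carrier S \<times> B" by blast
      have "set (xs @ ys) \<subseteq> carrier S \<times> B" using xs ys by simp
      then show "x \<oplus>\<^bsub>U\<^esub> y \<in> ?W" unfolding xs(1) ys(1) app[OF xs(2) ys(2), symmetric] by blast }
    { assume x: "x \<in> carrier S"
      have "set (map (map_prod (\<lambda>b. x \<otimes>\<^bsub>S\<^esub> b) id) ys) \<subseteq> carrier S \<times> B" using x ys by auto
      then show "x \<odot>\<^bsub>U\<^esub> y \<in> ?W" unfolding ys(1) sm[OF x ys(2), symmetric] by blast }
  qed
  moreover have "basis_vec S b \<in> ?W" if "b \<in> B" for b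
  proof -
    have "comb_val S [(\<one>\<^bsub>S\<^esub>, b)] = basis_vec S b" using comb_val_Cons[of "\<one>\<^bsub>S\<^esub>" "[]" b] by (simp add: comb_val_Nil)
    moreover have "set [(\<one>\<^bsub>S\<^esub>, b)] \<subseteq> carrier S \<times> B" using that by simp
    ultimately show ?thesis by (metis (mono_tags, lifting) mem_Collect_eq)
  qed
  ultimately show ?thesis using free_on_induct[OF S] v by blast
qed

section \<open>Exactness of the standard resolution\<close>

lemma eps_lin: "eps \<in> lin S U (F 0) X"
  by (rule lin_ext_lin[OF S X]) auto

lemma eps_basis: "x \<in> carrier X \<Longrightarrow> eps (basis_vec S (Elt x)) = x"
  using lin_ext_basis_vec[OF S X, of elt_val "Elt x"] by simp

text \<open>Merges the two successor equations of \<open>res_basis\<close>, which differ only in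
  whether cycles are detected by the augmentation or by a boundary.\<close>

lemma bas_Suc: "bas (Suc n) = {Syz xs | xs. set xs \<subseteq> carrier S \<times> bas n \<and> comb_val S xs \<in> cyc n}"
proof -
  have "set xs \<subseteq> carrier S \<times> bas n \<Longrightarrow> comb_val S xs \<in> F n" for xs by (rule comb_val_free)
  then show ?thesis by (cases n) (auto simp: res_bdry_def res_module_def free_module_simps)
qed

lemma bas_SucE:
  assumes "b \<in> bas (Suc n)"
  obtains xs where "b = Syz xs" "set xs \<subseteq> carrier S \<times> bas n" "comb_val S xs \<in> cyc n"
  using assms unfolding bas_Suc by blast

lemma syz_val_cyc: "b \<in> bas (Suc n) \<Longrightarrow> syz_val S b \<in> cyc n"
  by (erule bas_SucE) simp

lemma syz_val_F: "b \<in> bas (Suc n) \<Longrightarrow> syz_val S b \<in> F n"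
  by (rule cyc_F[OF syz_val_cyc])

lemma bd_lin: "bd n \<in> lin S U (F (Suc n)) U"
proof -
  have "bd n \<in> lin S U (F (Suc n)) (free_module S (bas n))"
    unfolding res_bdry_def res_module_def
    by (rule lin_ext_lin[OF S module_free[OF S]]) (use syz_val_F in \<open>simp add: carrier_free_module del: res_basis.simps\<close>)
  then show ?thesis by (rule lin_free_codomain[OF _ S subset_UNIV])
qed

lemma bd_basis: "b \<in> bas (Suc n) \<Longrightarrow> bd n (basis_vec S b) = syz_val S b"
  unfolding res_bdry_def res_module_def
  using lin_ext_basis_vec[OF S module_free[OF S], of "syz_val S" b "bas n"] syz_val_F[of b n]
  by (simp add: carrier_free_module del: res_basis.simps)

lemma cyc_sub: "submodule (cyc n) S U"
proof (cases n)
  case 0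
  then show ?thesis using submod_preimage[OF U X eps_lin F_sub submod_trivial[OF X]] by simp
next
  case (Suc k)
  then show ?thesis using submod_preimage[OF U U bd_lin F_sub submod_trivial[OF U]]
    by (simp del: res_basis.simps)
qed

lemma bd_cyc: "v \<in> F (Suc n) \<Longrightarrow> bd n v \<in> cyc n"
proof -
  assume v: "v \<in> F (Suc n)"
  have "F (Suc n) \<subseteq> {v \<in> F (Suc n). bd n v \<in> cyc n}"
    by (rule free_on_induct[OF S submod_preimage[OF U U bd_lin F_sub cyc_sub]])
      (use bd_basis syz_val_cyc basis_vec_free_on[OF S] in \<open>simp del: res_basis.simps cyc.simps\<close>)
  then show ?thesis using v by blast
qed

lemma bd_F: "v \<in> F (Suc n) \<Longrightarrow> bd n v \<in> F n"
  by (rule cyc_F[OF bd_cyc])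

lemma bd_surj: "c \<in> cyc n \<Longrightarrow> \<exists>v\<in>F (Suc n). bd n v = c"
proof -
  assume c: "c \<in> cyc n"
  obtain xs where xs: "set xs \<subseteq> carrier S \<times> bas n" "comb_val S xs = c" using ex_comb_val[OF cyc_F[OF c]] by blast
  then have b: "Syz xs \<in> bas (Suc n)" using c unfolding bas_Suc by blast
  show ?thesis using basis_vec_free_on[OF S b] bd_basis[OF b] xs by (intro bexI[of _ "basis_vec S (Syz xs)"]) simp_all
qed

lemma eps_cyc: "v \<in> cyc 0 \<Longrightarrow> eps v = \<zero>\<^bsub>X\<^esub>" and bd_cyc_zero: "v \<in> cyc (Suc n) \<Longrightarrow> bd n v = \<zero>\<^bsub>U\<^esub>"
  by simp_all

lemma cyc_SucI: "v \<in> F (Suc n) \<Longrightarrow> bd n v = \<zero>\<^bsub>U\<^esub> \<Longrightarrow> v \<in> cyc (Suc n)"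
  by simp

lemma cyc_0I: "v \<in> F 0 \<Longrightarrow> eps v = \<zero>\<^bsub>X\<^esub> \<Longrightarrow> v \<in> cyc 0"
  by simp

declare cyc.simps [simp del] res_basis.simps [simp del]

text \<open>Projectivity of free modules: preimages are chosen on the basis, within the prescribed
  submodule \<open>W\<close>.\<close>

lemma lift_free:
  assumes p: "p \<in> lin S U (free_on S B) U" "\<And>v. v \<in> free_on S B \<Longrightarrow> p v \<in> d ` W" and d: "d \<in> lin S U V U" and W: "submodule W S U" "W \<subseteq> V"
  obtains q where "q \<in> lin S U (free_on S B) U" "\<And>v. v \<in> free_on S B \<Longrightarrow> q v \<in> W" "\<And>v. v \<in> free_on S B \<Longrightarrow> d (q v) = p v"
proof -
  have "\<exists>w\<in>W. d w = p (basis_vec S b)" if "b \<in> B" for b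
    using p(2)[OF basis_vec_free_on[OF S that]] by force
  then obtain g where g: "\<And>b. b \<in> B \<Longrightarrow> g b \<in> W" "\<And>b. b \<in> B \<Longrightarrow> d (g b) = p (basis_vec S b)" by metis
  have gU: "g b \<in> carrier U" if "b \<in> B" for b using submod_mem[OF U W(1) g(1)[OF that]] .
  have q: "lin_ext S U g \<in> lin S U (free_on S B) U" by (rule lin_ext_lin[OF S U gU])
  have qW: "lin_ext S U g v \<in> W" if "v \<in> free_on S B" for v by (rule lin_ext_mem[OF S U W(1) g(1) that])
  have "d (lin_ext S U g v) = p v" if "v \<in> free_on S B" for v
  proof (rule free_on_lin_eq[OF S U _ p(1) _ subset_UNIV that])
    show "(\<lambda>v. d (lin_ext S U g v)) \<in> lin S U (free_on S B) U"
      by (rule lin_comp[OF q _ d]) (use qW W(2) in blast)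
    show "d (lin_ext S U g (basis_vec S b)) = p (basis_vec S b)" if "b \<in> B" for b
      using lin_ext_basis_vec[OF S U, of g b] gU[OF that] g(2)[OF that] by simp
  qed
  then show ?thesis using that q qW by blast
qed

subsection \<open>Multiplication by a scalar\<close>

context
  fixes s :: 's and h :: "'m \<Rightarrow> 'm"
  assumes s: "s \<in> carrier S" and h: "\<And>x. x \<in> carrier X \<Longrightarrow> h x = s \<odot>\<^bsub>X\<^esub> x"
begin

abbreviation rm where "rm \<equiv> res_map S X h"

text \<open>The claims depend on each other across degrees: \<open>map_gen\<close> respects the
  basis of degree \<open>Suc n\<close> because the chain map of degree \<open>n\<close> preserves
  cycles, and cycles of degree \<open>Suc n\<close> are then preserved because the chain map
  commutes with the boundary. In degree \<open>0\<close> the augmentation turns the chain map into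
  multiplication by \<open>s\<close>.\<close>

lemma res_map_facts:
  shows "b \<in> bas n \<Longrightarrow> map_gen id h b \<in> bas n"
    and "v \<in> cyc n \<Longrightarrow> rm n v \<in> cyc n" and "rm n \<in> lin S U (F n) U" "v \<in> F n \<Longrightarrow> rm n v \<in> F n"
    and "b \<in> bas n \<Longrightarrow> rm n (basis_vec S b) = basis_vec S (map_gen id h b)"
    and "w \<in> F (Suc n) \<Longrightarrow> bd n (rm (Suc n) w) = rm n (bd n w)"
proof -
  have gen: "rm n \<in> lin S U (F n) U \<and> (\<forall>v\<in>F n. rm n v \<in> F n) \<and> (\<forall>b\<in>bas n. rm n (basis_vec S b) = basis_vec S (map_gen id h b))"
    if m: "\<And>b. b \<in> bas n \<Longrightarrow> map_gen id h b \<in> bas n" for n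
  proof (intro conjI ballI)
    let ?N = "free_module S (bas n)"
    have g: "basis_vec S (map_gen id h b) \<in> carrier ?N" if "b \<in> bas n" for b
      using basis_vec_free_on[OF S m[OF that]] by (simp add: carrier_free_module)
    have l: "rm n \<in> lin S U (F n) ?N" unfolding res_map_def res_module_def
      by (rule lin_ext_lin[OF S module_free[OF S] g])
    then show "rm n \<in> lin S U (F n) U" by (rule lin_free_codomain[OF _ S subset_UNIV])
    show "rm n v \<in> F n" if "v \<in> F n" for v using lin_closed[OF l that] by (simp add: carrier_free_module)
    show "rm n (basis_vec S b) = basis_vec S (map_gen id h b)" if "b \<in> bas n" for b
      unfolding res_map_def res_module_def
      using lin_ext_basis_vec[OF S module_free[OF S], of "\<lambda>b. basis_vec S (map_gen id h b)" b "bas n"] g[OF that] by simp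
  qed
  have nxt: "(\<forall>b\<in>bas (Suc n). map_gen id h b \<in> bas (Suc n)) \<and> (\<forall>v\<in>F (Suc n). bd n (rm (Suc n) v) = rm n (bd n v))"
    if A: "(\<forall>b\<in>bas n. map_gen id h b \<in> bas n) \<and> (\<forall>v\<in>cyc n. rm n v \<in> cyc n)" for n
  proof -
    have g: "rm n \<in> lin S U (F n) U" "\<And>b. b \<in> bas n \<Longrightarrow> rm n (basis_vec S b) = basis_vec S (map_gen id h b)"
      using gen[of n] A by blast+
    have cv: "rm n (comb_val S xs) = comb_val S (map (map_prod id (map_gen id h)) xs)" if "set xs \<subseteq> carrier S \<times> bas n" for xs
      by (rule lin_comb_val[OF g that])
    have m: "map_gen id h b \<in> bas (Suc n) \<and> syz_val S (map_gen id h b) = rm n (syz_val S b)" if b: "b \<in> bas (Suc n)" for b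
    proof -
      obtain xs where xs: "b = Syz xs" "set xs \<subseteq> carrier S \<times> bas n" "comb_val S xs \<in> cyc n" using bas_SucE[OF b] by blast
      have "set (map (map_prod id (map_gen id h)) xs) \<subseteq> carrier S \<times> bas n" using xs(2) A by auto
      moreover have "comb_val S (map (map_prod id (map_gen id h)) xs) \<in> cyc n" using cv[OF xs(2)] A xs(3) by auto
      ultimately show ?thesis unfolding bas_Suc xs(1) using cv[OF xs(2)] by auto
    qed
    have g': "rm (Suc n) \<in> lin S U (F (Suc n)) U" "\<And>v. v \<in> F (Suc n) \<Longrightarrow> rm (Suc n) v \<in> F (Suc n)"
      "\<And>b. b \<in> bas (Suc n) \<Longrightarrow> rm (Suc n) (basis_vec S b) = basis_vec S (map_gen id h b)" using gen[of "Suc n"] m by blast+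
    have "bd n (rm (Suc n) v) = rm n (bd n v)" if v: "v \<in> F (Suc n)" for v
    proof (rule free_on_lin_eq[OF S U _ _ _ subset_UNIV v])
      show "(\<lambda>v. bd n (rm (Suc n) v)) \<in> lin S U (F (Suc n)) U" by (rule lin_comp[OF g'(1) _ bd_lin]) (use g'(2) in blast)
      show "(\<lambda>v. rm n (bd n v)) \<in> lin S U (F (Suc n)) U" by (rule lin_comp[OF bd_lin _ g(1)]) (use bd_F in blast)
      show "bd n (rm (Suc n) (basis_vec S b)) = rm n (bd n (basis_vec S b))" if "b \<in> bas (Suc n)" for b
        using g'(3)[OF that] m[OF that] bd_basis that by simp
    qed
    then show ?thesis using m by blast
  qed
  have main: "(\<forall>b\<in>bas n. map_gen id h b \<in> bas n) \<and> (\<forall>v\<in>cyc n. rm n v \<in> cyc n)" for n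
  proof (induction n)
    case 0
    have m: "map_gen id h b \<in> bas 0" if "b \<in> bas 0" for b using that h s by (auto simp: res_basis.simps)
    note g = gen[OF m]
    have e: "eps (rm 0 v) = s \<odot>\<^bsub>X\<^esub> eps v" if v: "v \<in> F 0" for v
    proof (rule free_on_lin_eq[OF S X _ lin_scale[OF U X eps_lin s] _ subset_UNIV v])
      show "(\<lambda>v. eps (rm 0 v)) \<in> lin S U (F 0) X" by (rule lin_comp[OF _ _ eps_lin]) (use g in auto)
      fix b assume b: "b \<in> bas 0"
      then obtain x where x: "b = Elt x" "x \<in> carrier X" by (auto simp: res_basis.simps)
      then show "eps (rm 0 (basis_vec S b)) = s \<odot>\<^bsub>X\<^esub> eps (basis_vec S b)"
        using g b eps_basis[OF x(2)] eps_basis[of "h x"] h[OF x(2)] s by simp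
    qed
    have c: "rm 0 v \<in> cyc 0" if "v \<in> cyc 0" for v
      using cyc_0I[of "rm 0 v"] g cyc_F[OF that] e[OF cyc_F[OF that]] eps_cyc[OF that] s by simp
    show ?case using m c by blast
  next
    case (Suc n)
    note N = nxt[OF Suc]
    have g: "rm n \<in> lin S U (F n) U" using gen[of n] Suc by blast
    have g': "rm (Suc n) v \<in> F (Suc n)" if "v \<in> F (Suc n)" for v using gen[of "Suc n"] N that by blast
    have "rm (Suc n) v \<in> cyc (Suc n)" if v: "v \<in> cyc (Suc n)" for v
    proof (rule cyc_SucI[OF g'[OF cyc_F[OF v]]])
      show "bd n (rm (Suc n) v) = \<zero>\<^bsub>U\<^esub>"
        using N cyc_F[OF v] bd_cyc_zero[OF v] lin_zero[OF U U g F_sub] by simp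
    qed
    then show ?case using N by blast
  qed
  show "b \<in> bas n \<Longrightarrow> map_gen id h b \<in> bas n" "v \<in> cyc n \<Longrightarrow> rm n v \<in> cyc n"
    "w \<in> F (Suc n) \<Longrightarrow> bd n (rm (Suc n) w) = rm n (bd n w)" using main[of n] nxt[OF main] by blast+
  show "rm n \<in> lin S U (F n) U" "v \<in> F n \<Longrightarrow> rm n v \<in> F n" "b \<in> bas n \<Longrightarrow> rm n (basis_vec S b) = basis_vec S (map_gen id h b)"
    using gen main by blast+
qed

text \<open>The chain map \<open>rm\<close> and the multiplication by \<open>s\<close> lift the same map \<open>h\<close>, hence are homotopic.
  The map \<open>\<kappa>\<close> is the half of the homotopy that survives composition with a cocycle.\<close>

lemma res_map_homotopic:
  "\<exists>\<kappa>\<in>lin S U (F n) U. (\<forall>v\<in>F n. \<kappa> v \<in> F n) \<and> (\<forall>c\<in>cyc n. \<kappa> c = \<zero>\<^bsub>U\<^esub>) \<and>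
     (case n of 0 \<Rightarrow> \<forall>v\<in>F n. \<kappa> v = \<zero>\<^bsub>U\<^esub>
        | Suc m \<Rightarrow> \<exists>k\<in>lin S U (F m) U. (\<forall>v\<in>F m. k v \<in> F n) \<and> (\<forall>v\<in>F n. \<kappa> v = k (bd m v))) \<and>
     (\<forall>v\<in>F n. (rm n v \<ominus>\<^bsub>U\<^esub> s \<odot>\<^bsub>U\<^esub> v) \<ominus>\<^bsub>U\<^esub> \<kappa> v \<in> cyc n)"
proof (induction n)
  case 0
  have eq: "eps (rm 0 v) = s \<odot>\<^bsub>X\<^esub> eps v" if v: "v \<in> F 0" for v
  proof (rule free_on_lin_eq[OF S X _ lin_scale[OF U X eps_lin s] _ subset_UNIV v])
    show "(\<lambda>v. eps (rm 0 v)) \<in> lin S U (F 0) X" by (rule lin_comp[OF _ _ eps_lin]) (use res_map_facts in auto)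
    fix b assume b: "b \<in> bas 0"
    then obtain x where x: "b = Elt x" "x \<in> carrier X" by (auto simp: res_basis.simps)
    then show "eps (rm 0 (basis_vec S b)) = s \<odot>\<^bsub>X\<^esub> eps (basis_vec S b)"
      using res_map_facts(5)[OF b] eps_basis[OF x(2)] eps_basis[of "h x"] h[OF x(2)] s by simp
  qed
  have "(rm 0 v \<ominus>\<^bsub>U\<^esub> s \<odot>\<^bsub>U\<^esub> v) \<ominus>\<^bsub>U\<^esub> \<zero>\<^bsub>U\<^esub> \<in> cyc 0" if v: "v \<in> F 0" for v
  proof -
    note m = res_map_facts(4)[OF v] submod_smult[OF U F_sub s v]
    have d: "rm 0 v \<ominus>\<^bsub>U\<^esub> s \<odot>\<^bsub>U\<^esub> v \<in> F 0" by (rule submod_diff[OF U F_sub m])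
    have "eps (rm 0 v \<ominus>\<^bsub>U\<^esub> s \<odot>\<^bsub>U\<^esub> v) = \<zero>\<^bsub>X\<^esub>"
      using lin_diff[OF U X eps_lin F_sub m] eq[OF v] lin_smult[OF eps_lin s v] lin_closed[OF eps_lin v] s
      by (simp add: a_minus_def X.r_neg)
    moreover have "(rm 0 v \<ominus>\<^bsub>U\<^esub> s \<odot>\<^bsub>U\<^esub> v) \<ominus>\<^bsub>U\<^esub> \<zero>\<^bsub>U\<^esub> = rm 0 v \<ominus>\<^bsub>U\<^esub> s \<odot>\<^bsub>U\<^esub> v"
      by (rule U.minus_zero_right[OF F_U[OF d]])
    ultimately show ?thesis using cyc_0I[OF d] by simp
  qed
  then show ?case
    by (intro bexI[of _ "\<lambda>_. \<zero>\<^bsub>U\<^esub>"]) (simp_all add: lin_const_zero[OF U U] submod_zero[OF U F_sub])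
next
  case (Suc n)
  then obtain \<kappa> where \<kappa>: "\<kappa> \<in> lin S U (F n) U" "\<And>v. v \<in> F n \<Longrightarrow> \<kappa> v \<in> F n" "\<And>c. c \<in> cyc n \<Longrightarrow> \<kappa> c = \<zero>\<^bsub>U\<^esub>"
    "\<And>v. v \<in> F n \<Longrightarrow> (rm n v \<ominus>\<^bsub>U\<^esub> s \<odot>\<^bsub>U\<^esub> v) \<ominus>\<^bsub>U\<^esub> \<kappa> v \<in> cyc n" by blast
  let ?\<delta> = "\<lambda>v. rm n v \<ominus>\<^bsub>U\<^esub> s \<odot>\<^bsub>U\<^esub> v"
  have \<delta>: "?\<delta> \<in> lin S U (F n) U" by (rule lin_minus[OF U U res_map_facts(3) lin_smult_scalar[OF U F_sub s]])
  \<comment> \<open>The difference of the two chain maps, less the half of the homotopy already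
    built, has values in cycles. These are boundaries, so it lifts through \<open>bd n\<close>, and
    the lift supplies the next half.\<close>
  obtain k where k: "k \<in> lin S U (F n) U" "\<And>v. v \<in> F n \<Longrightarrow> k v \<in> F (Suc n)" "\<And>v. v \<in> F n \<Longrightarrow> bd n (k v) = ?\<delta> v \<ominus>\<^bsub>U\<^esub> \<kappa> v"
  proof (rule lift_free[OF lin_minus[OF U U \<delta> \<kappa>(1)] _ bd_lin F_sub order_refl])
    show "?\<delta> v \<ominus>\<^bsub>U\<^esub> \<kappa> v \<in> bd n ` F (Suc n)" if "v \<in> F n" for v using bd_surj[OF \<kappa>(4)[OF that]] by force
  next
    fix q assume "q \<in> lin S U (F n) U" "\<And>v. v \<in> F n \<Longrightarrow> q v \<in> F (Suc n)" "\<And>v. v \<in> F n \<Longrightarrow> bd n (q v) = ?\<delta> v \<ominus>\<^bsub>U\<^esub> \<kappa> v"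
    then show thesis by (rule that)
  qed
  let ?\<kappa> = "\<lambda>v. k (bd n v)"
  have \<kappa>': "?\<kappa> \<in> lin S U (F (Suc n)) U" by (rule lin_comp[OF bd_lin _ k(1)]) (use bd_F in blast)
  have "(rm (Suc n) v \<ominus>\<^bsub>U\<^esub> s \<odot>\<^bsub>U\<^esub> v) \<ominus>\<^bsub>U\<^esub> ?\<kappa> v \<in> cyc (Suc n)" if v: "v \<in> F (Suc n)" for v
  proof -
    note bv = bd_F[OF v]
    note m = res_map_facts(4)[OF v] submod_smult[OF U F_sub s v]
    note d = submod_diff[OF U F_sub m]
    note e = submod_diff[OF U F_sub d k(2)[OF bv]]
    have "bd n ((rm (Suc n) v \<ominus>\<^bsub>U\<^esub> s \<odot>\<^bsub>U\<^esub> v) \<ominus>\<^bsub>U\<^esub> ?\<kappa> v) = ?\<delta> (bd n v) \<ominus>\<^bsub>U\<^esub> (?\<delta> (bd n v) \<ominus>\<^bsub>U\<^esub> \<kappa> (bd n v))"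
      using lin_diff[OF U U bd_lin F_sub d k(2)[OF bv]] lin_diff[OF U U bd_lin F_sub m] lin_smult[OF bd_lin s v]
        res_map_facts(6)[OF v] k(3)[OF bv] by simp
    \<comment> \<open>On the boundary of \<open>v\<close>, which is a cycle, \<open>\<kappa>\<close>
      vanishes, so the two differences cancel.\<close>
    also have "\<dots> = \<zero>\<^bsub>U\<^esub>" using \<kappa>(3)[OF bd_cyc[OF v]] lin_closed[OF \<delta> bv] U.minus_eq_zero_iff
      by (simp add: U.minus_zero_right)
    finally show ?thesis by (rule cyc_SucI[OF e])
  qed
  moreover have "?\<kappa> c = \<zero>\<^bsub>U\<^esub>" if "c \<in> cyc (Suc n)" for c
    using bd_cyc_zero[OF that] lin_zero[OF U U k(1) F_sub] by simp
  moreover have "\<forall>v\<in>F (Suc n). ?\<kappa> v \<in> F (Suc n)" using k(2) bd_F by blast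
  ultimately show ?case using \<kappa>' k(1,2) by (intro bexI[of _ ?\<kappa>]) (simp_all, blast)
qed

end

end

section \<open>A finite subresolution\<close>

context standard_resolution
begin

definition subcyc :: "(nat \<Rightarrow> ('s, 'm) gen set) \<Rightarrow> nat \<Rightarrow> (('s, 'm) gen \<Rightarrow> 's) set" where
  "subcyc B n = cyc n \<inter> free_on S (B n)"

definition subresolution :: "(nat \<Rightarrow> ('s, 'm) gen set) \<Rightarrow> bool" where
  "subresolution B \<longleftrightarrow> (\<forall>n. finite (B n) \<and> B n \<subseteq> bas n) \<and> eps ` free_on S (B 0) = carrier X \<and>
    (\<forall>n. bd n ` free_on S (B (Suc n)) = cyc n \<inter> free_on S (B n))"

lemma sub_Int: "submodule V S U \<Longrightarrow> submodule W S U \<Longrightarrow> submodule (V \<inter> W) S U"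
  by (rule submodI[OF U]) (auto simp: submod_facts[OF U])

text \<open>Cycles in a free module of finite rank over a noetherian ring are finitely generated.
  Each generator is written as a formal combination of the indices already chosen, and this list
  names a basis element of the standard resolution one degree higher.\<close>

lemma ex_subresolution:
  assumes noeth: "noetherian_ring S" and fg: "finite G" "G \<subseteq> carrier X" "\<And>N. submodule N S X \<Longrightarrow> G \<subseteq> N \<Longrightarrow> N = carrier X"
  obtains B where "subresolution B"
proof -
  define P where "P n C \<longleftrightarrow> finite C \<and> C \<subseteq> bas n \<and> (n = 0 \<longrightarrow> C = Elt ` G)" for n C
  define R where "R n C C' \<longleftrightarrow> bd n ` free_on S C' = cyc n \<inter> free_on S C" for n C C'
  have "\<exists>B. \<forall>n. P n (B n) \<and> R n (B n) (B (Suc n))"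
  proof (rule dependent_nat_choice)
    show "\<exists>C. P 0 C" using fg by (auto simp: P_def res_basis.simps)
    fix C n assume "P n C"
    then have C: "finite C \<and> C \<subseteq> bas n" by (simp add: P_def)
    let ?K = "cyc n \<inter> free_on S C"
    have Ks: "submodule ?K S U" by (rule sub_Int[OF cyc_sub submod_free_on[OF S subset_UNIV]])
    have nK: "noeth_sub S U ?K"
      by (rule noeth_sub_subset[OF noeth_sub_free[OF S noeth _ subset_UNIV] Ks, of C]) (use C in auto)
    obtain V where V: "finite V" "V \<subseteq> ?K" "\<And>N. submodule N S U \<Longrightarrow> V \<subseteq> N \<Longrightarrow> ?K \<subseteq> N"
      using noeth_sub_finite_gen[OF U nK] by metis
    have "\<exists>xs. set xs \<subseteq> carrier S \<times> C \<and> comb_val S xs = v" if "v \<in> V" for v using ex_comb_val V(2) that by blast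
    then obtain xs where xs: "\<And>v. v \<in> V \<Longrightarrow> set (xs v) \<subseteq> carrier S \<times> C" "\<And>v. v \<in> V \<Longrightarrow> comb_val S (xs v) = v" by metis
    let ?C = "(\<lambda>v. Syz (xs v)) ` V"
    have b: "Syz (xs v) \<in> bas (Suc n)" if "v \<in> V" for v
    proof -
      have "carrier S \<times> C \<subseteq> carrier S \<times> bas n" using C by auto
      then have "set (xs v) \<subseteq> carrier S \<times> bas n" by (rule subset_trans[OF xs(1)[OF that]])
      moreover have "comb_val S (xs v) \<in> cyc n" using xs(2)[OF that] subsetD[OF V(2) that] by simp
      ultimately show ?thesis unfolding bas_Suc by (intro CollectI exI conjI) simp_all
    qed
    have bv: "bd n (basis_vec S (Syz (xs v))) = v" if "v \<in> V" for v using bd_basis[OF b[OF that]] xs(2)[OF that] by simp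
    have Cb: "?C \<subseteq> bas (Suc n)" using b by blast
    have l: "bd n \<in> lin S U (free_on S ?C) U" by (rule lin_subset[OF bd_lin free_on_mono[OF S Cb]])
    have "bd n ` free_on S ?C = ?K"
    proof
      have "free_on S ?C \<subseteq> {v \<in> free_on S ?C. bd n v \<in> ?K}"
        by (rule free_on_induct[OF S submod_preimage[OF U U l submod_free_on[OF S subset_UNIV] Ks]])
          (use bv V(2) in \<open>auto intro!: basis_vec_free_on[OF S]\<close>)
      then show "bd n ` free_on S ?C \<subseteq> ?K" by blast
      show "?K \<subseteq> bd n ` free_on S ?C"
      proof (rule V(3)[OF submod_image[OF U U l submod_free_on[OF S subset_UNIV]]], rule subsetI)
        fix v assume v: "v \<in> V"
        then have "basis_vec S (Syz (xs v)) \<in> free_on S ?C" by (intro basis_vec_free_on[OF S]) blast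
        then show "v \<in> bd n ` free_on S ?C" using bv[OF v] by force
      qed
    qed
    then show "\<exists>C'. P (Suc n) C' \<and> R n C C'"
      using V(1) Cb unfolding P_def R_def by (intro exI[of _ ?C]) blast
  qed
  then obtain B where PR: "\<And>n. P n (B n)" "\<And>n. R n (B n) (B (Suc n))" by blast
  have B: "\<And>n. finite (B n)" "\<And>n. B n \<subseteq> bas n" "B 0 = Elt ` G"
    "\<And>n. bd n ` free_on S (B (Suc n)) = cyc n \<inter> free_on S (B n)" using PR by (simp_all add: P_def R_def)
  have l: "eps \<in> lin S U (free_on S (B 0)) X" by (rule lin_subset[OF eps_lin free_on_mono[OF S B(2)]])
  have "eps ` free_on S (B 0) = carrier X"
  proof (rule fg(3)[OF submod_image[OF U X l submod_free_on[OF S subset_UNIV]]], rule subsetI)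
    fix x assume x: "x \<in> G"
    then have "basis_vec S (Elt x) \<in> free_on S (B 0)" using B(3) by (intro basis_vec_free_on[OF S]) blast
    moreover have "eps (basis_vec S (Elt x)) = x" using eps_basis x fg(2) by blast
    ultimately show "x \<in> eps ` free_on S (B 0)" by force
  qed
  then have "subresolution B" unfolding subresolution_def using B by blast
  then show ?thesis by (rule that)
qed

context
  fixes B :: "nat \<Rightarrow> ('s, 'm) gen set"
  assumes B: "subresolution B"
begin

abbreviation G where "G n \<equiv> free_on S (B n)"

lemma sub_facts: "finite (B n)" "B n \<subseteq> bas n" "eps ` G 0 = carrier X" "bd n ` G (Suc n) = cyc n \<inter> G n"
  using B unfolding subresolution_def by blast+

lemma G_sub: "submodule (G n) S U" by (rule submod_free_on[OF S subset_UNIV])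

lemma G_F: "G n \<subseteq> F n" by (rule free_on_mono[OF S sub_facts(2)])

text \<open>Since \<open>G\<close> is spanned by part of the standard basis, a lift of the identity of \<open>X\<close> can be
  chosen to fix \<open>G\<close> pointwise, so that \<open>G\<close> is a retract and not merely homotopy equivalent to \<open>F\<close>.\<close>

lemma ex_retraction:
  "\<exists>u\<in>lin S U (F n) U. (\<forall>v\<in>F n. u v \<in> G n) \<and> (\<forall>v\<in>G n. u v = v) \<and> (\<forall>v\<in>cyc n. u v \<in> cyc n)"
proof (induction n)
  case 0
  have "\<exists>w\<in>G 0. eps w = eps (basis_vec S b) \<and> (b \<in> B 0 \<longrightarrow> w = basis_vec S b)" if b: "b \<in> bas 0" for b
  proof (cases "b \<in> B 0")
    case True then show ?thesis using basis_vec_free_on[OF S True] by blast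
  next
    case False
    have "eps (basis_vec S b) \<in> eps ` G 0" unfolding sub_facts(3) using lin_closed[OF eps_lin basis_vec_free_on[OF S b]] .
    then show ?thesis using False by force
  qed
  then obtain g where g': "\<forall>b\<in>bas 0. g b \<in> G 0 \<and> eps (g b) = eps (basis_vec S b) \<and> (b \<in> B 0 \<longrightarrow> g b = basis_vec S b)"
    by metis
  then have g: "\<And>b. b \<in> bas 0 \<Longrightarrow> g b \<in> G 0" "\<And>b. b \<in> bas 0 \<Longrightarrow> eps (g b) = eps (basis_vec S b)"
    "\<And>b. b \<in> B 0 \<Longrightarrow> g b = basis_vec S b" using sub_facts(2)[of 0] by blast+
  have gU: "g b \<in> carrier U" if "b \<in> bas 0" for b using submod_mem[OF U G_sub g(1)[OF that]] .
  let ?u = "lin_ext S U g"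
  have u: "?u \<in> lin S U (F 0) U" by (rule lin_ext_lin[OF S U gU])
  have uG: "?u v \<in> G 0" if "v \<in> F 0" for v by (rule lin_ext_mem[OF S U G_sub g(1) that])
  have ub: "?u (basis_vec S b) = g b" if "b \<in> bas 0" for b
    using lin_ext_basis_vec[OF S U, of g b] gU[OF that] by simp
  have "?u v = id v" if "v \<in> G 0" for v
    by (rule free_on_lin_eq[OF S U lin_subset[OF u G_F] _ _ subset_UNIV that])
      (use ub g(3) sub_facts(2)[of 0] submod_mem[OF U G_sub] in \<open>auto intro: linI\<close>)
  moreover have e: "eps (?u v) = eps v" if "v \<in> F 0" for v
  proof (rule free_on_lin_eq[OF S X _ eps_lin _ subset_UNIV that])
    show "(\<lambda>v. eps (?u v)) \<in> lin S U (F 0) X" by (rule lin_comp[OF u _ eps_lin]) (use uG G_F in blast)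
  qed (simp add: ub g)
  moreover have "?u v \<in> cyc 0" if "v \<in> cyc 0" for v
    using cyc_0I[of "?u v"] uG[OF cyc_F[OF that]] G_F e[OF cyc_F[OF that]] eps_cyc[OF that] by auto
  ultimately show ?case using u uG by (intro bexI[of _ ?u]) auto
next
  case (Suc n)
  then obtain w where w: "w \<in> lin S U (F n) U" "\<And>v. v \<in> F n \<Longrightarrow> w v \<in> G n" "\<And>v. v \<in> G n \<Longrightarrow> w v = v" "\<And>v. v \<in> cyc n \<Longrightarrow> w v \<in> cyc n" by blast
  have "\<exists>x\<in>G (Suc n). bd n x = w (bd n (basis_vec S b)) \<and> (b \<in> B (Suc n) \<longrightarrow> x = basis_vec S b)" if b: "b \<in> bas (Suc n)" for b
  proof (cases "b \<in> B (Suc n)")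
    case True
    have bG: "basis_vec S b \<in> G (Suc n)" by (rule basis_vec_free_on[OF S True])
    then have "bd n (basis_vec S b) \<in> G n" using sub_facts(4)[of n] by blast
    then show ?thesis using bG w(3) by (intro bexI[of _ "basis_vec S b"]) simp_all
  next
    case False
    note bF = basis_vec_free_on[OF S b]
    \<comment> \<open>The retraction one degree below preserves cycles and lands in
      \<open>G n\<close>, and cycles in \<open>G n\<close> are boundaries from
      \<open>G (Suc n)\<close>.\<close>
    have "w (bd n (basis_vec S b)) \<in> bd n ` G (Suc n)" unfolding sub_facts(4)
      using w(2)[OF bd_F[OF bF]] w(4)[OF bd_cyc[OF bF]] by blast
    then show ?thesis using False by force
  qed
  then obtain g where g: "\<And>b. b \<in> bas (Suc n) \<Longrightarrow> g b \<in> G (Suc n)" "\<And>b. b \<in> bas (Suc n) \<Longrightarrow> bd n (g b) = w (bd n (basis_vec S b))"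
    "\<And>b. b \<in> B (Suc n) \<Longrightarrow> g b = basis_vec S b" using sub_facts(2)[of "Suc n"] by (metis subsetD)
  have gU: "g b \<in> carrier U" if "b \<in> bas (Suc n)" for b using submod_mem[OF U G_sub g(1)[OF that]] .
  let ?u = "lin_ext S U g"
  have u: "?u \<in> lin S U (F (Suc n)) U" by (rule lin_ext_lin[OF S U gU])
  have uG: "?u v \<in> G (Suc n)" if "v \<in> F (Suc n)" for v by (rule lin_ext_mem[OF S U G_sub g(1) that])
  have ub: "?u (basis_vec S b) = g b" if "b \<in> bas (Suc n)" for b
    using lin_ext_basis_vec[OF S U, of g b] gU[OF that] by simp
  have "?u v = id v" if "v \<in> G (Suc n)" for v
    by (rule free_on_lin_eq[OF S U lin_subset[OF u G_F] _ _ subset_UNIV that])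
      (use ub g(3) sub_facts(2)[of "Suc n"] submod_mem[OF U G_sub] in \<open>auto intro: linI\<close>)
  moreover have e: "bd n (?u v) = w (bd n v)" if "v \<in> F (Suc n)" for v
  proof (rule free_on_lin_eq[OF S U _ _ _ subset_UNIV that])
    show "(\<lambda>v. bd n (?u v)) \<in> lin S U (F (Suc n)) U" by (rule lin_comp[OF u _ bd_lin]) (use uG G_F in blast)
    show "(\<lambda>v. w (bd n v)) \<in> lin S U (F (Suc n)) U" by (rule lin_comp[OF bd_lin _ w(1)]) (use bd_F in blast)
  qed (simp add: ub g)
  moreover have "?u v \<in> cyc (Suc n)" if v: "v \<in> cyc (Suc n)" for v
  proof (rule cyc_SucI)
    show "?u v \<in> F (Suc n)" using uG[OF cyc_F[OF v]] G_F by blast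
    show "bd n (?u v) = \<zero>\<^bsub>U\<^esub>" using e[OF cyc_F[OF v]] bd_cyc_zero[OF v] lin_zero[OF U U w(1) F_sub] by simp
  qed
  ultimately show ?case using u uG by (intro bexI[of _ ?u]) auto
qed

end

section \<open>Annihilators of extension classes\<close>

text \<open>The coboundary condition freed of extensionality; in degree \<open>0\<close> only zero
  satisfies it.\<close>

definition trivial :: "nat \<Rightarrow> ((('s, 'm) gen \<Rightarrow> 's) \<Rightarrow> 's) \<Rightarrow> bool" where
  "trivial n \<phi> \<longleftrightarrow> (case n of 0 \<Rightarrow> \<forall>v\<in>F 0. \<phi> v = \<zero>\<^bsub>S\<^esub>
     | Suc k \<Rightarrow> \<exists>\<psi>\<in>lin S U (F k) (self_module S). \<forall>v\<in>F (Suc k). \<phi> v = \<psi> (bd k v))"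

lemma trivial_cong: "trivial n \<phi> \<Longrightarrow> (\<And>v. v \<in> F n \<Longrightarrow> \<phi>' v = \<phi> v) \<Longrightarrow> trivial n \<phi>'"
  by (cases n) (auto simp: trivial_def)

lemma trivial_zero: "(\<And>v. v \<in> F n \<Longrightarrow> \<phi> v = \<zero>\<^bsub>S\<^esub>) \<Longrightarrow> trivial n \<phi>"
  using lin_const_zero[OF U module_self[OF S]] by (cases n) (auto simp: trivial_def intro!: bexI[of _ "\<lambda>_. \<zero>\<^bsub>S\<^esub>"])

lemma trivial_add: "trivial n \<phi> \<Longrightarrow> trivial n \<psi> \<Longrightarrow> trivial n (\<lambda>v. \<phi> v \<oplus>\<^bsub>S\<^esub> \<psi> v)"
proof (cases n)
  case (Suc k)
  assume "trivial n \<phi>" "trivial n \<psi>"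
  then obtain f g where "f \<in> lin S U (F k) (self_module S)" "\<And>v. v \<in> F n \<Longrightarrow> \<phi> v = f (bd k v)"
    "g \<in> lin S U (F k) (self_module S)" "\<And>v. v \<in> F n \<Longrightarrow> \<psi> v = g (bd k v)" unfolding trivial_def Suc by auto
  then show ?thesis using lin_plus[OF U module_self[OF S], of f "F k" g]
    unfolding trivial_def Suc by (auto intro!: bexI[of _ "\<lambda>v. f v \<oplus>\<^bsub>S\<^esub> g v"])
qed (simp add: trivial_def)

lemma trivial_scale: "trivial n \<phi> \<Longrightarrow> a \<in> carrier S \<Longrightarrow> trivial n (\<lambda>v. a \<otimes>\<^bsub>S\<^esub> \<phi> v)"
proof (cases n)
  case (Suc k)
  assume "trivial n \<phi>" and a: "a \<in> carrier S"
  then obtain f where "f \<in> lin S U (F k) (self_module S)" "\<And>v. v \<in> F n \<Longrightarrow> \<phi> v = f (bd k v)"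
     unfolding trivial_def Suc by auto
  then show ?thesis using lin_scale[OF U module_self[OF S], of f "F k" a] a
    unfolding trivial_def Suc by (auto intro!: bexI[of _ "\<lambda>v. a \<otimes>\<^bsub>S\<^esub> f v"])
qed (simp add: trivial_def)

text \<open>The finiteness arguments run on the subresolution of finite rank, and the result is
  carried to the standard resolution along the retraction \<open>u\<close>. Because \<open>u\<close>
  fixes the finite part, composition with it changes neither what vanishes nor what extends, and the
  ideal of multipliers stays the same.\<close>

theorem ex_cocycle_annihilator:
  assumes noeth: "noetherian_ring S" and fg: "finite A" "A \<subseteq> carrier X" "\<And>N. submodule N S X \<Longrightarrow> A \<subseteq> N \<Longrightarrow> N = carrier X"
    and c: "inj_complex S Q J D e n" and x: "x \<in> carrier X" "{s \<in> carrier S. s \<odot>\<^bsub>X\<^esub> x = \<zero>\<^bsub>X\<^esub>} = Q"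
  shows "\<exists>i. \<exists>\<phi>\<in>lin S U (F i) (self_module S). (\<forall>v\<in>cyc i. \<phi> v = \<zero>\<^bsub>S\<^esub>) \<and>
    {s \<in> carrier S. trivial i (\<lambda>v. s \<otimes>\<^bsub>S\<^esub> \<phi> v)} = Q"
proof -
  obtain B where B: "subresolution B" using ex_subresolution[OF noeth fg] by metis
  note sub = sub_facts[OF B] and G_sub = G_sub[OF B] and G_F = G_F[OF B]
  let ?G = "\<lambda>n. free_on S (B n)"
  let ?K = "\<lambda>n. cyc n \<inter> ?G n"
  interpret I: inj_complex S Q J D e n by (rule c)
  \<comment> \<open>One-term lists under \<open>Syz\<close> embed the type into itself and miss
    every \<open>Elt\<close>.\<close>
  have "infinite (UNIV :: ('s, 'm) gen set)"
  proof
    assume fin: "finite (UNIV :: ('s, 'm) gen set)"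
    have "inj (\<lambda>b::('s, 'm) gen. Syz [(undefined, b)])" by (rule injI) simp
    then have "surj (\<lambda>b::('s, 'm) gen. Syz [(undefined, b)])" by (rule finite_UNIV_inj_surj[OF fin])
    then obtain b :: "('s, 'm) gen" where "Elt undefined = Syz [(undefined, b)]" unfolding surj_def by blast
    then show False by simp
  qed
  then interpret E: inj_complex_enough S Q J D e n U by (rule I.enough_free)
  have Ks: "submodule (?K j) S U" for j by (rule sub_Int[OF cyc_sub G_sub])
  have ac: "E.acyclic (?G j)" for j by (rule I.acyclic_free_on[OF sub(1) subset_UNIV])
  \<comment> \<open>Index \<open>0\<close> holds the tautological presentation of \<open>X\<close>
    as \<open>G 0\<close> modulo the kernel of the augmentation; the boundaries are thereby moved to
    positive indices.\<close>
  define p where "p j = (case j of 0 \<Rightarrow> (\<lambda>v. v) | Suc k \<Rightarrow> bd k)" for j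
  define Y where "Y j = (case j of 0 \<Rightarrow> ?G 0 | Suc k \<Rightarrow> ?K k)" for j
  define Z where "Z j = (case j of 0 \<Rightarrow> ?K 0 | Suc k \<Rightarrow> {\<zero>\<^bsub>U\<^esub>})" for j
  have zero_left: "v = \<zero>\<^bsub>U\<^esub> \<oplus>\<^bsub>U\<^esub> v" if "v \<in> F j" for v j using F_U[OF that] by simp
  have pr: "E.presents (?G j) (p j) (Y j) (Z j) (?K j)" for j
  proof (cases j)
    case 0
    have "p 0 \<in> lin S U (?G 0) U" using submod_mem[OF U G_sub] by (intro linI) (simp_all add: p_def)
    moreover have "\<forall>y\<in>?G 0. \<exists>z\<in>?K 0. \<exists>x\<in>?G 0. y = z \<oplus>\<^bsub>U\<^esub> x"
      using zero_left G_F submod_zero[OF U Ks] by blast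
    ultimately show ?thesis unfolding E.presents_def using 0 ac G_sub Ks by (auto simp: p_def Y_def Z_def)
  next
    case (Suc k)
    have l: "bd k \<in> lin S U (?G (Suc k)) U" by (rule lin_subset[OF bd_lin G_F])
    have cov: "\<forall>y\<in>?K k. \<exists>z\<in>{\<zero>\<^bsub>U\<^esub>}. \<exists>x\<in>?G (Suc k). y = z \<oplus>\<^bsub>U\<^esub> bd k x"
    proof
      fix y assume y: "y \<in> ?K k"
      then obtain x where "x \<in> ?G (Suc k)" "y = bd k x" using sub(4)[of k] by blast
      then show "\<exists>z\<in>{\<zero>\<^bsub>U\<^esub>}. \<exists>x\<in>?G (Suc k). y = z \<oplus>\<^bsub>U\<^esub> bd k x" using zero_left[of y k] y cyc_F by blast
    qed
    have K: "?K (Suc k) = {x \<in> ?G (Suc k). bd k x \<in> {\<zero>\<^bsub>U\<^esub>}}"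
      using G_F[of "Suc k"] bd_cyc_zero cyc_SucI by auto
    show ?thesis unfolding E.presents_def Suc p_def Y_def Z_def nat.case
      using ac[of "Suc k"] l sub(4)[of k] Ks[of k] submod_trivial[OF U] submod_zero[OF U Ks[of k]] cov K by simp
  qed
  obtain y where y: "y \<in> ?G 0" "eps y = x" using sub(3) x(1) by (metis imageE)
  have yF: "y \<in> F 0" using y G_F by blast
  have "s \<odot>\<^bsub>U\<^esub> y \<in> ?K 0 \<longleftrightarrow> s \<odot>\<^bsub>X\<^esub> x = \<zero>\<^bsub>X\<^esub>" if s: "s \<in> carrier S" for s
    using lin_smult[OF eps_lin s yF] y submod_smult[OF U G_sub s y(1)] submod_smult[OF U F_sub s yF] eps_cyc cyc_0I by auto
  then have col: "colon S U (?K 0) y = Q" unfolding colon_def using x(2) by blast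
  have alt: "(\<exists>\<phi>\<in>lin S U (?G 0) (self_module S). (\<forall>z\<in>?K 0. \<phi> z = \<zero>\<^bsub>S\<^esub>) \<and>
       {s \<in> carrier S. \<forall>y\<in>?G 0. s \<otimes>\<^bsub>S\<^esub> \<phi> y = \<zero>\<^bsub>S\<^esub>} = Q) \<or>
    (\<exists>j. \<exists>\<phi>\<in>lin S U (?K j) (self_module S).
       {s \<in> carrier S. \<exists>\<gamma>\<in>lin S U (?G j) (self_module S). \<forall>x\<in>?K j. s \<otimes>\<^bsub>S\<^esub> \<phi> x = \<gamma> x} = Q)"
    using E.annihilator_in_resolution[of ?G p Y Z ?K y, OF pr] y(1) col
      noeth_sub_free[OF S noeth sub(1) subset_UNIV, of 0] by (simp add: Y_def Z_def)
  obtain u where u: "\<And>n. u n \<in> lin S U (F n) U" "\<And>n v. v \<in> F n \<Longrightarrow> u n v \<in> ?G n" "\<And>n v. v \<in> ?G n \<Longrightarrow> u n v = v" "\<And>n v. v \<in> cyc n \<Longrightarrow> u n v \<in> cyc n"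
    using ex_retraction[OF B] by metis
  from alt show ?thesis
  proof (elim disjE exE bexE conjE)
    fix \<phi> assume f: "\<phi> \<in> lin S U (?G 0) (self_module S)" "\<forall>z\<in>?K 0. \<phi> z = \<zero>\<^bsub>S\<^esub>"
      "{s \<in> carrier S. \<forall>y\<in>?G 0. s \<otimes>\<^bsub>S\<^esub> \<phi> y = \<zero>\<^bsub>S\<^esub>} = Q"
    let ?f = "\<lambda>v. \<phi> (u 0 v)"
    have "?f \<in> lin S U (F 0) (self_module S)" by (rule lin_comp[OF u(1) _ f(1)]) (use u(2) in blast)
    moreover have "\<forall>v\<in>cyc 0. ?f v = \<zero>\<^bsub>S\<^esub>" using f(2) u(2,4) cyc_F by blast
    moreover have "trivial 0 (\<lambda>v. s \<otimes>\<^bsub>S\<^esub> ?f v) \<longleftrightarrow> (\<forall>y\<in>?G 0. s \<otimes>\<^bsub>S\<^esub> \<phi> y = \<zero>\<^bsub>S\<^esub>)" for s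
    proof -
      have "\<phi> (u 0 y) = \<phi> y" "y \<in> F 0" if "y \<in> ?G 0" for y using u(3)[OF that] that G_F by auto
      then show ?thesis unfolding trivial_def nat.case using u(2)[of _ 0] by metis
    qed
    ultimately show ?thesis using f(3) by (intro exI[of _ 0] bexI[of _ ?f]) auto
  next
    fix j \<phi> assume f: "\<phi> \<in> lin S U (?K j) (self_module S)"
      "{s \<in> carrier S. \<exists>\<gamma>\<in>lin S U (?G j) (self_module S). \<forall>x\<in>?K j. s \<otimes>\<^bsub>S\<^esub> \<phi> x = \<gamma> x} = Q"
    \<comment> \<open>A map on the cycles of degree \<open>j\<close>, composed with the boundary, is
      a cocycle of degree \<open>Suc j\<close>; \<open>u\<close> first moves the boundary of an
      arbitrary chain into the finite part, where \<open>\<phi>\<close> is linear.\<close>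
    let ?f = "\<lambda>v. \<phi> (u j (bd j v))"
    have uK: "u j (bd j v) \<in> ?K j" if "v \<in> F (Suc j)" for v using u(2)[OF bd_F[OF that]] u(4)[OF bd_cyc[OF that]] by blast
    have ubd: "(\<lambda>v. u j (bd j v)) \<in> lin S U (F (Suc j)) U" by (rule lin_comp[OF bd_lin _ u(1)]) (use bd_F in blast)
    have "?f \<in> lin S U (F (Suc j)) (self_module S)" by (rule lin_comp[OF ubd _ f(1)]) (use uK in blast)
    moreover have "?f v = \<zero>\<^bsub>S\<^esub>" if "v \<in> cyc (Suc j)" for v
      using bd_cyc_zero[OF that] lin_zero[OF U U u(1) F_sub] lin_zero[OF U module_self[OF S] f(1) Ks] by simp
    moreover have "trivial (Suc j) (\<lambda>v. s \<otimes>\<^bsub>S\<^esub> ?f v) \<longleftrightarrow> (\<exists>\<gamma>\<in>lin S U (?G j) (self_module S). \<forall>x\<in>?K j. s \<otimes>\<^bsub>S\<^esub> \<phi> x = \<gamma> x)" for s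
    proof
      assume "trivial (Suc j) (\<lambda>v. s \<otimes>\<^bsub>S\<^esub> ?f v)"
      then obtain g where g: "g \<in> lin S U (F j) (self_module S)" "\<And>v. v \<in> F (Suc j) \<Longrightarrow> s \<otimes>\<^bsub>S\<^esub> ?f v = g (bd j v)" unfolding trivial_def by auto
      have "s \<otimes>\<^bsub>S\<^esub> \<phi> x = g x" if xK: "x \<in> ?K j" for x
      proof -
        obtain v where v: "v \<in> ?G (Suc j)" "bd j v = x" using sub(4)[of j] xK by (metis imageE)
        then show ?thesis using g(2)[of v] G_F u(3)[of x j] xK by auto
      qed
      then show "\<exists>\<gamma>\<in>lin S U (?G j) (self_module S). \<forall>x\<in>?K j. s \<otimes>\<^bsub>S\<^esub> \<phi> x = \<gamma> x"
        using lin_subset[OF g(1) G_F] by blast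
    next
      assume "\<exists>\<gamma>\<in>lin S U (?G j) (self_module S). \<forall>x\<in>?K j. s \<otimes>\<^bsub>S\<^esub> \<phi> x = \<gamma> x"
      then obtain g where g: "g \<in> lin S U (?G j) (self_module S)" "\<And>x. x \<in> ?K j \<Longrightarrow> s \<otimes>\<^bsub>S\<^esub> \<phi> x = g x" by blast
      have "(\<lambda>v. g (u j v)) \<in> lin S U (F j) (self_module S)" by (rule lin_comp[OF u(1) _ g(1)]) (use u(2) in blast)
      then show "trivial (Suc j) (\<lambda>v. s \<otimes>\<^bsub>S\<^esub> ?f v)" unfolding trivial_def nat.case
        using g(2)[OF uK] by (intro bexI[of _ "\<lambda>v. g (u j v)"]) simp_all
    qed
    ultimately show ?thesis using f(2) by (intro exI[of _ "Suc j"] bexI[of _ ?f]) auto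
  qed
qed

text \<open>A cocycle kills the part of the homotopy with values in cycles, and the other part
  \<open>\<kappa>\<close> factors through the boundary, so the two actions of the scalar differ by a
  coboundary.\<close>

lemma res_map_trivial:
  assumes s: "s \<in> carrier S" and h: "\<And>x. x \<in> carrier X \<Longrightarrow> h x = s \<odot>\<^bsub>X\<^esub> x"
    and f: "\<phi> \<in> lin S U (F n) (self_module S)" "\<And>v. v \<in> cyc n \<Longrightarrow> \<phi> v = \<zero>\<^bsub>S\<^esub>"
  shows "trivial n (\<lambda>v. \<phi> (res_map S X h n v) \<ominus>\<^bsub>S\<^esub> s \<otimes>\<^bsub>S\<^esub> \<phi> v)"
proof -
  let ?w = "res_map S X h n"
  note mS = module_self[OF S]
  obtain \<kappa> where \<kappa>: "\<kappa> \<in> lin S U (F n) U" "\<And>v. v \<in> F n \<Longrightarrow> \<kappa> v \<in> F n"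
    "(case n of 0 \<Rightarrow> \<forall>v\<in>F n. \<kappa> v = \<zero>\<^bsub>U\<^esub>
        | Suc m \<Rightarrow> \<exists>k\<in>lin S U (F m) U. (\<forall>v\<in>F m. k v \<in> F n) \<and> (\<forall>v\<in>F n. \<kappa> v = k (bd m v)))"
    "\<And>v. v \<in> F n \<Longrightarrow> (?w v \<ominus>\<^bsub>U\<^esub> s \<odot>\<^bsub>U\<^esub> v) \<ominus>\<^bsub>U\<^esub> \<kappa> v \<in> cyc n" using res_map_homotopic[OF s h, of n] by blast
  have eq: "\<phi> (?w v) \<ominus>\<^bsub>S\<^esub> s \<otimes>\<^bsub>S\<^esub> \<phi> v = \<phi> (\<kappa> v)" if v: "v \<in> F n" for v
  proof -
    have wF: "?w v \<in> F n" by (rule res_map_facts(4)[OF s _ v]) (rule h)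
    note sv = submod_smult[OF U F_sub s v]
    note d = submod_diff[OF U F_sub wF sv]
    have cl: "\<phi> (?w v) \<in> carrier S" "\<phi> v \<in> carrier S" "\<phi> (\<kappa> v) \<in> carrier S"
      using lin_closed[OF f(1)] wF v \<kappa>(2)[OF v] by auto
    \<comment> \<open>Subtraction depends on the additive structure alone, which \<open>S\<close>
      shares with its \<open>self_module\<close>.\<close>
    have m: "x \<ominus>\<^bsub>self_module S\<^esub> y = x \<ominus>\<^bsub>S\<^esub> y" for x y
      by (simp add: a_minus_def a_inv_def self_module_def m_inv_def)
    have "\<zero>\<^bsub>S\<^esub> = (\<phi> (?w v) \<ominus>\<^bsub>S\<^esub> s \<otimes>\<^bsub>S\<^esub> \<phi> v) \<ominus>\<^bsub>S\<^esub> \<phi> (\<kappa> v)"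
      using f(2)[OF \<kappa>(4)[OF v]] lin_diff[OF U mS f(1) F_sub d \<kappa>(2)[OF v]] lin_diff[OF U mS f(1) F_sub wF sv] lin_smult[OF f(1) s v]
      by (simp add: m)
    then show ?thesis using S.minus_eq_zero_iff[of "\<phi> (?w v) \<ominus>\<^bsub>S\<^esub> s \<otimes>\<^bsub>S\<^esub> \<phi> v" "\<phi> (\<kappa> v)"] cl s by simp
  qed
  show ?thesis
  proof (rule trivial_cong[OF _ eq])
    show "trivial n (\<lambda>v. \<phi> (\<kappa> v))"
    proof (cases n)
      case 0
      then show ?thesis using \<kappa>(3) lin_zero[OF U mS f(1) F_sub] by (intro trivial_zero) simp
    next
      case (Suc m)
      then obtain k where k: "k \<in> lin S U (F m) U" "\<And>v. v \<in> F m \<Longrightarrow> k v \<in> F n" "\<And>v. v \<in> F n \<Longrightarrow> \<kappa> v = k (bd m v)" using \<kappa>(3) by auto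
      have "(\<lambda>v. \<phi> (k v)) \<in> lin S U (F m) (self_module S)" by (rule lin_comp[OF k(1) _ f(1)]) (use k(2) in blast)
      then show ?thesis unfolding trivial_def Suc nat.case using k(3) Suc by (intro bexI[of _ "\<lambda>v. \<phi> (k v)"]) auto
    qed
  qed
qed

lemma trivial_cocycle:
  assumes "trivial n \<phi>"
  shows "\<phi> \<in> lin S U (F n) (self_module S)" "\<And>v. v \<in> cyc n \<Longrightarrow> \<phi> v = \<zero>\<^bsub>S\<^esub>"
proof -
  note mS = module_self[OF S]
  obtain \<psi> where \<psi>: "\<psi> \<in> lin S U (F n) (self_module S)" "\<And>v. v \<in> F n \<Longrightarrow> \<phi> v = \<psi> v" "\<And>v. v \<in> cyc n \<Longrightarrow> \<psi> v = \<zero>\<^bsub>S\<^esub>"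
  proof (cases n)
    case 0
    then show ?thesis using that[OF lin_const_zero[OF U mS]] assms by (simp add: trivial_def)
  next
    case (Suc k)
    then obtain g where g: "g \<in> lin S U (F k) (self_module S)" "\<And>v. v \<in> F n \<Longrightarrow> \<phi> v = g (bd k v)"
      using assms unfolding trivial_def by auto
    have "(\<lambda>v. g (bd k v)) \<in> lin S U (F n) (self_module S)" unfolding Suc by (rule lin_comp[OF bd_lin _ g(1)]) (use bd_F in blast)
    moreover have "g (bd k v) = \<zero>\<^bsub>S\<^esub>" if "v \<in> cyc n" for v
      using bd_cyc_zero[of v k] that lin_zero[OF U mS g(1) F_sub] Suc by simp
    ultimately show ?thesis using that g(2) by blast
  qed
  show "\<phi> \<in> lin S U (F n) (self_module S)" using lin_cong[OF U F_sub \<psi>(1)] \<psi>(2) by simp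
  show "\<phi> v = \<zero>\<^bsub>S\<^esub>" if "v \<in> cyc n" for v using \<psi>(2,3) that cyc_F by metis
qed

section \<open>Cohomology classes of the standard resolution\<close>

abbreviation C where "C \<equiv> cochains S X (self_module S)"

lemma carrier_res_module: "carrier (res_module S X n) = F n"
  by (simp add: res_module_def carrier_free_module)

lemma cochains_simps:
  "carrier (C n) = lin S U (F n) (self_module S) \<inter> extensional (F n)"
  "\<zero>\<^bsub>C n\<^esub> = (\<lambda>v\<in>F n. \<zero>\<^bsub>S\<^esub>)" "\<phi> \<oplus>\<^bsub>C n\<^esub> \<psi> = (\<lambda>v\<in>F n. \<phi> v \<oplus>\<^bsub>S\<^esub> \<psi> v)"
proof -
  have "module_hom S (res_module S X n) (self_module S) = lin S U (F n) (self_module S)"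
    unfolding module_hom_eq_lin carrier_res_module by (simp add: res_module_def lin_free_module[of S "bas n" _ _ UNIV])
  then show "carrier (C n) = lin S U (F n) (self_module S) \<inter> extensional (F n)"
    "\<zero>\<^bsub>C n\<^esub> = (\<lambda>v\<in>F n. \<zero>\<^bsub>S\<^esub>)" "\<phi> \<oplus>\<^bsub>C n\<^esub> \<psi> = (\<lambda>v\<in>F n. \<phi> v \<oplus>\<^bsub>S\<^esub> \<psi> v)"
    by (simp_all add: cochains_def Hom_module_def carrier_res_module)
qed

text \<open>The bridge from extensional cochains to \<open>trivial\<close>; extensionality remains
  as a side condition only.\<close>

lemma coboundaries_iff: "\<chi> \<in> coboundaries S X (self_module S) n \<longleftrightarrow> \<chi> \<in> extensional (F n) \<and> trivial n \<chi>"
proof (cases n)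
  case 0
  then show ?thesis by (auto simp: cochains_simps trivial_def intro: extensionalityI)
next
  case (Suc k)
  show ?thesis
  proof
    assume "\<chi> \<in> coboundaries S X (self_module S) n"
    then obtain \<psi> where "\<psi> \<in> carrier (C k)" "\<chi> = cobdry S X k \<psi>" using Suc by auto
    then show "\<chi> \<in> extensional (F n) \<and> trivial n \<chi>"
      unfolding Suc by (auto simp: cochains_simps cobdry_def carrier_res_module compose_def trivial_def intro!: bexI[of _ \<psi>])
  next
    assume \<chi>: "\<chi> \<in> extensional (F n) \<and> trivial n \<chi>"
    then obtain \<psi> where \<psi>: "\<psi> \<in> lin S U (F k) (self_module S)" "\<And>v. v \<in> F n \<Longrightarrow> \<chi> v = \<psi> (bd k v)" unfolding trivial_def Suc by auto
    have "restrict \<psi> (F k) \<in> carrier (C k)"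
      unfolding cochains_simps using lin_cong[OF U F_sub \<psi>(1), of "restrict \<psi> (F k)"] by simp
    moreover have "\<chi> = cobdry S X k (restrict \<psi> (F k))"
      by (rule extensionalityI[of _ "F n"])
        (use \<chi> \<psi>(2) bd_F Suc in \<open>auto simp: cobdry_def compose_def carrier_res_module\<close>)
    ultimately show "\<chi> \<in> coboundaries S X (self_module S) n" using Suc by simp
  qed
qed

abbreviation cls where "cls \<equiv> Ext_class S X (self_module S)"

text \<open>Only the values of \<open>\<phi>\<close> on \<open>F n\<close> enter, so the class of a
  multiple or a composite can be written without \<open>restrict\<close>.\<close>

lemma mem_cls_iff:
  assumes f: "\<And>v. v \<in> F n \<Longrightarrow> \<phi> v \<in> carrier S"
  shows "\<chi> \<in> cls n \<phi> \<longleftrightarrow> \<chi> \<in> extensional (F n) \<and> (\<forall>v\<in>F n. \<chi> v \<in> carrier S) \<and> trivial n (\<lambda>v. \<chi> v \<ominus>\<^bsub>S\<^esub> \<phi> v)"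
proof
  assume "\<chi> \<in> cls n \<phi>"
  then obtain b where b: "b \<in> coboundaries S X (self_module S) n" "\<chi> = b \<oplus>\<^bsub>C n\<^esub> \<phi>"
    by (auto simp: Ext_class_def a_r_coset_def r_coset_def)
  then have t: "trivial n b" by (simp add: coboundaries_iff)
  have bc: "b v \<in> carrier S" if "v \<in> F n" for v using lin_closed[OF trivial_cocycle(1)[OF t] that] by simp
  have "\<chi> v \<ominus>\<^bsub>S\<^esub> \<phi> v = b v" if "v \<in> F n" for v
    using bc[OF that] f[OF that] that by (simp add: b(2) cochains_simps a_minus_def S.a_assoc S.r_neg)
  then have "trivial n (\<lambda>v. \<chi> v \<ominus>\<^bsub>S\<^esub> \<phi> v)" by (rule trivial_cong[OF t])
  then show "\<chi> \<in> extensional (F n) \<and> (\<forall>v\<in>F n. \<chi> v \<in> carrier S) \<and> trivial n (\<lambda>v. \<chi> v \<ominus>\<^bsub>S\<^esub> \<phi> v)"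
    using bc f by (auto simp: b(2) cochains_simps)
next
  assume \<chi>: "\<chi> \<in> extensional (F n) \<and> (\<forall>v\<in>F n. \<chi> v \<in> carrier S) \<and> trivial n (\<lambda>v. \<chi> v \<ominus>\<^bsub>S\<^esub> \<phi> v)"
  let ?b = "\<lambda>v\<in>F n. \<chi> v \<ominus>\<^bsub>S\<^esub> \<phi> v"
  have "?b \<in> coboundaries S X (self_module S) n"
    unfolding coboundaries_iff using \<chi> trivial_cong[of n "\<lambda>v. \<chi> v \<ominus>\<^bsub>S\<^esub> \<phi> v" ?b] by simp
  moreover have "\<chi> = ?b \<oplus>\<^bsub>C n\<^esub> \<phi>"
    by (rule extensionalityI[of _ "F n"]) (use \<chi> f in \<open>auto simp: cochains_simps a_minus_def S.a_assoc S.l_neg\<close>)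
  ultimately show "\<chi> \<in> cls n \<phi>" by (auto simp: Ext_class_def a_r_coset_def r_coset_def)
qed

lemma restrict_mem_cls:
  assumes "\<And>v. v \<in> F n \<Longrightarrow> \<phi> v \<in> carrier S"
  shows "restrict \<phi> (F n) \<in> cls n \<phi>"
proof (rule mem_cls_iff[THEN iffD2])
  have "trivial n (\<lambda>v. restrict \<phi> (F n) v \<ominus>\<^bsub>S\<^esub> \<phi> v)"
    by (rule trivial_zero) (simp add: assms a_minus_def S.r_neg)
  then show "restrict \<phi> (F n) \<in> extensional (F n) \<and> (\<forall>v\<in>F n. restrict \<phi> (F n) v \<in> carrier S) \<and>
    trivial n (\<lambda>v. restrict \<phi> (F n) v \<ominus>\<^bsub>S\<^esub> \<phi> v)" using assms by simp
qed (rule assms)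

lemma trivial_minus_sym:
  assumes "\<And>v. v \<in> F n \<Longrightarrow> \<phi> v \<in> carrier S" "\<And>v. v \<in> F n \<Longrightarrow> \<psi> v \<in> carrier S" "trivial n (\<lambda>v. \<phi> v \<ominus>\<^bsub>S\<^esub> \<psi> v)"
  shows "trivial n (\<lambda>v. \<psi> v \<ominus>\<^bsub>S\<^esub> \<phi> v)"
proof (rule trivial_cong[OF trivial_scale[OF assms(3), of "\<ominus>\<^bsub>S\<^esub> \<one>\<^bsub>S\<^esub>"]])
  show "\<psi> v \<ominus>\<^bsub>S\<^esub> \<phi> v = \<ominus>\<^bsub>S\<^esub> \<one>\<^bsub>S\<^esub> \<otimes>\<^bsub>S\<^esub> (\<phi> v \<ominus>\<^bsub>S\<^esub> \<psi> v)" if "v \<in> F n" for v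
    using assms(1,2)[OF that] by (simp add: S.l_minus a_minus_def S.minus_add S.a_comm)
qed simp

lemma trivial_minus_trans:
  assumes "\<And>v. v \<in> F n \<Longrightarrow> \<phi> v \<in> carrier S" "\<And>v. v \<in> F n \<Longrightarrow> \<psi> v \<in> carrier S" "\<And>v. v \<in> F n \<Longrightarrow> \<chi> v \<in> carrier S"
    "trivial n (\<lambda>v. \<phi> v \<ominus>\<^bsub>S\<^esub> \<psi> v)" "trivial n (\<lambda>v. \<psi> v \<ominus>\<^bsub>S\<^esub> \<chi> v)"
  shows "trivial n (\<lambda>v. \<phi> v \<ominus>\<^bsub>S\<^esub> \<chi> v)"
proof (rule trivial_cong[OF trivial_add[OF assms(4,5)]])
  show "\<phi> v \<ominus>\<^bsub>S\<^esub> \<chi> v = (\<phi> v \<ominus>\<^bsub>S\<^esub> \<psi> v) \<oplus>\<^bsub>S\<^esub> (\<psi> v \<ominus>\<^bsub>S\<^esub> \<chi> v)" if "v \<in> F n" for v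
    using assms(1,2,3)[OF that] by (simp add: a_minus_def S.a_assoc S.r_neg1)
qed

lemma cls_subset:
  assumes "\<And>v. v \<in> F n \<Longrightarrow> \<phi> v \<in> carrier S" "\<And>v. v \<in> F n \<Longrightarrow> \<psi> v \<in> carrier S"
    and t: "trivial n (\<lambda>v. \<phi> v \<ominus>\<^bsub>S\<^esub> \<psi> v)"
  shows "cls n \<phi> \<subseteq> cls n \<psi>"
proof
  fix \<chi> assume "\<chi> \<in> cls n \<phi>"
  then have \<chi>: "\<chi> \<in> extensional (F n)" "\<forall>v\<in>F n. \<chi> v \<in> carrier S" "trivial n (\<lambda>v. \<chi> v \<ominus>\<^bsub>S\<^esub> \<phi> v)"
    using mem_cls_iff[of n \<phi> \<chi>] assms(1) by blast+
  then have "trivial n (\<lambda>v. \<chi> v \<ominus>\<^bsub>S\<^esub> \<psi> v)"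
    by (intro trivial_minus_trans[OF _ assms(1,2) \<chi>(3) t]) auto
  then show "\<chi> \<in> cls n \<psi>" using mem_cls_iff[of n \<psi> \<chi>] assms(2) \<chi>(1,2) by blast
qed

lemma cls_eq_iff:
  assumes "\<And>v. v \<in> F n \<Longrightarrow> \<phi> v \<in> carrier S" "\<And>v. v \<in> F n \<Longrightarrow> \<psi> v \<in> carrier S"
  shows "cls n \<phi> = cls n \<psi> \<longleftrightarrow> trivial n (\<lambda>v. \<phi> v \<ominus>\<^bsub>S\<^esub> \<psi> v)"
proof
  assume eq: "cls n \<phi> = cls n \<psi>"
  have "restrict \<phi> (F n) \<in> cls n \<phi>" by (rule restrict_mem_cls[OF assms(1)])
  then have "trivial n (\<lambda>v. restrict \<phi> (F n) v \<ominus>\<^bsub>S\<^esub> \<psi> v)"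
    unfolding eq using mem_cls_iff[of n \<psi> "restrict \<phi> (F n)"] assms(2) by blast
  then show "trivial n (\<lambda>v. \<phi> v \<ominus>\<^bsub>S\<^esub> \<psi> v)" by (rule trivial_cong) simp
next
  assume t: "trivial n (\<lambda>v. \<phi> v \<ominus>\<^bsub>S\<^esub> \<psi> v)"
  show "cls n \<phi> = cls n \<psi>"
    using cls_subset[OF assms t] cls_subset[OF assms(2,1) trivial_minus_sym[OF assms t]] by (rule subset_antisym)
qed

lemma cls_in_Ext:
  assumes f: "\<phi> \<in> lin S U (F n) (self_module S)" "\<And>v. v \<in> cyc n \<Longrightarrow> \<phi> v = \<zero>\<^bsub>S\<^esub>"
  shows "cls n \<phi> \<in> carrier (Ext S X (self_module S) n)"
proof -
  have fc: "\<phi> v \<in> carrier S" if "v \<in> F n" for v using lin_closed[OF f(1) that] by simp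
  have "restrict \<phi> (F n) \<in> carrier (C n)"
    unfolding cochains_simps using lin_cong[OF U F_sub f(1), of "restrict \<phi> (F n)"] by simp
  moreover have "cobdry S X n (restrict \<phi> (F n)) = \<zero>\<^bsub>C (Suc n)\<^esub>"
    by (rule ext) (simp add: cobdry_def compose_def carrier_res_module cochains_simps bd_F f(2) bd_cyc)
  moreover have "cls n (restrict \<phi> (F n)) = cls n \<phi>"
    using cls_eq_iff[of n "restrict \<phi> (F n)" \<phi>] fc by (auto intro!: trivial_zero simp: a_minus_def S.r_neg)
  ultimately have "restrict \<phi> (F n) \<in> cocycles S X (self_module S) n" "cls n \<phi> = cls n (restrict \<phi> (F n))"
    by (simp_all add: cocycles_def)
  then show ?thesis unfolding Ext_def by (simp add: image_eqI)
qed

text \<open>The induced map is a union over the representatives of a class. They all contribute the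
  same class, because composing a cocycle with the chain map and multiplying it by \<open>s\<close>
  differ by a coboundary.\<close>

lemma Ext_map_scalar:
  assumes s: "s \<in> carrier S" and h: "\<And>x. x \<in> carrier X \<Longrightarrow> h x = s \<odot>\<^bsub>X\<^esub> x"
    and f: "\<phi> \<in> lin S U (F n) (self_module S)" "\<And>v. v \<in> cyc n \<Longrightarrow> \<phi> v = \<zero>\<^bsub>S\<^esub>"
  shows "Ext_map S X X (self_module S) n h (cls n \<phi>) = cls n (\<lambda>v. s \<otimes>\<^bsub>S\<^esub> \<phi> v)"
proof -
  note mS = module_self[OF S]
  let ?w = "res_map S X h n"
  have fc: "\<phi> v \<in> carrier S" if "v \<in> F n" for v using lin_closed[OF f(1) that] by simp
  have wF: "?w v \<in> F n" if "v \<in> F n" for v by (rule res_map_facts(4)[OF s _ that]) (rule h)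
  have "cls n (compose (F n) \<chi> ?w) = cls n (\<lambda>v. s \<otimes>\<^bsub>S\<^esub> \<phi> v)" if \<chi>: "\<chi> \<in> cls n \<phi>" for \<chi>
  proof -
    have t: "trivial n (\<lambda>v. \<chi> v \<ominus>\<^bsub>S\<^esub> \<phi> v)" and \<chi>c: "\<And>v. v \<in> F n \<Longrightarrow> \<chi> v \<in> carrier S"
      using \<chi> mem_cls_iff[OF fc] by auto
    note tc = trivial_cocycle[OF t]
    have eq: "\<chi> v = (\<chi> v \<ominus>\<^bsub>S\<^esub> \<phi> v) \<oplus>\<^bsub>S\<^esub> \<phi> v" if "v \<in> F n" for v
      using fc[OF that] \<chi>c[OF that] by (simp add: a_minus_def S.a_assoc S.l_neg)
    have \<chi>l: "\<chi> \<in> lin S U (F n) (self_module S)"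
      using lin_cong[OF U F_sub lin_plus[OF U mS tc(1) f(1)], of \<chi>] eq by simp
    have \<chi>z: "\<chi> v = \<zero>\<^bsub>S\<^esub>" if "v \<in> cyc n" for v
      using eq[OF cyc_F[OF that]] tc(2)[OF that] f(2)[OF that] by simp
    have "trivial n (\<lambda>v. \<chi> (?w v) \<ominus>\<^bsub>S\<^esub> s \<otimes>\<^bsub>S\<^esub> \<chi> v)"
      by (rule res_map_trivial[OF s _ \<chi>l \<chi>z]) (rule h)
    then have 1: "trivial n (\<lambda>v. compose (F n) \<chi> ?w v \<ominus>\<^bsub>S\<^esub> s \<otimes>\<^bsub>S\<^esub> \<chi> v)"
      by (rule trivial_cong) (simp add: compose_def)
    have 2: "trivial n (\<lambda>v. s \<otimes>\<^bsub>S\<^esub> \<chi> v \<ominus>\<^bsub>S\<^esub> s \<otimes>\<^bsub>S\<^esub> \<phi> v)"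
      by (rule trivial_cong[OF trivial_scale[OF t s]])
        (use s fc \<chi>c in \<open>simp add: a_minus_def S.r_distr S.r_minus\<close>)
    have 3: "compose (F n) \<chi> ?w v \<in> carrier S" if "v \<in> F n" for v using \<chi>c[OF wF[OF that]] that by (simp add: compose_def)
    have "trivial n (\<lambda>v. compose (F n) \<chi> ?w v \<ominus>\<^bsub>S\<^esub> s \<otimes>\<^bsub>S\<^esub> \<phi> v)"
      by (rule trivial_minus_trans[OF _ _ _ 1 2]) (use s fc \<chi>c 3 in auto)
    then show ?thesis by (subst cls_eq_iff) (use s fc 3 in auto)
  qed
  moreover have "restrict \<phi> (F n) \<in> cls n \<phi>" by (rule restrict_mem_cls[OF fc])
  ultimately show ?thesis unfolding Ext_map_def carrier_res_module by blast
qed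

end

section \<open>Associated primes of Ext\<close>

text \<open>Every \<open>r\<close> in \<open>R\<close> is the image of some \<open>s\<close>, and
  \<open>r\<close> acts on the class as \<open>s\<close> acts on the cocycle. The annihilator in
  \<open>S\<close> is the preimage of \<open>P\<close>, so by surjectivity the annihilator in
  \<open>R\<close> is \<open>P\<close> itself.\<close>

lemma Ass_Ext_over:
  assumes S: "cring S" and M: "module R M" and f: "f \<in> ring_hom S R" "f ` carrier S = carrier R"
    and P: "primeideal P R"
    and p: "\<phi> \<in> lin S (free_module S UNIV) (free_on S (res_basis S (restrict_scalars f M) n)) (self_module S)"
      "\<And>v. v \<in> standard_resolution.cyc S (restrict_scalars f M) n \<Longrightarrow> \<phi> v = \<zero>\<^bsub>S\<^esub>"
      "{s \<in> carrier S. standard_resolution.trivial S (restrict_scalars f M) n (\<lambda>v. s \<otimes>\<^bsub>S\<^esub> \<phi> v)} = {s \<in> carrier S. f s \<in> P}"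
  shows "P \<in> Ass R (Ext_over S f M (self_module S) n)"
proof -
  let ?X = "restrict_scalars f M"
  interpret X: standard_resolution S ?X
    using S module_restrict_scalars[OF S f(1) M] by (rule standard_resolution.intro)
  interpret P: primeideal P R by (rule P)
  let ?E = "Ext_over S f M (self_module S) n"
  have pc: "\<phi> v \<in> carrier S" if "v \<in> X.F n" for v using lin_closed[OF p(1) that] by simp
  let ?\<xi> = "X.cls n \<phi>"
  have mem: "?\<xi> \<in> carrier ?E" using X.cls_in_Ext[OF p(1,2)] by (simp add: Ext_over_def Let_def)
  have zero: "\<zero>\<^bsub>?E\<^esub> = X.cls n (\<lambda>v\<in>X.F n. \<zero>\<^bsub>S\<^esub>)"
    by (simp add: Ext_over_def Let_def Ext_def X.cochains_simps)
  have "r \<odot>\<^bsub>?E\<^esub> ?\<xi> = \<zero>\<^bsub>?E\<^esub> \<longleftrightarrow> r \<in> P" if r: "r \<in> carrier R" for r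
  proof -
    obtain s where s: "s \<in> carrier S" "r = f s" using r f(2) by blast
    have "r \<odot>\<^bsub>?E\<^esub> ?\<xi> = X.cls n (\<lambda>v. s \<otimes>\<^bsub>S\<^esub> \<phi> v)"
      using X.Ext_map_scalar[OF s(1) _ p(1,2), of "\<lambda>x. r \<odot>\<^bsub>M\<^esub> x"] s(2) by (simp add: Ext_over_def Let_def)
    then have "r \<odot>\<^bsub>?E\<^esub> ?\<xi> = \<zero>\<^bsub>?E\<^esub> \<longleftrightarrow> X.trivial n (\<lambda>v. s \<otimes>\<^bsub>S\<^esub> \<phi> v \<ominus>\<^bsub>S\<^esub> (\<lambda>v\<in>X.F n. \<zero>\<^bsub>S\<^esub>) v)"
      unfolding zero by (simp, subst X.cls_eq_iff) (use s pc in auto)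
    also have "\<dots> \<longleftrightarrow> X.trivial n (\<lambda>v. s \<otimes>\<^bsub>S\<^esub> \<phi> v)"
      using pc s by (auto elim!: X.trivial_cong simp: X.S.minus_zero_right)
    also have "\<dots> \<longleftrightarrow> r \<in> P" using p(3) s by blast
    finally show ?thesis .
  qed
  then have "P = {a \<in> carrier R. a \<odot>\<^bsub>?E\<^esub> ?\<xi> = \<zero>\<^bsub>?E\<^esub>}" using P.a_Hcarr by blast
  then show ?thesis unfolding Ass_def using P mem by blast
qed

theorem corollary3p7:
  fixes R :: "'r ring" and S :: "'s ring" and f :: "'s \<Rightarrow> 'r" and M :: "('r, 'm) module"
  assumes "local_ring R" and "noetherian_ring R"
    and "gorenstein_ring TYPE('e) S"
    and "f \<in> ring_hom S R" and "f ` carrier S = carrier R"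
    and "fin_gen_module R M"
  shows "Ass R M \<subseteq> (\<Union>i. Ass R (Ext_over S f M (self_module S) i))"
proof
  fix P assume "P \<in> Ass R M"
  then obtain x where P: "primeideal P R" and x: "x \<in> carrier M" "P = {a \<in> carrier R. a \<odot>\<^bsub>M\<^esub> x = \<zero>\<^bsub>M\<^esub>}"
    by (auto simp: Ass_def)
  have S: "cring S" "noetherian_ring S" using assms(3) by (simp_all add: gorenstein_ring_def)
  have M: "module R M" using assms(6) by (simp add: fin_gen_module_def)
  note h = ring_hom_memE[OF assms(4)]
  let ?X = "restrict_scalars f M"
  have X: "module S ?X" by (rule module_restrict_scalars[OF S(1) assms(4) M])
  interpret P: primeideal P R by (rule P)
  interpret S: cring S by (rule S)
  let ?Q = "{s \<in> carrier S. f s \<in> P}"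
  have Q: "{s \<in> carrier S. s \<odot>\<^bsub>?X\<^esub> x = \<zero>\<^bsub>?X\<^esub>} = ?Q"
  proof (rule Collect_cong, rule conj_cong[OF refl])
    fix s assume "s \<in> carrier S"
    then show "s \<odot>\<^bsub>?X\<^esub> x = \<zero>\<^bsub>?X\<^esub> \<longleftrightarrow> f s \<in> P" unfolding x(2) using h(1) by simp
  qed
  have "primeideal ?Q S"
  proof (rule primeidealI)
    show "ideal ?Q S" using ideal_colon[OF X submod_trivial[OF X], of x] x(1) Q by (simp add: colon_def)
    have "f \<one>\<^bsub>S\<^esub> \<notin> P" using h(4) P.one_imp_carrier P.I_notcarr by auto
    then show "carrier S \<noteq> ?Q" by blast
    show "a \<in> ?Q \<or> b \<in> ?Q" if "a \<in> carrier S" "b \<in> carrier S" "a \<otimes>\<^bsub>S\<^esub> b \<in> ?Q" for a b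
      using that h(1,2) P.I_prime by auto
  qed (rule S(1))
  then obtain J :: "nat \<Rightarrow> ('s, 'e) module" and D e n where c: "inj_complex S ?Q J D e n"
    by (rule gorenstein_inj_complex[OF assms(3)])
  obtain A where A: "finite A" "A \<subseteq> carrier M" "\<And>N. submodule N R M \<Longrightarrow> A \<subseteq> N \<Longrightarrow> N = carrier M"
    using assms(6) unfolding fin_gen_module_def by blast
  \<comment> \<open>Surjectivity of \<open>f\<close> makes submodules over \<open>S\<close> into
    submodules over \<open>R\<close>, so generators over \<open>R\<close> also generate over
    \<open>S\<close>.\<close>
  have A': "N = carrier ?X" if N: "submodule N S ?X" "A \<subseteq> N" for N
  proof -
    have "submodule N R M"
    proof (rule submodI[OF M])
      show "N \<subseteq> carrier M" "\<zero>\<^bsub>M\<^esub> \<in> N" "\<And>y z. y \<in> N \<Longrightarrow> z \<in> N \<Longrightarrow> y \<oplus>\<^bsub>M\<^esub> z \<in> N"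
        using submod_mem[OF X N(1)] submod_zero[OF X N(1)] submod_add[OF X N(1)] by auto
      fix a y assume "a \<in> carrier R" "y \<in> N"
      moreover from this obtain s where "s \<in> carrier S" "a = f s" using assms(5) by blast
      ultimately show "a \<odot>\<^bsub>M\<^esub> y \<in> N" using submod_smult[OF X N(1)] by simp
    qed
    then show ?thesis using A(3) N(2) by simp
  qed
  interpret X: standard_resolution S ?X using S(1) X by (rule standard_resolution.intro)
  have "\<exists>i. \<exists>\<phi>\<in>lin S X.U (X.F i) (self_module S). (\<forall>v\<in>X.cyc i. \<phi> v = \<zero>\<^bsub>S\<^esub>) \<and>
    {s \<in> carrier S. X.trivial i (\<lambda>v. s \<otimes>\<^bsub>S\<^esub> \<phi> v)} = ?Q"
    using A(1,2) A' x(1) Q by (intro X.ex_cocycle_annihilator[OF S(2) _ _ _ c]) auto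
  then obtain i \<phi> where "\<phi> \<in> lin S X.U (X.F i) (self_module S)" "\<forall>v\<in>X.cyc i. \<phi> v = \<zero>\<^bsub>S\<^esub>"
    "{s \<in> carrier S. X.trivial i (\<lambda>v. s \<otimes>\<^bsub>S\<^esub> \<phi> v)} = ?Q" by blast
  then have "P \<in> Ass R (Ext_over S f M (self_module S) i)"
    using Ass_Ext_over[OF S(1) M assms(4,5) P] by blast
  then show "P \<in> (\<Union>i. Ass R (Ext_over S f M (self_module S) i))" by blast
qed

end
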